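(* Let $1\le p,q\le\infty$, with $q<\infty$ if $p=1$ and $q>1$ if $p=\infty$, and let $\frac1p<r<1+\frac1p$ (with $1/\infty=0$). Then there is a constant $C>0$ such that for every $n\in\mathbb{N}$ and $N=2^{n+2}$, $$\mathrm{err}_N\big(S_{p,q}^rB([0,1)^2)^{\urcorner}\big)\le C\,N^{-r}(\log N)^{1-1/q}.$$
   Context: Besov spaces of dominating mixed smoothness: let $\mathcal{S}(\mathbb{R}^2)$ be the Schwartz space, $\mathcal{S}'(\mathbb{R}^2)$ the tempered distributions, $\mathcal{F}$ the Fourier transform. Let $\phi_0\in\mathcal{S}(\mathbb{R})$ be fixed with $\phi_0(t)=1$ for $|t|\le1$ and $\phi_0(t)=0$ for $|t|>\frac32$; put $\phi_k(t)=\phi_0(2^{-k}t)-\phi_0(2^{-k+1}t)$ for $k\in\mathbb{N}$, and $\phi_{\boldsymbol k}(\boldsymbol t)=\phi_{k_1}(t_1)\phi_{k_2}(t_2)$ for $\boldsymbol k=(k_1,k_2)\in\mathbb{N}_0^2$. For $0<p,q\le\infty$, $r\in\mathbb{R}$, the space $S_{p,q}^rB(\mathbb{R}^2)$ consists of all $f\in\mathcal{S}'(\mathbb{R}^2)$ with finite quasi-norm $$\|f|S_{p,q}^rB(\mathbb{R}^2)\|=\Big(\sum_{\boldsymbol k\in\mathbb{N}_0^2}2^{r(k_1+k_2)q}\|\mathcal{F}^{-1}(\phi_{\boldsymbol k}\mathcal{F}f)|L_p(\mathbb{R}^2)\|^q\Big)^{1/q}$$ (usual modification if $q=\infty$). Let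 $\mathcal{D}'([0,1)^2)$ be the dual of the space $\mathcal{D}([0,1)^2)$ of complex-valued infinitely differentiable functions on $\mathbb{R}^2$ with compact support in the interior of $[0,1)^2$. The space $S_{p,q}^rB([0,1)^2)$ consists of all $f\in\mathcal{D}'([0,1)^2)$ with finite quasi-norm $$\|f|S_{p,q}^rB([0,1)^2)\|=\inf\{\|g|S_{p,q}^rB(\mathbb{R}^2)\|: g\in S_{p,q}^rB(\mathbb{R}^2),\ g|_{[0,1)^2}=f\}.$$ For $r>1/p$ the elements are identified with their continuous representatives, which extend continuously to $[0,1]^2$. $S_{p,q}^rB([0,1)^2)^{\urcorner}$ denotes the class of all $f\in S_{p,q}^rB([0,1)^2)$ that vanish on the upper and right boundary lines, i.e. $f(x_1,1)=0$ and $f(1,x_2)=0$ for all $x_1,x_2\in[0,1]$, equipped with the norm of $S_{p,q}^rB([0,1)^2)$. Quasi-Monte Carlo integration: for a normed space $F$ of functions on $[0,1)^2$, $I(f)=\int_{[0,1)^2}f(\boldsymbol x)\,\mathrm d\boldsymbol x$, and for $\mathcal{P}=\{\boldsymbol x_1,\dots,\boldsymbol x_N\}$ (points may coincide), $Q_N(\mathcal{P},f)=\frac1N\sum_{i=1}^Nf(\boldsymbol x_i)$. The minimal worst-case error of QMC algorithms is $$\mathrm{err}_N(F)=\inf_{\#\mathcal{P}=N}\ \sup_{\|f|F\|\le1}|I(f)-Q_N(\mathcal{P},f)|,$$ the infimum being over all point sets in $[0,1)^2$ with $N$ elements (counted with multiplicity). *)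

theory Defs
  imports "HOL-Analysis.Analysis" "HOL-Probability.Essential_Supremum"
begin

subsection \<open>Schwartz functions and tempered distributions\<close>

text \<open>\<open>iter_deriv [u\<^sub>1, \<dots>, u\<^sub>m] f\<close> is the iterated directional derivative
  \<open>\<partial>\<^bsub>u\<^sub>1\<^esub> \<dots> \<partial>\<^bsub>u\<^sub>m\<^esub> f\<close>; lists over \<open>Basis\<close> play the role of multi-indices.\<close>

fun iter_deriv :: "'a list \<Rightarrow> ('a::euclidean_space \<Rightarrow> complex) \<Rightarrow> 'a \<Rightarrow> complex" where
  "iter_deriv [] f = f"
| "iter_deriv (u # us) f = (\<lambda>x. frechet_derivative (iter_deriv us f) (at x) u)"

definition smooth :: "('a::euclidean_space \<Rightarrow> complex) \<Rightarrow> bool" where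
  "smooth f \<longleftrightarrow> (\<forall>us x. set us \<subseteq> Basis \<longrightarrow> iter_deriv us f differentiable (at x))"

definition schwartz :: "('a::euclidean_space \<Rightarrow> complex) set" where
  "schwartz = {f. smooth f \<and>
     (\<forall>k us. set us \<subseteq> Basis \<longrightarrow> (\<exists>B. \<forall>x. norm x ^ k * cmod (iter_deriv us f x) \<le> B))}"

definition schwartz_seminorm :: "nat \<Rightarrow> 'a list \<Rightarrow> ('a::euclidean_space \<Rightarrow> complex) \<Rightarrow> real" where
  "schwartz_seminorm k us f = (SUP x. norm x ^ k * cmod (iter_deriv us f x))"

definition linear_functional_on ::
  "('a \<Rightarrow> complex) set \<Rightarrow> (('a \<Rightarrow> complex) \<Rightarrow> complex) \<Rightarrow> bool" where
  "linear_functional_on V T \<longleftrightarrow>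
     (\<forall>\<phi>\<in>V. \<forall>\<psi>\<in>V. \<forall>a b. T (\<lambda>x. a * \<phi> x + b * \<psi> x) = a * T \<phi> + b * T \<psi>)"

text \<open>Functionals are made extensional (\<open>undefined\<close> off their domain), so that equality of
  distributions is equality of functions. Continuity is expressed by the seminorms.\<close>

definition tempered_distributions :: "(('a::euclidean_space \<Rightarrow> complex) \<Rightarrow> complex) set" where
  "tempered_distributions = {T \<in> extensional schwartz. linear_functional_on schwartz T \<and>
     (\<exists>C m. \<forall>\<psi>\<in>schwartz. cmod (T \<psi>) \<le>
        C * (\<Sum>k\<le>m. \<Sum>us | set us \<subseteq> Basis \<and> length us \<le> m. schwartz_seminorm k us \<psi>))}"

definition fourier :: "('a::euclidean_space \<Rightarrow> complex) \<Rightarrow> 'a \<Rightarrow> complex" where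
  "fourier f \<xi> = of_real ((2 * pi) powr (- real DIM('a) / 2)) *
     (LINT x|lborel. exp (- \<i> * of_real (x \<bullet> \<xi>)) * f x)"

definition inv_fourier :: "('a::euclidean_space \<Rightarrow> complex) \<Rightarrow> 'a \<Rightarrow> complex" where
  "inv_fourier f x = of_real ((2 * pi) powr (- real DIM('a) / 2)) *
     (LINT \<xi>|lborel. exp (\<i> * of_real (x \<bullet> \<xi>)) * f \<xi>)"

definition fourier_distr ::
  "(('a::euclidean_space \<Rightarrow> complex) \<Rightarrow> complex) \<Rightarrow> ('a \<Rightarrow> complex) \<Rightarrow> complex" where
  "fourier_distr T = (\<lambda>\<psi>\<in>schwartz. T (fourier \<psi>))"

definition inv_fourier_distr ::
  "(('a::euclidean_space \<Rightarrow> complex) \<Rightarrow> complex) \<Rightarrow> ('a \<Rightarrow> complex) \<Rightarrow> complex" where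
  "inv_fourier_distr T = (\<lambda>\<psi>\<in>schwartz. T (inv_fourier \<psi>))"

definition mult_distr ::
  "('a::euclidean_space \<Rightarrow> complex) \<Rightarrow> (('a \<Rightarrow> complex) \<Rightarrow> complex) \<Rightarrow> ('a \<Rightarrow> complex) \<Rightarrow> complex" where
  "mult_distr \<phi> T = (\<lambda>\<psi>\<in>schwartz. T (\<lambda>x. \<phi> x * \<psi> x))"

subsection \<open>Lebesgue quasi-norms\<close>

text \<open>Only used with exponents \<open>a > 0\<close>.\<close>

definition ennreal_powr :: "ennreal \<Rightarrow> real \<Rightarrow> ennreal" where
  "ennreal_powr x a = (if x = \<infinity> then \<infinity> else ennreal (enn2real x powr a))"

definition Lp_norm :: "ereal \<Rightarrow> ('a::euclidean_space \<Rightarrow> complex) \<Rightarrow> ennreal" where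
  "Lp_norm p h =
     (if p = \<infinity> then esssup lborel (\<lambda>x. ennreal (cmod (h x)))
      else ennreal_powr (\<integral>\<^sup>+x. ennreal (cmod (h x) powr real_of_ereal p) \<partial>lborel)
             (1 / real_of_ereal p))"

definition represents ::
  "('a::euclidean_space \<Rightarrow> complex) \<Rightarrow> (('a \<Rightarrow> complex) \<Rightarrow> complex) \<Rightarrow> bool" where
  "represents h T \<longleftrightarrow> h \<in> borel_measurable lborel \<and>
     (\<forall>\<psi>\<in>schwartz. integrable lborel (\<lambda>x. h x * \<psi> x) \<and> T \<psi> = (LINT x|lborel. h x * \<psi> x))"

text \<open>A representing function is unique almost everywhere, so the infimum is its \<open>L\<^sub>p\<close> quasi-norm;
  it is \<open>\<infinity>\<close> if the distribution is not represented by a function.\<close>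

definition Lp_norm_distr ::
  "ereal \<Rightarrow> (('a::euclidean_space \<Rightarrow> complex) \<Rightarrow> complex) \<Rightarrow> ennreal" where
  "Lp_norm_distr p T = (INF h\<in>{h. represents h T}. Lp_norm p h)"

subsection \<open>Besov spaces of dominating mixed smoothness on the plane\<close>

definition resolution_generator :: "(real \<Rightarrow> complex) \<Rightarrow> bool" where
  "resolution_generator \<phi>\<^sub>0 \<longleftrightarrow> \<phi>\<^sub>0 \<in> schwartz \<and>
     (\<forall>t. \<bar>t\<bar> \<le> 1 \<longrightarrow> \<phi>\<^sub>0 t = 1) \<and> (\<forall>t. \<bar>t\<bar> > 3/2 \<longrightarrow> \<phi>\<^sub>0 t = 0)"

definition dyadic :: "(real \<Rightarrow> complex) \<Rightarrow> nat \<Rightarrow> real \<Rightarrow> complex" where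
  "dyadic \<phi>\<^sub>0 k t =
     (if k = 0 then \<phi>\<^sub>0 t
      else \<phi>\<^sub>0 (2 powr (- real k) * t) - \<phi>\<^sub>0 (2 powr (- real k + 1) * t))"

definition dyadic2 :: "(real \<Rightarrow> complex) \<Rightarrow> nat \<times> nat \<Rightarrow> real \<times> real \<Rightarrow> complex" where
  "dyadic2 \<phi>\<^sub>0 k t = dyadic \<phi>\<^sub>0 (fst k) (fst t) * dyadic \<phi>\<^sub>0 (snd k) (snd t)"

definition besov_norm ::
  "(real \<Rightarrow> complex) \<Rightarrow> ereal \<Rightarrow> ereal \<Rightarrow> real \<Rightarrow> ((real \<times> real \<Rightarrow> complex) \<Rightarrow> complex) \<Rightarrow> ennreal" where
  "besov_norm \<phi>\<^sub>0 p q r f =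
     (let block = (\<lambda>k. Lp_norm_distr p (inv_fourier_distr (mult_distr (dyadic2 \<phi>\<^sub>0 k) (fourier_distr f))))
      in if q = \<infinity>
         then (SUP k. ennreal (2 powr (r * real (fst k + snd k))) * block k)
         else ennreal_powr
           (\<Sum>\<^sub>\<infinity>k\<in>UNIV. ennreal (2 powr (r * real (fst k + snd k) * real_of_ereal q)) *
                            ennreal_powr (block k) (real_of_ereal q))
           (1 / real_of_ereal q))"

definition besov ::
  "(real \<Rightarrow> complex) \<Rightarrow> ereal \<Rightarrow> ereal \<Rightarrow> real \<Rightarrow> ((real \<times> real \<Rightarrow> complex) \<Rightarrow> complex) set" where
  "besov \<phi>\<^sub>0 p q r = {f \<in> tempered_distributions. besov_norm \<phi>\<^sub>0 p q r f < \<infinity>}"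

subsection \<open>Besov spaces on the unit square\<close>

abbreviation unit_square :: "(real \<times> real) set" where
  "unit_square \<equiv> {0..<1} \<times> {0..<1}"

definition supp :: "('a::topological_space \<Rightarrow> complex) \<Rightarrow> 'a set" where
  "supp \<phi> = closure {x. \<phi> x \<noteq> 0}"

definition test_functions :: "'a::euclidean_space set \<Rightarrow> ('a \<Rightarrow> complex) set" where
  "test_functions A = {\<phi>. smooth \<phi> \<and> compact (supp \<phi>) \<and> supp \<phi> \<subseteq> interior A}"

definition distributions :: "'a::euclidean_space set \<Rightarrow> (('a \<Rightarrow> complex) \<Rightarrow> complex) set" where
  "distributions A =
     {T \<in> extensional (test_functions A). linear_functional_on (test_functions A) T \<and>
       (\<forall>K. compact K \<and> K \<subseteq> interior A \<longrightarrow>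
         (\<exists>C m. \<forall>\<phi>\<in>test_functions A. supp \<phi> \<subseteq> K \<longrightarrow> cmod (T \<phi>) \<le>
            C * (\<Sum>us | set us \<subseteq> Basis \<and> length us \<le> m. schwartz_seminorm 0 us \<phi>)))}"

definition regular_distr ::
  "'a::euclidean_space set \<Rightarrow> ('a \<Rightarrow> complex) \<Rightarrow> ('a \<Rightarrow> complex) \<Rightarrow> complex" where
  "regular_distr A f = (\<lambda>\<phi>\<in>test_functions A. LINT x:A|lborel. f x * \<phi> x)"

definition besov_square_norm ::
  "(real \<Rightarrow> complex) \<Rightarrow> ereal \<Rightarrow> ereal \<Rightarrow> real \<Rightarrow> ((real \<times> real \<Rightarrow> complex) \<Rightarrow> complex) \<Rightarrow> ennreal" where
  "besov_square_norm \<phi>\<^sub>0 p q r f =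
     (INF g\<in>{g \<in> besov \<phi>\<^sub>0 p q r. restrict g (test_functions unit_square) = f}. besov_norm \<phi>\<^sub>0 p q r g)"

definition besov_square ::
  "(real \<Rightarrow> complex) \<Rightarrow> ereal \<Rightarrow> ereal \<Rightarrow> real \<Rightarrow> ((real \<times> real \<Rightarrow> complex) \<Rightarrow> complex) set" where
  "besov_square \<phi>\<^sub>0 p q r =
     {f \<in> distributions unit_square. besov_square_norm \<phi>\<^sub>0 p q r f < \<infinity>}"

text \<open>For \<open>r > 1/p\<close>, elements of \<^const>\<open>besov_square\<close> are identified with their continuous
  representatives, extended to the closed square; a function \<open>f\<close> below is such a representative.
  Its values outside the closed square are arbitrary and play no role.\<close>

definition besov_square_vanishing ::
  "(real \<Rightarrow> complex) \<Rightarrow> ereal \<Rightarrow> ereal \<Rightarrow> real \<Rightarrow> (real \<times> real \<Rightarrow> complex) set" where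
  "besov_square_vanishing \<phi>\<^sub>0 p q r =
     {f. continuous_on ({0..1} \<times> {0..1}) f \<and>
         regular_distr unit_square f \<in> besov_square \<phi>\<^sub>0 p q r \<and>
         (\<forall>x\<^sub>1\<in>{0..1}. f (x\<^sub>1, 1) = 0) \<and> (\<forall>x\<^sub>2\<in>{0..1}. f (1, x\<^sub>2) = 0)}"

definition besov_fun_norm ::
  "(real \<Rightarrow> complex) \<Rightarrow> ereal \<Rightarrow> ereal \<Rightarrow> real \<Rightarrow> (real \<times> real \<Rightarrow> complex) \<Rightarrow> ennreal" where
  "besov_fun_norm \<phi>\<^sub>0 p q r f = besov_square_norm \<phi>\<^sub>0 p q r (regular_distr unit_square f)"

subsection \<open>Quasi-Monte Carlo integration\<close>

definition qmc_rule :: "nat \<Rightarrow> (nat \<Rightarrow> real \<times> real) \<Rightarrow> (real \<times> real \<Rightarrow> complex) \<Rightarrow> complex" where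
  "qmc_rule N P f = (1 / of_nat N) * (\<Sum>i=1..N. f (P i))"

text \<open>The space is given by its set \<open>F\<close> of functions and its norm \<open>nrm\<close>.\<close>

definition qmc_error ::
  "(real \<times> real \<Rightarrow> complex) set \<Rightarrow> ((real \<times> real \<Rightarrow> complex) \<Rightarrow> ennreal) \<Rightarrow> nat \<Rightarrow> ennreal" where
  "qmc_error F nrm N =
     (INF P\<in>{1..N} \<rightarrow> unit_square. SUP f\<in>{f \<in> F. nrm f \<le> 1}.
        ennreal (cmod ((LINT x:unit_square|lborel. f x) - qmc_rule N P f)))"

end

theory Submission
  imports Defs "HOL-Probability.Probability"
begin

text \<open>
  The bound is attained by the Hammersley set of \<open>2 ^ n\<close> points, shifted to the midpoints of its grid
  cells and united with its images under the reflections \<open>x \<mapsto> 1 - x\<close> of either coordinate; this gives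
  \<open>N = 4 * 2 ^ n\<close> points. Write \<open>P = 1 / p\<close>.

  A continuous function on the square that vanishes on the upper and right edges is the uniform limit of its
  expansion into tensor products of Faber functions, which are \<open>1 - x\<close> and tents over dyadic intervals. Its
  quadrature error is therefore at most the sum over all pairs of levels \<open>(j, i)\<close> of the Faber coefficients,
  weighted with the quadrature errors of the basis functions (\<open>quadrature_error_le\<close>). The latter are
  explicit. Put \<open>s = j + i\<close>. As long as \<open>s + 2 \<le> n\<close>, the points in a dyadic box form a smaller Hammersley
  set, and a computation with bit reversal shows that each error is at most \<open>2 ^ s / 4 ^ n\<close>
  (\<open>tent_bitrev_sum\<close>, \<open>faber_err_near\<close>). For larger \<open>s\<close> a dyadic box contains at most two points of each
  reflected copy, so each error is at most \<open>2 / 2 ^ n\<close>, and all errors of a pair of levels add up to at most 2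
  (\<open>faber_err_far\<close>, \<open>sum_faber_err_le\<close>).

  The coefficients are estimated for each Littlewood-Paley block of an extension \<open>g\<close> of the function to the
  plane. The block of frequency \<open>(2 ^ m, 2 ^ m')\<close> is reproduced by convolution with a dilated Schwartz kernel, so
  its Faber coefficients are integrals against second differences of that kernel. These gain a factor \<open>4 powr
  (m - j)\<close> if the frequency is below the level. Interpolating between the mean and the supremum of the resulting
  weight (\<open>Lp_norm_weighted_le\<close>, \<open>faber_coeff2_piece_weighted_sum\<close>) bounds the weighted sum of the
  coefficients of the block, for one pair of levels, by its norm of order \<open>p\<close> times three factors that depend
  on \<open>m - j\<close>, \<open>m' - i\<close> and \<open>s - n\<close>. Each of them is \<open>growth P t\<close>, that is \<open>4 powr t\<close> for negative
  \<open>t\<close> and \<open>2 powr (P * t)\<close> otherwise.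

  The Besov norm weights the block with \<open>2 powr (r * (m + m'))\<close>. Dividing by this weight and splitting
  \<open>m + m' = n + (s - n) + (m - j) + (m' - i)\<close> yields the rate \<open>2 powr (- r * n)\<close>, and each growth factor
  becomes exponentially decaying in the modulus of its argument because \<open>P < r < 1 + P \<le> 2\<close>
  (\<open>growth_decay\<close>, \<open>level_error_le\<close>). Summation over the levels leaves a weight on the frequencies that is
  bounded and has total mass of order \<open>n\<close>, since there are about \<open>n\<close> pairs of levels with sum \<open>n\<close>.
  Hoelder's inequality for sequences (\<open>seq_norm_weighted_le\<close>) turns the mass into the factor
  \<open>n powr (1 - 1/q)\<close>, which is the power of the logarithm.

  To get from distributions to functions, the Fourier transform is shown to preserve families of Schwartz
  functions with uniform bounds, and Fourier inversion in the plane is proved with Gaussian averages. It follows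
  that the blocks sum up to \<open>g\<close> (\<open>sum_blocks_tendsto\<close>). Each block of finite norm is a continuous function
  (\<open>block_eq_integral_piece\<close>), the sum of these functions converges uniformly because \<open>P < r\<close>
  (\<open>pieces_represent\<close>), and it coincides with the given function on the square
  (\<open>distribution_determines_function\<close>).
\<close>

section \<open>Hoelder type inequalities with a weight\<close>

lemma ennreal_powr_ennreal: "0 \<le> x \<Longrightarrow> ennreal_powr (ennreal x) a = ennreal (x powr a)"
  by (simp add: ennreal_powr_def)

lemma measurable_ennreal_powr [measurable (raw)]:
  assumes [measurable]: "u \<in> borel_measurable M"
  shows "(\<lambda>x. ennreal_powr (u x) a) \<in> borel_measurable M"
  unfolding ennreal_powr_def by measurable

text \<open>Hoelder's inequality, with the conjugate norm of the weight interpolated between its total mass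
  \<open>S\<close> and its supremum \<open>V\<close>: the factor is \<open>S\<close> to the power \<open>1 - 1/p\<close> times \<open>V\<close> to the power \<open>1/p\<close>.
  Young's inequality \<open>t \<le> c powr (1 - p) / p * t powr p + (1 - 1/p) * c\<close>, integrated against \<open>W\<close>, uses
  \<open>V\<close> for the first summand and \<open>S\<close> for the second. The argument stays within the extended
  nonnegative numbers, so \<open>u\<close> may be infinite. All exponents \<open>1/p\<close> and \<open>1 - 1/q\<close> of the main estimate
  come from here.\<close>

lemma weighted_integral_le:
  fixes u W :: "'a \<Rightarrow> ennreal" and p S V :: real
  assumes [measurable]: "u \<in> borel_measurable M" "W \<in> borel_measurable M"
    and W: "(\<integral>\<^sup>+x. W x \<partial>M) \<le> ennreal S" "\<And>x. x \<in> space M \<Longrightarrow> W x \<le> ennreal V"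
    and pos: "0 < S" "0 < V" and p: "1 \<le> p"
  shows "(\<integral>\<^sup>+x. u x * W x \<partial>M) \<le> ennreal (S powr (1 - 1/p) * V powr (1/p)) *
           ennreal_powr (\<integral>\<^sup>+x. ennreal_powr (u x) p \<partial>M) (1/p)"
proof -
  let ?I = "\<integral>\<^sup>+x. ennreal_powr (u x) p \<partial>M"
  consider "?I = \<infinity>" | "?I = 0" | i where "?I = ennreal i" "i > 0"
  proof (cases ?I)
    case (real i)
    then show ?thesis using that by (cases "i = 0") auto
  qed (use that in auto)
  then show ?thesis
  proof cases
    case 1
    then show ?thesis using pos by (simp add: ennreal_powr_def ennreal_mult_top)
  next
    case 2
    have "AE x in M. ennreal_powr (u x) p = 0"
      using 2 by (subst (asm) nn_integral_0_iff_AE) auto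
    moreover have "u x = 0" if "ennreal_powr (u x) p = 0" for x
      using that by (cases "u x") (auto simp: ennreal_powr_def split: if_splits)
    ultimately have "AE x in M. u x * W x = 0" by (auto elim: eventually_mono)
    hence "(\<integral>\<^sup>+x. u x * W x \<partial>M) = 0" by (subst nn_integral_0_iff_AE) auto
    then show ?thesis by simp
  next
    case (3 i)
    \<comment> \<open>The parameter for which the two terms of Young's inequality, integrated, have the right ratio.\<close>
    define c where "c = (i * V / S) powr (1/p)"
    have c: "c > 0" using 3 pos by (simp add: c_def)
    have cp: "c powr p = i * V / S" using p 3 pos by (simp add: c_def powr_powr)
    define k1 where "k1 = 1/p * c powr (1-p)"
    define k2 where "k2 = (1-1/p) * c"
    have k: "k1 \<ge> 0" "k2 \<ge> 0" using p c by (auto simp: k1_def k2_def)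
    have young: "t \<le> k1 * t powr p + k2" if "t \<ge> 0" for t
    proof (cases "t = 0")
      case True then show ?thesis using k p by simp
    next
      case False
      have "(t powr p * c powr (1-p)) powr (1/p) * c powr (1-1/p)
             \<le> 1/p * (t powr p * c powr (1-p)) + (1-1/p) * c"
        using p c False that by (intro Youngs_inequality_0) auto
      moreover have "(t powr p * c powr (1-p)) powr (1/p) * c powr (1-1/p) = t"
      proof -
        have "(t powr p * c powr (1-p)) powr (1/p) = t * c powr ((1-p)/p)"
          using p c False that by (simp add: powr_mult powr_powr)
        moreover have "(1-p)/p + (1-1/p) = 0" using p by (simp add: field_simps)
        ultimately show ?thesis using c by (simp add: powr_add[symmetric])
      qed
      ultimately show ?thesis by (simp add: k1_def k2_def mult_ac)
    qed
    have pt: "u x \<le> ennreal k1 * ennreal_powr (u x) p + ennreal k2" for x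
    proof (cases "u x")
      case (real t)
      then show ?thesis using young[of t] k real
        by (simp add: ennreal_powr_ennreal ennreal_mult[symmetric] ennreal_plus[symmetric] del: ennreal_plus)
    next
      case top
      have "k1 > 0" using p c by (simp add: k1_def)
      then show ?thesis using top by (simp add: ennreal_powr_def ennreal_mult_top)
    qed
    have "(\<integral>\<^sup>+x. u x * W x \<partial>M) \<le> (\<integral>\<^sup>+x. ennreal k1 * ennreal V * ennreal_powr (u x) p + ennreal k2 * W x \<partial>M)"
    proof (rule nn_integral_mono)
      fix x assume x: "x \<in> space M"
      have "u x * W x \<le> (ennreal k1 * ennreal_powr (u x) p + ennreal k2) * W x"
        by (rule mult_right_mono[OF pt]) simp
      also have "\<dots> = ennreal k1 * ennreal_powr (u x) p * W x + ennreal k2 * W x"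
        by (simp add: distrib_right)
      also have "\<dots> \<le> ennreal k1 * ennreal_powr (u x) p * ennreal V + ennreal k2 * W x"
        by (intro add_right_mono mult_left_mono W x) simp
      finally show "u x * W x \<le> ennreal k1 * ennreal V * ennreal_powr (u x) p + ennreal k2 * W x"
        by (simp add: mult_ac)
    qed
    also have "\<dots> = ennreal k1 * ennreal V * ?I + ennreal k2 * (\<integral>\<^sup>+x. W x \<partial>M)"
      by (subst nn_integral_add) (auto simp: nn_integral_cmult)
    also have "\<dots> \<le> ennreal k1 * ennreal V * ennreal i + ennreal k2 * ennreal S"
      using 3 W by (intro add_mono mult_left_mono) auto
    also have "\<dots> = ennreal (k1 * V * i + k2 * S)"
      using k pos 3 by (simp add: ennreal_mult[symmetric] ennreal_plus[symmetric] del: ennreal_plus)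
    also have "k1 * V * i + k2 * S = c * S"
    proof -
      have "c powr (1-p) * (V * i) = c powr (1-p) * c powr p * S"
        using pos by (simp add: cp)
      also have "\<dots> = c * S" using c by (simp add: powr_add[symmetric])
      finally have "k1 * V * i = 1/p * (c * S)" by (simp add: k1_def mult_ac)
      thus ?thesis by (simp add: k2_def algebra_simps)
    qed
    also have "c * S = S powr (1 - 1/p) * V powr (1/p) * i powr (1/p)"
      using pos 3 by (simp add: c_def powr_mult powr_divide powr_diff)
    also have "ennreal \<dots> = ennreal (S powr (1 - 1/p) * V powr (1/p)) * ennreal_powr ?I (1/p)"
      using 3 by (simp add: ennreal_powr_ennreal ennreal_mult)
    finally show ?thesis .
  qed
qed

lemma Lp_norm_weighted_le:
  fixes h :: "'a::euclidean_space \<Rightarrow> complex" and W :: "'a \<Rightarrow> ennreal"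
  assumes [measurable]: "h \<in> borel_measurable lborel" "W \<in> borel_measurable lborel"
    and W: "(\<integral>\<^sup>+x. W x \<partial>lborel) \<le> ennreal S" "\<And>x. W x \<le> ennreal V"
    and pos: "0 < S" "0 < V" and p: "1 \<le> p"
  shows "(\<integral>\<^sup>+x. ennreal (cmod (h x)) * W x \<partial>lborel)
     \<le> ennreal (S powr (1 - real_of_ereal (1/p)) * V powr real_of_ereal (1/p)) * Lp_norm p h"
proof (cases "p = \<infinity>")
  case True
  have "AE x in lborel. ennreal (cmod (h x)) \<le> Lp_norm p h"
    using esssup_AE[of "\<lambda>x. ennreal (cmod (h x))" lborel] True by (simp add: Lp_norm_def)
  hence "(\<integral>\<^sup>+x. ennreal (cmod (h x)) * W x \<partial>lborel) \<le> (\<integral>\<^sup>+x. Lp_norm p h * W x \<partial>lborel)"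
    by (intro nn_integral_mono_AE) (auto elim!: eventually_mono intro: mult_right_mono)
  also have "\<dots> = Lp_norm p h * (\<integral>\<^sup>+x. W x \<partial>lborel)" by (simp add: nn_integral_cmult)
  also have "\<dots> \<le> Lp_norm p h * ennreal S" by (intro mult_left_mono W) auto
  finally show ?thesis using True pos by (simp add: mult.commute)
next
  case False
  then obtain P where P: "p = ereal P" "1 \<le> P" using p by (cases p) (auto simp: one_ereal_def)
  have "ennreal_powr (ennreal (cmod (h x))) P = ennreal (cmod (h x) powr P)" for x
    by (simp add: ennreal_powr_ennreal)
  with weighted_integral_le[of "\<lambda>x. ennreal (cmod (h x))" lborel W S V P] show ?thesis
    using W pos P by (simp add: Lp_norm_def one_ereal_def)
qed

text \<open>Both sides are suprema of finite partial sums; an enumeration of the pairs reduces the claim to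
  the partial sums of a series.\<close>

lemma nn_integral_count_space_le_infsum:
  fixes f :: "nat \<times> nat \<Rightarrow> ennreal"
  shows "(\<integral>\<^sup>+k. f k \<partial>count_space UNIV) \<le> infsum f UNIV"
proof -
  have "(\<integral>\<^sup>+k. f k \<partial>count_space UNIV) = (\<integral>\<^sup>+n. f (prod_decode n) \<partial>count_space UNIV)"
    using nn_integral_bij_count_space[OF bij_prod_decode] by metis
  also have "\<dots> = (\<Sum>n. f (prod_decode n))" by (rule nn_integral_count_space_nat)
  also have "\<dots> \<le> infsum f UNIV"
  proof (rule suminf_le_const)
    fix n
    have "(\<Sum>i<n. f (prod_decode i)) = sum f (prod_decode ` {..<n})"
      by (simp add: sum.reindex inj_prod_decode)
    also have "\<dots> \<le> infsum f UNIV"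
      by (subst nonneg_infsum_complete) (auto intro!: SUP_upper)
    finally show "(\<Sum>i<n. f (prod_decode i)) \<le> infsum f UNIV" .
  qed simp
  finally show ?thesis .
qed

text \<open>The counterpart of \<open>Lp_norm_weighted_le\<close> for sequences indexed by pairs of frequencies, with the
  quasi-norm written as in the definition of the Besov spaces. In the application \<open>W m\<close> is the total
  influence of the frequency \<open>m\<close> on the integration error, \<open>S\<close> is of order \<open>n\<close>, and \<open>V\<close> is a constant;
  the logarithm in the final rate is the factor \<open>S powr (1 - 1/q)\<close>.\<close>

lemma seq_norm_weighted_le:
  fixes u W :: "nat \<times> nat \<Rightarrow> ennreal"
  assumes W: "(\<integral>\<^sup>+x. W x \<partial>count_space UNIV) \<le> ennreal S" "\<And>x. W x \<le> ennreal V"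
    and pos: "0 < S" "0 < V" and q: "1 \<le> q"
  shows "(\<integral>\<^sup>+x. u x * W x \<partial>count_space UNIV)
     \<le> ennreal (S powr (1 - real_of_ereal (1/q)) * V powr real_of_ereal (1/q)) *
       (if q = \<infinity> then (SUP k. u k) else ennreal_powr (infsum (\<lambda>k. ennreal_powr (u k) (real_of_ereal q)) UNIV) (1/real_of_ereal q))"
proof (cases "q = \<infinity>")
  case True
  have "(\<integral>\<^sup>+x. u x * W x \<partial>count_space UNIV) \<le> (\<integral>\<^sup>+x. (SUP k. u k) * W x \<partial>count_space UNIV)"
    by (intro nn_integral_mono mult_right_mono SUP_upper) auto
  also have "\<dots> = (SUP k. u k) * (\<integral>\<^sup>+x. W x \<partial>count_space UNIV)" by (simp add: nn_integral_cmult)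
  also have "\<dots> \<le> (SUP k. u k) * ennreal S" by (intro mult_left_mono W) auto
  finally show ?thesis using True pos by (simp add: mult.commute)
next
  case False
  then obtain P where P: "q = ereal P" "1 \<le> P" using q by (cases q) (auto simp: one_ereal_def)
  have mono: "ennreal_powr x a \<le> ennreal_powr y a" if "x \<le> y" "a > 0" for x y a
    using that by (cases x; cases y) (auto simp: ennreal_powr_def top_unique intro!: ennreal_leI powr_mono2 split: if_splits)
  have "(\<integral>\<^sup>+x. u x * W x \<partial>count_space UNIV) \<le> ennreal (S powr (1 - 1/P) * V powr (1/P)) *
     ennreal_powr (\<integral>\<^sup>+x. ennreal_powr (u x) P \<partial>count_space UNIV) (1/P)"
    using W pos P by (intro weighted_integral_le) auto
  also have "\<dots> \<le> ennreal (S powr (1 - 1/P) * V powr (1/P)) *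
     ennreal_powr (infsum (\<lambda>x. ennreal_powr (u x) P) UNIV) (1/P)"
    using P by (intro mult_left_mono mono nn_integral_count_space_le_infsum) auto
  finally show ?thesis using P by (simp add: one_ereal_def)
qed

section \<open>Uniform families of Schwartz functions\<close>

definition dir_deriv :: "'a::euclidean_space \<Rightarrow> ('a \<Rightarrow> complex) \<Rightarrow> 'a \<Rightarrow> complex" where
  "dir_deriv u f = (\<lambda>x. frechet_derivative f (at x) u)"

lemma iter_deriv_Cons: "iter_deriv (u # us) f = dir_deriv u (iter_deriv us f)"
  by (simp add: dir_deriv_def)

declare iter_deriv.simps(2) [simp del]

lemma iter_deriv_dir_deriv: "iter_deriv us (dir_deriv u f) = iter_deriv (us @ [u]) f"
  by (induction us) (simp_all add: iter_deriv_Cons)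

lemma dir_deriv_eqI: "(f has_derivative f') (at x) \<Longrightarrow> dir_deriv u f x = f' u"
  unfolding dir_deriv_def by (metis frechet_derivative_at)

lemma has_derivative_dir_deriv: "f differentiable (at x) \<Longrightarrow> (f has_derivative (\<lambda>h. dir_deriv h f x)) (at x)"
  unfolding dir_deriv_def by (simp add: frechet_derivative_works)

lemma dir_deriv_mult:
  assumes "f differentiable (at x)" "g differentiable (at x)"
  shows "dir_deriv u (\<lambda>x. f x * g x) x = f x * dir_deriv u g x + dir_deriv u f x * g x"
  by (rule dir_deriv_eqI[OF has_derivative_mult[OF assms[THEN has_derivative_dir_deriv]]])

lemma dir_deriv_add:
  assumes "f differentiable (at x)" "g differentiable (at x)"
  shows "dir_deriv u (\<lambda>x. f x + g x) x = dir_deriv u f x + dir_deriv u g x"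
  by (rule dir_deriv_eqI[OF has_derivative_add[OF assms[THEN has_derivative_dir_deriv]]])

lemma dir_deriv_scaleR_plus:
  assumes "f differentiable (at (c *\<^sub>R x + y))"
  shows "(\<lambda>x. f (c *\<^sub>R x + y)) differentiable (at x)"
    and "dir_deriv u (\<lambda>x. f (c *\<^sub>R x + y)) x = of_real c * dir_deriv u f (c *\<^sub>R x + y)"
proof -
  let ?D = "\<lambda>h. dir_deriv h f (c *\<^sub>R x + y)"
  have D: "(f has_derivative ?D) (at (c *\<^sub>R x + y))" by (rule has_derivative_dir_deriv[OF assms])
  have "((\<lambda>x. c *\<^sub>R x + y) has_derivative (\<lambda>h. c *\<^sub>R h)) (at x)"
    by (auto intro!: derivative_eq_intros)
  from has_derivative_compose[OF this, of f ?D]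
  have *: "((\<lambda>x. f (c *\<^sub>R x + y)) has_derivative (\<lambda>h. dir_deriv (c *\<^sub>R h) f (c *\<^sub>R x + y))) (at x)"
    using D by (simp add: o_def)
  then show "(\<lambda>x. f (c *\<^sub>R x + y)) differentiable (at x)" by (auto simp: differentiable_def)
  have "dir_deriv (c *\<^sub>R u) f (c *\<^sub>R x + y) = c *\<^sub>R dir_deriv u f (c *\<^sub>R x + y)"
    using linear_scale[OF has_derivative_linear[OF D]] by simp
  then show "dir_deriv u (\<lambda>x. f (c *\<^sub>R x + y)) x = of_real c * dir_deriv u f (c *\<^sub>R x + y)"
    using dir_deriv_eqI[OF *, of u] by (simp add: scaleR_conv_of_real)
qed

text \<open>A family of functions with common bounds for each Schwartz seminorm. Keeping track of families
  rather than single functions makes every closure property of the Schwartz space quantitative: a family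
  that runs through products, dilations and Fourier transforms keeps bounds that do not depend on the index.\<close>

definition schwartz_family :: "('i \<Rightarrow> 'a::euclidean_space \<Rightarrow> complex) \<Rightarrow> bool" where
  "schwartz_family w \<longleftrightarrow> (\<forall>i. smooth (w i)) \<and>
     (\<forall>k us. set us \<subseteq> Basis \<longrightarrow> (\<exists>B. \<forall>i x. norm x ^ k * cmod (iter_deriv us (w i) x) \<le> B))"

text \<open>Families with polynomially bounded derivatives, uniformly in the index: the multipliers of
  \<open>schwartz_family\<close>.\<close>

definition slow_family :: "('i \<Rightarrow> 'a::euclidean_space \<Rightarrow> complex) \<Rightarrow> bool" where
  "slow_family a \<longleftrightarrow> (\<forall>i. smooth (a i)) \<and>
     (\<forall>us. set us \<subseteq> Basis \<longrightarrow> (\<exists>B k. \<forall>i x. cmod (iter_deriv us (a i) x) \<le> B * (1 + norm x) ^ k))"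

lemma schwartz_iff_family: "f \<in> schwartz \<longleftrightarrow> schwartz_family (\<lambda>_::unit. f)"
  by (simp add: schwartz_def schwartz_family_def)

lemma schwartz_family_const: "f \<in> schwartz \<Longrightarrow> schwartz_family (\<lambda>_. f)"
  by (simp add: schwartz_def schwartz_family_def)

lemma schwartz_family_in: "schwartz_family w \<Longrightarrow> w i \<in> schwartz"
  unfolding schwartz_def schwartz_family_def by blast

lemma iter_deriv_closed:
  assumes der: "\<And>w u. w \<in> X \<Longrightarrow> u \<in> Basis \<Longrightarrow> (\<lambda>i. dir_deriv u (w i)) \<in> X"
  shows "w \<in> X \<Longrightarrow> set us \<subseteq> Basis \<Longrightarrow> (\<lambda>i. iter_deriv us (w i)) \<in> X"
proof (induction us)
  case (Cons u us)
  then show ?case using der[of "\<lambda>i. iter_deriv us (w i)" u] by (simp add: iter_deriv_Cons)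
qed simp

text \<open>A class of families that is closed under the partial derivatives consists of Schwartz families as
  soon as its members themselves decay. Explicit formulas for iterated derivatives are never needed: one
  names a class, and computes one derivative.\<close>

lemma schwartz_family_coinduct_decay:
  fixes X :: "('i \<Rightarrow> 'a::euclidean_space \<Rightarrow> complex) set"
  assumes w: "w \<in> X"
    and diff: "\<And>w i x. w \<in> X \<Longrightarrow> w i differentiable (at x)"
    and decay: "\<And>w k. w \<in> X \<Longrightarrow> \<exists>B. \<forall>i x. norm x ^ k * cmod (w i x) \<le> B"
    and der: "\<And>w u. w \<in> X \<Longrightarrow> u \<in> Basis \<Longrightarrow> (\<lambda>i. dir_deriv u (w i)) \<in> X"
  shows "schwartz_family w"
proof -
  have it: "(\<lambda>i. iter_deriv us (w i)) \<in> X" if "set us \<subseteq> Basis" for us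
    by (rule iter_deriv_closed[OF der w that])
  show ?thesis unfolding schwartz_family_def smooth_def
    by (intro conjI allI impI diff[OF it] decay[OF it])
qed

text \<open>If the class is in addition closed under multiplication by coordinates, boundedness is enough,
  since powers of \<open>norm x\<close> are controlled by products of coordinates.\<close>

lemma schwartz_family_coinduct:
  fixes X :: "('i \<Rightarrow> 'a::euclidean_space \<Rightarrow> complex) set"
  assumes w: "w \<in> X"
    and diff: "\<And>w i x. w \<in> X \<Longrightarrow> w i differentiable (at x)"
    and bdd: "\<And>w. w \<in> X \<Longrightarrow> \<exists>B. \<forall>i x. cmod (w i x) \<le> B"
    and der: "\<And>w u. w \<in> X \<Longrightarrow> u \<in> Basis \<Longrightarrow> (\<lambda>i. dir_deriv u (w i)) \<in> X"
    and coord: "\<And>w u. w \<in> X \<Longrightarrow> u \<in> Basis \<Longrightarrow> (\<lambda>i x. of_real (x \<bullet> u) * w i x) \<in> X"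
  shows "schwartz_family w"
proof (rule schwartz_family_coinduct_decay[of w X])
  show "\<exists>B. \<forall>i x. norm x ^ k * cmod (v i x) \<le> B" if "v \<in> X" for v k
    using that
  proof (induction k arbitrary: v)
    case 0
    then show ?case using bdd by simp
  next
    case (Suc k)
    have "\<forall>u\<in>Basis. \<exists>B. \<forall>i x. norm x ^ k * cmod (of_real (x \<bullet> u) * v i x) \<le> B"
      by (intro ballI Suc.IH coord Suc.prems)
    then obtain B where B: "\<And>u i x. u \<in> Basis \<Longrightarrow> norm x ^ k * cmod (of_real (x \<bullet> u) * v i x) \<le> B u"
      by metis
    have "norm x ^ Suc k * cmod (v i x) \<le> (\<Sum>u\<in>Basis. B u)" for i x
    proof -
      have "norm x ^ Suc k * cmod (v i x) = norm x * (norm x ^ k * cmod (v i x))" by simp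
      also have "\<dots> \<le> (\<Sum>u\<in>Basis. \<bar>x \<bullet> u\<bar>) * (norm x ^ k * cmod (v i x))"
        by (rule mult_right_mono[OF norm_le_l1]) simp
      also have "\<dots> = (\<Sum>u\<in>Basis. norm x ^ k * cmod (of_real (x \<bullet> u) * v i x))"
        by (simp add: sum_distrib_right sum_distrib_left norm_mult mult_ac)
      also have "\<dots> \<le> (\<Sum>u\<in>Basis. B u)" by (intro sum_mono B)
      finally show ?thesis .
    qed
    then show ?case by blast
  qed
qed (use assms in auto)

lemma slow_family_coinduct:
  fixes X :: "('i \<Rightarrow> 'a::euclidean_space \<Rightarrow> complex) set"
  assumes w: "w \<in> X"
    and diff: "\<And>w i x. w \<in> X \<Longrightarrow> w i differentiable (at x)"
    and growth: "\<And>w. w \<in> X \<Longrightarrow> \<exists>B k. \<forall>i x. cmod (w i x) \<le> B * (1 + norm x) ^ k"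
    and der: "\<And>w u. w \<in> X \<Longrightarrow> u \<in> Basis \<Longrightarrow> (\<lambda>i. dir_deriv u (w i)) \<in> X"
  shows "slow_family w"
proof -
  have it: "(\<lambda>i. iter_deriv us (w i)) \<in> X" if "set us \<subseteq> Basis" for us
    by (rule iter_deriv_closed[OF der w that])
  show ?thesis unfolding slow_family_def smooth_def
    by (intro conjI allI impI diff[OF it] growth[OF it])
qed

lemma smooth_differentiable: "smooth f \<Longrightarrow> f differentiable (at x)"
  unfolding smooth_def by (drule spec[of _ "[]"]) simp

lemma schwartz_family_differentiable: "schwartz_family w \<Longrightarrow> w i differentiable (at x)"
  by (simp add: schwartz_family_def smooth_differentiable)

lemma slow_family_differentiable: "slow_family w \<Longrightarrow> w i differentiable (at x)"
  by (simp add: slow_family_def smooth_differentiable)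

lemma schwartz_family_decay: "schwartz_family w \<Longrightarrow> \<exists>B. \<forall>i x. norm x ^ k * cmod (w i x) \<le> B"
  unfolding schwartz_family_def by (drule conjunct2, drule spec[of _ k], drule spec[of _ "[]"]) simp

lemma schwartz_family_bounded: "schwartz_family w \<Longrightarrow> \<exists>B. \<forall>i x. cmod (w i x) \<le> B"
  using schwartz_family_decay[of w 0] by simp

lemma slow_family_growth: "slow_family w \<Longrightarrow> \<exists>B k. \<forall>i x. cmod (w i x) \<le> B * (1 + norm x) ^ k"
  unfolding slow_family_def by (drule conjunct2, drule spec[of _ "[]"]) simp

lemma smooth_dir_deriv: "smooth f \<Longrightarrow> u \<in> Basis \<Longrightarrow> smooth (dir_deriv u f)"
  unfolding smooth_def iter_deriv_dir_deriv by auto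

lemma schwartz_family_dir_deriv:
  assumes "schwartz_family w" "u \<in> Basis" shows "schwartz_family (\<lambda>i. dir_deriv u (w i))"
  using assms unfolding schwartz_family_def by (auto simp: smooth_dir_deriv) (simp add: iter_deriv_dir_deriv)

lemma slow_family_dir_deriv:
  assumes "slow_family w" "u \<in> Basis" shows "slow_family (\<lambda>i. dir_deriv u (w i))"
  using assms unfolding slow_family_def by (auto simp: smooth_dir_deriv) (simp add: iter_deriv_dir_deriv)

lemma schwartz_family_imp_slow: "schwartz_family w \<Longrightarrow> slow_family w"
proof -
  assume w: "schwartz_family w"
  have "\<exists>B k. \<forall>i x. cmod (iter_deriv us (w i) x) \<le> B * (1 + norm x) ^ k" if "set us \<subseteq> Basis" for us
  proof -
    from w that obtain B where "\<forall>i x. norm x ^ 0 * cmod (iter_deriv us (w i) x) \<le> B"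
      unfolding schwartz_family_def by blast
    then show ?thesis by (intro exI[of _ B] exI[of _ 0]) simp
  qed
  with w show ?thesis unfolding slow_family_def schwartz_family_def by blast
qed

lemma slow_family_scalar:
  fixes c :: "'i \<Rightarrow> complex"
  assumes "\<And>i. cmod (c i) \<le> B"
  shows "slow_family (\<lambda>i (x::'a::euclidean_space). c i)"
proof (rule slow_family_coinduct[where X = "{\<lambda>i x. c i | c. \<exists>B. \<forall>i. cmod (c i) \<le> B}"])
  show "(\<lambda>i x. c i) \<in> {\<lambda>i x. c i | c. \<exists>B. \<forall>i. cmod (c i) \<le> B}"
    using assms by (intro CollectI exI conjI refl) auto
next
  fix w :: "'i \<Rightarrow> 'a \<Rightarrow> complex" assume "w \<in> {\<lambda>i x. c i | c. \<exists>B. \<forall>i. cmod (c i) \<le> B}"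
  then obtain c B where w: "w = (\<lambda>i x. c i)" "\<forall>i. cmod (c i) \<le> B" by auto
  show "w i differentiable (at x)" for i x by (simp add: w)
  show "\<exists>B k. \<forall>i x. cmod (w i x) \<le> B * (1 + norm x) ^ k"
    using w by (intro exI[of _ B] exI[of _ 0]) simp
  have "(\<lambda>i. dir_deriv u (w i)) = (\<lambda>i x. 0)" for u
    by (intro ext) (simp add: w dir_deriv_eqI[OF has_derivative_const])
  then show "(\<lambda>i. dir_deriv u (w i)) \<in> {\<lambda>i x. c i | c. \<exists>B. \<forall>i. cmod (c i) \<le> B}" for u
    by (auto intro!: exI[of _ "\<lambda>_. 0"])
qed

lemma slow_family_coord:
  fixes u :: "'a::euclidean_space"
  shows "slow_family (\<lambda>(i::'i) x. of_real (x \<bullet> u))"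
proof (rule slow_family_coinduct[where X = "{\<lambda>i x. of_real (x \<bullet> u)} \<union> Collect slow_family"])
  fix w :: "'i \<Rightarrow> 'a \<Rightarrow> complex" assume "w \<in> {\<lambda>i x. of_real (x \<bullet> u)} \<union> Collect slow_family"
  then consider "slow_family w" | "w = (\<lambda>i x. of_real (x \<bullet> u))" by auto
  note cases = this
  have der: "((\<lambda>x. complex_of_real (x \<bullet> u)) has_derivative (\<lambda>h. of_real (h \<bullet> u))) (at x)" for x
    by (auto intro!: derivative_eq_intros)
  show "w i differentiable (at x)" for i x
    by (cases rule: cases) (use der in \<open>auto intro: slow_family_differentiable differentiableI\<close>)
  show "\<exists>B k. \<forall>i x. cmod (w i x) \<le> B * (1 + norm x) ^ k"
  proof (cases rule: cases)
    case 2
    have "\<bar>x \<bullet> u\<bar> \<le> norm u * (1 + norm x)" for x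
      using Cauchy_Schwarz_ineq2[of x u] by (simp add: algebra_simps add_increasing)
    with 2 show ?thesis by (intro exI[of _ "norm u"] exI[of _ 1]) simp
  qed (rule slow_family_growth)
  fix v :: 'a assume v: "v \<in> Basis"
  show "(\<lambda>i. dir_deriv v (w i)) \<in> {\<lambda>i x. of_real (x \<bullet> u)} \<union> Collect slow_family"
  proof (cases rule: cases)
    case 1
    then show ?thesis using slow_family_dir_deriv v by blast
  next
    case 2
    have "(\<lambda>i. dir_deriv v (w i)) = (\<lambda>i x. of_real (v \<bullet> u))"
      by (intro ext) (simp add: 2 dir_deriv_eqI[OF der])
    moreover have "slow_family (\<lambda>(i::'i) (x::'a). complex_of_real (v \<bullet> u))"
      by (rule slow_family_scalar) (rule order_refl)
    ultimately show ?thesis by simp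
  qed
qed simp

lemma schwartz_family_add:
  assumes "schwartz_family w" "schwartz_family v"
  shows "schwartz_family (\<lambda>i x. w i x + v i x)"
proof (rule schwartz_family_coinduct_decay[where
      X = "{\<lambda>i x. w i x + v i x | w v. schwartz_family w \<and> schwartz_family v}"])
  show "(\<lambda>i x. w i x + v i x) \<in> {\<lambda>i x. w i x + v i x | w v. schwartz_family w \<and> schwartz_family v}"
    by (rule CollectI, rule exI[of _ w], rule exI[of _ v]) (simp add: assms)
next
  fix z :: "'a \<Rightarrow> 'b \<Rightarrow> complex"
  assume "z \<in> {\<lambda>i x. w i x + v i x | w v. schwartz_family w \<and> schwartz_family v}"
  then obtain w v where z: "z = (\<lambda>i x. w i x + v i x)" and w: "schwartz_family w" and v: "schwartz_family v"
    by auto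
  note d = schwartz_family_differentiable[OF w] schwartz_family_differentiable[OF v]
  show "z i differentiable (at x)" for i x
    unfolding z using d by (intro differentiable_add) auto
  show "\<exists>B. \<forall>i x. norm x ^ k * cmod (z i x) \<le> B" for k
  proof -
    obtain B C where B: "\<And>i x. norm x ^ k * cmod (w i x) \<le> B" and C: "\<And>i x. norm x ^ k * cmod (v i x) \<le> C"
      using schwartz_family_decay[OF w, of k] schwartz_family_decay[OF v, of k] by blast
    have "norm x ^ k * cmod (z i x) \<le> B + C" for i x
    proof -
      have "norm x ^ k * cmod (z i x) \<le> norm x ^ k * (cmod (w i x) + cmod (v i x))"
        unfolding z by (intro mult_left_mono norm_triangle_ineq) simp
      then show ?thesis using B[of x i] C[of x i] by (simp add: distrib_left)
    qed
    then show ?thesis by blast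
  qed
  show "(\<lambda>i. dir_deriv u (z i)) \<in> {\<lambda>i x. w i x + v i x | w v. schwartz_family w \<and> schwartz_family v}"
    if "u \<in> Basis" for u
  proof -
    have "(\<lambda>i. dir_deriv u (z i)) = (\<lambda>i x. dir_deriv u (w i) x + dir_deriv u (v i) x)"
      unfolding z by (intro ext dir_deriv_add d)
    then show ?thesis using schwartz_family_dir_deriv[OF w that] schwartz_family_dir_deriv[OF v that]
      by (intro CollectI exI conjI)
  qed
qed

text \<open>The derivative of a product is a sum of two products, so the class to which coinduction applies
  has to contain sums.\<close>

inductive_set product_hull :: "('i \<Rightarrow> 'a::euclidean_space \<Rightarrow> complex) set" where
  prod: "slow_family a \<Longrightarrow> schwartz_family w \<Longrightarrow> (\<lambda>i x. a i x * w i x) \<in> product_hull"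
| add: "v \<in> product_hull \<Longrightarrow> w \<in> product_hull \<Longrightarrow> (\<lambda>i x. v i x + w i x) \<in> product_hull"

lemma product_hull_closed:
  assumes "z \<in> product_hull"
  shows "(\<forall>i x. z i differentiable (at x)) \<and> (\<forall>k. \<exists>B. \<forall>i x. norm x ^ k * cmod (z i x) \<le> B) \<and>
     (\<forall>u\<in>Basis. (\<lambda>i. dir_deriv u (z i)) \<in> product_hull)"
  using assms
proof induction
  case (prod a w)
  note d = slow_family_differentiable[OF prod(1)] schwartz_family_differentiable[OF prod(2)]
  have "\<exists>B. \<forall>i x. norm x ^ k * cmod (a i x * w i x) \<le> B" for k
  proof -
    obtain B l where B: "\<And>i x. cmod (a i x) \<le> B * (1 + norm x) ^ l"
      using slow_family_growth[OF prod(1)] by blast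
    obtain C D where C: "\<And>i x. norm x ^ k * cmod (w i x) \<le> C" and
      D: "\<And>i x. norm x ^ (k + l) * cmod (w i x) \<le> D"
      using schwartz_family_decay[OF prod(2), of k] schwartz_family_decay[OF prod(2), of "k + l"] by blast
    have B0: "0 \<le> B" using order_trans[OF norm_ge_zero B[of _ 0]] by simp
    have "norm x ^ k * cmod (a i x * w i x) \<le> B * (2 ^ l * (C + D))" for i x
    proof -
      have "(1 + norm x) ^ l \<le> 2 ^ l * (1 + norm x ^ l)"
      proof (cases "norm x \<le> 1")
        case True
        have "(1 + norm x) ^ l \<le> 2 ^ l" using True by (intro power_mono) auto
        also have "\<dots> \<le> 2 ^ l * (1 + norm x ^ l)" by simp
        finally show ?thesis .
      next
        case False
        have "(1 + norm x) ^ l \<le> (2 * norm x) ^ l" using False by (intro power_mono) auto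
        also have "\<dots> \<le> 2 ^ l * (1 + norm x ^ l)" by (simp add: power_mult_distrib)
        finally show ?thesis .
      qed
      hence "cmod (a i x) \<le> B * (2 ^ l * (1 + norm x ^ l))"
        by (rule order_trans[OF B mult_left_mono[OF _ B0]])
      hence "norm x ^ k * cmod (a i x * w i x) \<le> norm x ^ k * (B * (2 ^ l * (1 + norm x ^ l)) * cmod (w i x))"
        unfolding norm_mult by (intro mult_left_mono mult_right_mono) auto
      also have "\<dots> = B * (2 ^ l * (norm x ^ k * cmod (w i x) + norm x ^ (k + l) * cmod (w i x)))"
        by (simp add: algebra_simps power_add)
      also have "\<dots> \<le> B * (2 ^ l * (C + D))"
        using B0 by (intro mult_left_mono add_mono C D) auto
      finally show ?thesis .
    qed
    then show ?thesis by blast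
  qed
  moreover have "(\<lambda>i. dir_deriv u (\<lambda>x. a i x * w i x)) \<in> product_hull" if u: "u \<in> Basis" for u
  proof -
    have "(\<lambda>i. dir_deriv u (\<lambda>x. a i x * w i x)) = (\<lambda>i x. a i x * dir_deriv u (w i) x + dir_deriv u (a i) x * w i x)"
      by (intro ext dir_deriv_mult d)
    moreover have "\<dots> \<in> product_hull"
      using prod slow_family_dir_deriv[OF prod(1) u] schwartz_family_dir_deriv[OF prod(2) u]
      by (intro product_hull.intros)
    ultimately show ?thesis by simp
  qed
  ultimately show ?case using d by (auto intro!: differentiable_mult)
next
  case (add v w)
  then have d: "\<And>i x. v i differentiable (at x)" "\<And>i x. w i differentiable (at x)" by auto
  have "\<exists>B. \<forall>i x. norm x ^ k * cmod (v i x + w i x) \<le> B" for k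
  proof -
    obtain B C where B: "\<And>i x. norm x ^ k * cmod (v i x) \<le> B" and C: "\<And>i x. norm x ^ k * cmod (w i x) \<le> C"
      using add.IH by meson
    have "norm x ^ k * cmod (v i x + w i x) \<le> B + C" for i x
    proof -
      have "norm x ^ k * cmod (v i x + w i x) \<le> norm x ^ k * (cmod (v i x) + cmod (w i x))"
        by (intro mult_left_mono norm_triangle_ineq) simp
      then show ?thesis using B[of x i] C[of x i] by (simp add: distrib_left)
    qed
    then show ?thesis by blast
  qed
  moreover have "(\<lambda>i. dir_deriv u (\<lambda>x. v i x + w i x)) \<in> product_hull" if u: "u \<in> Basis" for u
  proof -
    have "(\<lambda>i. dir_deriv u (\<lambda>x. v i x + w i x)) = (\<lambda>i x. dir_deriv u (v i) x + dir_deriv u (w i) x)"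
      by (intro ext dir_deriv_add d)
    then show ?thesis using add.IH u by (auto intro!: product_hull.add)
  qed
  ultimately show ?case using d by (auto intro!: differentiable_add)
qed

lemma schwartz_family_mult:
  assumes "slow_family a" "schwartz_family w"
  shows "schwartz_family (\<lambda>i x. a i x * w i x)"
proof (rule schwartz_family_coinduct_decay[where X = product_hull])
  show "(\<lambda>i x. a i x * w i x) \<in> product_hull" using assms by (rule product_hull.prod)
  show "w i differentiable (at x)" if "w \<in> product_hull" for w :: "'a \<Rightarrow> 'b \<Rightarrow> complex" and i x
    using product_hull_closed[OF that] by simp
  show "\<exists>B. \<forall>i x. norm x ^ k * cmod (w i x) \<le> B" if "w \<in> product_hull" for w :: "'a \<Rightarrow> 'b \<Rightarrow> complex" and k
    using product_hull_closed[OF that] by simp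
  show "(\<lambda>i. dir_deriv u (w i)) \<in> product_hull" if "w \<in> product_hull" "u \<in> Basis" for w :: "'a \<Rightarrow> 'b \<Rightarrow> complex" and u
    using product_hull_closed[OF that(1)] that(2) by simp
qed

lemma schwartz_family_coord:
  "schwartz_family w \<Longrightarrow> schwartz_family (\<lambda>i x. of_real (x \<bullet> u) * w i x)"
  by (rule schwartz_family_mult[OF slow_family_coord])

lemma schwartz_family_cmult:
  fixes c :: complex
  shows "schwartz_family w \<Longrightarrow> schwartz_family (\<lambda>i x. c * w i x)"
  by (rule schwartz_family_mult[OF slow_family_scalar]) auto

lemma schwartz_family_affine:
  assumes w: "schwartz_family w" and c: "c \<noteq> 0"
  shows "schwartz_family (\<lambda>i x. w i (c *\<^sub>R x + y))"
proof (rule schwartz_family_coinduct[where X = "{\<lambda>i x. w i (c *\<^sub>R x + y) | w. schwartz_family w}"])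
  show "(\<lambda>i x. w i (c *\<^sub>R x + y)) \<in> {\<lambda>i x. w i (c *\<^sub>R x + y) | w. schwartz_family w}"
    by (rule CollectI, rule exI[of _ w]) (simp add: w)
next
  fix z :: "'a \<Rightarrow> 'b \<Rightarrow> complex"
  assume "z \<in> {\<lambda>i x. w i (c *\<^sub>R x + y) | w. schwartz_family w}"
  then obtain w where z: "z = (\<lambda>i x. w i (c *\<^sub>R x + y))" and w: "schwartz_family w" by auto
  note d = schwartz_family_differentiable[OF w]
  show "z i differentiable (at x)" for i x
    unfolding z by (rule dir_deriv_scaleR_plus(1)[OF d])
  show "\<exists>B. \<forall>i x. cmod (z i x) \<le> B" unfolding z using schwartz_family_bounded[OF w] by blast
  fix u :: 'b assume u: "u \<in> Basis"
  have "(\<lambda>i. dir_deriv u (z i)) = (\<lambda>i x. (\<lambda>x. of_real c * dir_deriv u (w i) x) (c *\<^sub>R x + y))"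
    unfolding z by (intro ext) (simp add: dir_deriv_scaleR_plus(2)[OF d])
  then show "(\<lambda>i. dir_deriv u (z i)) \<in> {\<lambda>i x. w i (c *\<^sub>R x + y) | w. schwartz_family w}"
    using schwartz_family_cmult[OF schwartz_family_dir_deriv[OF w u], of "of_real c"]
    by (intro CollectI exI conjI)
  have "(\<lambda>i x. of_real (x \<bullet> u) * z i x) = (\<lambda>i x. (\<lambda>x. of_real (1/c) * (of_real (x \<bullet> u) * w i x)
      + of_real (- (y \<bullet> u) / c) * w i x) (c *\<^sub>R x + y))"
  proof (intro ext)
    fix i x
    have e: "complex_of_real (x \<bullet> u) = of_real ((1/c) * ((c *\<^sub>R x + y) \<bullet> u)) + of_real (- (y \<bullet> u) / c)"
      using c unfolding of_real_add[symmetric] of_real_eq_iff by (simp add: inner_add_left field_simps)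
    show "of_real (x \<bullet> u) * z i x = of_real (1/c) * (of_real ((c *\<^sub>R x + y) \<bullet> u) * w i (c *\<^sub>R x + y))
      + of_real (- (y \<bullet> u) / c) * w i (c *\<^sub>R x + y)"
      unfolding z e by (simp add: distrib_right left_diff_distrib)
  qed
  moreover have "schwartz_family (\<lambda>i x. of_real (1/c) * (of_real (x \<bullet> u) * w i x) + of_real (- (y \<bullet> u) / c) * w i x)"
    by (intro schwartz_family_add schwartz_family_cmult schwartz_family_coord w)
  ultimately show "(\<lambda>i x. of_real (x \<bullet> u) * z i x) \<in> {\<lambda>i x. w i (c *\<^sub>R x + y) | w. schwartz_family w}"
    by (intro CollectI exI conjI)
qed

lemma integrable_inverse_square: "integrable lborel (\<lambda>x::real. 1 / (1 + x\<^sup>2))"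
  and integral_inverse_square: "(LINT x|lborel. 1 / (1 + x\<^sup>2)) = pi"
proof -
  have e: "einterval (-\<infinity>) \<infinity> = UNIV" by (auto simp: einterval_def)
  show "integrable lborel (\<lambda>x::real. 1 / (1 + x\<^sup>2))"
    using integrable_inverse_1_plus_square by (simp add: e set_integrable_def inverse_eq_divide)
  show "(LINT x|lborel. 1 / (1 + x\<^sup>2)) = pi"
    using LBINT_inverse_1_plus_square
    by (simp add: e interval_lebesgue_integral_def set_lebesgue_integral_def inverse_eq_divide)
qed

text \<open>The model of decay for all kernels below. It is integrable, it changes by bounded factors under
  bounded translations, and a multiple of it dominates any Schwartz function on the line.\<close>

definition rho :: "real \<Rightarrow> real" where "rho t = 1 / (1 + t\<^sup>2)"

lemma rho_pos [simp]: "0 < rho t" by (simp add: rho_def add_pos_nonneg)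
lemma rho_nonneg [simp]: "0 \<le> rho t" using rho_pos less_imp_le by blast
lemma rho_le_1: "rho t \<le> 1"
  using zero_le_power2[of t] unfolding rho_def by (subst divide_le_eq_1_pos) linarith+
lemma rho_measurable [measurable]: "rho \<in> borel_measurable borel" unfolding rho_def by measurable

lemma rho_shift:
  assumes "\<bar>s - t\<bar> \<le> 1" shows "rho s \<le> 3 * rho t"
proof -
  define d where "d = (s - t)\<^sup>2"
  have "d \<le> 1" using assms by (simp add: abs_square_le_1 d_def)
  moreover have "t\<^sup>2 \<le> 2 * s\<^sup>2 + 2 * d"
    using zero_le_power2[of "2 * s - t"] by (simp add: power2_eq_square algebra_simps d_def)
  moreover have "0 \<le> s\<^sup>2" by simp
  ultimately have "1 + t\<^sup>2 \<le> 3 * (1 + s\<^sup>2)" unfolding distrib_left by linarith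
  then show ?thesis by (simp add: rho_def field_simps add_pos_nonneg)
qed

lemma nn_integral_rho: "(\<integral>\<^sup>+x. ennreal (rho x) \<partial>lborel) = ennreal pi"
  using nn_integral_eq_integral[OF integrable_inverse_square] integral_inverse_square
  by (simp add: rho_def)

text \<open>An integrable majorant for Schwartz functions in any dimension; as a product over the coordinates
  its integral is a product of one-dimensional ones.\<close>

definition weight :: "'a::euclidean_space \<Rightarrow> real" where
  "weight x = (\<Prod>b\<in>Basis. rho (x \<bullet> b))"

lemma weight_nonneg [simp]: "0 \<le> weight x" unfolding weight_def by (intro prod_nonneg) simp

lemma weight_measurable [measurable]: "weight \<in> borel_measurable borel"
  unfolding weight_def by measurable

lemma integrable_weight: "integrable lborel (weight :: 'a::euclidean_space \<Rightarrow> real)"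
proof (rule integrableI_nonneg)
  have "(\<integral>\<^sup>+x. ennreal (weight x) \<partial>(lborel :: 'a measure)) = (\<integral>\<^sup>+x. (\<Prod>b\<in>Basis. ennreal (rho (x \<bullet> b))) \<partial>(lborel :: 'a measure))"
    by (simp add: weight_def prod_ennreal)
  also have "\<dots> = (\<Prod>b\<in>(Basis::'a set). (\<integral>\<^sup>+x. ennreal (rho x) \<partial>lborel))"
    by (rule nn_integral_lborel_prod) auto
  also have "\<dots> < \<infinity>" by (simp add: nn_integral_rho ennreal_power power_less_top_ennreal)
  finally show "(\<integral>\<^sup>+x. ennreal (weight x) \<partial>(lborel :: 'a measure)) < \<infinity>" .
qed auto

lemma weight_shift:
  assumes u: "u \<in> Basis" and s: "\<bar>s\<bar> \<le> 1"
  shows "weight (x + s *\<^sub>R u) \<le> 3 * weight x"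
proof -
  have *: "weight y = rho (y \<bullet> u) * (\<Prod>b\<in>Basis - {u}. rho (y \<bullet> b))" for y
    unfolding weight_def using u by (intro prod.remove) auto
  have 1: "(\<Prod>b\<in>Basis - {u}. rho ((x + s *\<^sub>R u) \<bullet> b)) = (\<Prod>b\<in>Basis - {u}. rho (x \<bullet> b))"
    by (intro prod.cong) (auto simp: inner_add_left inner_not_same_Basis u)
  have 2: "rho ((x + s *\<^sub>R u) \<bullet> u) \<le> 3 * rho (x \<bullet> u)"
    using u s by (intro rho_shift) (simp add: inner_add_left)
  show ?thesis unfolding *[of "x + s *\<^sub>R u"] *[of x] 1
    using mult_right_mono[OF 2, of "\<Prod>b\<in>Basis - {u}. rho (x \<bullet> b)"] by (simp add: prod_nonneg mult.assoc)
qed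

text \<open>The reciprocal of \<open>weight x\<close> is at most \<open>(1 + (norm x)\<^sup>2) ^ DIM('a)\<close>, a polynomial that the
  decay of the family absorbs.\<close>

lemma schwartz_family_le_weight:
  fixes w :: "'i \<Rightarrow> 'a::euclidean_space \<Rightarrow> complex"
  assumes "schwartz_family w"
  obtains B where "0 \<le> B" "\<And>i x. cmod (w i x) \<le> B * weight x"
proof -
  let ?d = "DIM('a)"
  obtain C D where C: "\<And>i x. cmod (w i x) \<le> C" and D: "\<And>i x. norm x ^ (2 * ?d) * cmod (w i x) \<le> D"
    using schwartz_family_bounded[OF assms] schwartz_family_decay[OF assms, of "2 * ?d"] by blast
  have "cmod (w i x) \<le> (2 ^ ?d * (C + D)) * weight x" for i x
  proof -
    define N where "N = (norm x)\<^sup>2"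
    have N0: "N \<ge> 0" by (simp add: N_def)
    have "(\<Prod>b\<in>(Basis::'a set). 1 + (x \<bullet> b)\<^sup>2) \<le> (\<Prod>b\<in>(Basis::'a set). 1 + N)"
    proof (intro prod_mono conjI)
      fix b :: 'a assume "b \<in> Basis"
      then show "1 + (x \<bullet> b)\<^sup>2 \<le> 1 + N" unfolding N_def
        using Basis_le_norm[of b x] by (simp add: abs_le_square_iff[symmetric])
    qed auto
    also have "\<dots> = (1 + N) ^ ?d" by simp
    also have "\<dots> \<le> 2 ^ ?d * (1 + N ^ ?d)"
    proof (cases "N \<le> 1")
      case True
      have "(1 + N) ^ ?d \<le> 2 ^ ?d" using True N0 by (intro power_mono) auto
      also have "\<dots> \<le> 2 ^ ?d * (1 + N ^ ?d)" using N0 by simp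
      finally show ?thesis .
    next
      case False
      have "(1 + N) ^ ?d \<le> (2 * N) ^ ?d" using False N0 by (intro power_mono) auto
      also have "\<dots> \<le> 2 ^ ?d * (1 + N ^ ?d)" by (simp add: power_mult_distrib)
      finally show ?thesis .
    qed
    finally have 1: "(\<Prod>b\<in>(Basis::'a set). 1 + (x \<bullet> b)\<^sup>2) \<le> 2 ^ ?d * (1 + N ^ ?d)" .
    have Nd: "N ^ ?d = norm x ^ (2 * ?d)" by (simp add: N_def power_mult)
    have "cmod (w i x) * (\<Prod>b\<in>(Basis::'a set). 1 + (x \<bullet> b)\<^sup>2) \<le> cmod (w i x) * (2 ^ ?d * (1 + N ^ ?d))"
      by (rule mult_left_mono[OF 1]) simp
    also have "\<dots> = 2 ^ ?d * (cmod (w i x) + norm x ^ (2 * ?d) * cmod (w i x))"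
      by (simp add: Nd algebra_simps)
    also have "\<dots> \<le> 2 ^ ?d * (C + D)" by (intro mult_left_mono add_mono C D) auto
    finally have 2: "cmod (w i x) * (\<Prod>b\<in>(Basis::'a set). 1 + (x \<bullet> b)\<^sup>2) \<le> 2 ^ ?d * (C + D)" .
    have w: "weight x = 1 / (\<Prod>b\<in>(Basis::'a set). 1 + (x \<bullet> b)\<^sup>2)"
      by (simp add: weight_def rho_def prod_dividef)
    have "(\<Prod>b\<in>(Basis::'a set). 1 + (x \<bullet> b)\<^sup>2) > 0" by (intro prod_pos) (auto simp: add_pos_nonneg)
    with 2 show ?thesis by (simp add: w field_simps)
  qed
  moreover have "0 \<le> 2 ^ ?d * (C + D)"
  proof -
    have "0 \<le> C" using order_trans[OF norm_ge_zero C] .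
    moreover have "0 \<le> D" using order_trans[OF _ D, of 0] by simp
    ultimately show ?thesis by simp
  qed
  ultimately show thesis using that by blast
qed

lemma schwartz_family_measurable:
  assumes "schwartz_family w" shows "w i \<in> borel_measurable borel"
proof (rule borel_measurable_continuous_onI)
  show "continuous_on UNIV (w i)"
    using schwartz_family_differentiable[OF assms]
    by (intro continuous_at_imp_continuous_on ballI differentiable_imp_continuous_within) auto
qed

lemma schwartz_family_integrable:
  assumes "schwartz_family w" shows "integrable lborel (w i)"
proof -
  obtain B where B: "0 \<le> B" "\<And>i x. cmod (w i x) \<le> B * weight x"
    using schwartz_family_le_weight[OF assms] by blast
  show ?thesis
    using schwartz_family_measurable[OF assms] B
    by (intro Bochner_Integration.integrable_bound[OF integrable_mult_right[OF integrable_weight, of B]])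
       (auto simp: abs_mult)
qed

lemmas schwartz_family_of = schwartz_iff_family[THEN iffD1]

lemma schwartz_measurable: "f \<in> schwartz \<Longrightarrow> f \<in> borel_measurable borel"
  using schwartz_family_measurable[OF schwartz_family_of] by blast

lemma schwartz_integrable: "f \<in> schwartz \<Longrightarrow> integrable lborel f"
  using schwartz_family_integrable[OF schwartz_family_of] by blast

lemma schwartz_differentiable: "f \<in> schwartz \<Longrightarrow> f differentiable (at x)"
  using schwartz_family_differentiable[OF schwartz_family_of] by blast

lemma schwartz_coord: "f \<in> schwartz \<Longrightarrow> (\<lambda>x. of_real (x \<bullet> u) * f x) \<in> schwartz"
  using schwartz_family_coord[OF schwartz_family_of] schwartz_family_in by fastforce

lemma schwartz_dir_deriv: "f \<in> schwartz \<Longrightarrow> u \<in> Basis \<Longrightarrow> dir_deriv u f \<in> schwartz"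
  using schwartz_family_dir_deriv[OF schwartz_family_of] schwartz_family_in by fastforce

lemma schwartz_cmult: "f \<in> schwartz \<Longrightarrow> (\<lambda>x. c * f x) \<in> schwartz" for c :: complex
  using schwartz_family_cmult[OF schwartz_family_of] schwartz_family_in by fastforce

lemma schwartz_add: "f \<in> schwartz \<Longrightarrow> g \<in> schwartz \<Longrightarrow> (\<lambda>x. f x + g x) \<in> schwartz"
  using schwartz_family_add[OF schwartz_family_of schwartz_family_of] schwartz_family_in by fastforce

section \<open>The Fourier transform of Schwartz functions\<close>

lemma integrable_unimodular_mult:
  fixes f :: "'a \<Rightarrow> complex"
  assumes "integrable M f" "a \<in> borel_measurable M" "\<And>x. cmod (a x) \<le> 1"
  shows "integrable M (\<lambda>x. a x * f x)"
proof (rule Bochner_Integration.integrable_bound[OF assms(1)])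
  show "(\<lambda>x. a x * f x) \<in> borel_measurable M" using assms by measurable
  show "AE x in M. cmod (a x * f x) \<le> cmod (f x)"
    by (intro AE_I2) (auto simp: norm_mult intro!: mult_left_le_one_le assms(3))
qed

lemma fourier_kernel_measurable [measurable]:
  "(\<lambda>x::'a::euclidean_space. exp (- \<i> * of_real (x \<bullet> \<xi>))) \<in> borel_measurable borel"
  "(\<lambda>x::'a::euclidean_space. exp (\<i> * of_real (x \<bullet> \<xi>))) \<in> borel_measurable borel"
  by measurable

lemma fourier_integrable:
  assumes "integrable lborel f"
  shows "integrable lborel (\<lambda>x. exp (- \<i> * of_real (x \<bullet> \<xi>)) * f x)"
  using assms by (rule integrable_unimodular_mult) (auto simp: norm_exp_eq_Re)

lemma fourier_linear:
  assumes "integrable lborel f" "integrable lborel g"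
  shows "fourier (\<lambda>x. a * f x + b * g x) \<xi> = a * fourier f \<xi> + b * fourier g \<xi>"
proof -
  note [simp] = fourier_integrable[OF assms(1), simplified] fourier_integrable[OF assms(2), simplified]
  have "(LINT x|lborel. exp (- \<i> * of_real (x \<bullet> \<xi>)) * (a * f x + b * g x)) =
    (LINT x|lborel. a * (exp (- \<i> * of_real (x \<bullet> \<xi>)) * f x) + b * (exp (- \<i> * of_real (x \<bullet> \<xi>)) * g x))"
    by (simp add: algebra_simps)
  also have "\<dots> = a * (LINT x|lborel. exp (- \<i> * of_real (x \<bullet> \<xi>)) * f x) + b * (LINT x|lborel. exp (- \<i> * of_real (x \<bullet> \<xi>)) * g x)"
    by (subst Bochner_Integration.integral_add) auto
  finally show ?thesis by (simp add: fourier_def algebra_simps)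
qed

lemma fourier_cmult: "fourier (\<lambda>x. a * f x) \<xi> = a * fourier f \<xi>"
proof -
  have "(LINT x|lborel. exp (- \<i> * of_real (x \<bullet> \<xi>)) * (a * f x)) =
    (LINT x|lborel. a * (exp (- \<i> * of_real (x \<bullet> \<xi>)) * f x))"
    by (simp add: algebra_simps)
  then show ?thesis by (simp add: fourier_def algebra_simps)
qed

lemma norm_fourier_le:
  fixes f :: "'a::euclidean_space \<Rightarrow> complex"
  assumes "integrable lborel f"
  shows "cmod (fourier f \<xi>) \<le> (2 * pi) powr (- real DIM('a) / 2) * (LINT x|lborel. cmod (f x))"
proof -
  have "cmod (LINT x|lborel. exp (- \<i> * of_real (x \<bullet> \<xi>)) * f x)
     \<le> (LINT x|lborel. cmod (exp (- \<i> * of_real (x \<bullet> \<xi>)) * f x))" by (rule integral_norm_bound)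
  also have "\<dots> = (LINT x|lborel. cmod (f x))" by (simp add: norm_mult norm_exp_eq_Re)
  finally show ?thesis by (simp add: fourier_def norm_mult mult_left_mono)
qed

lemma has_derivative_quadratic_remainder:
  fixes f :: "'a::real_normed_vector \<Rightarrow> 'b::real_normed_vector"
  assumes "bounded_linear D" and C: "\<And>h. norm (f (x + h) - f x - D h) \<le> C * (norm h)\<^sup>2"
  shows "(f has_derivative D) (at x)"
  unfolding has_derivative_at
proof (intro conjI assms(1))
  have "((\<lambda>h. C * norm h) \<longlongrightarrow> 0) (at 0)" by (auto intro!: tendsto_eq_intros)
  then show "(\<lambda>h. norm (f (x + h) - f x - D h) / norm h) \<midarrow>0\<rightarrow> 0"
  proof (rule Lim_null_comparison[rotated])
    have "norm (f (x + h) - f x - D h) / norm h \<le> C * norm h" if "h \<noteq> 0" for h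
      using C[of h] that by (simp add: divide_le_eq power2_eq_square mult_ac)
    then show "\<forall>\<^sub>F h in at 0. norm (norm (f (x + h) - f x - D h) / norm h) \<le> C * norm h"
      by (auto simp: eventually_at_filter)
  qed
qed

lemma norm_exp_i_minus_linear: "cmod (exp (\<i> * of_real s) - 1 - \<i> * of_real s) \<le> s\<^sup>2"
proof -
  have "cmod (exp (\<i> * of_real s) - 1 - \<i> * of_real s) \<le> \<bar>s\<bar> ^ 2 / fact 2"
    using iexp_approx1[of s 1] by (simp add: numeral_2_eq_2 algebra_simps)
  also have "\<dots> \<le> s\<^sup>2" by simp
  finally show ?thesis .
qed

text \<open>Differentiation under the integral sign. The remainder of the expansion of the exponential is at
  most \<open>(x \<bullet> h)\<^sup>2\<close>, and the second moment of a Schwartz function is finite.\<close>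

lemma fourier_has_derivative:
  fixes f :: "'a::euclidean_space \<Rightarrow> complex"
  assumes f: "f \<in> schwartz"
  shows "(fourier f has_derivative (\<lambda>h. fourier (\<lambda>x. - \<i> * (of_real (x \<bullet> h) * f x)) \<xi>)) (at \<xi>)"
proof -
  define c where "c = (2 * pi) powr (- real DIM('a) / 2)"
  note int = schwartz_integrable[OF f] schwartz_integrable[OF schwartz_coord[OF f]]
  let ?D = "\<lambda>h. fourier (\<lambda>x. - \<i> * (of_real (x \<bullet> h) * f x)) \<xi>"
  have "linear ?D"
  proof (rule linearI)
    show "?D (h + k) = ?D h + ?D k" for h k
      using fourier_linear[OF int(2)[of h] int(2)[of k], of "-\<i>" "-\<i>" \<xi>]
      by (simp add: fourier_cmult inner_add_right algebra_simps flip: fourier_cmult)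
    show "?D (r *\<^sub>R h) = r *\<^sub>R ?D h" for r h
      using fourier_cmult[of "of_real r" "\<lambda>x. - \<i> * (of_real (x \<bullet> h) * f x)" \<xi>]
      by (simp add: scaleR_conv_of_real mult_ac)
  qed
  hence lin: "bounded_linear ?D" by (simp add: linear_conv_bounded_linear)
  have sq: "integrable lborel (\<lambda>x. (norm x)\<^sup>2 * cmod (f x))"
  proof -
    have "integrable lborel (\<lambda>x. \<Sum>b\<in>Basis. cmod (of_real (x \<bullet> b) * (of_real (x \<bullet> b) * f x)))"
      by (intro Bochner_Integration.integrable_sum integrable_norm schwartz_integrable schwartz_coord f)
    moreover have "(\<Sum>b\<in>Basis. cmod (of_real (x \<bullet> b) * (of_real (x \<bullet> b) * f x))) = (norm x)\<^sup>2 * cmod (f x)" for x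
    proof -
      have "(norm x)\<^sup>2 = (\<Sum>b\<in>Basis. (x \<bullet> b) * (x \<bullet> b))"
        unfolding power2_norm_eq_inner by (rule euclidean_inner)
      then show ?thesis by (simp add: norm_mult sum_distrib_right mult.assoc[symmetric])
    qed
    ultimately show ?thesis by simp
  qed
  define C where "C = c * (LINT x|lborel. (norm x)\<^sup>2 * cmod (f x))"
  show ?thesis
  proof (rule has_derivative_quadratic_remainder[OF lin])
    fix h
    let ?r = "\<lambda>x. exp (- \<i> * of_real (x \<bullet> \<xi>)) * ((exp (- \<i> * of_real (x \<bullet> h)) - 1 + \<i> * of_real (x \<bullet> h)) * f x)"
    have r: "?r x = exp (- \<i> * of_real (x \<bullet> (\<xi> + h))) * f x - exp (- \<i> * of_real (x \<bullet> \<xi>)) * f x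
       - exp (- \<i> * of_real (x \<bullet> \<xi>)) * (- \<i> * (of_real (x \<bullet> h) * f x))" for x
      by (simp add: inner_add_right algebra_simps exp_add exp_diff exp_minus divide_inverse)
    have i3: "integrable lborel (\<lambda>x. - \<i> * (of_real (x \<bullet> h) * f x))" using int(2)[of h] by simp
    have "(LINT x|lborel. ?r x) = (LINT x|lborel. exp (- \<i> * of_real (x \<bullet> (\<xi> + h))) * f x) -
       (LINT x|lborel. exp (- \<i> * of_real (x \<bullet> \<xi>)) * f x)
       - (LINT x|lborel. exp (- \<i> * of_real (x \<bullet> \<xi>)) * (- \<i> * (of_real (x \<bullet> h) * f x)))"
      unfolding r
      by (subst Bochner_Integration.integral_diff Bochner_Integration.integral_diff;
          (intro Bochner_Integration.integrable_diff fourier_integrable int(1) i3)?)+ simp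
    note L = this
    have eq: "fourier f (\<xi> + h) - fourier f \<xi> - ?D h = of_real c * (LINT x|lborel. ?r x)"
      by (simp only: fourier_def c_def[symmetric] L right_diff_distrib)
    have "cmod (LINT x|lborel. ?r x) \<le> (LINT x|lborel. (norm h)\<^sup>2 * ((norm x)\<^sup>2 * cmod (f x)))"
    proof (rule order_trans[OF integral_norm_bound integral_mono])
      show "integrable lborel (\<lambda>x. cmod (?r x))"
        unfolding r by (intro integrable_norm Bochner_Integration.integrable_diff fourier_integrable int(1) i3)
      show "integrable lborel (\<lambda>x. (norm h)\<^sup>2 * ((norm x)\<^sup>2 * cmod (f x)))" using sq by simp
      fix x
      have "cmod (exp (- \<i> * of_real (x \<bullet> h)) - 1 + \<i> * of_real (x \<bullet> h)) \<le> (x \<bullet> h)\<^sup>2"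
        using norm_exp_i_minus_linear[of "- (x \<bullet> h)"] by simp
      also have "\<dots> \<le> (norm x * norm h)\<^sup>2"
        using Cauchy_Schwarz_ineq2[of x h] by (simp add: abs_le_square_iff[symmetric])
      finally have "cmod (exp (- \<i> * of_real (x \<bullet> h)) - 1 + \<i> * of_real (x \<bullet> h)) * cmod (f x) \<le> (norm x * norm h)\<^sup>2 * cmod (f x)"
        by (rule mult_right_mono) simp
      then show "cmod (?r x) \<le> (norm h)\<^sup>2 * ((norm x)\<^sup>2 * cmod (f x))"
        by (simp add: norm_mult norm_exp_eq_Re power_mult_distrib mult_ac)
    qed
    also have "\<dots> = (norm h)\<^sup>2 * (LINT x|lborel. (norm x)\<^sup>2 * cmod (f x))" by simp
    finally have "c * cmod (LINT x|lborel. ?r x) \<le> c * ((norm h)\<^sup>2 * (LINT x|lborel. (norm x)\<^sup>2 * cmod (f x)))"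
      by (rule mult_left_mono) (simp add: c_def)
    then show "cmod (fourier f (\<xi> + h) - fourier f \<xi> - ?D h) \<le> C * (norm h)\<^sup>2"
      unfolding eq by (simp add: norm_mult C_def c_def mult_ac)
  qed
qed

lemma line_has_vector_derivative:
  assumes "f differentiable (at (x + s *\<^sub>R u))"
  shows "((\<lambda>s. f (x + s *\<^sub>R u)) has_vector_derivative dir_deriv u f (x + s *\<^sub>R u)) (at s)"
proof -
  note D = has_derivative_dir_deriv[OF assms]
  have "((\<lambda>s. x + s *\<^sub>R u) has_derivative (\<lambda>h. h *\<^sub>R u)) (at s)"
    by (auto intro!: derivative_eq_intros)
  from has_derivative_compose[OF this D]
  have "((\<lambda>s. f (x + s *\<^sub>R u)) has_derivative (\<lambda>h. dir_deriv (h *\<^sub>R u) f (x + s *\<^sub>R u))) (at s)"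
    by (simp add: o_def)
  then show ?thesis
    unfolding has_vector_derivative_def using linear_scale[OF has_derivative_linear[OF D]] by simp
qed

text \<open>Taylor's formula along a line. Applying the linearised mean value inequality twice, first to the
  derivative and then to the function, gives the constant 3 in place of 1/2; only the order \<open>t\<^sup>2\<close> matters.\<close>

lemma second_order_remainder:
  assumes d1: "\<And>y. f differentiable (at y)" and d2: "\<And>y. dir_deriv u f differentiable (at y)"
    and B: "\<And>s. 0 \<le> s \<Longrightarrow> s \<le> t \<Longrightarrow> cmod (dir_deriv u (dir_deriv u f) (x + s *\<^sub>R u)) \<le> B" and t: "0 \<le> t"
  shows "cmod (f (x + t *\<^sub>R u) - f x - of_real t * dir_deriv u f x) \<le> 3 * t\<^sup>2 * B"
proof -
  have B0: "B \<ge> 0" using B[of 0] t order_trans[OF norm_ge_zero] by auto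
  have 1: "cmod (dir_deriv u f (x + s *\<^sub>R u) - dir_deriv u f x) \<le> 3 * t * B" if s: "s \<in> {0..t}" for s
  proof -
    have "cmod (dir_deriv u f (x + s *\<^sub>R u) - dir_deriv u f (x + 0 *\<^sub>R u) - (s - 0) *\<^sub>R dir_deriv u (dir_deriv u f) (x + 0 *\<^sub>R u))
       \<le> norm (s - 0) * (2 * B)"
    proof (rule vector_differentiable_bound_linearization[where S = "{0..t}"
          and f' = "\<lambda>s. dir_deriv u (dir_deriv u f) (x + s *\<^sub>R u)"])
      show "((\<lambda>s. dir_deriv u f (x + s *\<^sub>R u)) has_vector_derivative dir_deriv u (dir_deriv u f) (x + r *\<^sub>R u)) (at r within {0..t})" for r
        by (rule has_vector_derivative_at_within[OF line_has_vector_derivative[OF d2]])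
      show "closed_segment 0 s \<subseteq> {0..t}" using s by (auto simp: closed_segment_eq_real_ivl)
      show "norm (dir_deriv u (dir_deriv u f) (x + r *\<^sub>R u) - dir_deriv u (dir_deriv u f) (x + 0 *\<^sub>R u)) \<le> 2 * B" if "r \<in> {0..t}" for r
        using norm_triangle_ineq4[of "dir_deriv u (dir_deriv u f) (x + r *\<^sub>R u)" "dir_deriv u (dir_deriv u f) (x + 0 *\<^sub>R u)"]
          B[of r] B[of 0] that by auto
    qed (use t in auto)
    hence "cmod (dir_deriv u f (x + s *\<^sub>R u) - dir_deriv u f x) \<le> cmod (s *\<^sub>R dir_deriv u (dir_deriv u f) x) + s * (2 * B)"
      using s norm_triangle_ineq2[of "dir_deriv u f (x + s *\<^sub>R u) - dir_deriv u f x" "s *\<^sub>R dir_deriv u (dir_deriv u f) x"] by auto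
    also have "\<dots> \<le> s * B + s * (2 * B)" using mult_left_mono[OF B[of 0], of s] t s by (auto simp: mult.commute)
    also have "\<dots> = s * (3 * B)" by simp
    also have "\<dots> \<le> t * (3 * B)" using s B0 by (intro mult_right_mono) auto
    finally show ?thesis by simp
  qed
  have "cmod (f (x + t *\<^sub>R u) - f (x + 0 *\<^sub>R u) - (t - 0) *\<^sub>R dir_deriv u f (x + 0 *\<^sub>R u)) \<le> norm (t - 0) * (3 * t * B)"
  proof (rule vector_differentiable_bound_linearization[where S = "{0..t}"
        and f' = "\<lambda>s. dir_deriv u f (x + s *\<^sub>R u)"])
    show "((\<lambda>s. f (x + s *\<^sub>R u)) has_vector_derivative dir_deriv u f (x + r *\<^sub>R u)) (at r within {0..t})" for r
      by (rule has_vector_derivative_at_within[OF line_has_vector_derivative[OF d1]])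
    show "closed_segment 0 t \<subseteq> {0..t}" using t by (auto simp: closed_segment_eq_real_ivl)
  qed (use 1 t in auto)
  then show ?thesis using t by (simp add: scaleR_conv_of_real power2_eq_square mult_ac)
qed

lemma lborel_integral_translate:
  fixes g :: "'a::euclidean_space \<Rightarrow> 'b::{banach, second_countable_topology}"
  assumes "g \<in> borel_measurable borel"
  shows "(LINT x|lborel. g (x + a)) = (LINT x|lborel. g x)"
proof -
  have "(LINT x|lborel. g x) = (LINT x|distr lborel borel ((+) a). g x)"
    by (simp add: lborel_distr_plus)
  also have "\<dots> = (LINT x|lborel. g (a + x))" using assms by (intro integral_distr) auto
  finally show ?thesis by (simp add: add.commute)
qed

lemma fourier_translate:
  assumes [measurable]: "f \<in> borel_measurable borel"
  shows "fourier (\<lambda>x. f (x + a)) \<xi> = exp (\<i> * of_real (a \<bullet> \<xi>)) * fourier f \<xi>"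
proof -
  have "(LINT x|lborel. exp (- \<i> * of_real (x \<bullet> \<xi>)) * f x) =
    (LINT x|lborel. exp (- \<i> * of_real ((x + a) \<bullet> \<xi>)) * f (x + a))"
    by (rule lborel_integral_translate[symmetric]) measurable
  also have "\<dots> = (LINT x|lborel. exp (- \<i> * of_real (a \<bullet> \<xi>)) * (exp (- \<i> * of_real (x \<bullet> \<xi>)) * f (x + a)))"
    by (intro Bochner_Integration.integral_cong refl) (simp add: mult_exp_exp inner_add_left distrib_left add.commute flip: mult.assoc)
  also have "\<dots> = exp (- \<i> * of_real (a \<bullet> \<xi>)) * (LINT x|lborel. exp (- \<i> * of_real (x \<bullet> \<xi>)) * f (x + a))"
    by simp
  finally show ?thesis by (simp add: fourier_def exp_minus field_simps)
qed

text \<open>Integration by parts by way of translations: the Fourier transform turns \<open>f (x + t u)\<close> into a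
  multiple of the transform of \<open>f\<close>, and the first order expansion of \<open>f (x + t u)\<close> in \<open>t\<close> has an error of
  order \<open>t\<^sup>2\<close> in the mean because \<open>weight\<close> bounds the second derivative locally uniformly. Dividing by
  \<open>t\<close> and letting \<open>t\<close> tend to 0 identifies the transform of the derivative.\<close>

lemma fourier_dir_deriv:
  fixes f :: "'a::euclidean_space \<Rightarrow> complex"
  assumes f: "f \<in> schwartz" and u: "u \<in> Basis"
  shows "fourier (dir_deriv u f) \<xi> = \<i> * of_real (u \<bullet> \<xi>) * fourier f \<xi>"
proof -
  define c where "c = (2 * pi) powr (- real DIM('a) / 2)"
  define s where "s = u \<bullet> \<xi>"
  note f1 = schwartz_dir_deriv[OF f u]
  obtain B where B: "0 \<le> B" "\<And>x. cmod (dir_deriv u (dir_deriv u f) x) \<le> B * weight x"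
    using schwartz_family_le_weight[OF schwartz_family_of[OF schwartz_dir_deriv[OF f1 u]]] by metis
  define C where "C = c * (LINT x|lborel. 9 * B * weight (x::'a)) + s\<^sup>2 * cmod (fourier f \<xi>)"
  \<comment> \<open>The restriction to \<open>t \<le> 1\<close> is the range of \<open>weight_shift\<close>.\<close>
  have bound: "cmod (\<i> * of_real s * fourier f \<xi> - fourier (dir_deriv u f) \<xi>) \<le> t * C" if t: "0 < t" "t \<le> 1" for t
  proof -
    let ?r = "\<lambda>x. f (x + t *\<^sub>R u) - f x - of_real t * dir_deriv u f x"
    have fs: "(\<lambda>x. f (x + t *\<^sub>R u)) \<in> schwartz"
      using schwartz_family_affine[OF schwartz_family_of[OF f], of 1 "t *\<^sub>R u"] schwartz_family_in by fastforce
    have r: "cmod (?r x) \<le> t\<^sup>2 * (9 * B * weight x)" for x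
    proof -
      have "cmod (?r x) \<le> 3 * t\<^sup>2 * (B * (3 * weight x))"
      proof (rule second_order_remainder)
        show "cmod (dir_deriv u (dir_deriv u f) (x + s *\<^sub>R u)) \<le> B * (3 * weight x)" if "0 \<le> s" "s \<le> t" for s
          using B(2)[of "x + s *\<^sub>R u"] mult_left_mono[OF weight_shift[OF u, of s x] B(1)] that t by simp
      qed (use t f f1 schwartz_differentiable in auto)
      then show ?thesis by simp
    qed
    have intr: "integrable lborel ?r"
      by (intro Bochner_Integration.integrable_diff integrable_mult_right schwartz_integrable fs f f1)
    have F: "fourier ?r \<xi> = (exp (\<i> * of_real (t * s)) - 1) * fourier f \<xi> - of_real t * fourier (dir_deriv u f) \<xi>"
    proof -
      have "fourier ?r \<xi> = fourier (\<lambda>x. 1 * (f (x + t *\<^sub>R u) - f x) + (- of_real t) * dir_deriv u f x) \<xi>" by simp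
      also have "\<dots> = 1 * fourier (\<lambda>x. 1 * f (x + t *\<^sub>R u) + (- 1) * f x) \<xi> + (- of_real t) * fourier (dir_deriv u f) \<xi>"
        using Bochner_Integration.integrable_diff[OF schwartz_integrable[OF fs] schwartz_integrable[OF f]]
        by (subst fourier_linear) (auto intro!: schwartz_integrable f1)
      also have "fourier (\<lambda>x. 1 * f (x + t *\<^sub>R u) + (- 1) * f x) \<xi> =
          1 * fourier (\<lambda>x. f (x + t *\<^sub>R u)) \<xi> + (-1) * fourier f \<xi>"
        by (rule fourier_linear) (auto intro!: schwartz_integrable fs f)
      finally show ?thesis
        by (simp add: fourier_translate[OF schwartz_measurable[OF f]] s_def algebra_simps)
    qed
    have "cmod (fourier ?r \<xi>) \<le> c * (LINT x|lborel. cmod (?r x))"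
      unfolding c_def by (rule norm_fourier_le[OF intr])
    also have "\<dots> \<le> c * (LINT x|lborel. t\<^sup>2 * (9 * B * weight (x::'a)))"
      using r by (intro mult_left_mono integral_mono integrable_norm intr) (auto simp: c_def intro!: integrable_mult_right integrable_weight)
    also have "\<dots> = t\<^sup>2 * (c * (LINT x|lborel. 9 * B * weight (x::'a)))" by simp
    finally have 1: "cmod (fourier ?r \<xi>) \<le> t\<^sup>2 * (c * (LINT x|lborel. 9 * B * weight (x::'a)))" .
    have "cmod ((exp (\<i> * of_real (t * s)) - 1 - \<i> * of_real (t * s)) * fourier f \<xi>) \<le> (t * s)\<^sup>2 * cmod (fourier f \<xi>)"
      unfolding norm_mult by (rule mult_right_mono[OF norm_exp_i_minus_linear]) simp
    hence 2: "cmod ((exp (\<i> * of_real (t * s)) - 1 - \<i> * of_real (t * s)) * fourier f \<xi>) \<le> t\<^sup>2 * (s\<^sup>2 * cmod (fourier f \<xi>))"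
      by (simp add: power_mult_distrib)
    have "of_real t * (\<i> * of_real s * fourier f \<xi> - fourier (dir_deriv u f) \<xi>) =
       fourier ?r \<xi> - (exp (\<i> * of_real (t * s)) - 1 - \<i> * of_real (t * s)) * fourier f \<xi>"
      unfolding F by (simp add: algebra_simps)
    hence "cmod (of_real t * (\<i> * of_real s * fourier f \<xi> - fourier (dir_deriv u f) \<xi>)) \<le> t\<^sup>2 * C"
      using norm_triangle_ineq4[of "fourier ?r \<xi>" "(exp (\<i> * of_real (t * s)) - 1 - \<i> * of_real (t * s)) * fourier f \<xi>"] 1 2
      by (simp add: C_def distrib_left)
    then show ?thesis using t by (simp add: norm_mult power2_eq_square)
  qed
  have "((\<lambda>t. t * C) \<longlongrightarrow> 0) (at_right 0)" by (auto intro!: tendsto_eq_intros)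
  moreover have "\<forall>\<^sub>F t in at_right 0. cmod (\<i> * of_real s * fourier f \<xi> - fourier (dir_deriv u f) \<xi>) \<le> t * C"
    using eventually_at_right_less[of "0::real"] eventually_at_rightI[of 0 "1::real"]
    by (auto simp: eventually_at_right_field intro!: exI[of _ 1] bound)
  ultimately have "cmod (\<i> * of_real s * fourier f \<xi> - fourier (dir_deriv u f) \<xi>) \<le> 0"
    by (intro tendsto_lowerbound[of _ _ "at_right 0"]) auto
  then show ?thesis by (simp add: s_def)
qed

text \<open>The transforms of Schwartz families form a class closed under derivatives (which become coordinate
  multiplications) and under coordinate multiplications (which become derivatives), so only a uniform
  bound remains, and that comes from the integrable majorant.\<close>

lemma fourier_schwartz_family:
  assumes w: "schwartz_family w"
  shows "schwartz_family (\<lambda>i. fourier (w i))"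
proof (rule schwartz_family_coinduct[where X = "{\<lambda>i. fourier (w i) | w. schwartz_family w}"])
  show "(\<lambda>i. fourier (w i)) \<in> {\<lambda>i. fourier (w i) | w. schwartz_family w}"
    by (rule CollectI, rule exI[of _ w]) (simp add: w)
next
  fix z :: "'a \<Rightarrow> 'b \<Rightarrow> complex" assume "z \<in> {\<lambda>i. fourier (w i) | w. schwartz_family w}"
  then obtain w where z: "z = (\<lambda>i. fourier (w i))" and w: "schwartz_family w" by auto
  note der = fourier_has_derivative[OF schwartz_family_in[OF w]]
  show "z i differentiable (at x)" for i x unfolding z using der by (rule differentiableI)
  show "\<exists>B. \<forall>i x. cmod (z i x) \<le> B"
  proof -
    obtain B where B: "0 \<le> B" "\<And>i x. cmod (w i x) \<le> B * weight x"
      using schwartz_family_le_weight[OF w] by metis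
    have "cmod (z i x) \<le> (2 * pi) powr (- real DIM('b) / 2) * (LINT x|lborel. B * weight (x::'b))" for i x
      unfolding z using B(2)
      by (intro order_trans[OF norm_fourier_le] mult_left_mono integral_mono integrable_norm
          schwartz_family_integrable w integrable_mult_right integrable_weight) auto
    then show ?thesis by blast
  qed
  fix u :: 'b assume u: "u \<in> Basis"
  have "(\<lambda>i. dir_deriv u (z i)) = (\<lambda>i. fourier (\<lambda>x. - \<i> * (of_real (x \<bullet> u) * w i x)))"
    unfolding z by (intro ext dir_deriv_eqI[OF der])
  then show "(\<lambda>i. dir_deriv u (z i)) \<in> {\<lambda>i. fourier (w i) | w. schwartz_family w}"
    by (intro CollectI exI[of _ "\<lambda>i x. - \<i> * (of_real (x \<bullet> u) * w i x)"] conjI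
       schwartz_family_cmult schwartz_family_coord w)
  have "(\<lambda>i x. of_real (x \<bullet> u) * z i x) = (\<lambda>i. fourier (\<lambda>x. - \<i> * dir_deriv u (w i) x))"
    unfolding z by (intro ext, subst fourier_cmult, subst fourier_dir_deriv[OF schwartz_family_in[OF w] u])
       (simp add: inner_commute mult.assoc[symmetric])
  then show "(\<lambda>i x. of_real (x \<bullet> u) * z i x) \<in> {\<lambda>i. fourier (w i) | w. schwartz_family w}"
    by (intro CollectI exI[of _ "\<lambda>i x. - \<i> * dir_deriv u (w i) x"] conjI
       schwartz_family_cmult schwartz_family_dir_deriv w u)
qed

lemma inv_fourier_eq: "inv_fourier f x = fourier f (- x)"
  by (simp add: inv_fourier_def fourier_def inner_commute)

lemma inv_fourier_schwartz_family:
  assumes w: "schwartz_family w"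
  shows "schwartz_family (\<lambda>i. inv_fourier (w i))"
  using schwartz_family_affine[OF fourier_schwartz_family[OF w], of "-1" 0]
  by (simp add: inv_fourier_eq[abs_def])

lemma fourier_schwartz: "f \<in> schwartz \<Longrightarrow> fourier f \<in> schwartz"
  using fourier_schwartz_family[OF schwartz_family_of] schwartz_family_in by fastforce

lemma inv_fourier_schwartz: "f \<in> schwartz \<Longrightarrow> inv_fourier f \<in> schwartz"
  using inv_fourier_schwartz_family[OF schwartz_family_of] schwartz_family_in by fastforce

section \<open>Fourier inversion in the plane\<close>

lemma lborel_integral_affine:
  fixes f :: "'a::euclidean_space \<Rightarrow> complex"
  assumes [measurable]: "f \<in> borel_measurable borel" and c: "c \<noteq> 0"
  shows "(LINT x|lborel. f x) = of_real (\<bar>c\<bar> ^ DIM('a)) * (LINT x|lborel. f (t + c *\<^sub>R x))"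
proof -
  have "(LINT x|lborel. f x) = (LINT x|density (distr lborel borel (\<lambda>x. t + c *\<^sub>R x)) (\<lambda>_. \<bar>c\<bar> ^ DIM('a)). f x)"
    using lborel_affine[OF c, of t] by simp
  also have "\<dots> = (LINT x|distr lborel borel (\<lambda>x. t + c *\<^sub>R x). \<bar>c\<bar> ^ DIM('a) *\<^sub>R f x)"
    by (intro integral_density) auto
  also have "\<dots> = (LINT x|lborel. \<bar>c\<bar> ^ DIM('a) *\<^sub>R f (t + c *\<^sub>R x))"
    by (intro integral_distr) auto
  finally show ?thesis by (simp add: scaleR_conv_of_real)
qed

lemma lborel_integrable_affine:
  fixes f :: "'a::euclidean_space \<Rightarrow> complex"
  assumes f: "integrable lborel f" and c: "c \<noteq> 0"
  shows "integrable lborel (\<lambda>x. f (t + c *\<^sub>R x))"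
proof -
  let ?D = "distr lborel borel (\<lambda>x. t + c *\<^sub>R x)" and ?k = "\<bar>c\<bar> ^ DIM('a)"
  have [measurable]: "f \<in> borel_measurable borel" using f by auto
  have "integrable (density ?D (\<lambda>_. ennreal ?k)) f"
    using f lborel_affine[OF c, of t] by simp
  hence "integrable ?D (\<lambda>x. ?k *\<^sub>R f x)" by (subst (asm) integrable_density) auto
  hence "integrable ?D (\<lambda>x. (1 / ?k) *\<^sub>R (?k *\<^sub>R f x))" by (rule integrable_scaleR_right)
  hence "integrable ?D f" using c by simp
  then show ?thesis by (rule integrable_distr[rotated]) measurable
qed

lemma tensor_integral:
  fixes f :: "'a::euclidean_space \<Rightarrow> complex" and g :: "'b::euclidean_space \<Rightarrow> complex"
  assumes f: "integrable lborel f" and g: "integrable lborel g"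
  shows tensor_integrable: "integrable lborel (\<lambda>z. f (fst z) * g (snd z))"
    and "(LINT z|lborel. f (fst z) * g (snd z)) = (LINT x|lborel. f x) * (LINT y|lborel. g y)"
proof -
  have [measurable]: "f \<in> borel_measurable borel" "g \<in> borel_measurable borel"
    using borel_measurable_integrable[OF f] borel_measurable_integrable[OF g] by auto
  have i: "integrable (lborel \<Otimes>\<^sub>M lborel) (\<lambda>z. f (fst z) * g (snd z))"
    by (rule lborel_pair.Fubini_integrable) (auto simp: norm_mult intro!: f g)
  then show "integrable lborel (\<lambda>z. f (fst z) * g (snd z))" by (simp add: lborel_prod)
  have "(LINT z|(lborel \<Otimes>\<^sub>M lborel). f (fst z) * g (snd z)) = (LINT x|lborel. LINT y|lborel. f (fst (x, y)) * g (snd (x, y)))"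
    by (rule lborel_pair.integral_fst'[OF i, symmetric])
  then show "(LINT z|lborel. f (fst z) * g (snd z)) = (LINT x|lborel. f x) * (LINT y|lborel. g y)"
    by (simp add: lborel_prod)
qed

text \<open>The form of Fubini's theorem behind the multiplication formula for the Fourier transform, with
  \<open>E\<close> the exponential kernel.\<close>

lemma fubini_unimodular:
  fixes f :: "'a::euclidean_space \<Rightarrow> complex" and g :: "'b::euclidean_space \<Rightarrow> complex"
  assumes f: "integrable lborel f" and g: "integrable lborel g"
    and E: "E \<in> borel_measurable borel" "\<And>z. cmod (E z) \<le> 1"
  shows "(LINT x|lborel. f x * (LINT y|lborel. E (x, y) * g y)) = (LINT y|lborel. g y * (LINT x|lborel. E (x, y) * f x))"
proof -
  have "integrable lborel (\<lambda>z. E z * (f (fst z) * g (snd z)))"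
    using E by (intro integrable_unimodular_mult[OF tensor_integrable[OF f g]]) auto
  hence i: "integrable (lborel \<Otimes>\<^sub>M lborel) (\<lambda>(x, y). E (x, y) * (f x * g y))"
    by (simp add: lborel_prod split_beta')
  have "(LINT x|lborel. f x * (LINT y|lborel. E (x, y) * g y)) = (LINT x|lborel. LINT y|lborel. E (x, y) * (f x * g y))"
    by (subst integral_mult_right_zero[symmetric]) (simp add: mult_ac)
  also have "\<dots> = (LINT y|lborel. LINT x|lborel. E (x, y) * (f x * g y))"
    using lborel_pair.Fubini_integral[OF i] by simp
  also have "\<dots> = (LINT y|lborel. g y * (LINT x|lborel. E (x, y) * f x))"
    by (subst integral_mult_right_zero[symmetric]) (simp add: mult_ac)
  finally show ?thesis .
qed

definition gauss2 :: "real \<times> real \<Rightarrow> real" where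
  "gauss2 z = std_normal_density (fst z) * std_normal_density (snd z)"

lemma gauss2_nonneg: "0 \<le> gauss2 z" by (simp add: gauss2_def)

lemma gauss2_measurable [measurable]: "gauss2 \<in> borel_measurable borel"
  unfolding gauss2_def borel_prod[symmetric] by measurable

lemma gauss2_eq: "gauss2 z = exp (- ((fst z)\<^sup>2 + (snd z)\<^sup>2) / 2) / (2 * pi)"
  by (simp add: gauss2_def normal_density_def mult_exp_exp add_divide_distrib)

lemma gauss2_integrable: "integrable lborel (\<lambda>z. complex_of_real (gauss2 z))"
  and gauss2_integral: "(LINT z|lborel. complex_of_real (gauss2 z)) = 1"
proof -
  have i: "integrable lborel (\<lambda>x. complex_of_real (std_normal_density x))"
    by (intro integrable_of_real integrable_normal_density) simp
  have "(LINT x|lborel. complex_of_real (std_normal_density x)) = 1"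
    by (simp add: integral_normal_density)
  then show "integrable lborel (\<lambda>z. complex_of_real (gauss2 z))" "(LINT z|lborel. complex_of_real (gauss2 z)) = 1"
    using tensor_integral[OF i i] by (simp_all add: gauss2_def)
qed

text \<open>The Gaussian is its own Fourier transform; on the line this is the characteristic function of the
  standard normal distribution.\<close>

lemma gauss2_transform:
  "(LINT z|lborel. exp (\<i> * of_real (v \<bullet> z)) * of_real (gauss2 z)) = 2 * pi * gauss2 v"
proof -
  have i: "integrable lborel (\<lambda>x. exp (\<i> * of_real (t * x)) * complex_of_real (std_normal_density x))" for t :: real
    by (rule integrable_unimodular_mult) (auto simp: norm_exp_eq_Re intro!: integrable_of_real integrable_normal_density)
  have c: "(LINT x|lborel. exp (\<i> * of_real (t * x)) * complex_of_real (std_normal_density x)) = exp (- (t\<^sup>2) / 2)" for t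
  proof -
    have "char std_normal_distribution t = (LINT x|lborel. std_normal_density x *\<^sub>R exp (\<i> * of_real (t * x)))"
      unfolding char_def by (intro integral_density) auto
    then show ?thesis using char_std_normal_distribution
      by (simp add: scaleR_conv_of_real mult.commute)
  qed
  have "(LINT z|lborel. exp (\<i> * of_real (v \<bullet> z)) * of_real (gauss2 z)) =
     (LINT z|lborel. (exp (\<i> * of_real (fst v * fst z)) * of_real (std_normal_density (fst z))) *
       (exp (\<i> * of_real (snd v * snd z)) * of_real (std_normal_density (snd z))))"
    by (simp add: gauss2_def inner_prod_def distrib_left exp_add mult_ac)
  also have "\<dots> = exp (- ((fst v)\<^sup>2) / 2) * exp (- ((snd v)\<^sup>2) / 2)"
    by (subst tensor_integral(2)[OF i i]) (simp only: c, simp)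
  also have "\<dots> = 2 * pi * gauss2 v"
  proof -
    have "exp (- ((fst v)\<^sup>2) / 2) * exp (- ((snd v)\<^sup>2) / 2) = exp (- ((fst v)\<^sup>2 + (snd v)\<^sup>2) / 2)"
      unfolding mult_exp_exp by (simp add: add_divide_distrib diff_divide_distrib)
    then show ?thesis by (simp only: gauss2_eq) simp
  qed
  finally show ?thesis .
qed

lemma fourier_constant_plane:
  "complex_of_real ((2 * pi) powr (- real DIM(real \<times> real) / 2)) = 1 / (2 * of_real pi)"
proof -
  have "- real DIM(real \<times> real) / 2 = - 1" by simp
  then have "(2 * pi) powr (- real DIM(real \<times> real) / 2) = 1 / (2 * pi)"
    using powr_neg_one[of "2 * pi"] by (simp only:) simp
  then show ?thesis by simp
qed

text \<open>Damp the inversion integral by the dilated Gaussian \<open>gauss2 (e \<xi>)\<close>. Since the Gaussian is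
  self-dual, the damped integral is an average of \<open>f (x - e z)\<close> over the Gaussian measure in \<open>z\<close>. As \<open>e\<close>
  tends to 0, dominated convergence gives the inversion integral on one side and \<open>f x\<close> on the other.\<close>

theorem inv_fourier_fourier:
  fixes f :: "real \<times> real \<Rightarrow> complex"
  assumes f: "f \<in> schwartz"
  shows "inv_fourier (fourier f) x = f x"
proof -
  note c = fourier_constant_plane
  note fF = fourier_schwartz[OF f]
  note [measurable] = schwartz_measurable[OF f] schwartz_measurable[OF fF]
  obtain B where B: "\<And>y. cmod (f y) \<le> B"
    using schwartz_family_bounded[OF schwartz_family_of[OF f]] by blast
  have cont: "isCont f y" for y
    using schwartz_differentiable[OF f] by (rule differentiable_imp_continuous_within)
  \<comment> \<open>The width of the Gaussian average.\<close>
  define e where "e k = 1 / (real k + 1)" for k :: nat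
  have e0: "e k > 0" for k by (simp add: e_def)
  have elim: "e \<longlonglongrightarrow> 0" unfolding e_def using LIMSEQ_inverse_real_of_nat
    by (simp add: inverse_eq_divide add.commute)
  define L where "L k = (LINT \<xi>|lborel. exp (\<i> * of_real (x \<bullet> \<xi>)) * (of_real (2 * pi * gauss2 (e k *\<^sub>R \<xi>)) * fourier f \<xi>))" for k
  have L1: "L \<longlonglongrightarrow> (LINT \<xi>|lborel. exp (\<i> * of_real (x \<bullet> \<xi>)) * fourier f \<xi>)"
    unfolding L_def
  proof (rule integral_dominated_convergence[where w = "\<lambda>\<xi>. cmod (fourier f \<xi>)"])
    show "integrable lborel (\<lambda>\<xi>. cmod (fourier f \<xi>))"
      by (intro integrable_norm schwartz_integrable fF)
    show "AE \<xi> in lborel. (\<lambda>k. exp (\<i> * of_real (x \<bullet> \<xi>)) * (of_real (2 * pi * gauss2 (e k *\<^sub>R \<xi>)) * fourier f \<xi>))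
       \<longlonglongrightarrow> exp (\<i> * of_real (x \<bullet> \<xi>)) * fourier f \<xi>"
    proof (rule AE_I2)
      fix \<xi> :: "real \<times> real"
      have "(\<lambda>k. exp (- ((e k * fst \<xi>)\<^sup>2 + (e k * snd \<xi>)\<^sup>2) / 2)) \<longlonglongrightarrow> exp (- ((0 * fst \<xi>)\<^sup>2 + (0 * snd \<xi>)\<^sup>2) / 2)"
        by (intro tendsto_intros elim) simp
      hence "(\<lambda>k. 2 * pi * gauss2 (e k *\<^sub>R \<xi>)) \<longlonglongrightarrow> 1" by (simp add: gauss2_eq)
      hence "(\<lambda>k. exp (\<i> * of_real (x \<bullet> \<xi>)) * (of_real (2 * pi * gauss2 (e k *\<^sub>R \<xi>)) * fourier f \<xi>))
       \<longlonglongrightarrow> exp (\<i> * of_real (x \<bullet> \<xi>)) * (of_real 1 * fourier f \<xi>)"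
        by (intro tendsto_intros)
      then show "(\<lambda>k. exp (\<i> * of_real (x \<bullet> \<xi>)) * (of_real (2 * pi * gauss2 (e k *\<^sub>R \<xi>)) * fourier f \<xi>))
       \<longlonglongrightarrow> exp (\<i> * of_real (x \<bullet> \<xi>)) * fourier f \<xi>" by simp
    qed
    show "AE \<xi> in lborel. cmod (exp (\<i> * of_real (x \<bullet> \<xi>)) * (of_real (2 * pi * gauss2 (e k *\<^sub>R \<xi>)) * fourier f \<xi>)) \<le> cmod (fourier f \<xi>)" for k
    proof (rule AE_I2)
      fix \<xi> :: "real \<times> real"
      have "\<bar>2 * pi * gauss2 (e k *\<^sub>R \<xi>)\<bar> \<le> 1" by (simp add: gauss2_eq)
      then show "cmod (exp (\<i> * of_real (x \<bullet> \<xi>)) * (of_real (2 * pi * gauss2 (e k *\<^sub>R \<xi>)) * fourier f \<xi>)) \<le> cmod (fourier f \<xi>)"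
        using mult_right_mono[OF _ norm_ge_zero[of "fourier f \<xi>"], of _ 1]
        unfolding norm_mult[of "exp _"] norm_mult[of "of_real _" "fourier f \<xi>"] norm_of_real
        by (simp add: norm_exp_eq_Re del: of_real_mult)
    qed
  qed measurable
  \<comment> \<open>Insert the definition of the transform, exchange the integrals, and substitute \<open>y = x - e z\<close>.\<close>
  have L2: "L k = 2 * of_real pi * (LINT z|lborel. f (x - e k *\<^sub>R z) * of_real (gauss2 z))" for k
  proof -
    have gi: "integrable lborel (\<lambda>\<xi>. exp (\<i> * of_real (x \<bullet> \<xi>)) * of_real (2 * pi * gauss2 (e k *\<^sub>R \<xi>)))"
    proof (rule integrable_unimodular_mult)
      have "integrable lborel (\<lambda>\<xi>. complex_of_real (gauss2 (0 + e k *\<^sub>R \<xi>)))"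
        using e0[of k] by (intro lborel_integrable_affine[OF gauss2_integrable]) simp
      then show "integrable lborel (\<lambda>\<xi>. complex_of_real (2 * pi * gauss2 (e k *\<^sub>R \<xi>)))" by simp
    qed (auto simp: norm_exp_eq_Re)
    have inner: "(LINT \<xi>|lborel. exp (- \<i> * of_real (y \<bullet> \<xi>)) * (exp (\<i> * of_real (x \<bullet> \<xi>)) * of_real (2 * pi * gauss2 (e k *\<^sub>R \<xi>))))
       = of_real (2 * pi * (2 * pi) * (1 / (e k)\<^sup>2) * gauss2 ((1 / e k) *\<^sub>R (x - y)))" for y
    proof -
      let ?v = "(1 / e k) *\<^sub>R (x - y)"
      have "exp (- \<i> * of_real (y \<bullet> \<xi>)) * (exp (\<i> * of_real (x \<bullet> \<xi>)) * of_real (2 * pi * gauss2 (e k *\<^sub>R \<xi>)))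
        = of_real (2 * pi) * (exp (\<i> * of_real (?v \<bullet> (0 + e k *\<^sub>R \<xi>))) * of_real (gauss2 (0 + e k *\<^sub>R \<xi>)))" for \<xi>
      proof -
        have a: "?v \<bullet> (0 + e k *\<^sub>R \<xi>) = (x - y) \<bullet> \<xi>" using e0[of k] by simp
        have b: "exp (- \<i> * of_real (y \<bullet> \<xi>)) * exp (\<i> * of_real (x \<bullet> \<xi>)) = exp (\<i> * of_real ((x - y) \<bullet> \<xi>))"
          unfolding mult_exp_exp by (simp add: inner_diff_left right_diff_distrib)
        show ?thesis unfolding a b[symmetric] by simp
      qed
      hence "(LINT \<xi>|lborel. exp (- \<i> * of_real (y \<bullet> \<xi>)) * (exp (\<i> * of_real (x \<bullet> \<xi>)) * of_real (2 * pi * gauss2 (e k *\<^sub>R \<xi>))))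
        = of_real (2 * pi) * (LINT \<xi>|lborel. exp (\<i> * of_real (?v \<bullet> (0 + e k *\<^sub>R \<xi>))) * of_real (gauss2 (0 + e k *\<^sub>R \<xi>)))"
        by (simp only: integral_mult_right_zero)
      moreover have "2 * pi * gauss2 ?v = of_real ((e k)\<^sup>2) * (LINT \<xi>|lborel. exp (\<i> * of_real (?v \<bullet> (0 + e k *\<^sub>R \<xi>))) * of_real (gauss2 (0 + e k *\<^sub>R \<xi>)))"
        using lborel_integral_affine[of "\<lambda>\<xi>. exp (\<i> * of_real (?v \<bullet> \<xi>)) * of_real (gauss2 \<xi>)" "e k" 0] e0[of k]
        unfolding gauss2_transform by (simp add: power2_eq_square)
      moreover have "X = of_real (2 * pi * (2 * pi) * (1 / E\<^sup>2) * G)"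
        if "X = of_real (2 * pi) * Y" "complex_of_real (2 * pi * G) = of_real (E\<^sup>2) * Y" "E > 0" for X Y :: complex and E G :: real
      proof -
        have "Y = of_real (2 * pi * G) / of_real (E\<^sup>2)" unfolding that(2) using that(3) by simp
        then show ?thesis unfolding that(1) by simp
      qed
      ultimately show ?thesis using e0[of k] by blast
    qed
    have "L k = (LINT \<xi>|lborel. (exp (\<i> * of_real (x \<bullet> \<xi>)) * of_real (2 * pi * gauss2 (e k *\<^sub>R \<xi>))) *
        (LINT y|lborel. exp (- \<i> * of_real (snd (\<xi>, y) \<bullet> fst (\<xi>, y))) * f y)) / (2 * of_real pi)"
    proof -
      have "fourier f \<xi> = (LINT y|lborel. exp (- \<i> * of_real (snd (\<xi>, y) \<bullet> fst (\<xi>, y))) * f y) / (2 * of_real pi)" for \<xi>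
        by (simp add: fourier_def c)
      note F = this
      have "exp (\<i> * of_real (x \<bullet> \<xi>)) * (of_real (2 * pi * gauss2 (e k *\<^sub>R \<xi>)) * fourier f \<xi>) =
        (exp (\<i> * of_real (x \<bullet> \<xi>)) * of_real (2 * pi * gauss2 (e k *\<^sub>R \<xi>))) *
        (LINT y|lborel. exp (- \<i> * of_real (snd (\<xi>, y) \<bullet> fst (\<xi>, y))) * f y) / (2 * of_real pi)" for \<xi>
        by (simp only: F times_divide_eq_right mult.assoc)
      then show ?thesis by (simp only: L_def integral_divide_zero)
    qed
    also have "\<dots> = (LINT y|lborel. f y * (LINT \<xi>|lborel. exp (- \<i> * of_real (snd (\<xi>, y) \<bullet> fst (\<xi>, y))) *
        (exp (\<i> * of_real (x \<bullet> \<xi>)) * of_real (2 * pi * gauss2 (e k *\<^sub>R \<xi>))))) / (2 * of_real pi)"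
    proof -
      have m: "(\<lambda>z::(real \<times> real) \<times> (real \<times> real). exp (- \<i> * complex_of_real (snd z \<bullet> fst z))) \<in> borel_measurable borel"
        by (intro borel_measurable_continuous_onI continuous_intros)
      show ?thesis
        using fubini_unimodular[OF gi schwartz_integrable[OF f] m] by (simp add: norm_exp_eq_Re)
    qed
    also have "\<dots> = (LINT y|lborel. f y * of_real (2 * pi * (2 * pi) * (1 / (e k)\<^sup>2) * gauss2 ((1 / e k) *\<^sub>R (x - y)))) / (2 * of_real pi)"
      using inner by simp
    also have "(LINT y|lborel. f y * of_real (2 * pi * (2 * pi) * (1 / (e k)\<^sup>2) * gauss2 ((1 / e k) *\<^sub>R (x - y))))
      = of_real (\<bar>- e k\<bar> ^ DIM(real \<times> real)) * (LINT z|lborel. f (x + (- e k) *\<^sub>R z) * of_real (2 * pi * (2 * pi) * (1 / (e k)\<^sup>2) * gauss2 ((1 / e k) *\<^sub>R (x - (x + (- e k) *\<^sub>R z)))))"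
      using e0[of k] by (intro lborel_integral_affine) auto
    also have "\<dots> = (2 * of_real pi) * (2 * of_real pi) * (LINT z|lborel. f (x - e k *\<^sub>R z) * of_real (gauss2 z))"
    proof -
      have "f (x + (- e k) *\<^sub>R z) * of_real (2 * pi * (2 * pi) * (1 / (e k)\<^sup>2) * gauss2 ((1 / e k) *\<^sub>R (x - (x + (- e k) *\<^sub>R z))))
         = of_real (2 * pi * (2 * pi) * (1 / (e k)\<^sup>2)) * (f (x - e k *\<^sub>R z) * of_real (gauss2 z))" for z
        using e0[of k] by simp
      then show ?thesis using e0[of k] by (simp only: integral_mult_right_zero) (simp add: power2_eq_square)
    qed
    finally show ?thesis by simp
  qed
  have "(\<lambda>k. LINT z|lborel. f (x - e k *\<^sub>R z) * of_real (gauss2 z)) \<longlonglongrightarrow> (LINT z|lborel. f x * of_real (gauss2 z))"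
  proof (rule integral_dominated_convergence[where w = "\<lambda>z. B * gauss2 z"])
    show "integrable lborel (\<lambda>z. B * gauss2 z)"
      using gauss2_integrable by (simp add: complex_of_real_integrable_eq)
    show "AE z in lborel. (\<lambda>k. f (x - e k *\<^sub>R z) * of_real (gauss2 z)) \<longlonglongrightarrow> f x * of_real (gauss2 z)"
    proof (rule AE_I2)
      fix z
      have "(\<lambda>k. x - e k *\<^sub>R z) \<longlonglongrightarrow> x - 0 *\<^sub>R z" by (intro tendsto_intros elim)
      hence "(\<lambda>k. f (x - e k *\<^sub>R z)) \<longlonglongrightarrow> f x"
        using isCont_tendsto_compose[OF cont[of x]] by simp
      then show "(\<lambda>k. f (x - e k *\<^sub>R z) * of_real (gauss2 z)) \<longlonglongrightarrow> f x * of_real (gauss2 z)"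
        by (intro tendsto_intros)
    qed
    show "AE z in lborel. cmod (f (x - e k *\<^sub>R z) * of_real (gauss2 z)) \<le> B * gauss2 z" for k
      by (intro AE_I2) (simp only: norm_mult norm_of_real abs_of_nonneg[OF gauss2_nonneg], intro mult_right_mono B gauss2_nonneg)
  qed measurable
  from tendsto_mult_left[OF this, of "2 * of_real pi"]
  have "L \<longlonglongrightarrow> 2 * of_real pi * (LINT z|lborel. f x * of_real (gauss2 z))"
    unfolding L2[abs_def] .
  hence "L \<longlonglongrightarrow> 2 * of_real pi * f x"
    unfolding integral_mult_right_zero gauss2_integral by simp
  from LIMSEQ_unique[OF L1 this] show ?thesis unfolding inv_fourier_def c by simp
qed

corollary fourier_inv_fourier:
  fixes f :: "real \<times> real \<Rightarrow> complex"
  assumes f: "f \<in> schwartz"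
  shows "fourier (inv_fourier f) x = f x"
proof -
  have r: "(\<lambda>x. f (- x)) \<in> schwartz"
    using schwartz_family_affine[OF schwartz_family_of[OF f], of "-1" 0] schwartz_family_in by fastforce
  have "inv_fourier f y = fourier (\<lambda>x. f (- x)) y" for y
  proof -
    have [measurable]: "f \<in> borel_measurable borel" by (rule schwartz_measurable[OF f])
    show ?thesis
      unfolding inv_fourier_def fourier_def
      using lborel_integral_affine[of "\<lambda>\<xi>. exp (\<i> * of_real (y \<bullet> \<xi>)) * f \<xi>" "-1" 0]
      by (simp add: inner_commute)
  qed
  hence "inv_fourier f = fourier (\<lambda>x. f (- x))" by (rule ext)
  hence "fourier (inv_fourier f) x = inv_fourier (fourier (\<lambda>x. f (- x))) (- x)"
    using inv_fourier_eq[of "fourier (\<lambda>x. f (- x))" "- x"] by simp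
  also have "\<dots> = f x" by (simp add: inv_fourier_fourier[OF r])
  finally show ?thesis .
qed

section \<open>Tensor products and frequency cutoffs\<close>

lemma has_derivative_tensor:
  fixes a b :: "real \<Rightarrow> complex" and z :: "real \<times> real"
  assumes "a differentiable (at (fst z))" "b differentiable (at (snd z))"
  shows "((\<lambda>z. a (fst z) * b (snd z)) has_derivative
     (\<lambda>h. a (fst z) * dir_deriv (snd h) b (snd z) + dir_deriv (fst h) a (fst z) * b (snd z))) (at z)"
proof -
  have "((\<lambda>z. a (fst z)) has_derivative (\<lambda>h. dir_deriv (fst h) a (fst z))) (at z)"
    using has_derivative_compose[OF bounded_linear_imp_has_derivative[OF bounded_linear_fst] has_derivative_dir_deriv[OF assms(1)]]
    by (simp add: o_def)
  moreover have "((\<lambda>z. b (snd z)) has_derivative (\<lambda>h. dir_deriv (snd h) b (snd z))) (at z)"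
    using has_derivative_compose[OF bounded_linear_imp_has_derivative[OF bounded_linear_snd] has_derivative_dir_deriv[OF assms(2)]]
    by (simp add: o_def)
  ultimately show ?thesis by (rule has_derivative_mult)
qed

lemma dir_deriv_0: "f differentiable (at x) \<Longrightarrow> dir_deriv 0 f x = 0"
  using linear_0[OF has_derivative_linear[OF has_derivative_dir_deriv]] by blast

lemma dir_deriv_tensor:
  fixes a b :: "real \<Rightarrow> complex" and z :: "real \<times> real"
  assumes "a differentiable (at (fst z))" "b differentiable (at (snd z))"
  shows "dir_deriv (1, 0) (\<lambda>z. a (fst z) * b (snd z)) z = dir_deriv 1 a (fst z) * b (snd z)"
    and "dir_deriv (0, 1) (\<lambda>z. a (fst z) * b (snd z)) z = a (fst z) * dir_deriv 1 b (snd z)"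
  using dir_deriv_eqI[OF has_derivative_tensor[OF assms]] by (simp_all add: dir_deriv_0 assms)

lemma Basis_real_prod: "(Basis :: (real \<times> real) set) = {(1, 0), (0, 1)}"
  by (auto simp: Basis_prod_def)

lemma schwartz_family_tensor:
  fixes a b :: "'i \<Rightarrow> real \<Rightarrow> complex"
  assumes "schwartz_family a" "schwartz_family b"
  shows "schwartz_family (\<lambda>i z. a i (fst z) * b i (snd z))"
proof -
  let ?X = "{\<lambda>i z. a i (fst z) * b i (snd z) | a b :: 'i \<Rightarrow> real \<Rightarrow> complex. schwartz_family a \<and> schwartz_family b}"
  show ?thesis
  proof (rule schwartz_family_coinduct[where X = ?X])
    show "(\<lambda>i z. a i (fst z) * b i (snd z)) \<in> ?X"
      by (rule CollectI, rule exI[of _ a], rule exI[of _ b]) (simp add: assms)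
    fix w :: "'i \<Rightarrow> real \<times> real \<Rightarrow> complex" assume "w \<in> ?X"
    then obtain a b :: "'i \<Rightarrow> real \<Rightarrow> complex" where w: "w = (\<lambda>i z. a i (fst z) * b i (snd z))"
      and a: "schwartz_family a" and b: "schwartz_family b" by auto
    note d = schwartz_family_differentiable[OF a] schwartz_family_differentiable[OF b]
    show "w i differentiable (at z)" for i z
      unfolding w by (rule differentiableI[OF has_derivative_tensor[of "a i" z "b i", OF d(1)[of i "fst z"] d(2)[of i "snd z"]]])
    show "\<exists>B. \<forall>i z. cmod (w i z) \<le> B"
    proof -
      obtain A B where A: "\<And>i x. cmod (a i x) \<le> A" and B: "\<And>i x. cmod (b i x) \<le> B"
        using schwartz_family_bounded[OF a] schwartz_family_bounded[OF b] by blast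
      have "cmod (w i z) \<le> A * B" for i z
        unfolding w norm_mult using order_trans[OF norm_ge_zero A]
        by (intro mult_mono A B) auto
      then show ?thesis by blast
    qed
    fix u :: "real \<times> real" assume u: "u \<in> Basis"
    then consider "u = (1, 0)" | "u = (0, 1)" by (auto simp: Basis_real_prod)
    note ucases = this
    show "(\<lambda>i. dir_deriv u (w i)) \<in> ?X"
    proof (cases rule: ucases)
      case 1
      have "(\<lambda>i. dir_deriv u (w i)) = (\<lambda>i z. dir_deriv 1 (a i) (fst z) * b i (snd z))"
        unfolding w 1 by (intro ext dir_deriv_tensor d)
      then show ?thesis using schwartz_family_dir_deriv[OF a, of 1] b
        by (intro CollectI exI[of _ "\<lambda>i. dir_deriv 1 (a i)"] exI[of _ b]) simp
    next
      case 2
      have "(\<lambda>i. dir_deriv u (w i)) = (\<lambda>i z. a i (fst z) * dir_deriv 1 (b i) (snd z))"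
        unfolding w 2 by (intro ext dir_deriv_tensor d)
      then show ?thesis using schwartz_family_dir_deriv[OF b, of 1] a
        by (intro CollectI exI[of _ "\<lambda>i. dir_deriv 1 (b i)"] exI[of _ a]) simp
    qed
    show "(\<lambda>i z. of_real (z \<bullet> u) * w i z) \<in> ?X"
    proof (cases rule: ucases)
      case 1
      have "(\<lambda>i z. of_real (z \<bullet> u) * w i z) = (\<lambda>i z. (\<lambda>i x. of_real (x \<bullet> 1) * a i x) i (fst z) * b i (snd z))"
        by (intro ext) (simp add: w 1 mult.assoc inner_prod_def)
      note e = conjI[OF this conjI[OF schwartz_family_coord[OF a] b]]
      show ?thesis by (rule CollectI, rule exI[of _ "\<lambda>i x. of_real (x \<bullet> 1) * a i x"], rule exI[of _ b]) (rule e)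
    next
      case 2
      have "(\<lambda>i z. of_real (z \<bullet> u) * w i z) = (\<lambda>i z. a i (fst z) * (\<lambda>i x. of_real (x \<bullet> 1) * b i x) i (snd z))"
        by (intro ext) (simp add: w 2 mult.left_commute inner_prod_def)
      note e = conjI[OF this conjI[OF a schwartz_family_coord[OF b]]]
      show ?thesis by (rule CollectI, rule exI[of _ a], rule exI[of _ "\<lambda>i x. of_real (x \<bullet> 1) * b i x"]) (rule e)
    qed
  qed
qed

lemma schwartz_tensor:
  fixes a b :: "real \<Rightarrow> complex"
  assumes "a \<in> schwartz" "b \<in> schwartz"
  shows "(\<lambda>z. a (fst z) * b (snd z)) \<in> schwartz"
  using schwartz_family_tensor[OF schwartz_family_of[OF assms(1)] schwartz_family_of[OF assms(2)]]
  by (simp add: schwartz_iff_family)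

lemma schwartz_affine: "f \<in> schwartz \<Longrightarrow> c \<noteq> 0 \<Longrightarrow> (\<lambda>x. f (c *\<^sub>R x + y)) \<in> schwartz"
  using schwartz_family_affine[OF schwartz_family_of] by (simp add: schwartz_iff_family)

lemma schwartz_mult: "f \<in> schwartz \<Longrightarrow> g \<in> schwartz \<Longrightarrow> (\<lambda>x. f x * g x) \<in> schwartz"
  using schwartz_family_mult[OF schwartz_family_imp_slow[OF schwartz_family_of] schwartz_family_of]
  by (simp add: schwartz_iff_family)

text \<open>The sum of the dyadic functions up to \<open>m\<close> in both directions, see \<open>dyadic2_sum\<close> below.\<close>

definition cutoff :: "(real \<Rightarrow> complex) \<Rightarrow> nat \<times> nat \<Rightarrow> real \<times> real \<Rightarrow> complex" where
  "cutoff \<phi>\<^sub>0 m \<xi> = \<phi>\<^sub>0 (fst \<xi> / 2 ^ fst m) * \<phi>\<^sub>0 (snd \<xi> / 2 ^ snd m)"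

lemma dilated_tensor_derivatives:
  fixes f g :: "real \<Rightarrow> complex" and s :: real and z :: "real \<times> real"
  assumes f: "f \<in> schwartz" and g: "g \<in> schwartz"
  shows "(\<lambda>z. f (s * fst z) * g (s * snd z)) differentiable (at z)"
    and "dir_deriv (1, 0) (\<lambda>z. f (s * fst z) * g (s * snd z)) z = of_real s * dir_deriv 1 f (s * fst z) * g (s * snd z)"
    and "dir_deriv (0, 1) (\<lambda>z. f (s * fst z) * g (s * snd z)) z = f (s * fst z) * (of_real s * dir_deriv 1 g (s * snd z))"
proof -
  have d: "(\<lambda>x. h (s * x)) differentiable (at x)" and chain: "dir_deriv 1 (\<lambda>x. h (s * x)) x = of_real s * dir_deriv 1 h (s * x)"
    if "h \<in> schwartz" for h :: "real \<Rightarrow> complex" and x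
    using dir_deriv_scaleR_plus(1)[of h s x 0] dir_deriv_scaleR_plus(2)[of h s x 0 1] schwartz_differentiable[OF that] by simp_all
  show "(\<lambda>z. f (s * fst z) * g (s * snd z)) differentiable (at z)"
    using has_derivative_tensor[OF d[OF f] d[OF g]] by (rule differentiableI)
  show "dir_deriv (1, 0) (\<lambda>z. f (s * fst z) * g (s * snd z)) z = of_real s * dir_deriv 1 f (s * fst z) * g (s * snd z)"
    "dir_deriv (0, 1) (\<lambda>z. f (s * fst z) * g (s * snd z)) z = f (s * fst z) * (of_real s * dir_deriv 1 g (s * snd z))"
    using dir_deriv_tensor[of "\<lambda>x. f (s * x)" z "\<lambda>x. g (s * x)", OF d[OF f] d[OF g]] by (simp_all add: chain f g)
qed

text \<open>The chain rule produces a factor \<open>s i\<close> with each derivative. It is at most 1 and is absorbed into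
  the bounded scalars \<open>c i\<close>, so the class is closed under derivatives.\<close>

lemma slow_family_scaled_tensor:
  fixes a b :: "real \<Rightarrow> complex" and c s :: "nat \<Rightarrow> real"
  assumes a: "a \<in> schwartz" and b: "b \<in> schwartz" and c: "\<And>i. \<bar>c i\<bar> \<le> C" and s: "\<And>i. \<bar>s i\<bar> \<le> 1"
  shows "slow_family (\<lambda>i z. of_real (c i) * (a (s i * fst z) * b (s i * snd z)))"
proof -
  let ?X = "{\<lambda>i z. of_real (c i) * (a (s i * fst z) * b (s i * snd z)) | a b c.
     a \<in> schwartz \<and> b \<in> schwartz \<and> (\<exists>C. \<forall>i. \<bar>c i\<bar> \<le> C)}"
  show ?thesis
  proof (rule slow_family_coinduct[where X = ?X])
    show "(\<lambda>i z. of_real (c i) * (a (s i * fst z) * b (s i * snd z))) \<in> ?X"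
      by (rule CollectI, rule exI[of _ a], rule exI[of _ b], rule exI[of _ c]) (use assms in auto)
    fix w :: "nat \<Rightarrow> real \<times> real \<Rightarrow> complex" assume "w \<in> ?X"
    then obtain a b c C where w: "w = (\<lambda>i z. of_real (c i) * (a (s i * fst z) * b (s i * snd z)))"
      and a: "a \<in> schwartz" and b: "b \<in> schwartz" and C: "\<And>i. \<bar>c i\<bar> \<le> C" by auto
    have td: "(\<lambda>z. a (s i * fst z) * b (s i * snd z)) differentiable (at z)" for i and z :: "real \<times> real"
      by (rule dilated_tensor_derivatives[OF a b])
    have cd: "dir_deriv u (w i) z = of_real (c i) * dir_deriv u (\<lambda>z. a (s i * fst z) * b (s i * snd z)) z" for u i z
      unfolding w by (subst dir_deriv_mult) (auto simp: td dir_deriv_eqI[OF has_derivative_const])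
    show "w i differentiable (at z)" for i z
      unfolding w by (rule differentiable_mult[OF differentiable_const td])
    show "\<exists>B k. \<forall>i z. cmod (w i z) \<le> B * (1 + norm z) ^ k"
    proof -
      obtain A B where A: "\<And>x. cmod (a x) \<le> A" and B: "\<And>x. cmod (b x) \<le> B"
        using schwartz_family_bounded[OF schwartz_family_of[OF a]] schwartz_family_bounded[OF schwartz_family_of[OF b]] by blast
      have "cmod (w i z) \<le> C * (A * B)" for i z
        unfolding w norm_mult using order_trans[OF norm_ge_zero A] order_trans[OF norm_ge_zero B] order_trans[OF abs_ge_zero C]
        by (intro mult_mono A B) (auto simp: C)
      hence "\<forall>i z. cmod (w i z) \<le> (C * (A * B)) * (1 + norm z) ^ 0" by simp
      then show ?thesis by blast
    qed
    have C': "\<exists>C. \<forall>i. \<bar>c i * s i\<bar> \<le> C"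
    proof (intro exI allI)
      show "\<bar>c i * s i\<bar> \<le> C * 1" for i
        unfolding abs_mult using order_trans[OF abs_ge_zero C] by (intro mult_mono C s) auto
    qed
    fix u :: "real \<times> real" assume "u \<in> Basis"
    then consider "u = (1, 0)" | "u = (0, 1)" by (auto simp: Basis_real_prod)
    then show "(\<lambda>i. dir_deriv u (w i)) \<in> ?X"
    proof cases
      case 1
      have "(\<lambda>i. dir_deriv u (w i)) = (\<lambda>i z. of_real (c i * s i) * (dir_deriv 1 a (s i * fst z) * b (s i * snd z)))"
        by (intro ext) (simp add: cd 1 dilated_tensor_derivatives(2)[OF a b] mult.assoc)
      note e = conjI[OF this conjI[OF schwartz_dir_deriv[OF a] conjI[OF b C']]]
      show ?thesis
        by (rule CollectI, rule exI[of _ "dir_deriv 1 a"], rule exI[of _ b], rule exI[of _ "\<lambda>i. c i * s i"], rule e) simp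
    next
      case 2
      have "(\<lambda>i. dir_deriv u (w i)) = (\<lambda>i z. of_real (c i * s i) * (a (s i * fst z) * dir_deriv 1 b (s i * snd z)))"
        by (intro ext) (simp add: cd 2 dilated_tensor_derivatives(3)[OF a b] mult.left_commute)
      note e = conjI[OF this conjI[OF a conjI[OF schwartz_dir_deriv[OF b] C']]]
      show ?thesis
        by (rule CollectI, rule exI[of _ a], rule exI[of _ "dir_deriv 1 b"], rule exI[of _ "\<lambda>i. c i * s i"], rule e) simp
    qed
  qed
qed

text \<open>The rate at which the cutoffs tend to 1. The remainder vanishes unless \<open>norm \<xi>\<close> exceeds
  \<open>2 ^ M\<close>, so the factor \<open>2 ^ M\<close> costs one power of \<open>norm \<xi>\<close>; the first derivative brings a
  factor \<open>1 / 2 ^ M\<close> that cancels it.\<close>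

lemma slow_family_cutoff_remainder:
  assumes \<phi>: "resolution_generator \<phi>\<^sub>0"
  shows "slow_family (\<lambda>M \<xi>. of_real (2 ^ M) * (1 - cutoff \<phi>\<^sub>0 (M, M) \<xi>))"
proof -
  have S: "\<phi>\<^sub>0 \<in> schwartz" and one: "\<And>t. \<bar>t\<bar> \<le> 1 \<Longrightarrow> \<phi>\<^sub>0 t = 1" using \<phi> by (auto simp: resolution_generator_def)
  define s :: "nat \<Rightarrow> real" where "s M = 1 / 2 ^ M" for M
  have s: "\<bar>s i\<bar> \<le> 1" for i by (simp add: s_def)
  have cs: "cutoff \<phi>\<^sub>0 (M, M) = (\<lambda>z. \<phi>\<^sub>0 (s M * fst z) * \<phi>\<^sub>0 (s M * snd z))" for M
    by (rule ext) (simp add: cutoff_def s_def)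
  let ?w = "\<lambda>M \<xi>. of_real (2 ^ M) * (1 - cutoff \<phi>\<^sub>0 (M, M) \<xi>)"
  have sM: "complex_of_real (- (2 ^ M)) * of_real (s M) = - 1" for M
    unfolding of_real_mult[symmetric] by (simp add: s_def)
  have td: "cutoff \<phi>\<^sub>0 (M, M) differentiable (at z)" for M z
    unfolding cs by (rule dilated_tensor_derivatives[OF S S])
  show ?thesis
  proof (rule slow_family_coinduct[where X = "{?w} \<union> Collect slow_family"])
    fix w assume "w \<in> {?w} \<union> Collect slow_family"
    then consider "slow_family w" | "w = ?w" by auto
    note cases = this
    have d1: "(\<lambda>z. 1 - cutoff \<phi>\<^sub>0 (M, M) z) differentiable (at z)" for M z
      by (intro differentiable_diff td) simp
    show "w M differentiable (at z)" for M z
      by (cases rule: cases) (auto intro!: slow_family_differentiable differentiable_mult d1)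
    show "\<exists>B k. \<forall>i x. cmod (w i x) \<le> B * (1 + norm x) ^ k"
    proof (cases rule: cases)
      case 2
      obtain A where A: "\<And>x. cmod (\<phi>\<^sub>0 x) \<le> A"
        using schwartz_family_bounded[OF schwartz_family_of[OF S]] by blast
      have A0: "0 \<le> A" using order_trans[OF norm_ge_zero A] .
      have "cmod (?w M \<xi>) \<le> (1 + A * A) * (1 + norm \<xi>) ^ 1" for M \<xi>
      proof (cases "norm \<xi> \<le> 2 ^ M")
        case True
        have "\<bar>fst \<xi>\<bar> \<le> 2 ^ M" "\<bar>snd \<xi>\<bar> \<le> 2 ^ M"
          using True norm_fst_le[of "fst \<xi>" "snd \<xi>"] norm_snd_le[of "snd \<xi>" "fst \<xi>"] by auto
        hence "cutoff \<phi>\<^sub>0 (M, M) \<xi> = 1" by (simp add: cutoff_def one)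
        then show ?thesis using A0 by simp
      next
        case False
        have "cmod (1 - cutoff \<phi>\<^sub>0 (M, M) \<xi>) \<le> 1 + cmod (cutoff \<phi>\<^sub>0 (M, M) \<xi>)"
          using norm_triangle_ineq4[of 1 "cutoff \<phi>\<^sub>0 (M, M) \<xi>"] by simp
        also have "cmod (cutoff \<phi>\<^sub>0 (M, M) \<xi>) \<le> A * A"
          unfolding cutoff_def norm_mult by (intro mult_mono A A0) simp
        finally have "2 ^ M * cmod (1 - cutoff \<phi>\<^sub>0 (M, M) \<xi>) \<le> (1 + norm \<xi>) * (1 + A * A)"
          using False A0 by (intro mult_mono) auto
        then show ?thesis by (simp add: norm_mult norm_power mult.commute)
      qed
      then show ?thesis unfolding 2 by blast
    qed (rule slow_family_growth)
    fix u :: "real \<times> real" assume u: "u \<in> Basis"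
    show "(\<lambda>i. dir_deriv u (w i)) \<in> {?w} \<union> Collect slow_family"
    proof (cases rule: cases)
      case 1
      then show ?thesis using slow_family_dir_deriv[OF 1 u] by simp
    next
      case 2
      have dw: "dir_deriv u (w M) z = of_real (- (2 ^ M)) * dir_deriv u (cutoff \<phi>\<^sub>0 (M, M)) z" for M z
      proof -
        have "((\<lambda>\<xi>. of_real (2 ^ M) * (1 - cutoff \<phi>\<^sub>0 (M, M) \<xi>)) has_derivative
           (\<lambda>h. of_real (2 ^ M) * (0 - dir_deriv h (cutoff \<phi>\<^sub>0 (M, M)) z))) (at z)"
          by (intro has_derivative_mult_right has_derivative_diff has_derivative_const has_derivative_dir_deriv td)
        then show ?thesis unfolding 2 by (subst dir_deriv_eqI) auto
      qed
      from u consider "u = (1, 0)" | "u = (0, 1)" by (auto simp: Basis_real_prod)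
      then have "slow_family (\<lambda>i. dir_deriv u (w i))"
      proof cases
        case 1
        have "(\<lambda>i. dir_deriv u (w i)) = (\<lambda>i z. of_real (- 1) * (dir_deriv 1 \<phi>\<^sub>0 (s i * fst z) * \<phi>\<^sub>0 (s i * snd z)))"
          by (intro ext) (simp only: dw[unfolded 1] cs 1 dilated_tensor_derivatives(2)[OF S S] mult.assoc[symmetric] sM, simp)
        then show ?thesis using slow_family_scaled_tensor[OF schwartz_dir_deriv[OF S, of 1] S, of "\<lambda>_. - 1" 1 s] s by simp
      next
        case 2
        have "(\<lambda>i. dir_deriv u (w i)) = (\<lambda>i z. of_real (- 1) * (\<phi>\<^sub>0 (s i * fst z) * dir_deriv 1 \<phi>\<^sub>0 (s i * snd z)))"
          by (intro ext) (simp only: dw[unfolded 2] cs 2 dilated_tensor_derivatives(3)[OF S S] mult.left_commute[of _ "of_real (s _)"], simp add: s_def)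
        then show ?thesis using slow_family_scaled_tensor[OF S schwartz_dir_deriv[OF S, of 1], of "\<lambda>_. - 1" 1 s] s by simp
      qed
      then show ?thesis by simp
    qed
  qed simp
qed

section \<open>Littlewood-Paley blocks and their reproducing kernels\<close>

lemma dyadic_eq: "dyadic \<phi>\<^sub>0 k t = (if k = 0 then \<phi>\<^sub>0 t else \<phi>\<^sub>0 (t / 2 ^ k) - \<phi>\<^sub>0 (t / 2 ^ (k - 1)))"
proof (cases k)
  case (Suc l)
  have "2 powr (- real k) * t = t / 2 ^ k" by (simp add: powr_minus powr_realpow divide_inverse mult.commute)
  moreover have "2 powr (- real k + 1) * t = t / 2 ^ (k - 1)"
    using powr_minus[of 2 "real l"] powr_realpow[of 2 l] by (simp add: Suc divide_inverse mult.commute)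
  ultimately show ?thesis using Suc by (simp add: dyadic_def)
qed (simp add: dyadic_def)

lemma dyadic_sum: "(\<Sum>k\<le>M. dyadic \<phi>\<^sub>0 k t) = \<phi>\<^sub>0 (t / 2 ^ M)"
  by (induction M) (simp_all add: dyadic_eq)

lemma dyadic2_sum: "(\<Sum>m\<in>{..M} \<times> {..M}. dyadic2 \<phi>\<^sub>0 m \<xi>) = cutoff \<phi>\<^sub>0 (M, M) \<xi>"
  by (simp add: dyadic2_def cutoff_def dyadic_sum[symmetric] sum_product sum.cartesian_product split_beta)

text \<open>The function of index \<open>k\<close> lives on \<open>\<bar>t\<bar> \<le> 3/2 * 2 ^ k\<close>, and \<open>\<phi>\<^sub>0 (t / 2 ^ Suc k)\<close> equals 1 for
  \<open>\<bar>t\<bar> \<le> 2 ^ Suc k\<close>.\<close>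

lemma dyadic_times_cutoff:
  assumes "resolution_generator \<phi>\<^sub>0"
  shows "dyadic \<phi>\<^sub>0 k t * \<phi>\<^sub>0 (t / 2 ^ Suc k) = dyadic \<phi>\<^sub>0 k t"
proof (cases "\<bar>t\<bar> \<le> 2 ^ Suc k")
  case True
  then have "\<bar>t / 2 ^ Suc k\<bar> \<le> 1" by (simp add: field_simps)
  then show ?thesis using assms by (simp only: resolution_generator_def) simp
next
  case False
  have z: "\<phi>\<^sub>0 s = 0" if "\<bar>s\<bar> > 3/2" for s using assms that by (simp add: resolution_generator_def)
  have "\<bar>t / 2 ^ k\<bar> > 3/2" using False by (simp add: field_simps)
  moreover have "\<bar>t / 2 ^ (k - 1)\<bar> > 3/2"
  proof -
    have "(2::real) ^ (k - 1) \<le> 2 ^ k" by (rule power_increasing) auto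
    hence "3 * 2 ^ (k - 1) < 2 * \<bar>t\<bar>"
      using False zero_less_power[of "2::real" k] unfolding not_le power_Suc by linarith
    then show ?thesis by (simp add: field_simps)
  qed
  ultimately have "dyadic \<phi>\<^sub>0 k t = 0" using z by (auto simp: dyadic_eq)
  then show ?thesis by simp
qed

definition next2 :: "nat \<times> nat \<Rightarrow> nat \<times> nat" where "next2 m = (Suc (fst m), Suc (snd m))"

lemma dyadic2_times_cutoff:
  assumes "resolution_generator \<phi>\<^sub>0"
  shows "dyadic2 \<phi>\<^sub>0 m \<xi> * cutoff \<phi>\<^sub>0 (next2 m) \<xi> = dyadic2 \<phi>\<^sub>0 m \<xi>"
proof -
  have "dyadic2 \<phi>\<^sub>0 m \<xi> * cutoff \<phi>\<^sub>0 (next2 m) \<xi> =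
    (dyadic \<phi>\<^sub>0 (fst m) (fst \<xi>) * \<phi>\<^sub>0 (fst \<xi> / 2 ^ Suc (fst m))) *
    (dyadic \<phi>\<^sub>0 (snd m) (snd \<xi>) * \<phi>\<^sub>0 (snd \<xi> / 2 ^ Suc (snd m)))"
    by (simp add: dyadic2_def cutoff_def next2_def mult_ac)
  then show ?thesis by (simp only: dyadic_times_cutoff[OF assms]) (simp add: dyadic2_def)
qed

lemma schwartz_scale: "f \<in> schwartz \<Longrightarrow> (\<lambda>t::real. f (t / 2 ^ k)) \<in> schwartz"
  using schwartz_affine[of f "1 / 2 ^ k" 0] by simp

lemma cutoff_schwartz: "\<phi>\<^sub>0 \<in> schwartz \<Longrightarrow> cutoff \<phi>\<^sub>0 m \<in> schwartz"
  unfolding cutoff_def[abs_def] by (intro schwartz_tensor schwartz_scale)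

lemma dyadic_schwartz: "\<phi>\<^sub>0 \<in> schwartz \<Longrightarrow> dyadic \<phi>\<^sub>0 k \<in> schwartz"
proof (cases "k = 0")
  case False
  assume S: "\<phi>\<^sub>0 \<in> schwartz"
  have "(\<lambda>t. \<phi>\<^sub>0 (t / 2 ^ k) + (- 1) * \<phi>\<^sub>0 (t / 2 ^ (k - 1))) \<in> schwartz"
    by (intro schwartz_add schwartz_cmult schwartz_scale S)
  then show ?thesis using False by (simp add: dyadic_eq[abs_def])
qed (simp add: dyadic_eq[abs_def])

lemma dyadic2_schwartz: "\<phi>\<^sub>0 \<in> schwartz \<Longrightarrow> dyadic2 \<phi>\<^sub>0 m \<in> schwartz"
  unfolding dyadic2_def[abs_def] by (intro schwartz_tensor dyadic_schwartz)

text \<open>The component of \<open>g\<close> with frequencies of size \<open>2 ^ fst m\<close> and \<open>2 ^ snd m\<close>.\<close>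

definition block :: "(real \<Rightarrow> complex) \<Rightarrow> ((real \<times> real \<Rightarrow> complex) \<Rightarrow> complex) \<Rightarrow> nat \<times> nat \<Rightarrow>
    (real \<times> real \<Rightarrow> complex) \<Rightarrow> complex" where
  "block \<phi>\<^sub>0 g m = inv_fourier_distr (mult_distr (dyadic2 \<phi>\<^sub>0 m) (fourier_distr g))"

lemma block_apply:
  assumes "\<phi>\<^sub>0 \<in> schwartz" "\<psi> \<in> schwartz"
  shows "block \<phi>\<^sub>0 g m \<psi> = g (fourier (\<lambda>\<xi>. dyadic2 \<phi>\<^sub>0 m \<xi> * inv_fourier \<psi> \<xi>))"
  using assms by (simp add: block_def inv_fourier_distr_def mult_distr_def fourier_distr_def
      inv_fourier_schwartz schwartz_mult dyadic2_schwartz)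

definition mother :: "(real \<Rightarrow> complex) \<Rightarrow> real \<Rightarrow> complex" where
  "mother \<phi>\<^sub>0 z = of_real ((2 * pi) powr (- 1 / 2)) * inv_fourier \<phi>\<^sub>0 z"

text \<open>The inverse Fourier transform of \<open>\<xi> \<mapsto> \<phi>\<^sub>0 (\<xi> / 2 ^ Suc m)\<close>, normalised such that convolution with it is
  the Fourier multiplier with that symbol; \<open>mother\<close> is the common shape of these kernels.\<close>

definition kern :: "(real \<Rightarrow> complex) \<Rightarrow> nat \<Rightarrow> real \<Rightarrow> complex" where
  "kern \<phi>\<^sub>0 m z = 2 ^ Suc m * mother \<phi>\<^sub>0 (2 ^ Suc m * z)"

definition kern2 :: "(real \<Rightarrow> complex) \<Rightarrow> nat \<times> nat \<Rightarrow> real \<times> real \<Rightarrow> complex" where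
  "kern2 \<phi>\<^sub>0 m z = kern \<phi>\<^sub>0 (fst m) (fst z) * kern \<phi>\<^sub>0 (snd m) (snd z)"

lemma mother_schwartz: "\<phi>\<^sub>0 \<in> schwartz \<Longrightarrow> mother \<phi>\<^sub>0 \<in> schwartz"
  unfolding mother_def[abs_def] by (intro schwartz_cmult inv_fourier_schwartz)

lemma kern_eq:
  assumes S: "\<phi>\<^sub>0 \<in> schwartz"
  shows "kern \<phi>\<^sub>0 m z = (LINT \<xi>|lborel. exp (\<i> * of_real (z * \<xi>)) * \<phi>\<^sub>0 (\<xi> / 2 ^ Suc m)) / (2 * of_real pi)"
proof -
  have [measurable]: "\<phi>\<^sub>0 \<in> borel_measurable borel" by (rule schwartz_measurable[OF S])
  have c: "(2 * pi) powr (- 1 / 2) * (2 * pi) powr (- real DIM(real) / 2) = 1 / (2 * pi)"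
  proof -
    have "(2 * pi) powr (- 1 / 2) * (2 * pi) powr (- real DIM(real) / 2) = (2 * pi) powr (- 1)"
      unfolding powr_add[symmetric] by simp
    then show ?thesis using powr_neg_one[of "2 * pi"] by (simp only:) simp
  qed
  have "mother \<phi>\<^sub>0 w = of_real (1 / (2 * pi)) * (LINT \<xi>|lborel. exp (\<i> * of_real (w * \<xi>)) * \<phi>\<^sub>0 \<xi>)" for w
    unfolding mother_def inv_fourier_def mult.assoc[symmetric] of_real_mult[symmetric] c by simp
  moreover have "(LINT \<xi>|lborel. exp (\<i> * of_real (z * \<xi>)) * \<phi>\<^sub>0 (\<xi> / 2 ^ Suc m)) =
     of_real (\<bar>2 ^ Suc m\<bar> ^ DIM(real)) * (LINT \<xi>|lborel. exp (\<i> * of_real (z * (0 + 2 ^ Suc m *\<^sub>R \<xi>))) * \<phi>\<^sub>0 ((0 + 2 ^ Suc m *\<^sub>R \<xi>) / 2 ^ Suc m))"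
    by (rule lborel_integral_affine) auto
  ultimately show ?thesis by (simp add: kern_def mult_ac)
qed

lemma kern2_eq:
  assumes S: "\<phi>\<^sub>0 \<in> schwartz"
  shows "kern2 \<phi>\<^sub>0 m z = (LINT \<xi>|lborel. exp (\<i> * of_real (z \<bullet> \<xi>)) * cutoff \<phi>\<^sub>0 (next2 m) \<xi>) / (2 * of_real pi)\<^sup>2"
proof -
  have i: "integrable lborel (\<lambda>\<xi>. exp (\<i> * of_real (t * \<xi>)) * \<phi>\<^sub>0 (\<xi> / 2 ^ Suc k))" for t k
    by (rule integrable_unimodular_mult[OF schwartz_integrable[OF schwartz_scale[OF S]]]) (auto simp: norm_exp_eq_Re)
  have "(LINT \<xi>|lborel. exp (\<i> * of_real (z \<bullet> \<xi>)) * cutoff \<phi>\<^sub>0 (next2 m) \<xi>) =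
     (LINT \<xi>|lborel. (exp (\<i> * of_real (fst z * fst \<xi>)) * \<phi>\<^sub>0 (fst \<xi> / 2 ^ Suc (fst m))) *
       (exp (\<i> * of_real (snd z * snd \<xi>)) * \<phi>\<^sub>0 (snd \<xi> / 2 ^ Suc (snd m))))"
    by (simp add: cutoff_def next2_def inner_prod_def distrib_left exp_add mult_ac)
  also have "\<dots> = (LINT \<xi>|lborel. exp (\<i> * of_real (fst z * \<xi>)) * \<phi>\<^sub>0 (\<xi> / 2 ^ Suc (fst m))) *
      (LINT \<xi>|lborel. exp (\<i> * of_real (snd z * \<xi>)) * \<phi>\<^sub>0 (\<xi> / 2 ^ Suc (snd m)))"
    by (rule tensor_integral(2)[OF i i])
  finally show ?thesis by (simp only: kern2_def kern_eq[OF S]) (simp add: power2_eq_square)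
qed

text \<open>The convolution theorem for the cutoff, by exchanging the two integrals.\<close>

lemma fourier_cutoff_inv_fourier:
  assumes S: "\<phi>\<^sub>0 \<in> schwartz" and \<psi>: "\<psi> \<in> schwartz"
  shows "fourier (\<lambda>\<xi>. cutoff \<phi>\<^sub>0 (next2 m) \<xi> * inv_fourier \<psi> \<xi>) x = (LINT y|lborel. \<psi> y * kern2 \<phi>\<^sub>0 m (y - x))"
proof -
  note c = fourier_constant_plane
  let ?X = "cutoff \<phi>\<^sub>0 (next2 m)"
  have i: "integrable lborel (\<lambda>\<xi>. exp (- \<i> * of_real (\<xi> \<bullet> x)) * ?X \<xi>)"
    by (rule fourier_integrable[OF schwartz_integrable[OF cutoff_schwartz[OF S]]])
  have "inv_fourier \<psi> \<xi> = (LINT y|lborel. exp (\<i> * of_real (fst (\<xi>, y) \<bullet> snd (\<xi>, y))) * \<psi> y) / (2 * of_real pi)" for \<xi>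
    by (simp add: inv_fourier_def c)
  hence "exp (- \<i> * of_real (\<xi> \<bullet> x)) * (?X \<xi> * inv_fourier \<psi> \<xi>) =
      (exp (- \<i> * of_real (\<xi> \<bullet> x)) * ?X \<xi>) * (LINT y|lborel. exp (\<i> * of_real (fst (\<xi>, y) \<bullet> snd (\<xi>, y))) * \<psi> y) / (2 * of_real pi)" for \<xi>
    by (simp only: times_divide_eq_right mult.assoc)
  hence "fourier (\<lambda>\<xi>. ?X \<xi> * inv_fourier \<psi> \<xi>) x =
    (LINT \<xi>|lborel. (exp (- \<i> * of_real (\<xi> \<bullet> x)) * ?X \<xi>) * (LINT y|lborel. exp (\<i> * of_real (fst (\<xi>, y) \<bullet> snd (\<xi>, y))) * \<psi> y)) / (2 * of_real pi)\<^sup>2"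
    unfolding fourier_def c by (simp only: integral_divide_zero) (simp add: power2_eq_square)
  also have "(LINT \<xi>|lborel. (exp (- \<i> * of_real (\<xi> \<bullet> x)) * ?X \<xi>) * (LINT y|lborel. exp (\<i> * of_real (fst (\<xi>, y) \<bullet> snd (\<xi>, y))) * \<psi> y))
    = (LINT y|lborel. \<psi> y * (LINT \<xi>|lborel. exp (\<i> * of_real (fst (\<xi>, y) \<bullet> snd (\<xi>, y))) * (exp (- \<i> * of_real (\<xi> \<bullet> x)) * ?X \<xi>)))"
  proof -
    have m: "(\<lambda>z::(real \<times> real) \<times> (real \<times> real). exp (\<i> * complex_of_real (fst z \<bullet> snd z))) \<in> borel_measurable borel"
      by (intro borel_measurable_continuous_onI continuous_intros)
    show ?thesis
      using fubini_unimodular[OF i schwartz_integrable[OF \<psi>] m] by (simp add: norm_exp_eq_Re)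
  qed
  also have "\<dots> / (2 * of_real pi)\<^sup>2 = (LINT y|lborel. \<psi> y * kern2 \<phi>\<^sub>0 m (y - x))"
  proof -
    have "exp (\<i> * of_real (fst (\<xi>, y) \<bullet> snd (\<xi>, y))) * (exp (- \<i> * of_real (\<xi> \<bullet> x)) * ?X \<xi>) = exp (\<i> * of_real ((y - x) \<bullet> \<xi>)) * ?X \<xi>" for y \<xi>
      unfolding mult.assoc[symmetric] mult_exp_exp
      by (simp add: inner_diff_left inner_diff_right inner_commute right_diff_distrib)
    then show ?thesis by (simp only: kern2_eq[OF S] times_divide_eq_right integral_divide_zero)
  qed
  finally show ?thesis .
qed

text \<open>A block does not change when the test function is convolved with the kernel, since the cutoff
  \<open>next2 m\<close> equals 1 on the frequencies of the block.\<close>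

lemma block_reproducing:
  assumes \<phi>: "resolution_generator \<phi>\<^sub>0" and \<psi>: "\<psi> \<in> schwartz"
  shows "(\<lambda>x. LINT y|lborel. \<psi> y * kern2 \<phi>\<^sub>0 m (y - x)) \<in> schwartz"
    and "block \<phi>\<^sub>0 g m \<psi> = block \<phi>\<^sub>0 g m (\<lambda>x. LINT y|lborel. \<psi> y * kern2 \<phi>\<^sub>0 m (y - x))"
proof -
  have S: "\<phi>\<^sub>0 \<in> schwartz" using \<phi> by (simp add: resolution_generator_def)
  let ?\<theta> = "\<lambda>\<xi>. cutoff \<phi>\<^sub>0 (next2 m) \<xi> * inv_fourier \<psi> \<xi>"
  have \<theta>: "?\<theta> \<in> schwartz" by (intro schwartz_mult cutoff_schwartz inv_fourier_schwartz S \<psi>)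
  have e: "(\<lambda>x. LINT y|lborel. \<psi> y * kern2 \<phi>\<^sub>0 m (y - x)) = fourier ?\<theta>"
    by (rule ext) (simp add: fourier_cutoff_inv_fourier[OF S \<psi>])
  show "(\<lambda>x. LINT y|lborel. \<psi> y * kern2 \<phi>\<^sub>0 m (y - x)) \<in> schwartz"
    unfolding e by (rule fourier_schwartz[OF \<theta>])
  have "block \<phi>\<^sub>0 g m (fourier ?\<theta>) = g (fourier (\<lambda>\<xi>. dyadic2 \<phi>\<^sub>0 m \<xi> * ?\<theta> \<xi>))"
    by (simp add: block_apply[OF S fourier_schwartz[OF \<theta>]] inv_fourier_fourier[OF \<theta>])
  also have "(\<lambda>\<xi>. dyadic2 \<phi>\<^sub>0 m \<xi> * ?\<theta> \<xi>) = (\<lambda>\<xi>. dyadic2 \<phi>\<^sub>0 m \<xi> * inv_fourier \<psi> \<xi>)"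
    by (simp add: mult.assoc[symmetric] dyadic2_times_cutoff[OF \<phi>])
  finally show "block \<phi>\<^sub>0 g m \<psi> = block \<phi>\<^sub>0 g m (\<lambda>x. LINT y|lborel. \<psi> y * kern2 \<phi>\<^sub>0 m (y - x))"
    unfolding e block_apply[OF S \<psi>] by simp
qed

lemma linear_functional_onD:
  "linear_functional_on V T \<Longrightarrow> \<phi> \<in> V \<Longrightarrow> \<psi> \<in> V \<Longrightarrow> T (\<lambda>x. a * \<phi> x + b * \<psi> x) = a * T \<phi> + b * T \<psi>"
  by (simp add: linear_functional_on_def)

lemma linear_functional_sum:
  assumes lin: "linear_functional_on schwartz g" and fin: "finite A" and f: "\<And>i. i \<in> A \<Longrightarrow> f i \<in> schwartz"
  shows "(\<lambda>x. \<Sum>i\<in>A. f i x) \<in> schwartz \<and> g (\<lambda>x. \<Sum>i\<in>A. f i x) = (\<Sum>i\<in>A. g (f i))"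
  using fin f
proof (induction A)
  case empty
  have z: "(\<lambda>x::'a. 0) \<in> schwartz"
    using schwartz_family_const unfolding schwartz_def smooth_def
  proof -
    have "iter_deriv us (\<lambda>x::'a. 0) = (\<lambda>x. 0)" for us
      by (induction us) (auto simp: iter_deriv_Cons dir_deriv_eqI[OF has_derivative_const])
    then show "(\<lambda>x::'a. 0) \<in> {f. (\<forall>us x. set us \<subseteq> Basis \<longrightarrow> iter_deriv us f differentiable at x) \<and>
     (\<forall>k us. set us \<subseteq> Basis \<longrightarrow> (\<exists>B. \<forall>x. norm x ^ k * cmod (iter_deriv us f x) \<le> B))}" by auto
  qed
  show ?case using z linear_functional_onD[OF lin z z, of 0 0] by simp
next
  case (insert i A)
  hence IH: "(\<lambda>x. \<Sum>i\<in>A. f i x) \<in> schwartz" "g (\<lambda>x. \<Sum>i\<in>A. f i x) = (\<Sum>i\<in>A. g (f i))" by auto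
  have fi: "f i \<in> schwartz" using insert by simp
  have "g (\<lambda>x. 1 * f i x + 1 * (\<Sum>i\<in>A. f i x)) = 1 * g (f i) + 1 * g (\<lambda>x. \<Sum>i\<in>A. f i x)"
    by (rule linear_functional_onD[OF lin fi IH(1)])
  then show ?case using insert IH schwartz_add[OF fi IH(1)] by simp
qed

lemma fourier_sum:
  assumes "finite A" "\<And>i. i \<in> A \<Longrightarrow> f i \<in> schwartz"
  shows "integrable lborel (\<lambda>x. \<Sum>i\<in>A. f i x) \<and> fourier (\<lambda>x. \<Sum>i\<in>A. f i x) \<xi> = (\<Sum>i\<in>A. fourier (f i) \<xi>)"
  using assms
proof (induction A)
  case (insert i A)
  then show ?case
    using fourier_linear[of "f i" "\<lambda>x. \<Sum>i\<in>A. f i x" 1 1 \<xi>] schwartz_integrable[of "f i"] by simp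
qed (simp add: fourier_def)

text \<open>The difference of \<open>g\<close> and the sum of its blocks up to \<open>M\<close> is \<open>2 powr (- M)\<close> times the value of
  \<open>g\<close> at the transform of a Schwartz function \<open>v M\<close>. The functions \<open>v M\<close> form a Schwartz family by
  \<open>slow_family_cutoff_remainder\<close>, and so do their transforms; a tempered distribution is bounded on it.\<close>

theorem sum_blocks_tendsto:
  assumes \<phi>: "resolution_generator \<phi>\<^sub>0" and g: "g \<in> tempered_distributions" and \<psi>: "\<psi> \<in> schwartz"
  shows "(\<lambda>M. \<Sum>m\<in>{..M} \<times> {..M}. block \<phi>\<^sub>0 g m \<psi>) \<longlonglongrightarrow> g \<psi>"
proof -
  have S: "\<phi>\<^sub>0 \<in> schwartz" using \<phi> by (simp add: resolution_generator_def)
  have lin: "linear_functional_on schwartz g" using g by (simp add: tempered_distributions_def)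
  obtain C n where C: "\<And>\<psi>. \<psi> \<in> schwartz \<Longrightarrow> cmod (g \<psi>) \<le>
        C * (\<Sum>k\<le>n. \<Sum>us | set us \<subseteq> Basis \<and> length us \<le> n. schwartz_seminorm k us \<psi>)"
    using g unfolding tempered_distributions_def by blast
  define \<eta> where "\<eta> = inv_fourier \<psi>"
  have \<eta>: "\<eta> \<in> schwartz" unfolding \<eta>_def by (rule inv_fourier_schwartz[OF \<psi>])
  \<comment> \<open>The part of \<open>\<eta>\<close> removed by the cutoff, magnified by \<open>2 ^ M\<close>.\<close>
  define v where "v M \<xi> = of_real (2 ^ M) * (1 - cutoff \<phi>\<^sub>0 (M, M) \<xi>) * \<eta> \<xi>" for M \<xi>
  have "schwartz_family v"
    unfolding v_def[abs_def] by (rule schwartz_family_mult[OF slow_family_cutoff_remainder[OF \<phi>] schwartz_family_const[OF \<eta>]])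
  hence Fv: "schwartz_family (\<lambda>M. fourier (v M))" by (rule fourier_schwartz_family)
  have vS: "v M \<in> schwartz" and FvS: "fourier (v M) \<in> schwartz" for M
    using schwartz_family_in[OF \<open>schwartz_family v\<close>] schwartz_family_in[OF Fv] by auto
  have "\<exists>B. \<forall>k us. set us \<subseteq> Basis \<longrightarrow> (\<forall>M. schwartz_seminorm k us (fourier (v M)) \<le> B k us)"
  proof -
    have "\<forall>k us. \<exists>B. set us \<subseteq> Basis \<longrightarrow> (\<forall>M x. norm x ^ k * cmod (iter_deriv us (fourier (v M)) x) \<le> B)"
      using Fv unfolding schwartz_family_def by blast
    then obtain B where B: "\<And>k us M x. set us \<subseteq> Basis \<Longrightarrow> norm x ^ k * cmod (iter_deriv us (fourier (v M)) x) \<le> B k us"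
      by metis
    then show ?thesis unfolding schwartz_seminorm_def
      by (intro exI[of _ B] allI impI cSUP_least) auto
  qed
  then obtain B where B: "\<And>k us M. set us \<subseteq> Basis \<Longrightarrow> schwartz_seminorm k us (fourier (v M)) \<le> B k us"
    by blast
  have sn0: "0 \<le> schwartz_seminorm k us (fourier (v M))" if "set us \<subseteq> Basis" for k us M
  proof -
    have "\<exists>K. \<forall>x. norm x ^ k * cmod (iter_deriv us (fourier (v M)) x) \<le> K"
      using FvS[of M] that unfolding schwartz_def by simp
    then obtain K where "\<And>x. norm x ^ k * cmod (iter_deriv us (fourier (v M)) x) \<le> K" by auto
    hence "bdd_above (range (\<lambda>x. norm x ^ k * cmod (iter_deriv us (fourier (v M)) x)))" by (intro bdd_aboveI2)
    from cSUP_upper2[OF this, of 0] show ?thesis unfolding schwartz_seminorm_def by simp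
  qed
  define K where "K = \<bar>C\<bar> * (\<Sum>k\<le>n. \<Sum>us | set us \<subseteq> (Basis :: (real \<times> real) set) \<and> length us \<le> n. B k us)"
  have gF: "cmod (g (fourier (v M))) \<le> K" for M
  proof -
    let ?s = "\<Sum>k\<le>n. \<Sum>us | set us \<subseteq> Basis \<and> length us \<le> n. schwartz_seminorm k us (fourier (v M))"
    have "cmod (g (fourier (v M))) \<le> C * ?s" by (rule C[OF FvS])
    also have "\<dots> \<le> \<bar>C\<bar> * ?s" by (intro mult_right_mono sum_nonneg) (auto intro: sn0)
    also have "\<dots> \<le> K" unfolding K_def by (intro mult_left_mono sum_mono) (auto intro: B)
    finally show ?thesis .
  qed
  have diff: "g \<psi> - (\<Sum>m\<in>{..M} \<times> {..M}. block \<phi>\<^sub>0 g m \<psi>) = g (fourier (v M)) / 2 ^ M" for M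
  proof -
    let ?A = "{..M} \<times> {..M}"
    have f: "(\<lambda>\<xi>. dyadic2 \<phi>\<^sub>0 m \<xi> * \<eta> \<xi>) \<in> schwartz" for m by (intro schwartz_mult dyadic2_schwartz S \<eta>)
    have F: "fourier (\<lambda>\<xi>. dyadic2 \<phi>\<^sub>0 m \<xi> * \<eta> \<xi>) \<in> schwartz" for m by (rule fourier_schwartz[OF f])
    have "(\<Sum>m\<in>?A. block \<phi>\<^sub>0 g m \<psi>) = (\<Sum>m\<in>?A. g (fourier (\<lambda>\<xi>. dyadic2 \<phi>\<^sub>0 m \<xi> * \<eta> \<xi>)))"
      by (simp add: block_apply[OF S \<psi>] \<eta>_def)
    also have "\<dots> = g (\<lambda>x. \<Sum>m\<in>?A. fourier (\<lambda>\<xi>. dyadic2 \<phi>\<^sub>0 m \<xi> * \<eta> \<xi>) x)"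
      using linear_functional_sum[OF lin, of ?A "\<lambda>m. fourier (\<lambda>\<xi>. dyadic2 \<phi>\<^sub>0 m \<xi> * \<eta> \<xi>)"] F by simp
    also have "(\<lambda>x. \<Sum>m\<in>?A. fourier (\<lambda>\<xi>. dyadic2 \<phi>\<^sub>0 m \<xi> * \<eta> \<xi>) x) = fourier (\<lambda>\<xi>. cutoff \<phi>\<^sub>0 (M, M) \<xi> * \<eta> \<xi>)"
      using fourier_sum[of ?A "\<lambda>m \<xi>. dyadic2 \<phi>\<^sub>0 m \<xi> * \<eta> \<xi>"] f
      by (intro ext) (simp add: sum_distrib_right[symmetric] dyadic2_sum)
    also have "\<dots> = (\<lambda>x. 1 * \<psi> x + (- 1 / 2 ^ M) * fourier (v M) x)"
    proof
      fix x
      have "cutoff \<phi>\<^sub>0 (M, M) \<xi> * \<eta> \<xi> = 1 * \<eta> \<xi> + (- 1 / 2 ^ M) * v M \<xi>" for \<xi>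
        by (simp add: v_def field_simps)
      hence "fourier (\<lambda>\<xi>. cutoff \<phi>\<^sub>0 (M, M) \<xi> * \<eta> \<xi>) x = 1 * fourier \<eta> x + (- 1 / 2 ^ M) * fourier (v M) x"
        by (simp only: fourier_linear[OF schwartz_integrable[OF \<eta>] schwartz_integrable[OF vS]])
      then show "fourier (\<lambda>\<xi>. cutoff \<phi>\<^sub>0 (M, M) \<xi> * \<eta> \<xi>) x = 1 * \<psi> x + (- 1 / 2 ^ M) * fourier (v M) x"
        by (simp only: \<eta>_def fourier_inv_fourier[OF \<psi>])
    qed
    also have "g \<dots> = 1 * g \<psi> + (- 1 / 2 ^ M) * g (fourier (v M))"
      by (rule linear_functional_onD[OF lin \<psi> FvS])
    finally show ?thesis by simp
  qed
  have "(\<lambda>M. K / 2 ^ M) \<longlonglongrightarrow> 0"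
    using LIMSEQ_divide_realpow_zero[of 2 K] by simp
  hence "(\<lambda>M. g \<psi> - (\<Sum>m\<in>{..M} \<times> {..M}. block \<phi>\<^sub>0 g m \<psi>)) \<longlonglongrightarrow> 0"
  proof (rule Lim_null_comparison[rotated])
    show "\<forall>\<^sub>F M in sequentially. cmod (g \<psi> - (\<Sum>m\<in>{..M} \<times> {..M}. block \<phi>\<^sub>0 g m \<psi>)) \<le> K / 2 ^ M"
      using gF unfolding diff by (intro always_eventually allI) (simp add: norm_divide norm_power divide_right_mono)
  qed
  from tendsto_diff[OF tendsto_const[of "g \<psi>"] this] show ?thesis by simp
qed

section \<open>Faber coefficients of the reproducing kernels\<close>

lemma nn_integral_tensor:
  assumes [measurable]: "f \<in> borel_measurable (lborel :: 'a::euclidean_space measure)"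
    "g \<in> borel_measurable (lborel :: 'b::euclidean_space measure)"
  shows "(\<integral>\<^sup>+z. f (fst z) * g (snd z) \<partial>lborel) = (\<integral>\<^sup>+x. f x \<partial>lborel) * (\<integral>\<^sup>+y. g y \<partial>lborel)"
proof -
  have "(\<integral>\<^sup>+z. f (fst z) * g (snd z) \<partial>(lborel \<Otimes>\<^sub>M lborel)) = (\<integral>\<^sup>+x. \<integral>\<^sup>+y. f (fst (x, y)) * g (snd (x, y)) \<partial>lborel \<partial>lborel)"
    by (rule lborel.nn_integral_fst[symmetric]) measurable
  also have "\<dots> = (\<integral>\<^sup>+x. f x \<partial>lborel) * (\<integral>\<^sup>+y. g y \<partial>lborel)"
    by (simp add: nn_integral_cmult nn_integral_multc)
  finally show ?thesis by (simp add: lborel_prod)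
qed

text \<open>\<open>rho\<close> dilated to the scale of the kernel \<open>kern \<phi>\<^sub>0 m\<close>, with integral \<open>pi\<close> for every \<open>m\<close>.\<close>

definition scaled_rho :: "nat \<Rightarrow> real \<Rightarrow> real" where "scaled_rho m z = 2 ^ Suc m * rho (2 ^ Suc m * z)"

lemma scaled_rho_nonneg [simp]: "0 \<le> scaled_rho m z" by (simp add: scaled_rho_def)

lemma scaled_rho_le: "scaled_rho m z \<le> 2 ^ Suc m"
  using rho_le_1 by (simp add: scaled_rho_def)

lemma scaled_rho_measurable [measurable]: "scaled_rho m \<in> borel_measurable borel" unfolding scaled_rho_def by measurable

lemma nn_integral_scaled_rho: "(\<integral>\<^sup>+x. ennreal (scaled_rho m (y - x)) \<partial>lborel) = ennreal pi"
proof -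
  let ?s = "2 ^ Suc m :: real"
  have "ennreal pi = (\<integral>\<^sup>+x. ennreal (rho x) \<partial>lborel)" by (simp add: nn_integral_rho)
  also have "\<dots> = \<bar>- ?s\<bar> * (\<integral>\<^sup>+x. ennreal (rho (?s * y + (- ?s) * x)) \<partial>lborel)"
    by (rule nn_integral_real_affine) auto
  also have "\<dots> = (\<integral>\<^sup>+x. ennreal ?s * ennreal (rho (?s * (y - x))) \<partial>lborel)"
    by (subst nn_integral_cmult) (auto simp: algebra_simps)
  also have "\<dots> = (\<integral>\<^sup>+x. ennreal (scaled_rho m (y - x)) \<partial>lborel)"
    unfolding scaled_rho_def by (subst ennreal_mult) auto
  finally show ?thesis by simp
qed

text \<open>Peetre's inequality, which compares values of \<open>rho\<close> at arbitrary distances.\<close>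

lemma rho_peetre: "rho a \<le> 2 * (1 + (a - b)\<^sup>2) * rho b"
proof -
  have "b\<^sup>2 \<le> 2 * a\<^sup>2 + 2 * (a - b)\<^sup>2"
    using zero_le_power2[of "2 * a - b"] by (simp add: power2_eq_square algebra_simps)
  moreover have "2 * (1 + (a - b)\<^sup>2) * (1 + a\<^sup>2) = 2 + 2 * (a - b)\<^sup>2 + 2 * a\<^sup>2 + 2 * ((a - b)\<^sup>2 * a\<^sup>2)"
    by (simp only: distrib_left distrib_right)
  moreover have "0 \<le> (a - b)\<^sup>2 * a\<^sup>2" by simp
  ultimately have "1 + b\<^sup>2 \<le> 2 * (1 + (a - b)\<^sup>2) * (1 + a\<^sup>2)" by linarith
  then show ?thesis by (simp add: rho_def field_simps add_pos_nonneg)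
qed

text \<open>Each summand is at most three times the mean of \<open>rho\<close> over an interval of length \<open>min \<delta> 1\<close> to the
  right of its node: on such an interval \<open>rho\<close> varies by a factor 3, and the intervals are disjoint.\<close>

lemma sum_rho_grid:
  assumes \<delta>: "0 < \<delta>"
  shows "(\<Sum>k<n. rho (\<delta> * real k + \<tau>)) \<le> 3 * pi / min \<delta> 1"
proof -
  define d where "d = min \<delta> 1"
  have d: "0 < d" "d \<le> 1" "d \<le> \<delta>" using \<delta> by (auto simp: d_def)
  define I where "I k = {\<delta> * real k + \<tau> ..< \<delta> * real k + \<tau> + d}" for k :: nat
  have disj: "disjoint_family_on I {..<n}"
  proof -
    have "I i \<inter> I j = {}" if "i < j" for i j
    proof -
      have "real i + 1 \<le> real j" using that by simp
      hence "\<delta> * real i + \<delta> * 1 \<le> \<delta> * real j" unfolding distrib_left[symmetric] using \<delta> by (intro mult_left_mono) auto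
      then show ?thesis using d by (auto simp: I_def)
    qed
    then show ?thesis unfolding disjoint_family_on_def by (metis Int_commute nat_neq_iff)
  qed
  have one: "ennreal (d * rho (\<delta> * real k + \<tau>)) \<le> (\<integral>\<^sup>+x. 3 * (ennreal (rho x) * indicator (I k) x) \<partial>lborel)" for k
  proof -
    have "ennreal (d * rho (\<delta> * real k + \<tau>)) = (\<integral>\<^sup>+x. ennreal (rho (\<delta> * real k + \<tau>)) * indicator (I k) x \<partial>lborel)"
      using d by (subst nn_integral_cmult_indicator) (auto simp: I_def ennreal_mult mult.commute)
    also have "\<dots> \<le> (\<integral>\<^sup>+x. 3 * (ennreal (rho x) * indicator (I k) x) \<partial>lborel)"
    proof (rule nn_integral_mono)
      fix x
      have "rho (\<delta> * real k + \<tau>) \<le> 3 * rho x" if "x \<in> I k"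
        using that d by (intro rho_shift) (auto simp: I_def)
      hence "ennreal (rho (\<delta> * real k + \<tau>)) \<le> 3 * ennreal (rho x)" if "x \<in> I k"
        using ennreal_leI[of _ "3 * rho x"] that by (simp add: ennreal_mult)
      then show "ennreal (rho (\<delta> * real k + \<tau>)) * indicator (I k) x \<le> 3 * (ennreal (rho x) * indicator (I k) x)"
        by (auto simp: indicator_def)
    qed
    finally show ?thesis .
  qed
  have "ennreal (d * (\<Sum>k<n. rho (\<delta> * real k + \<tau>))) = (\<Sum>k<n. ennreal (d * rho (\<delta> * real k + \<tau>)))"
    using d by (simp add: sum_distrib_left)
  also have "\<dots> \<le> (\<Sum>k<n. \<integral>\<^sup>+x. 3 * (ennreal (rho x) * indicator (I k) x) \<partial>lborel)"
    by (intro sum_mono one)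
  also have "\<dots> = (\<integral>\<^sup>+x. (\<Sum>k<n. 3 * (ennreal (rho x) * indicator (I k) x)) \<partial>lborel)"
    by (rule nn_integral_sum[symmetric]) (auto simp: I_def)
  also have "\<dots> \<le> (\<integral>\<^sup>+x. 3 * ennreal (rho x) \<partial>lborel)"
  proof (rule nn_integral_mono)
    fix x
    have "(\<Sum>k<n. 3 * (ennreal (rho x) * indicator (I k) x)) = 3 * (ennreal (rho x) * (\<Sum>k<n. indicator (I k) x))"
      by (simp only: sum_distrib_left)
    also have "(\<Sum>k<n. indicator (I k) x) = (indicator (\<Union>k<n. I k) x :: ennreal)"
      using disj by (subst indicator_UN_disjoint) auto
    also have "3 * (ennreal (rho x) * indicator (\<Union>k<n. I k) x) \<le> 3 * ennreal (rho x)"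
      by (auto simp: indicator_def)
    finally show "(\<Sum>k<n. 3 * (ennreal (rho x) * indicator (I k) x)) \<le> 3 * ennreal (rho x)" .
  qed
  also have "\<dots> = ennreal (3 * pi)" by (simp add: nn_integral_cmult nn_integral_rho ennreal_mult)
  finally have "d * (\<Sum>k<n. rho (\<delta> * real k + \<tau>)) \<le> 3 * pi" by (simp add: ennreal_le_iff)
  then show ?thesis using d by (simp add: d_def[symmetric] field_simps)
qed

lemma sum_scaled_rho_grid:
  "(\<Sum>k<n. scaled_rho m (real k / 2 ^ j + \<tau>)) \<le> 6 * pi * max (2 ^ m) (2 ^ j)"
proof -
  let ?s = "2 ^ Suc m :: real" and ?\<delta> = "2 ^ Suc m / 2 ^ j :: real"
  have "(\<Sum>k<n. scaled_rho m (real k / 2 ^ j + \<tau>)) = ?s * (\<Sum>k<n. rho (?\<delta> * real k + ?s * \<tau>))"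
    by (simp add: scaled_rho_def sum_distrib_left algebra_simps)
  also have "\<dots> \<le> ?s * (3 * pi / min ?\<delta> 1)"
    by (intro mult_left_mono sum_rho_grid) auto
  also have "\<dots> = 3 * pi * (?s / min ?\<delta> 1)" by simp
  also have "?s / min ?\<delta> 1 = max ?s (2 ^ j)"
  proof -
    have "x / min (x / y) 1 = max x y" if "0 < x" "0 < y" for x y :: real
      using that by (cases "x \<le> y") (auto simp: min_def max_def field_simps)
    note * = this
    show ?thesis by (rule *) simp_all
  qed
  also have "\<dots> \<le> 2 * max (2 ^ m) (2 ^ j)"
  proof -
    have "max (2 * x) y \<le> 2 * max x y" if "0 \<le> x" "0 \<le> y" for x y :: real
      using that by (auto simp: max_def)
    note * = this
    show ?thesis unfolding power_Suc by (rule *) simp_all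
  qed
  finally show ?thesis by simp
qed

lemma dir_deriv_minus_one:
  fixes f :: "real \<Rightarrow> complex"
  assumes "f differentiable (at x)" shows "dir_deriv (- 1) f x = - dir_deriv 1 f x"
  using linear_neg[OF has_derivative_linear[OF has_derivative_dir_deriv[OF assms]], of 1] by simp

text \<open>Adding the first order expansions in the two directions cancels the derivative.\<close>

lemma symmetric_second_difference:
  fixes f :: "real \<Rightarrow> complex"
  assumes f: "f \<in> schwartz" and t: "0 \<le> t"
    and B: "\<And>s. \<bar>s\<bar> \<le> t \<Longrightarrow> cmod (dir_deriv 1 (dir_deriv 1 f) (x + s)) \<le> B"
  shows "cmod (f x - (f (x - t) + f (x + t)) / 2) \<le> 3 * t\<^sup>2 * B"
proof -
  have f1: "dir_deriv 1 f \<in> schwartz" using schwartz_dir_deriv[OF f] by simp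
  note d = schwartz_differentiable[OF f] schwartz_differentiable[OF f1]
  have m: "dir_deriv (- 1) f = (\<lambda>x. - dir_deriv 1 f x)" by (rule ext) (rule dir_deriv_minus_one[OF d(1)])
  have md: "(\<lambda>x. - dir_deriv 1 f x) differentiable (at y)" for y by (intro differentiable_minus d)
  have mm: "dir_deriv (- 1) (\<lambda>x. - dir_deriv 1 f x) y = dir_deriv 1 (dir_deriv 1 f) y" for y
  proof -
    have "((\<lambda>x. - dir_deriv 1 f x) has_derivative (\<lambda>h. - dir_deriv h (dir_deriv 1 f) y)) (at y)"
      by (intro has_derivative_minus has_derivative_dir_deriv d)
    from dir_deriv_eqI[OF this, of "- 1"] show ?thesis by (simp add: dir_deriv_minus_one[OF d(2)])
  qed
  have 1: "cmod (f (x + t *\<^sub>R 1) - f x - of_real t * dir_deriv 1 f x) \<le> 3 * t\<^sup>2 * B"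
    by (rule second_order_remainder) (use d B t in auto)
  have 2: "cmod (f (x + t *\<^sub>R (- 1)) - f x - of_real t * dir_deriv (- 1) f x) \<le> 3 * t\<^sup>2 * B"
    by (rule second_order_remainder) (use d md B[of "- _"] t in \<open>auto simp: m mm\<close>)
  define P Q where "P = f (x + t *\<^sub>R 1) - f x - of_real t * dir_deriv 1 f x"
    and "Q = f (x + t *\<^sub>R (- 1)) - f x - of_real t * dir_deriv (- 1) f x"
  have "f x - (f (x - t) + f (x + t)) / 2 = - ((P + Q) / 2)"
    by (simp add: P_def Q_def m add_divide_distrib diff_divide_distrib)
  hence "cmod (f x - (f (x - t) + f (x + t)) / 2) = cmod (P + Q) / 2"
    by (simp only: norm_minus_cancel norm_divide) simp
  also have "\<dots> \<le> (3 * t\<^sup>2 * B + 3 * t\<^sup>2 * B) / 2"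
    by (intro divide_right_mono order_trans[OF norm_triangle_ineq] add_mono 1[folded P_def] 2[folded Q_def]) simp
  finally show ?thesis by (simp add: mult_ac)
qed

text \<open>The Faber functions on the unit interval are \<open>1 - x\<close>, with index 0, and the tents over the dyadic
  intervals of length \<open>1 / 2 ^ j\<close>, with index \<open>Suc j\<close>. The level is the binary logarithm of the number of
  functions with a given index; the indices 0 and 1 share the level 0.\<close>

definition level :: "nat \<Rightarrow> nat" where "level a = a - 1"

lemma level_simps [simp]: "level 0 = 0" "level (Suc j) = j" by (simp_all add: level_def)

text \<open>There is no function for the value at the endpoint 1, because the functions to be integrated vanish
  there.\<close>

fun faber_coeff :: "nat \<Rightarrow> nat \<Rightarrow> (real \<Rightarrow> complex) \<Rightarrow> complex" where
  "faber_coeff 0 k f = f 0"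
| "faber_coeff (Suc j) k f = f (real (2 * k + 1) / 2 ^ Suc j) -
     (f (real (2 * k) / 2 ^ Suc j) + f (real (2 * k + 2) / 2 ^ Suc j)) / 2"

text \<open>The gain of a second difference with step \<open>1 / 2 ^ j\<close> on a function of frequency \<open>2 ^ m\<close>.\<close>

definition smoothing :: "nat \<Rightarrow> nat \<Rightarrow> real" where
  "smoothing m j = (if m < j then (1 / 4) ^ (j - m) else 1)"

lemma smoothing_pos: "0 < smoothing m j" by (simp add: smoothing_def)

definition faber_kernel :: "(real \<Rightarrow> complex) \<Rightarrow> nat \<Rightarrow> nat \<Rightarrow> nat \<Rightarrow> real \<Rightarrow> complex" where
  "faber_kernel \<phi>\<^sub>0 a k m y = faber_coeff a k (\<lambda>x. kern \<phi>\<^sub>0 m (x - y))"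

lemma mother_bounds:
  assumes S: "\<phi>\<^sub>0 \<in> schwartz"
  obtains B where "0 < B" "\<And>z. cmod (mother \<phi>\<^sub>0 z) \<le> B * rho z" "\<And>z. cmod (dir_deriv 1 (dir_deriv 1 (mother \<phi>\<^sub>0)) z) \<le> B * rho z"
proof -
  have w: "weight x = rho x" for x :: real by (simp add: weight_def)
  note M = mother_schwartz[OF S]
  have M2: "dir_deriv 1 (dir_deriv 1 (mother \<phi>\<^sub>0)) \<in> schwartz" by (intro schwartz_dir_deriv M) auto
  obtain A where A: "0 \<le> A" "\<And>z. cmod (mother \<phi>\<^sub>0 z) \<le> A * weight z"
    using schwartz_family_le_weight[OF schwartz_family_of[OF M]] by metis
  obtain B where B: "0 \<le> B" "\<And>z. cmod (dir_deriv 1 (dir_deriv 1 (mother \<phi>\<^sub>0)) z) \<le> B * weight z"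
    using schwartz_family_le_weight[OF schwartz_family_of[OF M2]] by metis
  show thesis
  proof (rule that[of "A + B + 1"])
    show "cmod (mother \<phi>\<^sub>0 z) \<le> (A + B + 1) * rho z" "cmod (dir_deriv 1 (dir_deriv 1 (mother \<phi>\<^sub>0)) z) \<le> (A + B + 1) * rho z" for z
      by (rule order_trans[OF A(2)[unfolded w] mult_right_mono] order_trans[OF B(2)[unfolded w] mult_right_mono]; use A B in simp)+
  qed (use A B in auto)
qed

lemma kern_bound:
  assumes B: "\<And>z. cmod (mother \<phi>\<^sub>0 z) \<le> B * rho z"
  shows "cmod (kern \<phi>\<^sub>0 m z) \<le> B * scaled_rho m z"
  using mult_left_mono[OF B[of "2 ^ Suc m * z"], of "2 ^ Suc m"]
  by (simp add: kern_def scaled_rho_def norm_mult norm_power mult_ac)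

text \<open>The nodes with \<open>e = 0, 1, 2\<close> are those of the second difference; for the index 0 they coincide.\<close>

definition node :: "nat \<Rightarrow> nat \<Rightarrow> real \<Rightarrow> real" where
  "node a k e = (if a = 0 then 0 else real k / 2 ^ (a - 1) + e / 2 ^ a)"

text \<open>For frequencies below the level, the second difference of the dilated kernel is a second difference
  of \<open>mother\<close> with the small step \<open>(1/2) ^ (j - m)\<close>, whose square is the gain; here the 9 is the product of
  the constants 3 in \<open>symmetric_second_difference\<close> and \<open>rho_shift\<close>. For higher frequencies nothing cancels
  and the three values are estimated separately.\<close>

lemma faber_kernel_bound:
  assumes S: "\<phi>\<^sub>0 \<in> schwartz" and B0: "0 < B"
    and B: "\<And>z. cmod (mother \<phi>\<^sub>0 z) \<le> B * rho z" "\<And>z. cmod (dir_deriv 1 (dir_deriv 1 (mother \<phi>\<^sub>0)) z) \<le> B * rho z"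
  shows "cmod (faber_kernel \<phi>\<^sub>0 a k m y) \<le> 9 * B * smoothing m (level a) *
     (scaled_rho m (node a k 0 - y) + scaled_rho m (node a k 1 - y) + scaled_rho m (node a k 2 - y))"
proof (cases a)
  case 0
  have "cmod (faber_kernel \<phi>\<^sub>0 a k m y) \<le> B * scaled_rho m (- y)"
    using kern_bound[of \<phi>\<^sub>0 B m, OF B(1)] by (simp add: 0 faber_kernel_def)
  also have "\<dots> \<le> 27 * (B * scaled_rho m (- y))" using B0 by simp
  finally show ?thesis by (simp add: 0 smoothing_def node_def)
next
  case (Suc j)
  let ?c = "node a k 1" and ?l = "node a k 0" and ?r = "node a k 2"
  have n: "?l = real (2 * k) / 2 ^ Suc j" "?c = real (2 * k + 1) / 2 ^ Suc j" "?r = real (2 * k + 2) / 2 ^ Suc j"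
    by (simp_all add: node_def Suc field_simps)
  have K: "faber_kernel \<phi>\<^sub>0 a k m y = kern \<phi>\<^sub>0 m (?c - y) - (kern \<phi>\<^sub>0 m (?l - y) + kern \<phi>\<^sub>0 m (?r - y)) / 2"
    unfolding n by (simp only: faber_kernel_def Suc faber_coeff.simps)
  have nn: "0 \<le> B * scaled_rho m z" for z using B0 by simp
  show ?thesis
  proof (cases "m < j")
    case False
    have "cmod (faber_kernel \<phi>\<^sub>0 a k m y) \<le> cmod (kern \<phi>\<^sub>0 m (?c - y)) + (cmod (kern \<phi>\<^sub>0 m (?l - y)) + cmod (kern \<phi>\<^sub>0 m (?r - y))) / 2"
    proof -
      have "cmod (x - (u + v) / 2) \<le> cmod x + (cmod u + cmod v) / 2" for x u v :: complex
      proof -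
        have "cmod ((u + v) / 2) \<le> (cmod u + cmod v) / 2"
          using norm_triangle_ineq[of u v] by (simp add: norm_divide divide_right_mono)
        then show ?thesis using norm_triangle_ineq4[of x "(u + v) / 2"] by linarith
      qed
      then show ?thesis unfolding K .
    qed
    also have "\<dots> \<le> 9 * (B * scaled_rho m (?l - y) + B * scaled_rho m (?c - y) + B * scaled_rho m (?r - y))"
    proof -
      have "a + (b + c) / 2 \<le> 9 * (q + p + r)"
        if "a \<le> p" "b \<le> q" "c \<le> r" "0 \<le> p" "0 \<le> q" "0 \<le> r" for a b c p q r :: real
        using that by (simp add: field_simps)
      note * = this
      show ?thesis by (rule *) (intro kern_bound B nn)+
    qed
    finally show ?thesis using False by (simp add: smoothing_def Suc algebra_simps)
  next
    case True
    define s where "s = (2::real) ^ Suc m"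
    define x where "x = s * (?c - y)"
    define t where "t = s / 2 ^ Suc j"
    have t: "t = (1 / 2) ^ (j - m)"
      using True by (simp add: t_def s_def power_diff power_one_over field_simps)
    have t1: "0 \<le> t" "t \<le> 1" by (simp_all add: t power_le_one)
    have pl: "s * (?l - y) = x - t" "s * (?r - y) = x + t"
      by (simp_all add: x_def t_def node_def Suc s_def field_simps)
    have "faber_kernel \<phi>\<^sub>0 a k m y = of_real s * (mother \<phi>\<^sub>0 x - (mother \<phi>\<^sub>0 (x - t) + mother \<phi>\<^sub>0 (x + t)) / 2)"
      unfolding K kern_def s_def[symmetric] pl x_def[symmetric] by (simp add: s_def algebra_simps)
    hence "cmod (faber_kernel \<phi>\<^sub>0 a k m y) = s * cmod (mother \<phi>\<^sub>0 x - (mother \<phi>\<^sub>0 (x - t) + mother \<phi>\<^sub>0 (x + t)) / 2)"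
      by (simp add: norm_mult norm_power s_def)
    also have "\<dots> \<le> s * (3 * t\<^sup>2 * (B * (3 * rho x)))"
    proof (intro mult_left_mono symmetric_second_difference mother_schwartz S t1)
      fix r assume "\<bar>r\<bar> \<le> t"
      hence "rho (x + r) \<le> 3 * rho x" using t1 by (intro rho_shift) auto
      then show "cmod (dir_deriv 1 (dir_deriv 1 (mother \<phi>\<^sub>0)) (x + r)) \<le> B * (3 * rho x)"
        using B(2)[of "x + r"] B0 mult_left_mono[of "rho (x + r)" "3 * rho x" B] by linarith
    qed (simp add: s_def)
    also have "\<dots> = 9 * B * t\<^sup>2 * scaled_rho m (?c - y)"
      by (simp add: scaled_rho_def s_def x_def)
    also have "t\<^sup>2 = smoothing m (level a)"
      using True by (simp add: t smoothing_def Suc power2_eq_square flip: power_mult_distrib)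
    also have "9 * B * smoothing m (level a) * scaled_rho m (?c - y) \<le> 9 * B * smoothing m (level a) * (scaled_rho m (?l - y) + scaled_rho m (?c - y) + scaled_rho m (?r - y))"
      using B0 smoothing_pos[of m "level a"] by (intro mult_left_mono) auto
    finally show ?thesis .
  qed
qed

lemma kern_measurable [measurable]: "\<phi>\<^sub>0 \<in> schwartz \<Longrightarrow> kern \<phi>\<^sub>0 m \<in> borel_measurable borel"
proof -
  assume "\<phi>\<^sub>0 \<in> schwartz"
  hence [measurable]: "mother \<phi>\<^sub>0 \<in> borel_measurable borel" by (intro schwartz_measurable mother_schwartz)
  show ?thesis unfolding kern_def by measurable
qed

lemma faber_kernel_measurable:
  assumes "\<phi>\<^sub>0 \<in> schwartz" shows "faber_kernel \<phi>\<^sub>0 a k m \<in> borel_measurable borel"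
proof -
  have [measurable]: "kern \<phi>\<^sub>0 m \<in> borel_measurable borel" by (rule kern_measurable[OF assms])
  show ?thesis unfolding faber_kernel_def[abs_def] by (cases a) (auto simp del: of_nat_add of_nat_mult)
qed

text \<open>The two bounds of a Schur test: the mean of one coefficient functional over all translates of the
  kernel, and the sum over all functionals of a level at one translate. The second one counts how many
  nodes meet the essential support of a translate, whence \<open>max (2 ^ m) (2 ^ level a)\<close>.\<close>

lemma faber_kernel_schur:
  assumes S: "\<phi>\<^sub>0 \<in> schwartz"
  obtains D where "0 < D"
    "\<And>a k m. (\<integral>\<^sup>+y. ennreal (cmod (faber_kernel \<phi>\<^sub>0 a k m y)) \<partial>lborel) \<le> ennreal (D * smoothing m (level a))"
    "\<And>a m y. (\<Sum>k<2 ^ level a. cmod (faber_kernel \<phi>\<^sub>0 a k m y)) \<le> D * (smoothing m (level a) * max (2 ^ m) (2 ^ level a))"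
proof -
  obtain B where B0: "0 < B" and B: "\<And>z. cmod (mother \<phi>\<^sub>0 z) \<le> B * rho z" "\<And>z. cmod (dir_deriv 1 (dir_deriv 1 (mother \<phi>\<^sub>0)) z) \<le> B * rho z"
    using mother_bounds[OF S] by metis
  note FB = faber_kernel_bound[OF S B0 B]
  have nn: "0 \<le> 9 * B * smoothing m j" for m j using B0 smoothing_pos[of m j] by simp
  show thesis
  proof (rule that[of "162 * B * pi"])
    show "0 < 162 * B * pi" using B0 by simp
    fix a m
    show "(\<integral>\<^sup>+y. ennreal (cmod (faber_kernel \<phi>\<^sub>0 a k m y)) \<partial>lborel) \<le> ennreal (162 * B * pi * smoothing m (level a))" for k
    proof -
      have "(\<integral>\<^sup>+y. ennreal (cmod (faber_kernel \<phi>\<^sub>0 a k m y)) \<partial>lborel) \<le>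
        (\<integral>\<^sup>+y. ennreal (9 * B * smoothing m (level a)) * (ennreal (scaled_rho m (node a k 0 - y)) + ennreal (scaled_rho m (node a k 1 - y)) + ennreal (scaled_rho m (node a k 2 - y))) \<partial>lborel)"
      proof (rule nn_integral_mono)
        fix y
        show "ennreal (cmod (faber_kernel \<phi>\<^sub>0 a k m y)) \<le> ennreal (9 * B * smoothing m (level a)) * (ennreal (scaled_rho m (node a k 0 - y)) + ennreal (scaled_rho m (node a k 1 - y)) + ennreal (scaled_rho m (node a k 2 - y)))"
          using FB[of a k m y] nn[of m "level a"]
          by (simp add: ennreal_mult'[symmetric] ennreal_plus[symmetric] ennreal_leI del: ennreal_plus)
      qed
      also have "\<dots> = ennreal (9 * B * smoothing m (level a)) * (ennreal pi + ennreal pi + ennreal pi)"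
        by (simp add: nn_integral_cmult nn_integral_add nn_integral_scaled_rho)
      also have "\<dots> = ennreal (9 * B * smoothing m (level a) * (3 * pi))"
        using nn[of m "level a"] by (simp add: ennreal_mult'[symmetric] ennreal_plus[symmetric] del: ennreal_plus)
      also have "\<dots> \<le> ennreal (162 * B * pi * smoothing m (level a))"
        using B0 smoothing_pos[of m "level a"] by (intro ennreal_leI) simp
      finally show ?thesis .
    qed
    show "(\<Sum>k<2 ^ level a. cmod (faber_kernel \<phi>\<^sub>0 a k m y)) \<le> 162 * B * pi * (smoothing m (level a) * max (2 ^ m) (2 ^ level a))" for y
    proof -
      let ?M = "max (2 ^ m) (2 ^ level a) :: real"
      have e: "(\<Sum>k<2 ^ level a. scaled_rho m (node a k e - y)) \<le> 6 * pi * ?M" for e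
      proof (cases a)
        case 0
        have "scaled_rho m (- y) \<le> 2 * 2 ^ m" using scaled_rho_le[of m "- y"] by simp
        also have "\<dots> \<le> 6 * pi * ?M" using pi_gt3 by (intro mult_mono) auto
        finally show ?thesis by (simp add: 0 node_def)
      next
        case (Suc j)
        have "node a k e - y = real k / 2 ^ level a + (e / 2 ^ a - y)" for k
          by (simp add: node_def Suc)
        then show ?thesis by (simp only: sum_scaled_rho_grid)
      qed
      have "(\<Sum>k<2 ^ level a. cmod (faber_kernel \<phi>\<^sub>0 a k m y)) \<le> (\<Sum>k<2 ^ level a. 9 * B * smoothing m (level a) *
         (scaled_rho m (node a k 0 - y) + scaled_rho m (node a k 1 - y) + scaled_rho m (node a k 2 - y)))"
        by (intro sum_mono FB)
      also have "\<dots> = 9 * B * smoothing m (level a) * ((\<Sum>k<2 ^ level a. scaled_rho m (node a k 0 - y)) +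
          (\<Sum>k<2 ^ level a. scaled_rho m (node a k 1 - y)) + (\<Sum>k<2 ^ level a. scaled_rho m (node a k 2 - y)))"
        by (simp add: sum_distrib_left[symmetric] sum.distrib)
      also have "\<dots> \<le> 9 * B * smoothing m (level a) * (6 * pi * ?M + 6 * pi * ?M + 6 * pi * ?M)"
        by (intro mult_left_mono add_mono e nn)
      finally show ?thesis by (simp add: mult_ac)
    qed
  qed
qed

section \<open>Blocks as continuous functions and their Faber coefficients\<close>

lemma kern_reflect_schwartz:
  assumes S: "\<phi>\<^sub>0 \<in> schwartz" shows "(\<lambda>t. kern \<phi>\<^sub>0 m (c - t)) \<in> schwartz"
proof -
  have "(\<lambda>t. 2 ^ Suc m * mother \<phi>\<^sub>0 ((- (2 ^ Suc m)) *\<^sub>R t + 2 ^ Suc m * c)) \<in> schwartz"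
    by (intro schwartz_cmult schwartz_affine mother_schwartz S) simp
  then show ?thesis by (simp add: kern_def algebra_simps)
qed

lemma kern2_reflect_schwartz:
  assumes S: "\<phi>\<^sub>0 \<in> schwartz" shows "(\<lambda>x. kern2 \<phi>\<^sub>0 m (y - x)) \<in> schwartz"
  unfolding kern2_def fst_diff snd_diff by (intro schwartz_tensor kern_reflect_schwartz S)

lemma kern2_measurable: "\<phi>\<^sub>0 \<in> schwartz \<Longrightarrow> kern2 \<phi>\<^sub>0 m \<in> borel_measurable borel"
proof -
  assume "\<phi>\<^sub>0 \<in> schwartz"
  hence [measurable]: "kern \<phi>\<^sub>0 k \<in> borel_measurable borel" for k by (rule kern_measurable)
  show ?thesis unfolding kern2_def[abs_def] borel_prod[symmetric] by measurable
qed

definition scaled_rho2 :: "nat \<times> nat \<Rightarrow> real \<times> real \<Rightarrow> real" where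
  "scaled_rho2 m z = scaled_rho (fst m) (fst z) * scaled_rho (snd m) (snd z)"

lemma scaled_rho2_nonneg [simp]: "0 \<le> scaled_rho2 m z" by (simp add: scaled_rho2_def)

lemma scaled_rho2_measurable [measurable]: "scaled_rho2 m \<in> borel_measurable borel"
  unfolding scaled_rho2_def[abs_def] borel_prod[symmetric] by measurable

lemma kern2_bound:
  assumes "0 < B" "\<And>z. cmod (mother \<phi>\<^sub>0 z) \<le> B * rho z"
  shows "cmod (kern2 \<phi>\<^sub>0 m z) \<le> B\<^sup>2 * scaled_rho2 m z"
proof -
  have "cmod (kern2 \<phi>\<^sub>0 m z) \<le> (B * scaled_rho (fst m) (fst z)) * (B * scaled_rho (snd m) (snd z))"
    unfolding kern2_def norm_mult using assms by (intro mult_mono kern_bound) auto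
  then show ?thesis by (simp add: scaled_rho2_def power2_eq_square mult_ac)
qed

lemma Lp_norm_scaled_rho2:
  fixes h :: "real \<times> real \<Rightarrow> complex"
  assumes h: "h \<in> borel_measurable lborel" and p: "1 \<le> p"
  shows "(\<integral>\<^sup>+x. ennreal (cmod (h x)) * ennreal (scaled_rho2 m (y - x)) \<partial>lborel) \<le>
    ennreal ((pi * pi) powr (1 - real_of_ereal (1 / p)) * (2 ^ Suc (fst m) * 2 ^ Suc (snd m)) powr real_of_ereal (1 / p)) * Lp_norm p h"
proof (rule Lp_norm_weighted_le[OF h _ _ _ _ _ p])
  have "(\<integral>\<^sup>+x. ennreal (scaled_rho2 m (y - x)) \<partial>lborel) =
    (\<integral>\<^sup>+x. ennreal (scaled_rho (fst m) (fst y - fst x)) * ennreal (scaled_rho (snd m) (snd y - snd x)) \<partial>lborel)"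
    by (simp add: scaled_rho2_def ennreal_mult)
  also have "\<dots> = ennreal pi * ennreal pi"
    by (subst nn_integral_tensor[of "\<lambda>x. ennreal (scaled_rho (fst m) (fst y - x))" "\<lambda>x. ennreal (scaled_rho (snd m) (snd y - x))"])
       (simp_all add: nn_integral_scaled_rho)
  finally show "(\<integral>\<^sup>+x. ennreal (scaled_rho2 m (y - x)) \<partial>lborel) \<le> ennreal (pi * pi)"
    by (simp add: ennreal_mult)
  show "ennreal (scaled_rho2 m (y - x)) \<le> ennreal (2 ^ Suc (fst m) * 2 ^ Suc (snd m))" for x
    unfolding scaled_rho2_def by (intro ennreal_leI mult_mono scaled_rho_le) auto
  show "(\<lambda>x. ennreal (scaled_rho2 m (y - x))) \<in> borel_measurable lborel" by measurable
qed auto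

text \<open>The convolution of the block with its reproducing kernel. It is a genuine function, given by the
  distribution alone, and will turn out to represent the block.\<close>

definition piece :: "(real \<Rightarrow> complex) \<Rightarrow> ((real \<times> real \<Rightarrow> complex) \<Rightarrow> complex) \<Rightarrow> nat \<times> nat \<Rightarrow> real \<times> real \<Rightarrow> complex" where
  "piece \<phi>\<^sub>0 g m y = block \<phi>\<^sub>0 g m (\<lambda>x. kern2 \<phi>\<^sub>0 m (y - x))"

lemma piece_eq:
  assumes S: "\<phi>\<^sub>0 \<in> schwartz" and h: "represents h (block \<phi>\<^sub>0 g m)"
  shows "integrable lborel (\<lambda>x. h x * kern2 \<phi>\<^sub>0 m (y - x))"
    and "piece \<phi>\<^sub>0 g m y = (LINT x|lborel. h x * kern2 \<phi>\<^sub>0 m (y - x))"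
  using h kern2_reflect_schwartz[OF S, of m y] unfolding represents_def piece_def by auto

text \<open>The inequality of Bernstein and Nikolskii: the supremum of a band-limited function is bounded by
  its mean of order \<open>p\<close>.\<close>

lemma piece_bound:
  assumes S: "\<phi>\<^sub>0 \<in> schwartz" and h: "represents h (block \<phi>\<^sub>0 g m)" and p: "1 \<le> p"
    and B: "0 < B" "\<And>z. cmod (mother \<phi>\<^sub>0 z) \<le> B * rho z"
  shows "ennreal (cmod (piece \<phi>\<^sub>0 g m y)) \<le> ennreal (B\<^sup>2 * ((pi * pi) powr (1 - real_of_ereal (1 / p)) *
     (2 ^ Suc (fst m) * 2 ^ Suc (snd m)) powr real_of_ereal (1 / p))) * Lp_norm p h"
proof -
  have hm[measurable]: "h \<in> borel_measurable lborel" using h by (simp add: represents_def)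
  have "ennreal (cmod (piece \<phi>\<^sub>0 g m y)) \<le> (\<integral>\<^sup>+x. ennreal (cmod (h x * kern2 \<phi>\<^sub>0 m (y - x))) \<partial>lborel)"
    unfolding piece_eq(2)[OF S h] by (rule integral_norm_bound_ennreal[OF piece_eq(1)[OF S h]])
  also have "\<dots> \<le> (\<integral>\<^sup>+x. ennreal (B\<^sup>2) * (ennreal (cmod (h x)) * ennreal (scaled_rho2 m (y - x))) \<partial>lborel)"
  proof (rule nn_integral_mono)
    fix x
    have "cmod (h x * kern2 \<phi>\<^sub>0 m (y - x)) \<le> B\<^sup>2 * (cmod (h x) * scaled_rho2 m (y - x))"
      using mult_left_mono[OF kern2_bound[OF B, of m "y - x"], of "cmod (h x)"] by (simp add: norm_mult mult_ac)
    then show "ennreal (cmod (h x * kern2 \<phi>\<^sub>0 m (y - x))) \<le> ennreal (B\<^sup>2) * (ennreal (cmod (h x)) * ennreal (scaled_rho2 m (y - x)))"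
      by (simp add: ennreal_mult[symmetric] ennreal_leI)
  qed
  also have "\<dots> = ennreal (B\<^sup>2) * (\<integral>\<^sup>+x. ennreal (cmod (h x)) * ennreal (scaled_rho2 m (y - x)) \<partial>lborel)"
    by (rule nn_integral_cmult) measurable
  also have "\<dots> \<le> ennreal (B\<^sup>2) * (ennreal ((pi * pi) powr (1 - real_of_ereal (1 / p)) *
     (2 ^ Suc (fst m) * 2 ^ Suc (snd m)) powr real_of_ereal (1 / p)) * Lp_norm p h)"
    by (intro mult_left_mono Lp_norm_scaled_rho2 hm p) simp
  finally show ?thesis by (simp add: ennreal_mult mult.assoc)
qed

lemma scaled_rho_shift: "\<bar>d\<bar> \<le> R \<Longrightarrow> scaled_rho m (z + d) \<le> 2 * (1 + (2 ^ Suc m * R)\<^sup>2) * scaled_rho m z"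
proof -
  assume d: "\<bar>d\<bar> \<le> R"
  let ?s = "2 ^ Suc m :: real"
  have "rho (?s * (z + d)) \<le> 2 * (1 + (?s * (z + d) - ?s * z)\<^sup>2) * rho (?s * z)" by (rule rho_peetre)
  also have "(?s * (z + d) - ?s * z)\<^sup>2 = (?s * \<bar>d\<bar>)\<^sup>2" by (simp add: algebra_simps power_mult_distrib)
  also have "2 * (1 + (?s * \<bar>d\<bar>)\<^sup>2) * rho (?s * z) \<le> 2 * (1 + (?s * R)\<^sup>2) * rho (?s * z)"
    using d by (intro mult_right_mono mult_left_mono add_left_mono power_mono) auto
  finally have "?s * rho (?s * (z + d)) \<le> ?s * (2 * (1 + (?s * R)\<^sup>2) * rho (?s * z))" by (rule mult_left_mono) simp
  then show ?thesis by (simp add: scaled_rho_def mult_ac)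
qed

lemma piece_continuous:
  assumes S: "\<phi>\<^sub>0 \<in> schwartz" and h: "represents h (block \<phi>\<^sub>0 g m)" and p: "1 \<le> p" and fin: "Lp_norm p h < \<infinity>"
  shows "continuous_on UNIV (piece \<phi>\<^sub>0 g m)"
proof (rule continuous_at_imp_continuous_on, rule ballI)
  fix y :: "real \<times> real"
  have hm[measurable]: "h \<in> borel_measurable lborel" using h by (simp add: represents_def)
  have [measurable]: "kern2 \<phi>\<^sub>0 m \<in> borel_measurable borel" by (rule kern2_measurable[OF S])
  obtain B where B: "0 < B" "\<And>z. cmod (mother \<phi>\<^sub>0 z) \<le> B * rho z" using mother_bounds[OF S] by metis
  have bi: "integrable lborel (\<lambda>x. cmod (h x) * scaled_rho2 m (y - x))"
  proof (rule integrableI_nonneg)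
    have "(\<integral>\<^sup>+x. ennreal (cmod (h x)) * ennreal (scaled_rho2 m (y - x)) \<partial>lborel) < \<infinity>"
      by (rule le_less_trans[OF Lp_norm_scaled_rho2[OF hm p, of m y]]) (use fin in \<open>auto simp: ennreal_mult_less_top\<close>)
    then show "(\<integral>\<^sup>+x. ennreal (cmod (h x) * scaled_rho2 m (y - x)) \<partial>lborel) < \<infinity>" by (simp add: ennreal_mult)
  qed auto
  show "isCont (piece \<phi>\<^sub>0 g m) y"
    unfolding continuous_at_sequentially o_def
  proof (intro allI impI)
    fix Y :: "nat \<Rightarrow> real \<times> real" assume Y: "Y \<longlonglongrightarrow> y"
    have "(\<lambda>n. Y n - y) \<longlonglongrightarrow> y - y" by (intro tendsto_intros Y)
    hence "Bseq (\<lambda>n. Y n - y)" using convergentI convergent_imp_Bseq by blast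
    then obtain R where R: "0 < R" "\<And>n. norm (Y n - y) \<le> R" unfolding Bseq_def by blast
    define K where "K = (2 * (1 + (2 ^ Suc (fst m) * R)\<^sup>2)) * (2 * (1 + (2 ^ Suc (snd m) * R)\<^sup>2))"
    have bb: "scaled_rho2 m (Y n - x) \<le> K * scaled_rho2 m (y - x)" for n x
    proof -
      have 1: "\<bar>fst (Y n - y)\<bar> \<le> R" "\<bar>snd (Y n - y)\<bar> \<le> R"
        using R(2)[of n] norm_fst_le[of "fst (Y n - y)" "snd (Y n - y)"] norm_snd_le[of "snd (Y n - y)" "fst (Y n - y)"]
        unfolding prod.collapse real_norm_def by linarith+
      have "scaled_rho2 m (Y n - x) = scaled_rho (fst m) (fst (y - x) + fst (Y n - y)) * scaled_rho (snd m) (snd (y - x) + snd (Y n - y))"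
        by (simp add: scaled_rho2_def)
      also have "\<dots> \<le> (2 * (1 + (2 ^ Suc (fst m) * R)\<^sup>2) * scaled_rho (fst m) (fst (y - x))) * (2 * (1 + (2 ^ Suc (snd m) * R)\<^sup>2) * scaled_rho (snd m) (snd (y - x)))"
        by (intro mult_mono scaled_rho_shift 1) auto
      finally show ?thesis by (simp add: K_def scaled_rho2_def mult_ac)
    qed
    have "(\<lambda>n. LINT x|lborel. h x * kern2 \<phi>\<^sub>0 m (Y n - x)) \<longlonglongrightarrow> (LINT x|lborel. h x * kern2 \<phi>\<^sub>0 m (y - x))"
    proof (rule integral_dominated_convergence[where w = "\<lambda>x. B\<^sup>2 * K * (cmod (h x) * scaled_rho2 m (y - x))"])
      show "integrable lborel (\<lambda>x. B\<^sup>2 * K * (cmod (h x) * scaled_rho2 m (y - x)))" using bi by simp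
      have mc: "isCont (mother \<phi>\<^sub>0) z" for z
        using schwartz_differentiable[OF mother_schwartz[OF S]] by (rule differentiable_imp_continuous_within)
      show "AE x in lborel. (\<lambda>n. h x * kern2 \<phi>\<^sub>0 m (Y n - x)) \<longlonglongrightarrow> h x * kern2 \<phi>\<^sub>0 m (y - x)"
      proof (rule AE_I2)
        fix x
        have "(\<lambda>n. mother \<phi>\<^sub>0 (c * (e (Y n) - e x))) \<longlonglongrightarrow> mother \<phi>\<^sub>0 (c * (e y - e x))"
          if "(\<lambda>n. e (Y n)) \<longlonglongrightarrow> e y" for c and e :: "real \<times> real \<Rightarrow> real"
          using that by (intro isCont_tendsto_compose[OF mc] tendsto_intros)
        from this[OF tendsto_fst[OF Y]] this[OF tendsto_snd[OF Y]]
        show "(\<lambda>n. h x * kern2 \<phi>\<^sub>0 m (Y n - x)) \<longlonglongrightarrow> h x * kern2 \<phi>\<^sub>0 m (y - x)"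
          unfolding kern2_def kern_def fst_diff snd_diff by (intro tendsto_intros)
      qed
      show "AE x in lborel. cmod (h x * kern2 \<phi>\<^sub>0 m (Y n - x)) \<le> B\<^sup>2 * K * (cmod (h x) * scaled_rho2 m (y - x))" for n
      proof (rule AE_I2)
        fix x
        have "cmod (kern2 \<phi>\<^sub>0 m (Y n - x)) \<le> B\<^sup>2 * (K * scaled_rho2 m (y - x))"
          by (rule order_trans[OF kern2_bound[OF B] mult_left_mono[OF bb]]) simp
        from mult_left_mono[OF this, of "cmod (h x)"]
        show "cmod (h x * kern2 \<phi>\<^sub>0 m (Y n - x)) \<le> B\<^sup>2 * K * (cmod (h x) * scaled_rho2 m (y - x))"
          by (simp add: norm_mult mult_ac)
      qed
    qed measurable
    then show "(\<lambda>n. piece \<phi>\<^sub>0 g m (Y n)) \<longlonglongrightarrow> piece \<phi>\<^sub>0 g m y" unfolding piece_eq(2)[OF S h] .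
  qed
qed

text \<open>The reproducing formula and Fubini's theorem; the finite norm of \<open>h\<close> makes the double integral
  absolutely convergent.\<close>

theorem block_eq_integral_piece:
  assumes \<phi>: "resolution_generator \<phi>\<^sub>0" and h: "represents h (block \<phi>\<^sub>0 g m)" and p: "1 \<le> p" and fin: "Lp_norm p h < \<infinity>"
    and \<psi>: "\<psi> \<in> schwartz"
  shows "block \<phi>\<^sub>0 g m \<psi> = (LINT y|lborel. \<psi> y * piece \<phi>\<^sub>0 g m y)"
proof -
  have S: "\<phi>\<^sub>0 \<in> schwartz" using \<phi> by (simp add: resolution_generator_def)
  have hm: "h \<in> borel_measurable lborel" using h by (simp add: represents_def)
  hence [measurable]: "h \<in> borel_measurable borel" by simp
  have [measurable]: "kern2 \<phi>\<^sub>0 m \<in> borel_measurable borel" by (rule kern2_measurable[OF S])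
  have [measurable]: "\<psi> \<in> borel_measurable borel" by (rule schwartz_measurable[OF \<psi>])
  obtain B where B: "0 < B" "\<And>z. cmod (mother \<phi>\<^sub>0 z) \<le> B * rho z" using mother_bounds[OF S] by metis
  define c where "c = B\<^sup>2 * ((pi * pi) powr (1 - real_of_ereal (1 / p)) *
     (2 ^ Suc (fst m) * 2 ^ Suc (snd m)) powr real_of_ereal (1 / p))"
  let ?F = "\<lambda>(x, y). h x * (\<psi> y * kern2 \<phi>\<^sub>0 m (y - x))"
  have Fm: "?F \<in> borel_measurable (lborel \<Otimes>\<^sub>M lborel)"
    unfolding split_beta' by measurable
  have Fi: "integrable (lborel \<Otimes>\<^sub>M lborel) ?F"
  proof (rule integrableI_bounded[OF Fm])
    have inner: "(\<integral>\<^sup>+x. ennreal (cmod (?F (x, y))) \<partial>lborel) \<le> ennreal (cmod (\<psi> y)) * (ennreal c * Lp_norm p h)" for y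
    proof -
      have "(\<integral>\<^sup>+x. ennreal (cmod (?F (x, y))) \<partial>lborel) \<le> (\<integral>\<^sup>+x. (ennreal (cmod (\<psi> y)) * ennreal (B\<^sup>2)) * (ennreal (cmod (h x)) * ennreal (scaled_rho2 m (y - x))) \<partial>lborel)"
      proof (rule nn_integral_mono)
        fix x
        have "cmod (h x) * cmod (\<psi> y) * cmod (kern2 \<phi>\<^sub>0 m (y - x)) \<le> cmod (h x) * cmod (\<psi> y) * (B\<^sup>2 * scaled_rho2 m (y - x))"
          by (intro mult_left_mono kern2_bound B) auto
        then show "ennreal (cmod (?F (x, y))) \<le> (ennreal (cmod (\<psi> y)) * ennreal (B\<^sup>2)) * (ennreal (cmod (h x)) * ennreal (scaled_rho2 m (y - x)))"
          by (simp add: norm_mult mult_ac ennreal_mult[symmetric] ennreal_leI)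
      qed
      also have "\<dots> = (ennreal (cmod (\<psi> y)) * ennreal (B\<^sup>2)) * (\<integral>\<^sup>+x. ennreal (cmod (h x)) * ennreal (scaled_rho2 m (y - x)) \<partial>lborel)"
        by (rule nn_integral_cmult) measurable
      also have "\<dots> \<le> (ennreal (cmod (\<psi> y)) * ennreal (B\<^sup>2)) * (ennreal ((pi * pi) powr (1 - real_of_ereal (1 / p)) *
     (2 ^ Suc (fst m) * 2 ^ Suc (snd m)) powr real_of_ereal (1 / p)) * Lp_norm p h)"
        by (intro mult_left_mono Lp_norm_scaled_rho2 hm p) simp
      finally show ?thesis by (simp add: c_def ennreal_mult mult.assoc)
    qed
    have "(\<integral>\<^sup>+z. ennreal (cmod (?F z)) \<partial>(lborel \<Otimes>\<^sub>M lborel)) = (\<integral>\<^sup>+y. \<integral>\<^sup>+x. ennreal (cmod (?F (x, y))) \<partial>lborel \<partial>lborel)"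
      using Fm by (intro lborel_pair.nn_integral_snd[symmetric]) measurable
    also have "\<dots> \<le> (\<integral>\<^sup>+y. ennreal (cmod (\<psi> y)) * (ennreal c * Lp_norm p h) \<partial>lborel)"
      by (intro nn_integral_mono inner)
    also have "\<dots> = (\<integral>\<^sup>+y. ennreal (cmod (\<psi> y)) \<partial>lborel) * (ennreal c * Lp_norm p h)"
      by (rule nn_integral_multc) measurable
    also have "\<dots> < \<infinity>"
      using schwartz_integrable[OF \<psi>] fin by (auto simp: integrable_iff_bounded ennreal_mult_less_top)
    finally show "(\<integral>\<^sup>+z. ennreal (cmod (?F z)) \<partial>(lborel \<Otimes>\<^sub>M lborel)) < \<infinity>" .
  qed
  have "block \<phi>\<^sub>0 g m \<psi> = (LINT x|lborel. h x * (LINT y|lborel. \<psi> y * kern2 \<phi>\<^sub>0 m (y - x)))"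
    using h block_reproducing(1)[OF \<phi> \<psi>, of m] block_reproducing(2)[OF \<phi> \<psi>, of g m] unfolding represents_def by simp
  also have "\<dots> = (LINT x|lborel. LINT y|lborel. h x * (\<psi> y * kern2 \<phi>\<^sub>0 m (y - x)))" by simp
  also have "\<dots> = (LINT y|lborel. LINT x|lborel. h x * (\<psi> y * kern2 \<phi>\<^sub>0 m (y - x)))"
    using lborel_pair.Fubini_integral[OF Fi] by simp
  also have "\<dots> = (LINT y|lborel. \<psi> y * piece \<phi>\<^sub>0 g m y)"
  proof -
    have "(LINT x|lborel. h x * (\<psi> y * kern2 \<phi>\<^sub>0 m (y - x))) = \<psi> y * piece \<phi>\<^sub>0 g m y" for y
      unfolding piece_eq(2)[OF S h] integral_mult_right_zero[symmetric] by (simp add: mult_ac)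
    then show ?thesis by simp
  qed
  finally show ?thesis .
qed

lemma faber_coeff_integral:
  fixes F :: "real \<Rightarrow> 'a \<Rightarrow> complex"
  assumes "\<And>x. integrable M (F x)"
  shows "integrable M (\<lambda>z. faber_coeff a k (\<lambda>x. F x z))"
    and "faber_coeff a k (\<lambda>x. LINT z|M. F x z) = (LINT z|M. faber_coeff a k (\<lambda>x. F x z))"
  using assms by (cases a; simp)+

lemma faber_coeff_cmult: "faber_coeff a k (\<lambda>x. c * f x) = c * faber_coeff a k f"
  by (cases a) (simp_all add: algebra_simps)

definition faber_coeff2 :: "nat \<Rightarrow> nat \<Rightarrow> nat \<Rightarrow> nat \<Rightarrow> (real \<times> real \<Rightarrow> complex) \<Rightarrow> complex" where
  "faber_coeff2 a k b l f = faber_coeff a k (\<lambda>x. faber_coeff b l (\<lambda>y. f (x, y)))"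

lemma faber_coeff2_piece:
  assumes S: "\<phi>\<^sub>0 \<in> schwartz" and h: "represents h (block \<phi>\<^sub>0 g m)"
  shows "integrable lborel (\<lambda>z. h z * (faber_kernel \<phi>\<^sub>0 a k (fst m) (fst z) * faber_kernel \<phi>\<^sub>0 b l (snd m) (snd z)))"
    and "faber_coeff2 a k b l (piece \<phi>\<^sub>0 g m) =
     (LINT z|lborel. h z * (faber_kernel \<phi>\<^sub>0 a k (fst m) (fst z) * faber_kernel \<phi>\<^sub>0 b l (snd m) (snd z)))"
proof -
  have 1: "faber_coeff b l (\<lambda>y. h z * kern2 \<phi>\<^sub>0 m ((x, y) - z)) = h z * kern \<phi>\<^sub>0 (fst m) (x - fst z) * faber_kernel \<phi>\<^sub>0 b l (snd m) (snd z)" for x z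
    unfolding kern2_def fst_diff snd_diff fst_conv snd_conv mult.assoc[symmetric] by (simp only: faber_coeff_cmult faber_kernel_def)
  have 2: "faber_coeff a k (\<lambda>x. h z * kern \<phi>\<^sub>0 (fst m) (x - fst z) * faber_kernel \<phi>\<^sub>0 b l (snd m) (snd z)) =
     h z * (faber_kernel \<phi>\<^sub>0 a k (fst m) (fst z) * faber_kernel \<phi>\<^sub>0 b l (snd m) (snd z))" for z
  proof -
    have "faber_coeff a k (\<lambda>x. (h z * faber_kernel \<phi>\<^sub>0 b l (snd m) (snd z)) * kern \<phi>\<^sub>0 (fst m) (x - fst z)) =
      (h z * faber_kernel \<phi>\<^sub>0 b l (snd m) (snd z)) * faber_kernel \<phi>\<^sub>0 a k (fst m) (fst z)"
      by (simp only: faber_coeff_cmult faber_kernel_def)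
    then show ?thesis by (simp add: mult_ac)
  qed
  note i1 = faber_coeff_integral[of lborel "\<lambda>y z. h z * kern2 \<phi>\<^sub>0 m ((x, y) - z)" b l for x, OF piece_eq(1)[OF S h]]
  note i1' = i1[unfolded 1]
  note i2 = faber_coeff_integral[of lborel "\<lambda>x z. h z * kern \<phi>\<^sub>0 (fst m) (x - fst z) * faber_kernel \<phi>\<^sub>0 b l (snd m) (snd z)" a k, OF i1'(1), unfolded 2]
  show "integrable lborel (\<lambda>z. h z * (faber_kernel \<phi>\<^sub>0 a k (fst m) (fst z) * faber_kernel \<phi>\<^sub>0 b l (snd m) (snd z)))"
    by (rule i2(1))
  show "faber_coeff2 a k b l (piece \<phi>\<^sub>0 g m) =
     (LINT z|lborel. h z * (faber_kernel \<phi>\<^sub>0 a k (fst m) (fst z) * faber_kernel \<phi>\<^sub>0 b l (snd m) (snd z)))"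
    unfolding faber_coeff2_def piece_eq(2)[OF S h] i1'(2) i2(2) ..
qed

lemma ennreal_le_mult_INF:
  fixes X :: ennreal
  assumes c: "0 < c" and le: "\<And>x. x \<in> A \<Longrightarrow> X \<le> ennreal c * f x"
  shows "X \<le> ennreal c * (INF x\<in>A. f x)"
proof -
  have "ennreal (1 / c) * X \<le> (INF x\<in>A. f x)"
  proof (rule INF_greatest)
    fix x assume "x \<in> A"
    from mult_left_mono[OF le[OF this], of "ennreal (1 / c)"]
    have "ennreal (1 / c) * X \<le> ennreal (1 / c) * (ennreal c * f x)" by simp
    also have "\<dots> = f x" using c by (simp add: mult.assoc[symmetric] ennreal_mult''[symmetric])
    finally show "ennreal (1 / c) * X \<le> f x" .
  qed
  from mult_left_mono[OF this, of "ennreal c"]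
  have "ennreal c * (ennreal (1 / c) * X) \<le> ennreal c * (INF x\<in>A. f x)" by simp
  moreover have "ennreal c * (ennreal (1 / c) * X) = X"
    using c by (simp add: mult.assoc[symmetric] ennreal_mult''[symmetric])
  ultimately show ?thesis by simp
qed

text \<open>The coefficients are integrals of \<open>h\<close> against tensor products of Faber kernels. A weighted sum of
  their moduli is therefore an integral of \<open>cmod (h z)\<close> against one weight function, whose total mass and
  supremum are bounded by the two parts of the Schur test; \<open>\<sigma>\<close> and \<open>\<omega>\<close> are the total mass and the
  supremum of the given weights. In the application these weights are integration errors.\<close>

theorem faber_coeff2_piece_weighted_sum:
  assumes S: "\<phi>\<^sub>0 \<in> schwartz" and p: "1 \<le> p"
    and D: "0 < D"
    "\<And>a k m. (\<integral>\<^sup>+y. ennreal (cmod (faber_kernel \<phi>\<^sub>0 a k m y)) \<partial>lborel) \<le> ennreal (D * smoothing m (level a))"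
    "\<And>a m y. (\<Sum>k<2 ^ level a. cmod (faber_kernel \<phi>\<^sub>0 a k m y)) \<le> D * (smoothing m (level a) * max (2 ^ m) (2 ^ level a))"
    and w: "\<And>k l. k < 2 ^ level a \<Longrightarrow> l < 2 ^ level b \<Longrightarrow> 0 \<le> w k l \<and> w k l \<le> \<omega>"
    and sw: "(\<Sum>k<2 ^ level a. \<Sum>l<2 ^ level b. w k l) \<le> \<sigma>" and pos: "0 < \<omega>" "0 < \<sigma>"
  shows "(\<Sum>k<2 ^ level a. \<Sum>l<2 ^ level b. ennreal (w k l * cmod (faber_coeff2 a k b l (piece \<phi>\<^sub>0 g m)))) \<le>
    ennreal ((\<sigma> * (D\<^sup>2 * (smoothing (fst m) (level a) * smoothing (snd m) (level b)))) powr (1 - real_of_ereal (1 / p)) *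
      (\<omega> * (D\<^sup>2 * (smoothing (fst m) (level a) * smoothing (snd m) (level b)) *
        (max (2 ^ fst m) (2 ^ level a) * max (2 ^ snd m) (2 ^ level b)))) powr real_of_ereal (1 / p)) *
    Lp_norm_distr p (block \<phi>\<^sub>0 g m)" (is "?X \<le> ennreal ?c * _")
proof -
  have c0: "0 < ?c"
    using pos D(1) smoothing_pos[of "fst m" "level a"] smoothing_pos[of "snd m" "level b"]
    by (simp add: less_imp_neq[THEN not_sym] max_def)
  have key: "?X \<le> ennreal ?c * Lp_norm p h" if h: "represents h (block \<phi>\<^sub>0 g m)" for h
  proof -
    have hm[measurable]: "h \<in> borel_measurable lborel" using h by (simp add: represents_def)
    have [measurable]: "faber_kernel \<phi>\<^sub>0 a k m \<in> borel_measurable borel" for a k m by (rule faber_kernel_measurable[OF S])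
    let ?A = "\<lambda>k z. cmod (faber_kernel \<phi>\<^sub>0 a k (fst m) z)" and ?B = "\<lambda>l z. cmod (faber_kernel \<phi>\<^sub>0 b l (snd m) z)"
    let ?W = "\<lambda>z::real \<times> real. \<Sum>k<2 ^ level a. \<Sum>l<2 ^ level b. ennreal (w k l) * (ennreal (?A k (fst z)) * ennreal (?B l (snd z)))"
    have [measurable]: "fst \<in> borel_measurable (lborel :: (real \<times> real) measure)" "snd \<in> borel_measurable (lborel :: (real \<times> real) measure)"
      by (simp_all add: borel_prod[symmetric])
    have Wm: "?W \<in> borel_measurable lborel" by measurable
    have "?X \<le> (\<Sum>k<2 ^ level a. \<Sum>l<2 ^ level b. (\<integral>\<^sup>+z. ennreal (cmod (h z)) * (ennreal (w k l) * (ennreal (?A k (fst z)) * ennreal (?B l (snd z)))) \<partial>lborel))"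
    proof (intro sum_mono)
      fix k l :: nat assume "k \<in> {..<2 ^ level a}" "l \<in> {..<2 ^ level b}"
      hence w0: "0 \<le> w k l" using w by auto
      have "ennreal (w k l * cmod (faber_coeff2 a k b l (piece \<phi>\<^sub>0 g m))) = ennreal (w k l) * ennreal (cmod (faber_coeff2 a k b l (piece \<phi>\<^sub>0 g m)))"
        using w0 by (simp add: ennreal_mult)
      also have "\<dots> \<le> ennreal (w k l) * (\<integral>\<^sup>+z. ennreal (cmod (h z * (faber_kernel \<phi>\<^sub>0 a k (fst m) (fst z) * faber_kernel \<phi>\<^sub>0 b l (snd m) (snd z)))) \<partial>lborel)"
        unfolding faber_coeff2_piece(2)[OF S h] by (intro mult_left_mono integral_norm_bound_ennreal faber_coeff2_piece(1)[OF S h]) simp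
      also have "\<dots> = (\<integral>\<^sup>+z. ennreal (w k l) * ennreal (cmod (h z * (faber_kernel \<phi>\<^sub>0 a k (fst m) (fst z) * faber_kernel \<phi>\<^sub>0 b l (snd m) (snd z)))) \<partial>lborel)"
        by (rule nn_integral_cmult[symmetric]) measurable
      also have "\<dots> = (\<integral>\<^sup>+z. ennreal (cmod (h z)) * (ennreal (w k l) * (ennreal (?A k (fst z)) * ennreal (?B l (snd z)))) \<partial>lborel)"
        by (simp add: norm_mult ennreal_mult mult_ac)
      finally show "ennreal (w k l * cmod (faber_coeff2 a k b l (piece \<phi>\<^sub>0 g m))) \<le> (\<integral>\<^sup>+z. ennreal (cmod (h z)) * (ennreal (w k l) * (ennreal (?A k (fst z)) * ennreal (?B l (snd z)))) \<partial>lborel)" .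
    qed
    also have "\<dots> = (\<integral>\<^sup>+z. (\<Sum>k<2 ^ level a. \<Sum>l<2 ^ level b. ennreal (cmod (h z)) * (ennreal (w k l) * (ennreal (?A k (fst z)) * ennreal (?B l (snd z))))) \<partial>lborel)"
      by (subst nn_integral_sum, measurable, intro sum.cong refl, subst nn_integral_sum, measurable)
    also have "\<dots> = (\<integral>\<^sup>+z. ennreal (cmod (h z)) * ?W z \<partial>lborel)"
      by (simp only: sum_distrib_left)
    also have "\<dots> \<le> ennreal ?c * Lp_norm p h"
    proof (rule Lp_norm_weighted_le[OF hm Wm _ _ _ _ p])
      have "(\<integral>\<^sup>+z. ?W z \<partial>lborel) = (\<Sum>k<2 ^ level a. \<Sum>l<2 ^ level b. (\<integral>\<^sup>+z. ennreal (w k l) * (ennreal (?A k (fst z)) * ennreal (?B l (snd z))) \<partial>lborel))"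
        by (subst nn_integral_sum, measurable, intro sum.cong refl, subst nn_integral_sum, measurable)
      also have "\<dots> = (\<Sum>k<2 ^ level a. \<Sum>l<2 ^ level b. ennreal (w k l) * ((\<integral>\<^sup>+z. ennreal (?A k z) \<partial>lborel) * (\<integral>\<^sup>+z. ennreal (?B l z) \<partial>lborel)))"
        by (intro sum.cong refl, subst nn_integral_cmult, measurable,
            subst nn_integral_tensor[of "\<lambda>z. ennreal (?A k z)" "\<lambda>z. ennreal (?B l z)" for k l], measurable)
      also have "\<dots> \<le> (\<Sum>k<2 ^ level a. \<Sum>l<2 ^ level b. ennreal (w k l) * (ennreal (D * smoothing (fst m) (level a)) * ennreal (D * smoothing (snd m) (level b))))"
        by (intro sum_mono mult_left_mono mult_mono D) auto
      also have "\<dots> = (\<Sum>k<2 ^ level a. \<Sum>l<2 ^ level b. ennreal (w k l)) * (ennreal (D * smoothing (fst m) (level a)) * ennreal (D * smoothing (snd m) (level b)))"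
        by (simp only: sum_distrib_right)
      also have "(\<Sum>k<2 ^ level a. \<Sum>l<2 ^ level b. ennreal (w k l)) = ennreal (\<Sum>k<2 ^ level a. \<Sum>l<2 ^ level b. w k l)"
      proof -
        have "(\<Sum>k<2 ^ level a. \<Sum>l<2 ^ level b. ennreal (w k l)) = (\<Sum>k<2 ^ level a. ennreal (\<Sum>l<2 ^ level b. w k l))"
          using w by (intro sum.cong refl sum_ennreal) auto
        also have "\<dots> = ennreal (\<Sum>k<2 ^ level a. \<Sum>l<2 ^ level b. w k l)"
          using w by (intro sum_ennreal sum_nonneg) auto
        finally show ?thesis .
      qed
      also have "\<dots> * (ennreal (D * smoothing (fst m) (level a)) * ennreal (D * smoothing (snd m) (level b))) \<le>
         ennreal \<sigma> * (ennreal (D * smoothing (fst m) (level a)) * ennreal (D * smoothing (snd m) (level b)))"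
        by (intro mult_right_mono ennreal_leI sw) simp
      also have "\<dots> = ennreal (\<sigma> * (D\<^sup>2 * (smoothing (fst m) (level a) * smoothing (snd m) (level b))))"
        using pos D(1) less_imp_le[OF smoothing_pos] by (simp add: ennreal_mult[symmetric] power2_eq_square mult_ac)
      finally show "(\<integral>\<^sup>+z. ?W z \<partial>lborel) \<le> ennreal (\<sigma> * (D\<^sup>2 * (smoothing (fst m) (level a) * smoothing (snd m) (level b))))" .
      show "?W z \<le> ennreal (\<omega> * (D\<^sup>2 * (smoothing (fst m) (level a) * smoothing (snd m) (level b)) *
        (max (2 ^ fst m) (2 ^ level a) * max (2 ^ snd m) (2 ^ level b))))" for z
      proof -
        have "?W z = ennreal (\<Sum>k<2 ^ level a. \<Sum>l<2 ^ level b. w k l * (?A k (fst z) * ?B l (snd z)))"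
        proof -
          have "(\<Sum>l<2 ^ level b. ennreal (w k l) * (ennreal (?A k (fst z)) * ennreal (?B l (snd z)))) = ennreal (\<Sum>l<2 ^ level b. w k l * (?A k (fst z) * ?B l (snd z)))"
            if "k < 2 ^ level a" for k
            using w that by (subst sum_ennreal[symmetric]) (auto simp: ennreal_mult intro!: sum.cong)
          then show ?thesis using w by (subst sum_ennreal[symmetric]) (auto intro!: sum.cong sum_nonneg)
        qed
        also have "\<dots> \<le> ennreal (\<Sum>k<2 ^ level a. \<Sum>l<2 ^ level b. \<omega> * (?A k (fst z) * ?B l (snd z)))"
          using w by (intro ennreal_leI sum_mono mult_right_mono) auto
        also have "(\<Sum>k<2 ^ level a. \<Sum>l<2 ^ level b. \<omega> * (?A k (fst z) * ?B l (snd z))) =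
          \<omega> * ((\<Sum>k<2 ^ level a. ?A k (fst z)) * (\<Sum>l<2 ^ level b. ?B l (snd z)))"
          by (subst sum_product) (simp only: sum_distrib_left)
        also have "\<dots> \<le> \<omega> * ((D * (smoothing (fst m) (level a) * max (2 ^ fst m) (2 ^ level a))) * (D * (smoothing (snd m) (level b) * max (2 ^ snd m) (2 ^ level b))))"
          using pos D(1) by (intro mult_left_mono mult_mono D) (auto intro!: sum_nonneg mult_nonneg_nonneg less_imp_le[OF smoothing_pos] simp: le_max_iff_disj)
        finally show ?thesis by (simp add: power2_eq_square mult_ac ennreal_leI)
      qed
      show "0 < \<sigma> * (D\<^sup>2 * (smoothing (fst m) (level a) * smoothing (snd m) (level b)))"
        using pos D(1) smoothing_pos by simp
      show "0 < \<omega> * (D\<^sup>2 * (smoothing (fst m) (level a) * smoothing (snd m) (level b)) *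
        (max (2 ^ fst m) (2 ^ level a) * max (2 ^ snd m) (2 ^ level b)))"
        using pos D(1) smoothing_pos by (intro mult_pos_pos) (auto simp: less_max_iff_disj)
    qed
    finally show ?thesis .
  qed
  show ?thesis unfolding Lp_norm_distr_def
    by (rule ennreal_le_mult_INF[OF c0]) (use key in blast)
qed

section \<open>Tent functions along bit reversal\<close>

fun bitrev :: "nat \<Rightarrow> nat \<Rightarrow> nat" where
  "bitrev 0 x = 0"
| "bitrev (Suc n) x = (x mod 2) * 2 ^ n + bitrev n (x div 2)"

lemma bitrev_less: "bitrev n x < 2 ^ n"
proof (induction n arbitrary: x)
  case (Suc n)
  have "(x mod 2) * 2 ^ n \<le> 1 * 2 ^ n" by (intro mult_right_mono) auto
  then show ?case using Suc[of "x div 2"] unfolding bitrev.simps power_Suc by linarith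
qed simp

lemma bitrev_concat:
  "y < 2 ^ b \<Longrightarrow> bitrev (a + b) (x * 2 ^ b + y) = bitrev b y * 2 ^ a + bitrev a x"
proof (induction b arbitrary: y)
  case (Suc b)
  have "bitrev (a + Suc b) (x * 2 ^ Suc b + y) =
     ((x * 2 ^ Suc b + y) mod 2) * 2 ^ (a + b) + bitrev (a + b) ((x * 2 ^ Suc b + y) div 2)" by simp
  also have "(x * 2 ^ Suc b + y) mod 2 = y mod 2"
    by (metis mod_mult_self3 mult.assoc mult.commute power_Suc)
  also have "(x * 2 ^ Suc b + y) div 2 = x * 2 ^ b + y div 2"
    by simp
  also have "bitrev (a + b) (x * 2 ^ b + y div 2) = bitrev b (y div 2) * 2 ^ a + bitrev a x"
    using Suc.prems by (intro Suc.IH) auto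
  finally show ?case by (simp add: power_add algebra_simps)
qed simp

lemma bitrev_bitrev: "x < 2 ^ n \<Longrightarrow> bitrev n (bitrev n x) = x"
proof (induction n arbitrary: x)
  case (Suc n)
  have d: "x div 2 < 2 ^ n" using Suc.prems by auto
  have "bitrev (1 + n) ((x mod 2) * 2 ^ n + bitrev n (x div 2)) = bitrev n (bitrev n (x div 2)) * 2 ^ 1 + bitrev 1 (x mod 2)"
    by (rule bitrev_concat) (rule bitrev_less)
  then show ?case using Suc.IH[OF d] by simp
qed simp

lemma bij_bitrev: "bij_betw (bitrev n) {..<2 ^ n} {..<2 ^ n}"
  by (rule bij_betw_byWitness[of _ "bitrev n"]) (auto simp: bitrev_bitrev bitrev_less)

lemma sum_split_pow:
  fixes g :: "nat \<Rightarrow> 'a::comm_monoid_add"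
  shows "(\<Sum>i<2 ^ (a + b). g i) = (\<Sum>x<2 ^ a. \<Sum>y<2 ^ b. g (x * 2 ^ b + y))"
proof -
  have "(\<Sum>x<2 ^ a. \<Sum>y<2 ^ b. g (x * 2 ^ b + y)) = (\<Sum>z\<in>{..<2 ^ a} \<times> {..<2 ^ b}. g (fst z * 2 ^ b + snd z))"
    by (simp add: sum.cartesian_product split_beta)
  also have "\<dots> = (\<Sum>i<2 ^ (a + b). g i)"
  proof (rule sum.reindex_bij_witness[where i = "\<lambda>i. (i div 2 ^ b, i mod 2 ^ b)" and j = "\<lambda>z. fst z * 2 ^ b + snd z"])
    fix i :: nat assume "i \<in> {..<2 ^ (a + b)}"
    then show "(i div 2 ^ b, i mod 2 ^ b) \<in> {..<2 ^ a} \<times> {..<2 ^ b}"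
      by (simp add: less_mult_imp_div_less power_add)
  next
    fix z :: "nat \<times> nat" assume z: "z \<in> {..<2 ^ a} \<times> {..<2 ^ b}"
    then obtain x y where z': "z = (x, y)" "x < 2 ^ a" "y < 2 ^ b" by auto
    have "x * 2 ^ b + y < (x + 1) * 2 ^ b" using z' by simp
    also have "\<dots> \<le> 2 ^ a * 2 ^ b" using z' by (intro mult_right_mono) auto
    finally show "fst z * 2 ^ b + snd z \<in> {..<2 ^ (a + b)}" using z' by (simp add: power_add)
  qed (auto simp: power_add div_mult_mod_eq)
  finally show ?thesis by simp
qed

definition tent :: "real \<Rightarrow> real" where
  "tent t = max 0 (1 - \<bar>2 * t - 1\<bar>)"

lemma tent_nonneg [simp]: "0 \<le> tent t" by (simp add: tent_def)
lemma tent_le_1: "tent t \<le> 1" by (simp add: tent_def)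
lemma tent_outside: "t \<le> 0 \<or> 1 \<le> t \<Longrightarrow> tent t = 0" by (auto simp: tent_def)
lemma tent_left: "0 \<le> t \<Longrightarrow> t \<le> 1 / 2 \<Longrightarrow> tent t = 2 * t" by (simp add: tent_def)
lemma tent_right: "1 / 2 \<le> t \<Longrightarrow> t \<le> 1 \<Longrightarrow> tent t = 2 - 2 * t" by (simp add: tent_def)
lemma tent_reflect: "tent (1 - t) = tent t" by (simp add: tent_def abs_minus_commute)

lemma tent_complement: "0 \<le> t \<Longrightarrow> t \<le> 1 / 2 \<Longrightarrow> tent (t + 1 / 2) = 1 - tent t"
  by (simp add: tent_left tent_right)

lemma sum_pow_Suc_halves:
  fixes g :: "nat \<Rightarrow> real"
  shows "(\<Sum>i<2 ^ Suc n. g i) = (\<Sum>i<2 ^ n. g i + g (i + 2 ^ n))"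
  using sum_split_pow[of g 1 n] by (simp add: numeral_2_eq_2 sum.distrib add.commute)

lemma sum_pow_Suc_pairs:
  fixes g :: "nat \<Rightarrow> real"
  shows "(\<Sum>i<2 ^ Suc n. g i) = (\<Sum>i<2 ^ n. g (2 * i) + g (2 * i + 1))"
  using sum_split_pow[of g n 1] by (simp add: numeral_2_eq_2 mult.commute)

lemma cell_bounds:
  assumes "t < 2 ^ n" "0 \<le> \<theta>" "\<theta> \<le> 1"
  shows "0 \<le> (real t + \<theta>) / 2 ^ n" "(real t + \<theta>) / 2 ^ n \<le> 1"
proof -
  have "real (t + 1) \<le> 2 ^ n" using assms by (metis Suc_eq_plus1 Suc_leI of_nat_le_iff of_nat_numeral of_nat_power)
  then show "(real t + \<theta>) / 2 ^ n \<le> 1" using assms by (simp add: divide_le_eq)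
qed (use assms in simp)

text \<open>Points at distance 1/2 have tent values that add up to 1.\<close>

lemma tent_grid_sum:
  assumes \<theta>: "0 \<le> \<theta>" "\<theta> \<le> 1"
  shows "(\<Sum>t<2 ^ Suc n. tent ((real t + \<theta>) / 2 ^ Suc n)) = 2 ^ n"
proof -
  have "(\<Sum>t<2 ^ Suc n. tent ((real t + \<theta>) / 2 ^ Suc n)) =
    (\<Sum>t<2 ^ n. tent ((real t + \<theta>) / 2 ^ Suc n) + tent ((real (t + 2 ^ n) + \<theta>) / 2 ^ Suc n))"
    by (rule sum_pow_Suc_halves)
  also have "\<dots> = (\<Sum>t<(2::nat) ^ n. 1)"
  proof (intro sum.cong refl)
    fix t :: nat assume "t \<in> {..<2 ^ n}"
    hence b: "0 \<le> (real t + \<theta>) / 2 ^ n" "(real t + \<theta>) / 2 ^ n \<le> 1" using cell_bounds[OF _ \<theta>] by auto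
    have "(real (t + 2 ^ n) + \<theta>) / 2 ^ Suc n = (real t + \<theta>) / 2 ^ Suc n + 1 / 2"
      by (simp add: field_simps)
    then show "tent ((real t + \<theta>) / 2 ^ Suc n) + tent ((real (t + 2 ^ n) + \<theta>) / 2 ^ Suc n) = 1"
      using b tent_complement[of "(real t + \<theta>) / 2 ^ Suc n"] by (simp add: field_simps)
  qed
  finally show ?thesis by simp
qed

text \<open>The arguments stay in the left half of the interval, where the tent is linear, so that consecutive
  terms have a constant difference.\<close>

lemma tent_alternating_sum:
  assumes \<theta>: "0 \<le> \<theta>" "\<theta> \<le> 1"
  shows "(\<Sum>t<2 ^ Suc n. (if even t then 1 else - 1) * tent ((real t + \<theta>) / 2 ^ (n + 2))) = - 1 / 2"
proof -
  have "(\<Sum>t<2 ^ Suc n. (if even t then 1 else - 1) * tent ((real t + \<theta>) / 2 ^ (n + 2))) =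
    (\<Sum>t<2 ^ n. tent ((real (2 * t) + \<theta>) / 2 ^ (n + 2)) - tent ((real (2 * t + 1) + \<theta>) / 2 ^ (n + 2)))"
    by (subst sum_pow_Suc_pairs) simp
  also have "\<dots> = (\<Sum>t<(2::nat) ^ n. - 2 / 2 ^ (n + 2))"
  proof (intro sum.cong refl)
    fix t :: nat assume t: "t \<in> {..<2 ^ n}"
    have "2 * t < 2 ^ Suc n" "2 * t + 1 < 2 ^ Suc n" using t by auto
    note b = cell_bounds[OF this(1) \<theta>] cell_bounds[OF this(2) \<theta>]
    have "tent ((real (2 * t) + \<theta>) / 2 ^ (n + 2)) = 2 * ((real (2 * t) + \<theta>) / 2 ^ (n + 2))"
      "tent ((real (2 * t + 1) + \<theta>) / 2 ^ (n + 2)) = 2 * ((real (2 * t + 1) + \<theta>) / 2 ^ (n + 2))"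
      using b by - (rule tent_left; simp add: field_simps)+
    then show "tent ((real (2 * t) + \<theta>) / 2 ^ (n + 2)) - tent ((real (2 * t + 1) + \<theta>) / 2 ^ (n + 2)) = - 2 / 2 ^ (n + 2)"
      by (simp add: field_simps)
  qed
  also have "\<dots> = - 1 / 2" by simp
  finally show ?thesis .
qed

text \<open>The exact quadrature error of a tensor product of two tents at a shifted Hammersley set: the value
  \<open>2 ^ n\<close> is \<open>2 ^ (n + 2)\<close> times the integral 1/4. The top bit of \<open>t\<close> becomes the last bit of its reversal.
  Pairing \<open>t\<close> with \<open>t + 2 ^ (n + 1)\<close> therefore replaces the first tent by its complement and moves the second
  argument to the neighbouring grid point, whence \<open>X Y + (1 - X) Y' = Y' - X (Y' - Y)\<close>. The sum of \<open>Y'\<close> is a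
  full grid sum. The difference \<open>Y' - Y\<close> has constant modulus, and its sign is the parity of \<open>t\<close>: the first bit
  of the reversal decides on which side of the tent the second argument lies. What remains is an
  alternating sum.\<close>

theorem tent_bitrev_sum:
  assumes \<theta>: "0 \<le> \<theta>" "\<theta> \<le> 1" and \<theta>': "0 \<le> \<theta>'" "\<theta>' \<le> 1"
  shows "(\<Sum>t<2 ^ (n + 2). tent ((real t + \<theta>) / 2 ^ (n + 2)) * tent ((real (bitrev (n + 2) t) + \<theta>') / 2 ^ (n + 2)))
     = 2 ^ n + 1 / 2 ^ (n + 2)"
proof -
  let ?L = "2 ^ (n + 2) :: real"
  define X where "X t = tent ((real t + \<theta>) / ?L)" for t
  define Y where "Y u = tent ((real u + \<theta>') / ?L)" for u
  have "(\<Sum>t<2 ^ (n + 2). X t * Y (bitrev (n + 2) t)) =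
    (\<Sum>t<2 ^ (n + 1). X t * Y (bitrev (n + 2) t) + X (t + 2 ^ (n + 1)) * Y (bitrev (n + 2) (t + 2 ^ (n + 1))))"
    using sum_pow_Suc_halves[of "\<lambda>t. X t * Y (bitrev (n + 2) t)" "n + 1"] by (simp only: add_2_eq_Suc' Suc_eq_plus1[symmetric])
  also have "\<dots> = (\<Sum>t<2 ^ (n + 1). Y (2 * bitrev (n + 1) t + 1) - (if even t then 1 else - 1) * X t * (2 / ?L))"
  proof (intro sum.cong refl)
    fix t :: nat assume "t \<in> {..<2 ^ (n + 1)}"
    hence t: "t < 2 ^ (n + 1)" by simp
    define u where "u = bitrev (n + 1) t"
    have u: "u < 2 ^ (n + 1)" unfolding u_def by (rule bitrev_less)
    have r1: "bitrev (n + 2) t = 2 * u"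
      using bitrev_concat[OF t, of 1 0] by (simp add: u_def mult.commute)
    have r2: "bitrev (n + 2) (t + 2 ^ (n + 1)) = 2 * u + 1"
      using bitrev_concat[OF t, of 1 1] by (simp add: u_def add.commute mult.commute)
    have Xc: "X (t + 2 ^ (n + 1)) = 1 - X t"
    proof -
      have "(real (t + 2 ^ (n + 1)) + \<theta>) / ?L = (real t + \<theta>) / ?L + 1 / 2" by (simp add: field_simps)
      moreover have "0 \<le> (real t + \<theta>) / ?L" "(real t + \<theta>) / ?L \<le> 1 / 2"
        using cell_bounds[OF t \<theta>] by (simp_all add: field_simps)
      ultimately show ?thesis unfolding X_def by (simp only: tent_complement)
    qed
    \<comment> \<open>The last bit of \<open>t\<close> is the first bit of its reversal.\<close>
    have sgn: "even t \<longleftrightarrow> u < 2 ^ n"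
    proof -
      have "u = (t mod 2) * 2 ^ n + bitrev n (t div 2)" by (simp add: u_def)
      then show ?thesis using bitrev_less[of n "t div 2"] by (cases "even t") (auto simp: even_iff_mod_2_eq_zero odd_iff_mod_2_eq_one)
    qed
    have Yd: "Y (2 * u + 1) - Y (2 * u) = (if even t then 1 else - 1) * (2 / ?L)"
    proof (cases "even t")
      case True
      hence "2 * u + 1 < 2 ^ (n + 1)" "2 * u < 2 ^ (n + 1)" using sgn by auto
      note b = cell_bounds[OF this(1) \<theta>'] cell_bounds[OF this(2) \<theta>']
      have "Y (2 * u + 1) = 2 * ((real (2 * u + 1) + \<theta>') / ?L)" "Y (2 * u) = 2 * ((real (2 * u) + \<theta>') / ?L)"
        unfolding Y_def using b by - (rule tent_left; simp add: field_simps)+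
      then show ?thesis using True by (simp add: field_simps)
    next
      case False
      hence un: "2 ^ n \<le> u" using sgn by simp
      have un': "(2::real) ^ n \<le> real u" using un by (metis of_nat_le_iff of_nat_numeral of_nat_power)
      have "2 * u + 1 < 2 ^ (n + 2)" "2 * u < 2 ^ (n + 2)" using u by auto
      note b = cell_bounds[OF this(1) \<theta>'] cell_bounds[OF this(2) \<theta>']
      have "Y (2 * u + 1) = 2 - 2 * ((real (2 * u + 1) + \<theta>') / ?L)" "Y (2 * u) = 2 - 2 * ((real (2 * u) + \<theta>') / ?L)"
      proof -
        have "2 * 2 ^ n \<le> real (2 * u) + \<theta>'" using un' \<theta>'(1) by linarith
        hence "1 / 2 \<le> (real (2 * u) + \<theta>') / ?L" by (simp add: le_divide_eq)
        moreover have "(real (2 * u) + \<theta>') / ?L \<le> (real (2 * u + 1) + \<theta>') / ?L"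
          by (intro divide_right_mono) auto
        ultimately have h: "1 / 2 \<le> (real (2 * u) + \<theta>') / ?L" "1 / 2 \<le> (real (2 * u + 1) + \<theta>') / ?L" by linarith+
        show "Y (2 * u + 1) = 2 - 2 * ((real (2 * u + 1) + \<theta>') / ?L)" "Y (2 * u) = 2 - 2 * ((real (2 * u) + \<theta>') / ?L)"
          unfolding Y_def using tent_right[OF h(1) b(4)] tent_right[OF h(2) b(2)] by auto
      qed
      then show ?thesis using False by (simp add: field_simps)
    qed
    have "X t * Y (2 * u) + (1 - X t) * Y (2 * u + 1) = Y (2 * u + 1) - X t * (Y (2 * u + 1) - Y (2 * u))"
      by (simp add: algebra_simps)
    then show "X t * Y (bitrev (n + 2) t) + X (t + 2 ^ (n + 1)) * Y (bitrev (n + 2) (t + 2 ^ (n + 1))) =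
       Y (2 * bitrev (n + 1) t + 1) - (if even t then 1 else - 1) * X t * (2 / ?L)"
      unfolding r1 r2 Xc Yd u_def[symmetric] by (simp only: mult_ac)
  qed
  also have "\<dots> = (\<Sum>t<2 ^ (n + 1). Y (2 * bitrev (n + 1) t + 1)) - (\<Sum>t<2 ^ (n + 1). (if even t then 1 else - 1) * X t) * (2 / ?L)"
    by (simp only: sum_subtractf sum_distrib_right)
  also have "(\<Sum>t<2 ^ (n + 1). (if even t then 1 else - 1) * X t) = - 1 / 2"
    using tent_alternating_sum[OF \<theta>, of n] by (simp add: X_def)
  also have "(\<Sum>t<2 ^ (n + 1). Y (2 * bitrev (n + 1) t + 1)) = (\<Sum>u<2 ^ (n + 1). Y (2 * u + 1))"
    using bij_bitrev[of "n + 1"] by (rule sum.reindex_bij_betw)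
  also have "\<dots> = 2 ^ n"
  proof -
    have "Y (2 * u + 1) = tent ((real u + (1 + \<theta>') / 2) / 2 ^ Suc n)" for u
      unfolding Y_def by (rule arg_cong[of _ _ tent]) (simp add: field_simps)
    then show ?thesis using tent_grid_sum[of "(1 + \<theta>') / 2" n] \<theta>' by simp
  qed
  finally show ?thesis by (simp add: X_def Y_def)
qed

section \<open>Integration errors of the Faber functions\<close>

fun faber_fun :: "nat \<Rightarrow> nat \<Rightarrow> real \<Rightarrow> real" where
  "faber_fun 0 k x = 1 - x"
| "faber_fun (Suc j) k x = tent (2 ^ j * x - real k)"

text \<open>Midpoints of the grid cells, so that no point lies on the boundary of a dyadic interval of length at least \<open>1 / 2 ^ n\<close>.\<close>

definition coordx :: "nat \<Rightarrow> nat \<Rightarrow> real" where "coordx n i = (real i + 1 / 2) / 2 ^ n"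

definition coordy :: "nat \<Rightarrow> nat \<Rightarrow> real" where "coordy n i = coordx n (bitrev n i)"

definition reflect :: "nat \<Rightarrow> real \<Rightarrow> real" where "reflect c x = (if c = 0 then x else 1 - x)"

lemma coordx_bounds: "i < 2 ^ n \<Longrightarrow> 0 < coordx n i" "i < 2 ^ n \<Longrightarrow> coordx n i < 1"
proof -
  assume i: "i < 2 ^ n"
  show "0 < coordx n i" by (simp add: coordx_def add_nonneg_pos)
  have "real (i + 1) \<le> 2 ^ n" using i by (metis Suc_eq_plus1 Suc_leI of_nat_le_iff of_nat_numeral of_nat_power)
  then show "coordx n i < 1" by (simp add: coordx_def divide_less_eq)
qed

lemma coordy_bounds: "0 < coordy n i" "coordy n i < 1"
  unfolding coordy_def using coordx_bounds[OF bitrev_less[of n i]] by auto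

text \<open>Functions supported in the dyadic box with indices \<open>k\<close> and \<open>m\<close> only see the points in that box.
  Splitting the binary digits of a point index into the \<open>j\<close> leading ones, \<open>L\<close> middle ones and \<open>l\<close> trailing
  ones, the leading digits fix the first coordinate to the precision of the box, the trailing digits fix the
  second, and the middle digits run through a Hammersley set of \<open>2 ^ L\<close> points, rescaled to the box.\<close>

lemma hammersley_cell_sum:
  fixes u v :: "real \<Rightarrow> real"
  assumes u: "\<And>t. t \<le> 0 \<or> 1 \<le> t \<Longrightarrow> u t = 0" and v: "\<And>t. t \<le> 0 \<or> 1 \<le> t \<Longrightarrow> v t = 0"
    and k: "k < 2 ^ j" and m: "m < 2 ^ l" and n: "n = j + (L + l)"
  shows "(\<Sum>i<2 ^ n. u (2 ^ j * coordx n i - real k) * v (2 ^ l * coordy n i - real m)) =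
    (\<Sum>t<2 ^ L. u ((real t + (real (bitrev l m) + 1 / 2) / 2 ^ l) / 2 ^ L) *
                 v ((real (bitrev L t) + (real (bitrev j k) + 1 / 2) / 2 ^ j) / 2 ^ L))"
proof -
  define U where "U t b = (real t + (real b + 1 / 2) / 2 ^ l) / 2 ^ L" for t b :: nat
  define V where "V t k' = (real (bitrev L t) + (real (bitrev j k') + 1 / 2) / 2 ^ j) / 2 ^ L" for t k' :: nat
  have half: "0 \<le> (real b + 1 / 2) / 2 ^ l \<and> (real b + 1 / 2) / 2 ^ l \<le> 1" if "b < 2 ^ l" for b l :: nat
    using coordx_bounds[OF that] by (simp add: coordx_def less_imp_le)
  have Ub: "0 \<le> U t b" "U t b \<le> 1" if "t < 2 ^ L" "b < 2 ^ l" for t b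
    unfolding U_def using cell_bounds[OF that(1)] half[OF that(2)] by auto
  have Vb: "0 \<le> V t k'" "V t k' \<le> 1" for t k'
    unfolding V_def using cell_bounds[OF bitrev_less[of L t]] half[OF bitrev_less[of j k']] by auto
  have kill: "w (real a + s - real b) = 0" if "\<And>t. t \<le> 0 \<or> 1 \<le> t \<Longrightarrow> w t = 0" "0 \<le> s" "s \<le> 1" "a \<noteq> b"
    for w :: "real \<Rightarrow> real" and a b :: nat and s
  proof -
    have "real a + 1 \<le> real b \<or> real b + 1 \<le> real a" using that(4) by linarith
    then show ?thesis using that by (intro that(1)) linarith
  qed
  have cx: "2 ^ j * coordx n (k' * 2 ^ (L + l) + (t * 2 ^ l + b)) = real k' + U t b" for k' t b
    by (simp add: coordx_def U_def n power_add field_simps)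
  have br: "bitrev n (k' * 2 ^ (L + l) + (t * 2 ^ l + b)) = bitrev l b * 2 ^ (L + j) + bitrev L t * 2 ^ j + bitrev j k'"
    if "t < 2 ^ L" "b < 2 ^ l" for k' t b
  proof -
    have "t * 2 ^ l + b < (t + 1) * 2 ^ l" using that by simp
    also have "\<dots> \<le> 2 ^ L * 2 ^ l" using that by (intro mult_right_mono) auto
    finally have z: "t * 2 ^ l + b < 2 ^ (L + l)" by (simp add: power_add)
    show ?thesis unfolding n bitrev_concat[OF z] bitrev_concat[OF that(2)]
      by (simp add: power_add algebra_simps)
  qed
  have cy: "2 ^ l * coordy n (k' * 2 ^ (L + l) + (t * 2 ^ l + b)) = real (bitrev l b) + V t k'"
    if "t < 2 ^ L" "b < 2 ^ l" for k' t b
    unfolding coordy_def br[OF that] by (simp add: coordx_def V_def n power_add field_simps)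
  let ?G = "\<lambda>i. u (2 ^ j * coordx n i - real k) * v (2 ^ l * coordy n i - real m)"
  have "(\<Sum>i<2 ^ n. ?G i) = (\<Sum>k'<2 ^ j. \<Sum>z<2 ^ (L + l). ?G (k' * 2 ^ (L + l) + z))"
    using sum_split_pow[of ?G j "L + l"] by (simp only: n)
  also have "\<dots> = (\<Sum>k'<2 ^ j. \<Sum>t<2 ^ L. \<Sum>b<2 ^ l. ?G (k' * 2 ^ (L + l) + (t * 2 ^ l + b)))"
    by (intro sum.cong refl sum_split_pow)
  also have "\<dots> = (\<Sum>k'<2 ^ j. \<Sum>t<2 ^ L. \<Sum>b<2 ^ l. if k' = k \<and> b = bitrev l m then u (U t b) * v (V t k') else 0)"
  proof (intro sum.cong refl)
    fix k' t b :: nat assume "k' \<in> {..<2 ^ j}" "t \<in> {..<2 ^ L}" "b \<in> {..<2 ^ l}"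
    hence tb: "t < 2 ^ L" "b < 2 ^ l" by auto
    have bm: "bitrev l b = m \<longleftrightarrow> b = bitrev l m" using tb m bitrev_bitrev by auto
    consider "k' \<noteq> k" | "bitrev l b \<noteq> m" | "k' = k" "bitrev l b = m" by auto
    then show "?G (k' * 2 ^ (L + l) + (t * 2 ^ l + b)) = (if k' = k \<and> b = bitrev l m then u (U t b) * v (V t k') else 0)"
    proof cases
      case 1
      then show ?thesis using kill[of u "U t b" k' k, OF u Ub[OF tb]] by (simp add: cx)
    next
      case 2
      then show ?thesis using kill[of v "V t k'" "bitrev l b" m, OF v Vb] bm by (auto simp: cy[OF tb])
    next
      case 3
      hence "?G (k' * 2 ^ (L + l) + (t * 2 ^ l + b)) = u (U t b) * v (V t k')"
        unfolding cx cy[OF tb] by simp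
      then show ?thesis using 3 bm by simp
    qed
  qed
  also have "\<dots> = (\<Sum>k'<2 ^ j. if k' = k then (\<Sum>t<2 ^ L. \<Sum>b<2 ^ l. if b = bitrev l m then u (U t b) * v (V t k) else 0) else 0)"
    by (intro sum.cong refl) auto
  also have "\<dots> = (\<Sum>t<2 ^ L. \<Sum>b<2 ^ l. if b = bitrev l m then u (U t b) * v (V t k) else 0)"
    using k by simp
  also have "\<dots> = (\<Sum>t<2 ^ L. u (U t (bitrev l m)) * v (V t k))"
    using bitrev_less[of l m] by simp
  finally show ?thesis by (simp only: U_def V_def)
qed

lemma grid_tent_sum:
  assumes m: "m < 2 ^ l" and n: "l < n"
  shows "(\<Sum>i<2 ^ n. tent (2 ^ l * coordx n i - real m)) = 2 ^ (n - l - 1)"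
proof -
  obtain L where L: "n = l + Suc L" using n less_iff_Suc_add by auto
  define U where "U t = (real t + 1 / 2) / 2 ^ Suc L" for t :: nat
  have "(\<Sum>i<2 ^ n. tent (2 ^ l * coordx n i - real m)) = (\<Sum>k<2 ^ l. \<Sum>t<2 ^ Suc L. tent (2 ^ l * coordx n (k * 2 ^ Suc L + t) - real m))"
    using sum_split_pow[of "\<lambda>i. tent (2 ^ l * coordx n i - real m)" l "Suc L"] by (simp only: L)
  also have "\<dots> = (\<Sum>k<2 ^ l. if k = m then (\<Sum>t<2 ^ Suc L. tent (U t)) else 0)"
  proof (intro sum.cong refl)
    fix k :: nat
    have e: "2 ^ l * coordx n (k * 2 ^ Suc L + t) - real m = real k + U t - real m" for t
      by (simp add: coordx_def U_def L power_add field_simps)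
    have "tent (real k + U t - real m) = 0" if "k \<noteq> m" "t < 2 ^ Suc L" for t
    proof -
      have "0 \<le> U t" "U t \<le> 1" unfolding U_def using cell_bounds[OF that(2), of "1 / 2"] by auto
      moreover have "real k + 1 \<le> real m \<or> real m + 1 \<le> real k" using that(1) by linarith
      ultimately show ?thesis by (intro tent_outside) linarith
    qed
    then show "(\<Sum>t<2 ^ Suc L. tent (2 ^ l * coordx n (k * 2 ^ Suc L + t) - real m)) = (if k = m then (\<Sum>t<2 ^ Suc L. tent (U t)) else 0)"
      unfolding e by (auto intro!: sum.neutral)
  qed
  also have "\<dots> = 2 ^ L" using m tent_grid_sum[of "1 / 2" L] by (simp add: U_def)
  finally show ?thesis by (simp add: L)
qed

text \<open>The common integral of the Faber functions with index \<open>a\<close>, see \<open>faber_fun_integral\<close> below.\<close>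

definition faber_int :: "nat \<Rightarrow> real" where "faber_int a = 1 / 2 ^ Suc (level a)"

text \<open>The binary digits of \<open>c < 4\<close> tell which of the two coordinates are reflected.\<close>

definition hammersley :: "nat \<Rightarrow> nat \<Rightarrow> nat \<Rightarrow> real \<times> real" where
  "hammersley n c i = (reflect (c div 2) (coordx n i), reflect (c mod 2) (coordy n i))"

text \<open>The error of the symmetrised rule with \<open>4 * 2 ^ n\<close> points on a tensor product of Faber functions.\<close>

definition faber_err :: "nat \<Rightarrow> nat \<Rightarrow> nat \<Rightarrow> nat \<Rightarrow> nat \<Rightarrow> real" where
  "faber_err n a k b l = faber_int a * faber_int b -
     (\<Sum>c<4. \<Sum>i<2 ^ n. faber_fun a k (fst (hammersley n c i)) * faber_fun b l (snd (hammersley n c i))) / 2 ^ (n + 2)"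

lemma faber_fun_reflect:
  assumes "k < 2 ^ j"
  shows "faber_fun (Suc j) k (1 - x) = faber_fun (Suc j) (2 ^ j - 1 - k) x"
proof -
  have "2 ^ j * (1 - x) - real k = 1 - (2 ^ j * x - real (2 ^ j - 1 - k))"
    using assms by (simp add: of_nat_diff algebra_simps)
  then show ?thesis by (simp only: faber_fun.simps tent_reflect)
qed

lemma sum4: "(\<Sum>c<(4::nat). f c) = f 0 + f 1 + f 2 + (f 3 :: real)"
  by (simp add: numeral_eq_Suc add.assoc)

lemma tent_tent_err:
  assumes k: "k < 2 ^ j" and l: "l < 2 ^ i" and n: "j + i + 2 \<le> n"
  shows "(\<Sum>s<2 ^ n. faber_fun (Suc j) k (coordx n s) * faber_fun (Suc i) l (coordy n s)) = 2 ^ n * (faber_int (Suc j) * faber_int (Suc i)) + 2 ^ (j + i) / 2 ^ n"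
proof -
  define L where "L = n - j - i - 2"
  have nL: "n = j + ((L + 2) + i)" using n by (simp add: L_def)
  have half: "0 \<le> (real b + 1 / 2) / 2 ^ l \<and> (real b + 1 / 2) / 2 ^ l \<le> 1" if "b < 2 ^ l" for b l :: nat
    using coordx_bounds[OF that] by (simp add: coordx_def less_imp_le)
  have "(\<Sum>s<2 ^ n. tent (2 ^ j * coordx n s - real k) * tent (2 ^ i * coordy n s - real l)) = 2 ^ L + 1 / 2 ^ (L + 2)"
  proof -
    have "(\<Sum>s<2 ^ n. tent (2 ^ j * coordx n s - real k) * tent (2 ^ i * coordy n s - real l)) =
      (\<Sum>t<2 ^ (L + 2). tent ((real t + (real (bitrev i l) + 1 / 2) / 2 ^ i) / 2 ^ (L + 2)) *
                 tent ((real (bitrev (L + 2) t) + (real (bitrev j k) + 1 / 2) / 2 ^ j) / 2 ^ (L + 2)))"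
      by (rule hammersley_cell_sum[OF _ _ k l nL]; rule tent_outside)
    also have "\<dots> = 2 ^ L + 1 / 2 ^ (L + 2)"
      using half[OF bitrev_less] by (intro tent_bitrev_sum) auto
    finally show ?thesis .
  qed
  then show ?thesis by (simp add: faber_int_def nL power_add field_simps)
qed

text \<open>For two tents the rescaled Hammersley set in their common box has at least four points, and the error
  is known exactly from \<open>tent_bitrev_sum\<close>; a reflection turns tents into tents. When a factor is \<open>1 - x\<close>, the symmetrisation pays off: adding the values
  at \<open>x\<close> and \<open>1 - x\<close> turns it into the constant 1, and the rule becomes an exact one-dimensional grid sum.\<close>

theorem faber_err_near:
  assumes k: "k < 2 ^ level a" and l: "l < 2 ^ level b" and n: "level a + level b + 2 \<le> n"
  shows "\<bar>faber_err n a k b l\<bar> \<le> 2 ^ (level a + level b) / 4 ^ n"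
proof -
  have pts: "(\<Sum>c<4. \<Sum>i<2 ^ n. F (fst (hammersley n c i)) * G (snd (hammersley n c i))) =
    (\<Sum>i<2 ^ n. F (coordx n i) * G (coordy n i)) + (\<Sum>i<2 ^ n. F (coordx n i) * G (1 - coordy n i)) +
    (\<Sum>i<2 ^ n. F (1 - coordx n i) * G (coordy n i)) + (\<Sum>i<2 ^ n. F (1 - coordx n i) * G (1 - coordy n i))"
    for F G :: "real \<Rightarrow> real"
    unfolding sum4 by (simp add: hammersley_def reflect_def)
  have yx: "(\<Sum>i<2 ^ n. g (coordy n i)) = (\<Sum>i<2 ^ n. g (coordx n i))" for g :: "real \<Rightarrow> real"
    unfolding coordy_def by (rule sum.reindex_bij_betw[OF bij_bitrev])
  have one: "(\<Sum>i<2 ^ n. faber_fun (Suc j) k (coordx n i)) + (\<Sum>i<2 ^ n. faber_fun (Suc j) k (1 - coordx n i)) = 2 ^ (n - j)"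
    if "k < 2 ^ j" "j < n" for j k
  proof -
    have k': "2 ^ j - 1 - k < 2 ^ j" by simp
    have "Suc (n - j - 1) = n - j" using that by simp
    hence "2 * 2 ^ (n - j - 1) = (2::real) ^ (n - j)" by (metis power_Suc)
    then show ?thesis unfolding faber_fun_reflect[OF that(1)] unfolding faber_fun.simps
      using grid_tent_sum[OF that] grid_tent_sum[OF k' that(2)] by simp
  qed
  have edge: "2 ^ (n - j) / 2 ^ (n + 2) = faber_int 0 * faber_int (Suc j)" if "j < n" for j
    using that by (simp add: faber_int_def power_diff power_add field_simps)
  consider "a = 0" "b = 0" | j where "a = Suc j" "b = 0" | i where "a = 0" "b = Suc i" | j i where "a = Suc j" "b = Suc i"
    by (metis not0_implies_Suc)
  then show ?thesis
  proof cases
    case 1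
    have "(\<Sum>c<4. \<Sum>i<2 ^ n. faber_fun 0 k (fst (hammersley n c i)) * faber_fun 0 l (snd (hammersley n c i))) = (\<Sum>i<(2::nat) ^ n. 1)"
      unfolding pts sum.distrib[symmetric] by (intro sum.cong refl) (simp add: algebra_simps)
    then show ?thesis unfolding faber_err_def 1 by (simp add: faber_int_def power_add)
  next
    case (2 j)
    have "(\<Sum>c<4. \<Sum>i<2 ^ n. faber_fun (Suc j) k (fst (hammersley n c i)) * faber_fun 0 l (snd (hammersley n c i))) =
      (\<Sum>i<2 ^ n. faber_fun (Suc j) k (coordx n i)) + (\<Sum>i<2 ^ n. faber_fun (Suc j) k (1 - coordx n i))"
      unfolding pts sum.distrib[symmetric] by (intro sum.cong refl) (simp add: algebra_simps)
    also have "\<dots> = 2 ^ (n - j)" using k n by (intro one) (auto simp: 2)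
    finally show ?thesis unfolding faber_err_def 2 using edge[of j] n by (simp add: 2 mult.commute)
  next
    case (3 i)
    have "(\<Sum>c<4. \<Sum>s<2 ^ n. faber_fun 0 k (fst (hammersley n c s)) * faber_fun (Suc i) l (snd (hammersley n c s))) =
      (\<Sum>s<2 ^ n. faber_fun (Suc i) l (coordy n s)) + (\<Sum>s<2 ^ n. faber_fun (Suc i) l (1 - coordy n s))"
      unfolding pts sum.distrib[symmetric] by (intro sum.cong refl) (simp add: algebra_simps)
    also have "\<dots> = 2 ^ (n - i)"
      unfolding yx yx[of "\<lambda>y. faber_fun (Suc i) l (1 - y)"] using l n by (intro one) (auto simp: 3)
    finally show ?thesis unfolding faber_err_def 3 using edge[of i] n by (simp add: 3)
  next
    case (4 j i)
    have kj: "k < 2 ^ j" "2 ^ j - 1 - k < 2 ^ j" and li: "l < 2 ^ i" "2 ^ i - 1 - l < 2 ^ i" using k l by (auto simp: 4)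
    have n': "j + i + 2 \<le> n" using n by (simp add: 4)
    have "(\<Sum>c<4. \<Sum>s<2 ^ n. faber_fun (Suc j) k (fst (hammersley n c s)) * faber_fun (Suc i) l (snd (hammersley n c s))) =
      4 * (2 ^ n * (faber_int (Suc j) * faber_int (Suc i)) + 2 ^ (j + i) / 2 ^ n)"
      unfolding pts faber_fun_reflect[OF kj(1)] faber_fun_reflect[OF li(1)]
        tent_tent_err[OF kj(1) li(1) n'] tent_tent_err[OF kj(1) li(2) n'] tent_tent_err[OF kj(2) li(1) n'] tent_tent_err[OF kj(2) li(2) n']
      by simp
    hence "faber_err n a k b l = - (2 ^ (j + i) / 2 ^ n) / 2 ^ n"
      unfolding faber_err_def 4 by (simp add: power_add field_simps)
    also have "\<bar>\<dots>\<bar> = 2 ^ (j + i) / 4 ^ n"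
      by (simp add: power_mult_distrib[symmetric])
    finally show ?thesis by (simp add: 4)
  qed
qed

lemma tent_le_cell: "tent t \<le> (if 0 < t \<and> t < 1 then 1 else 0)"
  using tent_le_1 tent_outside[of t] by auto

text \<open>The majorant of a tent that only records whether a point lies in the open dyadic interval.\<close>

definition cell :: "real \<Rightarrow> real" where "cell t = (if 0 < t \<and> t < 1 then 1 else 0)"

lemma cell_coarsen: "cell (2 ^ (j + d) * x - real k) \<le> cell (2 ^ j * x - real (k div 2 ^ d))"
proof (cases "0 < 2 ^ (j + d) * x - real k \<and> 2 ^ (j + d) * x - real k < 1")
  case True
  define q where "q = k div 2 ^ d"
  have n: "q * 2 ^ d \<le> k" "k + 1 \<le> (q + 1) * 2 ^ d"
    unfolding q_def using div_times_less_eq_dividend[of k "2 ^ d"] dividend_less_div_times[of "2 ^ d" k] by (auto simp: algebra_simps)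
  have "real (q * 2 ^ d) \<le> real k" "real (k + 1) \<le> real ((q + 1) * 2 ^ d)"
    using n by (simp_all only: of_nat_le_iff)
  hence q: "real q * 2 ^ d \<le> real k" "real k + 1 \<le> (real q + 1) * 2 ^ d"
    by (simp_all add: algebra_simps)
  have "real q * 2 ^ d < (2 ^ j * x) * 2 ^ d" "(2 ^ j * x) * 2 ^ d < (real q + 1) * 2 ^ d"
  proof -
    have e: "2 ^ (j + d) * x = (2 ^ j * x) * 2 ^ d" by (simp add: power_add)
    show "real q * 2 ^ d < (2 ^ j * x) * 2 ^ d" "(2 ^ j * x) * 2 ^ d < (real q + 1) * 2 ^ d"
      using True q unfolding e by linarith+
  qed
  hence "real q < 2 ^ j * x" "2 ^ j * x < real q + 1" by auto
  then show ?thesis by (simp add: cell_def q_def)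
qed (auto simp: cell_def)

lemma faber_fun_le_cell:
  assumes x: "0 < x" "x < 1" and k: "k < 2 ^ level a"
  shows "0 \<le> faber_fun a k x" "faber_fun a k x \<le> cell (2 ^ level a * x - real k)"
    and "0 \<le> faber_fun a k (1 - x)" "faber_fun a k (1 - x) \<le> cell (2 ^ level a * x - real (2 ^ level a - 1 - k))"
proof -
  show "0 \<le> faber_fun a k x" "0 \<le> faber_fun a k (1 - x)" using x by (cases a; simp)+
  show "faber_fun a k x \<le> cell (2 ^ level a * x - real k)" using x k tent_le_cell[of "2 ^ level a * x - real k"] by (cases a) (simp_all add: cell_def)
  show "faber_fun a k (1 - x) \<le> cell (2 ^ level a * x - real (2 ^ level a - 1 - k))"
  proof (cases a)
    case (Suc j)
    then show ?thesis using k faber_fun_reflect[of k j x] tent_le_cell[of "2 ^ j * x - real (2 ^ j - 1 - k)"] by (simp add: cell_def)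
  qed (use x k in \<open>simp add: cell_def\<close>)
qed

lemma cell_nonneg [simp]: "0 \<le> cell t" by (simp add: cell_def)

text \<open>A box of area at least \<open>1 / 2 ^ n\<close> contains exactly as many points as its area predicts, hence at
  most two here. A smaller box is first enlarged to a dyadic box of area \<open>1 / 2 ^ n\<close>.\<close>

lemma cell_count:
  assumes k: "k < 2 ^ j" and l: "l < 2 ^ i" and n: "n \<le> j + i + 1"
  shows "(\<Sum>s<2 ^ n. cell (2 ^ j * coordx n s - real k) * cell (2 ^ i * coordy n s - real l)) \<le> 2"
proof -
  have b: "\<And>t. t \<le> 0 \<or> 1 \<le> t \<Longrightarrow> cell t = 0" by (auto simp: cell_def)
  have main: "(\<Sum>s<2 ^ n. cell (2 ^ j * coordx n s - real k) * cell (2 ^ i * coordy n s - real l)) \<le> 2"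
    if k: "k < 2 ^ j" and l: "l < 2 ^ i" and n: "n = j + (L + i)" and L: "L \<le> 1" for j k i l L
  proof -
    have "(\<Sum>s<2 ^ n. cell (2 ^ j * coordx n s - real k) * cell (2 ^ i * coordy n s - real l)) \<le> (\<Sum>t<(2::nat) ^ L. 1)"
    proof -
      have "(\<Sum>s<2 ^ n. cell (2 ^ j * coordx n s - real k) * cell (2 ^ i * coordy n s - real l)) =
        (\<Sum>t<2 ^ L. cell ((real t + (real (bitrev i l) + 1 / 2) / 2 ^ i) / 2 ^ L) *
                   cell ((real (bitrev L t) + (real (bitrev j k) + 1 / 2) / 2 ^ j) / 2 ^ L))"
        by (rule hammersley_cell_sum[OF _ _ k l n]; rule b)
      also have "\<dots> \<le> (\<Sum>t<(2::nat) ^ L. 1)" by (intro sum_mono) (auto simp: cell_def)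
      finally show ?thesis .
    qed
    also have "\<dots> \<le> 2" using power_increasing[OF L, of "2::real"] by simp
    finally show ?thesis .
  qed
  show ?thesis
  proof (cases "j + i \<le> n")
    case True
    then show ?thesis using n by (intro main[OF k l, of "n - j - i"]) auto
  next
    case False
    \<comment> \<open>The enlarged box has sides \<open>1 / 2 ^ j'\<close> and \<open>1 / 2 ^ i'\<close> with \<open>j' + i' = n\<close>.\<close>
    define j' where "j' = min j n"
    define i' where "i' = n - j'"
    have d: "j = j' + (j - j')" "i = i' + (i - i')" using False by (auto simp: j'_def i'_def)
    have k': "k div 2 ^ (j - j') < 2 ^ j'" using k d(1) by (metis less_mult_imp_div_less power_add)
    have l': "l div 2 ^ (i - i') < 2 ^ i'" using l d(2) by (metis less_mult_imp_div_less power_add)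
    have "(\<Sum>s<2 ^ n. cell (2 ^ j * coordx n s - real k) * cell (2 ^ i * coordy n s - real l)) \<le>
      (\<Sum>s<2 ^ n. cell (2 ^ j' * coordx n s - real (k div 2 ^ (j - j'))) * cell (2 ^ i' * coordy n s - real (l div 2 ^ (i - i'))))"
      by (intro sum_mono mult_mono) (use cell_coarsen[of j' "j - j'" _ k] cell_coarsen[of i' "i - i'" _ l] d in auto)
    also have "\<dots> \<le> 2" by (rule main[OF k' l', of 0]) (auto simp: i'_def j'_def)
    finally show ?thesis .
  qed
qed

lemma hammersley_sum_bounds:
  assumes k: "k < 2 ^ level a" and l: "l < 2 ^ level b"
  shows "0 \<le> (\<Sum>c<4. \<Sum>i<2 ^ n. faber_fun a k (fst (hammersley n c i)) * faber_fun b l (snd (hammersley n c i)))"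
    and "n \<le> level a + level b + 1 \<Longrightarrow>
      (\<Sum>c<4. \<Sum>i<2 ^ n. faber_fun a k (fst (hammersley n c i)) * faber_fun b l (snd (hammersley n c i))) \<le> 8"
proof -
  have one: "0 \<le> (\<Sum>i<2 ^ n. faber_fun a k (reflect c (coordx n i)) * faber_fun b l (reflect c' (coordy n i)))"
     "n \<le> level a + level b + 1 \<Longrightarrow> (\<Sum>i<2 ^ n. faber_fun a k (reflect c (coordx n i)) * faber_fun b l (reflect c' (coordy n i))) \<le> 2" for c c'
  proof -
    define k' where "k' = (if c = 0 then k else 2 ^ level a - 1 - k)"
    define l' where "l' = (if c' = 0 then l else 2 ^ level b - 1 - l)"
    have kl': "k' < 2 ^ level a" "l' < 2 ^ level b" using k l by (auto simp: k'_def l'_def)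
    have fx: "0 \<le> faber_fun a k (reflect c (coordx n i))" "faber_fun a k (reflect c (coordx n i)) \<le> cell (2 ^ level a * coordx n i - real k')"
      if "i < 2 ^ n" for i
      using faber_fun_le_cell[OF coordx_bounds[OF that] k] by (auto simp: reflect_def k'_def)
    have fy: "0 \<le> faber_fun b l (reflect c' (coordy n i))" "faber_fun b l (reflect c' (coordy n i)) \<le> cell (2 ^ level b * coordy n i - real l')" for i
      using faber_fun_le_cell[OF coordy_bounds l] by (auto simp: reflect_def l'_def)
    show "0 \<le> (\<Sum>i<2 ^ n. faber_fun a k (reflect c (coordx n i)) * faber_fun b l (reflect c' (coordy n i)))"
      using fx fy by (intro sum_nonneg mult_nonneg_nonneg) auto
    assume n: "n \<le> level a + level b + 1"
    have "(\<Sum>i<2 ^ n. faber_fun a k (reflect c (coordx n i)) * faber_fun b l (reflect c' (coordy n i))) \<le>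
      (\<Sum>i<2 ^ n. cell (2 ^ level a * coordx n i - real k') * cell (2 ^ level b * coordy n i - real l'))"
      using fx fy by (intro sum_mono mult_mono) auto
    also have "\<dots> \<le> 2" by (rule cell_count[OF kl' n])
    finally show "(\<Sum>i<2 ^ n. faber_fun a k (reflect c (coordx n i)) * faber_fun b l (reflect c' (coordy n i))) \<le> 2" .
  qed
  show "0 \<le> (\<Sum>c<4. \<Sum>i<2 ^ n. faber_fun a k (fst (hammersley n c i)) * faber_fun b l (snd (hammersley n c i)))"
    unfolding hammersley_def fst_conv snd_conv by (intro sum_nonneg one)
  assume n: "n \<le> level a + level b + 1"
  have "(\<Sum>c<4. \<Sum>i<2 ^ n. faber_fun a k (fst (hammersley n c i)) * faber_fun b l (snd (hammersley n c i))) \<le> (\<Sum>c<(4::nat). 2)"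
    unfolding hammersley_def fst_conv snd_conv by (intro sum_mono one(2) n)
  then show "(\<Sum>c<4. \<Sum>i<2 ^ n. faber_fun a k (fst (hammersley n c i)) * faber_fun b l (snd (hammersley n c i))) \<le> 8" by simp
qed

text \<open>Both the integral and the mean over the points are small, as the support contains at most two points
  of each of the four reflected copies.\<close>

theorem faber_err_far:
  assumes k: "k < 2 ^ level a" and l: "l < 2 ^ level b" and n: "n \<le> level a + level b + 1"
  shows "\<bar>faber_err n a k b l\<bar> \<le> 2 / 2 ^ n"
proof -
  let ?S = "\<Sum>c<4. \<Sum>i<2 ^ n. faber_fun a k (fst (hammersley n c i)) * faber_fun b l (snd (hammersley n c i))"
  have "?S / 2 ^ (n + 2) \<le> 8 / 2 ^ (n + 2)" by (intro divide_right_mono hammersley_sum_bounds k l n) simp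
  hence 1: "?S / 2 ^ (n + 2) \<le> 2 / 2 ^ n" by (simp add: power_add)
  have 2: "0 \<le> ?S / 2 ^ (n + 2)" using hammersley_sum_bounds(1)[OF k l, of n] by simp
  have "faber_int a * faber_int b = 1 / 2 ^ (level a + level b + 2)" by (simp add: faber_int_def power_add)
  also have "\<dots> \<le> 1 / 2 ^ n" using n by (intro divide_left_mono power_increasing) auto
  also have "\<dots> \<le> 2 / 2 ^ n" by (intro divide_right_mono) auto
  finally have 3: "faber_int a * faber_int b \<le> 2 / 2 ^ n" .
  have 4: "0 \<le> faber_int a * faber_int b" by (simp add: faber_int_def)
  show ?thesis unfolding faber_err_def using 1 2 3 4 by linarith
qed

text \<open>Functions with the same index have disjoint supports in the interior.\<close>

lemma sum_faber_fun_le_1: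
  assumes x: "0 < x" "x < 1"
  shows "0 \<le> (\<Sum>k<2 ^ level a. faber_fun a k x)" "(\<Sum>k<2 ^ level a. faber_fun a k x) \<le> 1"
proof -
  show "0 \<le> (\<Sum>k<2 ^ level a. faber_fun a k x)" using faber_fun_le_cell(1)[OF x] by (intro sum_nonneg) auto
  show "(\<Sum>k<2 ^ level a. faber_fun a k x) \<le> 1"
  proof (cases a)
    case (Suc j)
    have "(\<Sum>k<2 ^ level a. faber_fun a k x) \<le> (\<Sum>k<(2::nat) ^ j. if k = nat \<lfloor>2 ^ j * x\<rfloor> then 1 else 0)"
      unfolding Suc level_simps
    proof (intro sum_mono)
      fix k :: nat
      show "faber_fun (Suc j) k x \<le> (if k = nat \<lfloor>2 ^ j * x\<rfloor> then 1 else 0)"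
      proof (cases "0 < 2 ^ j * x - real k \<and> 2 ^ j * x - real k < 1")
        case True
        hence "\<lfloor>2 ^ j * x\<rfloor> = int k" by (intro floor_unique) auto
        then show ?thesis by (simp add: tent_le_1)
      next
        case False
        then have "tent (2 ^ j * x - real k) = 0" by (intro tent_outside) auto
        then show ?thesis by simp
      qed
    qed
    also have "\<dots> \<le> 1" by (subst sum.delta) auto
    finally show ?thesis .
  qed (use x in simp)
qed

lemma sum_swap_pairs:
  "(\<Sum>k\<in>A. \<Sum>l\<in>B. \<Sum>c\<in>C. \<Sum>i\<in>D. g k l c i) = (\<Sum>c\<in>C. \<Sum>i\<in>D. \<Sum>k\<in>A. \<Sum>l\<in>B. g k l c i :: real)"
proof -
  have "(\<Sum>k\<in>A. \<Sum>l\<in>B. \<Sum>c\<in>C. \<Sum>i\<in>D. g k l c i) = (\<Sum>k\<in>A. \<Sum>c\<in>C. \<Sum>l\<in>B. \<Sum>i\<in>D. g k l c i)"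
    by (intro sum.cong refl sum.swap)
  also have "\<dots> = (\<Sum>c\<in>C. \<Sum>k\<in>A. \<Sum>l\<in>B. \<Sum>i\<in>D. g k l c i)" by (rule sum.swap)
  also have "\<dots> = (\<Sum>c\<in>C. \<Sum>k\<in>A. \<Sum>i\<in>D. \<Sum>l\<in>B. g k l c i)" by (intro sum.cong refl sum.swap)
  also have "\<dots> = (\<Sum>c\<in>C. \<Sum>i\<in>D. \<Sum>k\<in>A. \<Sum>l\<in>B. g k l c i)" by (intro sum.cong refl sum.swap)
  finally show ?thesis .
qed

text \<open>For many functions on a level the individual bound \<open>faber_err_far\<close> is wasteful: as nonnegative
  functions with sum at most 1 on the square, all of them together have integral and mean value at most 1.\<close>

theorem sum_faber_err_le:
  "(\<Sum>k<2 ^ level a. \<Sum>l<2 ^ level b. \<bar>faber_err n a k b l\<bar>) \<le> 2"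
proof -
  let ?S = "\<lambda>k l. \<Sum>c<4. \<Sum>i<2 ^ n. faber_fun a k (fst (hammersley n c i)) * faber_fun b l (snd (hammersley n c i))"
  have "(\<Sum>k<2 ^ level a. \<Sum>l<2 ^ level b. \<bar>faber_err n a k b l\<bar>) \<le>
    (\<Sum>k<2 ^ level a. \<Sum>l<2 ^ level b. faber_int a * faber_int b + ?S k l / 2 ^ (n + 2))"
  proof (intro sum_mono)
    fix k l :: nat assume "k \<in> {..<2 ^ level a}" "l \<in> {..<2 ^ level b}"
    hence "0 \<le> ?S k l / 2 ^ (n + 2)" using hammersley_sum_bounds(1)[of k a l b n] by simp
    moreover have "0 \<le> faber_int a * faber_int b" by (simp add: faber_int_def)
    ultimately show "\<bar>faber_err n a k b l\<bar> \<le> faber_int a * faber_int b + ?S k l / 2 ^ (n + 2)"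
      unfolding faber_err_def by linarith
  qed
  also have "\<dots> = 2 ^ level a * 2 ^ level b * (faber_int a * faber_int b) + (\<Sum>k<2 ^ level a. \<Sum>l<2 ^ level b. ?S k l) / 2 ^ (n + 2)"
    by (simp add: sum.distrib sum_divide_distrib)
  also have "2 ^ level a * 2 ^ level b * (faber_int a * faber_int b) = 1 / 4"
    by (simp add: faber_int_def)
  also have "(\<Sum>k<2 ^ level a. \<Sum>l<2 ^ level b. ?S k l) / 2 ^ (n + 2) \<le> 1"
  proof -
    have "(\<Sum>k<2 ^ level a. \<Sum>l<2 ^ level b. ?S k l) =
      (\<Sum>c<4. \<Sum>i<2 ^ n. \<Sum>k<2 ^ level a. \<Sum>l<2 ^ level b. faber_fun a k (fst (hammersley n c i)) * faber_fun b l (snd (hammersley n c i)))"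
      by (rule sum_swap_pairs)
    also have "\<dots> = (\<Sum>c<4. \<Sum>i<2 ^ n. (\<Sum>k<2 ^ level a. faber_fun a k (fst (hammersley n c i))) * (\<Sum>l<2 ^ level b. faber_fun b l (snd (hammersley n c i))))"
      by (simp only: sum_product)
    also have "\<dots> \<le> (\<Sum>c<(4::nat). \<Sum>i<(2::nat) ^ n. 1 * 1)"
    proof (intro sum_mono mult_mono)
      fix c i :: nat assume "i \<in> {..<2 ^ n}"
      hence i: "i < 2 ^ n" by simp
      have fb: "0 < fst (hammersley n c i)" "fst (hammersley n c i) < 1" and sb: "0 < snd (hammersley n c i)" "snd (hammersley n c i) < 1"
        using coordx_bounds[OF i] coordy_bounds[of n i] by (auto simp: hammersley_def reflect_def)
      show "(\<Sum>k<2 ^ level a. faber_fun a k (fst (hammersley n c i))) \<le> 1" by (rule sum_faber_fun_le_1[OF fb])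
      show "(\<Sum>l<2 ^ level b. faber_fun b l (snd (hammersley n c i))) \<le> 1" by (rule sum_faber_fun_le_1[OF sb])
      show "0 \<le> (\<Sum>l<2 ^ level b. faber_fun b l (snd (hammersley n c i)))" by (rule sum_faber_fun_le_1[OF sb])
    qed auto
    also have "\<dots> = 2 ^ (n + 2)" by simp
    finally show ?thesis by simp
  qed
  finally show ?thesis by simp
qed

section \<open>Convergence of the Faber expansion\<close>

definition faber_sum :: "nat \<Rightarrow> (real \<Rightarrow> complex) \<Rightarrow> real \<Rightarrow> complex" where
  "faber_sum J f x = (\<Sum>a\<le>J. \<Sum>k<2 ^ level a. faber_coeff a k f * of_real (faber_fun a k x))"

text \<open>The partial sum is the piecewise linear interpolant on the grid of mesh \<open>1 / 2 ^ J\<close>, up to the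
  contribution \<open>x * f 1\<close> of the endpoint for which there is no Faber function. Passing to the next level
  inserts midpoints, where the coefficient is the deviation from linearity.\<close>

lemma faber_sum_interpolates:
  assumes x: "0 \<le> x" "x < 1"
  obtains i where "i < 2 ^ J" "0 \<le> 2 ^ J * x - real i" "2 ^ J * x - real i < 1"
    "\<And>f. faber_sum J f x = of_real (1 - (2 ^ J * x - real i)) * f (real i / 2 ^ J) +
        of_real (2 ^ J * x - real i) * f (real (i + 1) / 2 ^ J) - of_real x * f 1"
proof -
  have "\<exists>i. i < 2 ^ J \<and> 0 \<le> 2 ^ J * x - real i \<and> 2 ^ J * x - real i < 1 \<and>
    (\<forall>f. faber_sum J f x = of_real (1 - (2 ^ J * x - real i)) * f (real i / 2 ^ J) +
        of_real (2 ^ J * x - real i) * f (real (i + 1) / 2 ^ J) - of_real x * f 1)"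
  proof (induction J)
    case 0
    show ?case using x by (intro exI[of _ 0]) (simp add: faber_sum_def algebra_simps)
  next
    case (Suc J)
    then obtain i where i: "i < 2 ^ J" and t: "0 \<le> 2 ^ J * x - real i" "2 ^ J * x - real i < 1"
      and f: "\<And>f. faber_sum J f x = of_real (1 - (2 ^ J * x - real i)) * f (real i / 2 ^ J) +
        of_real (2 ^ J * x - real i) * f (real (i + 1) / 2 ^ J) - of_real x * f 1" by blast
    define \<tau> where "\<tau> = 2 ^ J * x - real i"
    have t': "0 \<le> \<tau>" "\<tau> < 1" using t by (auto simp: \<tau>_def)
    have new: "(\<Sum>k<2 ^ J. faber_coeff (Suc J) k f * of_real (faber_fun (Suc J) k x)) = faber_coeff (Suc J) i f * of_real (tent \<tau>)" for f
    proof -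
      have "(\<Sum>k<2 ^ J. faber_coeff (Suc J) k f * of_real (faber_fun (Suc J) k x)) =
        (\<Sum>k<2 ^ J. if k = i then faber_coeff (Suc J) i f * of_real (tent \<tau>) else 0)"
      proof (intro sum.cong refl)
        fix k :: nat
        have "tent (2 ^ J * x - real k) = 0" if "k \<noteq> i"
        proof -
          have "real k + 1 \<le> real i \<or> real i + 1 \<le> real k" using that by linarith
          then show ?thesis using t by (intro tent_outside) linarith
        qed
        then show "faber_coeff (Suc J) k f * of_real (faber_fun (Suc J) k x) = (if k = i then faber_coeff (Suc J) i f * of_real (tent \<tau>) else 0)"
          by (auto simp: \<tau>_def simp del: faber_coeff.simps)
      qed
      then show ?thesis using i by simp
    qed
    define A B C where "A = (\<lambda>f :: real \<Rightarrow> complex. f (real i / 2 ^ J))"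
      and "B = (\<lambda>f :: real \<Rightarrow> complex. f (real (i + 1) / 2 ^ J))" and "C = (\<lambda>f :: real \<Rightarrow> complex. f (real (2 * i + 1) / 2 ^ Suc J))"
    have e1: "real (2 * i) / 2 ^ Suc J = real i / 2 ^ J" "real (2 * i + 2) / 2 ^ Suc J = real (i + 1) / 2 ^ J" "real (2 * i + 1 + 1) / 2 ^ Suc J = real (i + 1) / 2 ^ J"
      by (simp_all add: field_simps)
    have S: "faber_sum (Suc J) f x = of_real (1 - \<tau>) * A f + of_real \<tau> * B f - of_real x * f 1 + (C f - (A f + B f) / 2) * of_real (tent \<tau>)" for f
    proof -
      have "faber_sum (Suc J) f x = faber_sum J f x + (\<Sum>k<2 ^ J. faber_coeff (Suc J) k f * of_real (faber_fun (Suc J) k x))"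
        by (simp add: faber_sum_def del: faber_coeff.simps faber_fun.simps)
      also have "faber_coeff (Suc J) i f = C f - (A f + B f) / 2"
        unfolding faber_coeff.simps e1 A_def B_def C_def ..
      ultimately show ?thesis unfolding new f A_def B_def C_def \<tau>_def by simp
    qed
    show ?case
    proof (cases "\<tau> < 1 / 2")
      case True
      have r: "2 ^ Suc J * x - real (2 * i) = 2 * \<tau>" by (simp add: \<tau>_def)
      have "faber_sum (Suc J) f x = of_real (1 - 2 * \<tau>) * A f + of_real (2 * \<tau>) * C f - of_real x * f 1" for f
        unfolding S using True t' by (simp add: tent_left) (simp add: field_simps)
      then show ?thesis using i True t'
        by (intro exI[of _ "2 * i"]) (simp only: r e1 A_def C_def, simp)
    next
      case False
      have r: "2 ^ Suc J * x - real (2 * i + 1) = 2 * \<tau> - 1" by (simp add: \<tau>_def)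
      have "faber_sum (Suc J) f x = of_real (1 - (2 * \<tau> - 1)) * C f + of_real (2 * \<tau> - 1) * B f - of_real x * f 1" for f
        unfolding S using False t' by (simp add: tent_right) (simp add: field_simps)
      then show ?thesis using i False t'
        by (intro exI[of _ "2 * i + 1"]) (simp only: r e1 B_def C_def, simp)
    qed
  qed
  then show thesis using that by blast
qed

lemma faber_coeff_sum: "finite A \<Longrightarrow> faber_coeff a k (\<lambda>x. \<Sum>i\<in>A. F i x) = (\<Sum>i\<in>A. faber_coeff a k (F i))"
  by (cases a) (simp_all add: sum_subtractf sum.distrib sum_divide_distrib[symmetric])

lemma faber_coeff_mult_right: "faber_coeff a k (\<lambda>x. f x * c) = faber_coeff a k f * c"
  using faber_coeff_cmult[of a k c f] by (simp add: mult.commute)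

definition faber_sum2 :: "nat \<Rightarrow> (real \<times> real \<Rightarrow> complex) \<Rightarrow> real \<times> real \<Rightarrow> complex" where
  "faber_sum2 J f z = (\<Sum>a\<le>J. \<Sum>b\<le>J. \<Sum>k<2 ^ level a. \<Sum>l<2 ^ level b.
     faber_coeff2 a k b l f * of_real (faber_fun a k (fst z) * faber_fun b l (snd z)))"

lemma faber_sum2_eq: "faber_sum2 J f (x, y) = faber_sum J (\<lambda>x. faber_sum J (\<lambda>y. f (x, y)) y) x"
proof -
  have "faber_coeff a k (\<lambda>x. faber_sum J (\<lambda>y. f (x, y)) y) = (\<Sum>b\<le>J. \<Sum>l<2 ^ level b. faber_coeff2 a k b l f * of_real (faber_fun b l y))" for a k
    unfolding faber_sum_def faber_coeff2_def by (simp add: faber_coeff_sum faber_coeff_mult_right)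
  note c = this
  have "faber_sum2 J f (x, y) = (\<Sum>a\<le>J. \<Sum>k<2 ^ level a. \<Sum>b\<le>J. \<Sum>l<2 ^ level b.
     faber_coeff2 a k b l f * of_real (faber_fun a k x * faber_fun b l y))"
    unfolding faber_sum2_def fst_conv snd_conv by (intro sum.cong refl sum.swap)
  also have "\<dots> = faber_sum J (\<lambda>x. faber_sum J (\<lambda>y. f (x, y)) y) x"
    unfolding faber_sum_def[of J "\<lambda>x. faber_sum J (\<lambda>y. f (x, y)) y"] c
    by (intro sum.cong refl) (simp add: sum_distrib_left mult_ac)
  finally show ?thesis .
qed

lemma norm_convex2_le:
  fixes u v w :: complex
  assumes "0 \<le> t" "t \<le> 1" "cmod (u - w) \<le> e" "cmod (v - w) \<le> e"
  shows "cmod (of_real (1 - t) * u + of_real t * v - w) \<le> e"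
proof -
  have "of_real (1 - t) * u + of_real t * v - w = of_real (1 - t) * (u - w) + of_real t * (v - w)"
    by (simp add: algebra_simps)
  also have "cmod \<dots> \<le> cmod (of_real (1 - t) * (u - w)) + cmod (of_real t * (v - w))" by (rule norm_triangle_ineq)
  also have "\<dots> = (1 - t) * cmod (u - w) + t * cmod (v - w)" using assms by (simp only: norm_mult norm_of_real)
  also have "\<dots> \<le> (1 - t) * e + t * e" using assms by (intro add_mono mult_left_mono) auto
  finally show ?thesis by (simp add: algebra_simps)
qed

text \<open>The partial sums interpolate in each variable because \<open>f\<close> vanishes on the two edges, so their
  values are convex combinations of values of \<open>f\<close> at nearby points.\<close>

theorem faber_sum2_uniform:
  fixes f :: "real \<times> real \<Rightarrow> complex"
  assumes cont: "continuous_on ({0..1} \<times> {0..1}) f"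
    and top: "\<And>x. x \<in> {0..1} \<Longrightarrow> f (x, 1) = 0" and right: "\<And>y. y \<in> {0..1} \<Longrightarrow> f (1, y) = 0" and e: "0 < e"
  shows "\<exists>J. \<forall>z\<in>unit_square. cmod (faber_sum2 J f z - f z) \<le> e"
proof -
  have "uniformly_continuous_on ({0..1} \<times> {0..1}) f"
    by (rule compact_uniformly_continuous[OF cont]) (intro compact_Times compact_Icc)
  then obtain d where d: "0 < d" and unif: "\<And>z z'. z \<in> {0..1} \<times> {0..1} \<Longrightarrow> z' \<in> {0..1} \<times> {0..1} \<Longrightarrow> dist z' z < d \<Longrightarrow> dist (f z') (f z) < e"
    unfolding uniformly_continuous_on_def using e by metis
  obtain J where J: "(1 / 2) ^ J < d / 2" using real_arch_pow_inv[of "d / 2" "1 / 2"] d by auto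
  have node: "0 \<le> real i / 2 ^ J" "real i / 2 ^ J \<le> 1" if "i \<le> 2 ^ J" for i :: nat
  proof -
    have "real i \<le> 2 ^ J" using that by (metis of_nat_le_iff of_nat_numeral of_nat_power)
    then show "real i / 2 ^ J \<le> 1" by (simp add: divide_le_eq)
  qed simp
  have near: "\<bar>real i / 2 ^ J - x\<bar> < d / 2" "\<bar>real (i + 1) / 2 ^ J - x\<bar> < d / 2"
    if "0 \<le> 2 ^ J * x - real i" "2 ^ J * x - real i < 1" for i x
  proof -
    have h: "(1 / 2) ^ J = 1 / (2::real) ^ J" by (simp add: power_one_over)
    have "\<bar>real i / 2 ^ J - x\<bar> = \<bar>2 ^ J * x - real i\<bar> / 2 ^ J"
    proof -
      have "real i / 2 ^ J - x = - ((2 ^ J * x - real i) / 2 ^ J)" by (simp add: field_simps)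
      then show ?thesis by (simp only: abs_divide abs_minus_cancel) simp
    qed
    also have "\<dots> \<le> 1 / 2 ^ J" using that by (intro divide_right_mono) auto
    finally show "\<bar>real i / 2 ^ J - x\<bar> < d / 2" using J h by simp
    have "\<bar>real (i + 1) / 2 ^ J - x\<bar> = \<bar>real (i + 1) - 2 ^ J * x\<bar> / 2 ^ J"
    proof -
      have "real (i + 1) / 2 ^ J - x = (real (i + 1) - 2 ^ J * x) / 2 ^ J" by (simp add: field_simps)
      then show ?thesis by (simp only: abs_divide) simp
    qed
    also have "\<dots> \<le> 1 / 2 ^ J" using that by (intro divide_right_mono) auto
    finally show "\<bar>real (i + 1) / 2 ^ J - x\<bar> < d / 2" using J h by simp
  qed
  have "cmod (faber_sum2 J f (x, y) - f (x, y)) \<le> e" if x: "0 \<le> x" "x < 1" and y: "0 \<le> y" "y < 1" for x y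
  proof -
    obtain i where i: "i < 2 ^ J" and s: "0 \<le> 2 ^ J * x - real i" "2 ^ J * x - real i < 1"
      and fx: "\<And>f. faber_sum J f x = of_real (1 - (2 ^ J * x - real i)) * f (real i / 2 ^ J) +
        of_real (2 ^ J * x - real i) * f (real (i + 1) / 2 ^ J) - of_real x * f 1"
      using faber_sum_interpolates[OF x, of J] by metis
    obtain j where j: "j < 2 ^ J" and t: "0 \<le> 2 ^ J * y - real j" "2 ^ J * y - real j < 1"
      and fy: "\<And>f. faber_sum J f y = of_real (1 - (2 ^ J * y - real j)) * f (real j / 2 ^ J) +
        of_real (2 ^ J * y - real j) * f (real (j + 1) / 2 ^ J) - of_real y * f 1"
      using faber_sum_interpolates[OF y, of J] by metis
    define g where "g x' = faber_sum J (\<lambda>y. f (x', y)) y" for x'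
    have nd: "real i / 2 ^ J \<in> {0..1}" "real (i + 1) / 2 ^ J \<in> {0..1}" "real j / 2 ^ J \<in> {0..1}" "real (j + 1) / 2 ^ J \<in> {0..1}"
      using node[of i] node[of "i + 1"] node[of j] node[of "j + 1"] i j by auto
    have close: "cmod (f (x', y') - f (x, y)) \<le> e"
      if "x' \<in> {0..1}" "y' \<in> {0..1}" "\<bar>x' - x\<bar> < d / 2" "\<bar>y' - y\<bar> < d / 2" for x' y'
    proof -
      have "dist (x', y') (x, y) \<le> \<bar>x' - x\<bar> + \<bar>y' - y\<bar>"
        using real_sqrt_sum_squares_triangle_ineq[of "x' - x" 0 0 "y' - y"] by (simp add: dist_Pair_Pair dist_real_def)
      also have "\<dots> < d" using that by simp
      finally show ?thesis using unif[of "(x, y)" "(x', y')"] that x y by (simp add: dist_norm less_imp_le)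
    qed
    have gin: "cmod (g x' - f (x, y)) \<le> e" if "x' \<in> {0..1}" "\<bar>x' - x\<bar> < d / 2" for x'
    proof -
      have "g x' = of_real (1 - (2 ^ J * y - real j)) * f (x', real j / 2 ^ J) +
        of_real (2 ^ J * y - real j) * f (x', real (j + 1) / 2 ^ J)"
        unfolding g_def fy using top[OF that(1)] by simp
      then show ?thesis using t near[OF t] nd that by (simp only:) (intro norm_convex2_le close, auto)
    qed
    have g1: "g 1 = 0" unfolding g_def fy using right nd by simp
    have "faber_sum2 J f (x, y) = of_real (1 - (2 ^ J * x - real i)) * g (real i / 2 ^ J) +
        of_real (2 ^ J * x - real i) * g (real (i + 1) / 2 ^ J)"
      unfolding faber_sum2_eq fx g_def[symmetric] g1 by simp
    then show ?thesis using s near[OF s] nd by (simp only:) (intro norm_convex2_le gin, auto)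
  qed
  then show ?thesis by (intro exI[of _ J]) auto
qed

lemma integral_tent: "(LINT x:{0..<1}|lborel. tent (2 ^ j * x - real k)) = 1 / 2 ^ Suc j"
  and integrable_tent: "set_integrable lborel {0..<1} (\<lambda>x. tent (2 ^ j * x - real k))" if "k < 2 ^ j"
proof -
  have m[measurable]: "tent \<in> borel_measurable borel" unfolding tent_def by measurable
  have kj: "real k + 1 \<le> 2 ^ j" using that by (metis Suc_eq_plus1 Suc_leI of_nat_1 of_nat_add of_nat_le_iff of_nat_numeral of_nat_power)
  have e: "indicator {0..<1} x *\<^sub>R tent (2 ^ j * x - real k) = tent (- real k + 2 ^ j * x)" for x
  proof (cases "x \<in> {0..<1}")
    case False
    have "2 ^ j * x - real k \<le> 0 \<or> 1 \<le> 2 ^ j * x - real k"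
    proof (cases "x < 0")
      case True
      then have "2 ^ j * x \<le> 0" by (simp add: mult_nonneg_nonpos)
      then show ?thesis by simp
    next
      case nF: False
      hence "1 \<le> x" using False by simp
      hence "2 ^ j * 1 \<le> 2 ^ j * x" by (intro mult_left_mono) auto
      then show ?thesis using kj by linarith
    qed
    then show ?thesis using False tent_outside by simp
  qed simp
  have ti: "has_bochner_integral lborel tent (1 / 2)"
  proof -
    have h1: "has_bochner_integral lborel (\<lambda>x::real. (2 * x) * indicator {0..1/2} x) ((1/2)\<^sup>2 - 0\<^sup>2)"
      by (rule has_bochner_integral_FTC_Icc_real[where F = "\<lambda>x. x\<^sup>2"]) (auto intro!: derivative_eq_intros continuous_intros)
    have h2: "has_bochner_integral lborel (\<lambda>x::real. (2 - 2 * x) * indicator {1/2..1} x) ((2 * 1 - 1\<^sup>2) - (2 * (1/2) - (1/2)\<^sup>2))"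
      by (rule has_bochner_integral_FTC_Icc_real[where F = "\<lambda>x. 2 * x - x\<^sup>2"]) (auto intro!: derivative_eq_intros continuous_intros)
    have "has_bochner_integral lborel (\<lambda>x::real. (2 * x) * indicator {0..1/2} x + (2 - 2 * x) * indicator {1/2..1} x) (1/2)"
      using has_bochner_integral_add[OF h1 h2] by (simp add: power2_eq_square)
    moreover have "AE x in lborel. x \<noteq> 1/2" by (rule AE_lborel_singleton)
    hence "AE x in lborel. (2 * x) * indicator {0..1/2} x + (2 - 2 * x) * indicator {1/2..1} x = tent x"
      by eventually_elim (auto simp: tent_def indicator_def)
    ultimately show ?thesis by (subst (asm) has_bochner_integral_cong_AE) auto
  qed
  have "has_bochner_integral lborel (\<lambda>x. tent (- real k + 2 ^ j * x)) ((1 / 2) /\<^sub>R \<bar>2 ^ j\<bar>)"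
    using ti by (intro lborel_has_bochner_integral_real_affine_iff[THEN iffD1]) auto
  moreover have "(1 / 2) /\<^sub>R \<bar>2 ^ j\<bar> = (1 / 2 ^ Suc j :: real)" by (simp add: field_simps)
  ultimately have "has_bochner_integral lborel (\<lambda>x. tent (- real k + 2 ^ j * x)) (1 / 2 ^ Suc j)" by metis
  then show "(LINT x:{0..<1}|lborel. tent (2 ^ j * x - real k)) = 1 / 2 ^ Suc j"
    "set_integrable lborel {0..<1} (\<lambda>x. tent (2 ^ j * x - real k))"
    unfolding set_lebesgue_integral_def set_integrable_def e by (auto simp: has_bochner_integral_iff)
qed

lemma faber_fun_integral:
  assumes k: "k < 2 ^ level a"
  shows "set_integrable lborel {0..<1} (faber_fun a k)" "(LINT x:{0..<1}|lborel. faber_fun a k x) = faber_int a"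
proof -
  have "has_bochner_integral lborel (\<lambda>x::real. (1 - x) * indicator {0..1} x) ((1 - 1\<^sup>2 / 2) - (0 - 0\<^sup>2 / 2))"
    by (rule has_bochner_integral_FTC_Icc_real[where F = "\<lambda>x. x - x\<^sup>2 / 2"]) (auto intro!: derivative_eq_intros continuous_intros)
  moreover have "AE x in lborel. x \<noteq> (1::real)" by (rule AE_lborel_singleton)
  hence "AE x in lborel. (1 - x) * indicator {0..1} x = indicator {0..<1} x *\<^sub>R (1 - x :: real)"
    by eventually_elim (auto simp: indicator_def)
  ultimately have z: "has_bochner_integral lborel (\<lambda>x. indicator {0..<1} x *\<^sub>R (1 - x :: real)) (1/2)"
    by (subst (asm) has_bochner_integral_cong_AE) auto
  show "set_integrable lborel {0..<1} (faber_fun a k)"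
    using z integrable_tent[of k "a - 1"] k
    by (cases a) (auto simp: set_integrable_def has_bochner_integral_iff faber_fun.simps[abs_def])
  show "(LINT x:{0..<1}|lborel. faber_fun a k x) = faber_int a"
    using z integral_tent[of k "a - 1"] k
    by (cases a) (auto simp: set_lebesgue_integral_def has_bochner_integral_iff faber_int_def)
qed

section \<open>The continuous representative of a smooth distribution\<close>

lemma schwartz_cnj:
  fixes f :: "'a::euclidean_space \<Rightarrow> complex"
  assumes f: "f \<in> schwartz" shows "(\<lambda>x. cnj (f x)) \<in> schwartz"
proof -
  let ?X = "{\<lambda>(i::unit) x. cnj (f x) | f :: 'a \<Rightarrow> complex. f \<in> schwartz}"
  have "schwartz_family (\<lambda>(i::unit) x. cnj (f x))"
  proof (rule schwartz_family_coinduct[where X = ?X])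
    show "(\<lambda>(i::unit) x. cnj (f x)) \<in> ?X" by (rule CollectI, rule exI[of _ f]) (simp add: f)
    fix w assume "w \<in> ?X"
    then obtain f where w: "w = (\<lambda>(i::unit) (x::'a). cnj (f x))" and f: "f \<in> schwartz" by auto
    have der: "((\<lambda>x. cnj (f x)) has_derivative (\<lambda>h. cnj (dir_deriv h f x))) (at x)" for x
      using bounded_linear.has_derivative[OF bounded_linear_cnj has_derivative_dir_deriv[OF schwartz_differentiable[OF f]]] .
    show "w i differentiable (at x)" for i x unfolding w using der by (rule differentiableI)
    show "\<exists>B. \<forall>i x. cmod (w i x) \<le> B"
      using schwartz_family_bounded[OF schwartz_family_of[OF f]] by (simp add: w)
    fix u :: 'a assume u: "u \<in> Basis"
    have "(\<lambda>i. dir_deriv u (w i)) = (\<lambda>i x. cnj (dir_deriv u f x))" unfolding w by (intro ext dir_deriv_eqI[OF der])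
    note e = conjI[OF this schwartz_dir_deriv[OF f u]]
    show "(\<lambda>i. dir_deriv u (w i)) \<in> ?X" by (rule CollectI, rule exI[of _ "dir_deriv u f"]) (rule e)
    have "(\<lambda>i x. of_real (x \<bullet> u) * w i x) = (\<lambda>i x. cnj (of_real (x \<bullet> u) * f x))" by (simp add: w)
    note e = conjI[OF this schwartz_coord[OF f]]
    show "(\<lambda>i x. of_real (x \<bullet> u) * w i x) \<in> ?X" by (rule CollectI, rule exI[of _ "\<lambda>x. of_real (x \<bullet> u) * f x"]) (rule e)
  qed
  then show ?thesis by (simp add: schwartz_iff_family)
qed

text \<open>The squared modulus turns \<open>\<phi>\<^sub>0\<close> into a nonnegative test function, here centred at \<open>a\<close> with width \<open>\<delta>\<close>.\<close>

definition bump :: "(real \<Rightarrow> complex) \<Rightarrow> real \<Rightarrow> real \<Rightarrow> real \<Rightarrow> real" where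
  "bump \<phi>\<^sub>0 \<delta> a t = (cmod (\<phi>\<^sub>0 ((t - a) / \<delta>)))\<^sup>2"

lemma bump_schwartz:
  assumes S: "\<phi>\<^sub>0 \<in> schwartz" and \<delta>: "0 < \<delta>"
  shows "(\<lambda>t. complex_of_real (bump \<phi>\<^sub>0 \<delta> a t)) \<in> schwartz"
proof -
  have "(\<lambda>t. \<phi>\<^sub>0 ((1 / \<delta>) *\<^sub>R t + (- a / \<delta>))) \<in> schwartz"
    using \<delta> by (intro schwartz_affine S) auto
  hence s: "(\<lambda>t. \<phi>\<^sub>0 ((t - a) / \<delta>)) \<in> schwartz" by (simp add: diff_divide_distrib)
  have "(\<lambda>t. complex_of_real (bump \<phi>\<^sub>0 \<delta> a t)) = (\<lambda>t. \<phi>\<^sub>0 ((t - a) / \<delta>) * cnj (\<phi>\<^sub>0 ((t - a) / \<delta>)))"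
    unfolding bump_def by (simp only: complex_norm_square)
  then show ?thesis using schwartz_mult[OF s schwartz_cnj[OF s]] by simp
qed

lemma bump_integral_pos:
  assumes \<phi>: "resolution_generator \<phi>\<^sub>0" and \<delta>: "0 < \<delta>"
  shows "0 < (LINT t|lborel. bump \<phi>\<^sub>0 \<delta> a t)"
proof -
  have S: "\<phi>\<^sub>0 \<in> schwartz" using \<phi> by (simp add: resolution_generator_def)
  have i: "integrable lborel (bump \<phi>\<^sub>0 \<delta> a)"
    using schwartz_integrable[OF bump_schwartz[OF S \<delta>, of a]] by (simp add: complex_of_real_integrable_eq)
  have "(LINT t|lborel. indicator {a - \<delta>..a + \<delta>} t :: real) \<le> (LINT t|lborel. bump \<phi>\<^sub>0 \<delta> a t)"
  proof (rule integral_mono[OF _ i])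
    show "integrable lborel (indicator {a - \<delta>..a + \<delta>} :: real \<Rightarrow> real)" using \<delta> by simp
    fix t
    have "\<phi>\<^sub>0 ((t - a) / \<delta>) = 1" if "t \<in> {a - \<delta>..a + \<delta>}"
    proof -
      have "\<bar>(t - a) / \<delta>\<bar> \<le> 1" using that \<delta> by (auto simp: abs_le_iff field_simps)
      then show ?thesis using \<phi> unfolding resolution_generator_def by blast
    qed
    then show "indicator {a - \<delta>..a + \<delta>} t \<le> bump \<phi>\<^sub>0 \<delta> a t" by (auto simp: indicator_def bump_def)
  qed
  moreover have "(LINT t|lborel. indicator {a - \<delta>..a + \<delta>} t :: real) = 2 * \<delta>" using \<delta> by simp
  ultimately show ?thesis using \<delta> by linarith
qed

lemma bump_support:
  assumes \<phi>: "resolution_generator \<phi>\<^sub>0" and \<delta>: "0 < \<delta>" and t: "bump \<phi>\<^sub>0 \<delta> a t \<noteq> 0"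
  shows "\<bar>t - a\<bar> \<le> 3/2 * \<delta>"
proof (rule ccontr)
  assume "\<not> \<bar>t - a\<bar> \<le> 3/2 * \<delta>"
  hence "\<bar>(t - a) / \<delta>\<bar> > 3/2" using \<delta> by (simp add: field_simps)
  hence "\<phi>\<^sub>0 ((t - a) / \<delta>) = 0" using \<phi> unfolding resolution_generator_def by blast
  then show False using t by (simp add: bump_def)
qed

lemma bump_nonneg [simp]: "0 \<le> bump \<phi>\<^sub>0 \<delta> a t" by (simp add: bump_def)

text \<open>If the continuous functions \<open>f\<close> and \<open>F\<close> differed at an interior point, their difference \<open>D\<close> would be
  nearly constant on a small square around it, and a nonnegative test function supported there would detect it.
  Equality extends to the boundary by continuity.\<close>

lemma distribution_determines_function:
  fixes f F :: "real \<times> real \<Rightarrow> complex"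
  assumes \<phi>: "resolution_generator \<phi>\<^sub>0"
    and f: "continuous_on ({0..1} \<times> {0..1}) f" and F: "continuous_on UNIV F"
    and rep: "\<And>\<psi>. \<psi> \<in> schwartz \<Longrightarrow> g \<psi> = (LINT y|lborel. \<psi> y * F y)"
    and restr: "restrict g (test_functions unit_square) = regular_distr unit_square f"
    and z: "z \<in> {0..1} \<times> {0..1}"
  shows "f z = F z"
proof -
  have S: "\<phi>\<^sub>0 \<in> schwartz" using \<phi> by (simp add: resolution_generator_def)
  have inner: "f c = F c" if c: "c \<in> {0<..<1} \<times> {0<..<1}" for c
  proof (rule ccontr)
    assume ne: "f c \<noteq> F c"
    define D where "D z = f z - F z" for z
    obtain a b where ab: "c = (a, b)" "0 < a" "a < 1" "0 < b" "b < 1" using c by auto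
    have Dc: "continuous_on ({0..1} \<times> {0..1}) D"
      unfolding D_def by (intro continuous_intros f continuous_on_subset[OF F]) auto
    have e: "0 < cmod (D c) / 2" using ne by (simp add: D_def)
    have cc: "c \<in> {0..1} \<times> {0..1}" using c by auto
    obtain d where d: "0 < d" "\<And>z. z \<in> {0..1} \<times> {0..1} \<Longrightarrow> dist z c < d \<Longrightarrow> dist (D z) (D c) < cmod (D c) / 2"
      using Dc[unfolded continuous_on_iff, rule_format, OF cc e] by blast
    \<comment> \<open>The support, of half-width \<open>3/2 * \<delta>\<close>, has to lie in the open square and in the ball of radius \<open>d\<close>.\<close>
    define \<delta> where "\<delta> = Min {d / 4, a / 2, (1 - a) / 2, b / 2, (1 - b) / 2}"
    have \<delta>: "0 < \<delta>" "\<delta> \<le> d / 4" "\<delta> \<le> a / 2" "\<delta> \<le> (1 - a) / 2" "\<delta> \<le> b / 2" "\<delta> \<le> (1 - b) / 2"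
    proof -
      show "0 < \<delta>" unfolding \<delta>_def using d(1) ab by auto
    qed (unfold \<delta>_def, rule Min_le; simp)+
    define w where "w z = bump \<phi>\<^sub>0 \<delta> a (fst z) * bump \<phi>\<^sub>0 \<delta> b (snd z)" for z
    define \<psi> where "\<psi> z = complex_of_real (w z)" for z
    have \<psi>e: "\<psi> = (\<lambda>z. complex_of_real (bump \<phi>\<^sub>0 \<delta> a (fst z)) * complex_of_real (bump \<phi>\<^sub>0 \<delta> b (snd z)))"
      by (rule ext) (simp add: \<psi>_def w_def)
    have \<psi>S: "\<psi> \<in> schwartz" unfolding \<psi>e by (intro schwartz_tensor bump_schwartz S \<delta>(1))
    have supp_w: "z \<in> {a - 3/2 * \<delta>..a + 3/2 * \<delta>} \<times> {b - 3/2 * \<delta>..b + 3/2 * \<delta>}" if "w z \<noteq> 0" for z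
    proof -
      have "\<bar>fst z - a\<bar> \<le> 3/2 * \<delta>" "\<bar>snd z - b\<bar> \<le> 3/2 * \<delta>"
        using that by (auto simp only: w_def mult_eq_0_iff intro: bump_support[OF \<phi> \<delta>(1)])
      then show ?thesis unfolding mem_Times_iff atLeastAtMost_iff by (intro conjI; linarith)
    qed
    let ?K = "{a - 3/2 * \<delta>..a + 3/2 * \<delta>} \<times> {b - 3/2 * \<delta>..b + 3/2 * \<delta>}"
    have Kc: "compact ?K" by (intro compact_Times compact_Icc)
    have Ko: "?K \<subseteq> {0<..<1} \<times> {0<..<1}" using \<delta> ab by auto
    have sK: "supp \<psi> \<subseteq> ?K"
      unfolding supp_def by (rule closure_minimal) (use supp_w compact_imp_closed[OF Kc] in \<open>auto simp: \<psi>_def\<close>)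
    have "supp \<psi> \<subseteq> interior unit_square"
    proof -
      have "{0<..<1} \<times> {0<..<1} \<subseteq> interior unit_square" by (rule interior_maximal) (auto intro: open_Times)
      then show ?thesis using sK Ko by blast
    qed
    moreover have "compact (supp \<psi>)"
      using compact_Int_closed[OF Kc, of "supp \<psi>"] sK by (simp add: supp_def Int_absorb1)
    moreover have "smooth \<psi>" using \<psi>S by (simp add: schwartz_def)
    ultimately have test: "\<psi> \<in> test_functions unit_square" by (simp add: test_functions_def)
    have "g \<psi> = restrict g (test_functions unit_square) \<psi>" using test by simp
    also have "\<dots> = (LINT x:unit_square|lborel. f x * \<psi> x)" unfolding restr regular_distr_def using test by simp
    finally have gf: "g \<psi> = (LINT x|lborel. indicator unit_square x *\<^sub>R (f x * \<psi> x))" by (simp add: set_lebesgue_integral_def)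
    have \<psi>0: "\<psi> x = 0" if "x \<notin> ?K" for x using supp_w[of x] that by (auto simp: \<psi>_def)
    have KQ: "?K \<subseteq> {0..1} \<times> {0..1}" "?K \<subseteq> unit_square" using Ko by fastforce+
    have bor: "?K \<in> sets lborel" using compact_imp_closed[OF Kc] by simp
    have fi: "integrable lborel (\<lambda>x. indicator ?K x *\<^sub>R (\<psi> x * G x))" if G: "continuous_on ?K G" for G
    proof (rule borel_integrable_compact[OF Kc])
      have "continuous_on UNIV \<psi>"
        using schwartz_differentiable[OF \<psi>S] by (intro continuous_at_imp_continuous_on ballI differentiable_imp_continuous_within) auto
      then show "continuous_on ?K (\<lambda>x. \<psi> x * G x)" by (intro continuous_intros G continuous_on_subset[of UNIV \<psi> ?K]) auto
    qed
    have gf': "g \<psi> = (LINT x|lborel. indicator ?K x *\<^sub>R (\<psi> x * f x))"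
      unfolding gf by (intro Bochner_Integration.integral_cong refl) (use \<psi>0 KQ in \<open>auto simp: indicator_def\<close>)
    have gF: "g \<psi> = (LINT x|lborel. indicator ?K x *\<^sub>R (\<psi> x * F x))"
      unfolding rep[OF \<psi>S] by (intro Bochner_Integration.integral_cong refl) (use \<psi>0 in \<open>auto simp: indicator_def\<close>)
    have iff: "integrable lborel (\<lambda>x. indicator ?K x *\<^sub>R (\<psi> x * f x))" "integrable lborel (\<lambda>x. indicator ?K x *\<^sub>R (\<psi> x * F x))"
      "integrable lborel (\<lambda>x. indicator ?K x *\<^sub>R (\<psi> x * D c))" "integrable lborel (\<lambda>x. indicator ?K x *\<^sub>R (\<psi> x * (D c - D x)))"
      by (rule fi[OF continuous_on_subset[OF f KQ(1)]] fi[OF continuous_on_subset[OF F subset_UNIV]] fi[OF continuous_on_const]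
          fi[OF continuous_on_diff[OF continuous_on_const continuous_on_subset[OF Dc KQ(1)]]])+
    have wi: "integrable lborel w"
      using schwartz_integrable[OF \<psi>S] by (simp add: \<psi>_def[abs_def] complex_of_real_integrable_eq)
    have w0: "0 \<le> w x" for x by (simp add: w_def)
    have "indicator ?K x *\<^sub>R (\<psi> x * (D c - D x)) = indicator ?K x *\<^sub>R (\<psi> x * D c) -
       (indicator ?K x *\<^sub>R (\<psi> x * f x) - indicator ?K x *\<^sub>R (\<psi> x * F x))" for x
      unfolding D_def[of x] by (simp add: scaleR_diff_right[symmetric] right_diff_distrib)
    hence "(LINT x|lborel. indicator ?K x *\<^sub>R (\<psi> x * (D c - D x))) =
      (LINT x|lborel. indicator ?K x *\<^sub>R (\<psi> x * D c) - (indicator ?K x *\<^sub>R (\<psi> x * f x) - indicator ?K x *\<^sub>R (\<psi> x * F x)))"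
      by (simp only:)
    also have "\<dots> = (LINT x|lborel. indicator ?K x *\<^sub>R (\<psi> x * D c)) -
       ((LINT x|lborel. indicator ?K x *\<^sub>R (\<psi> x * f x)) - (LINT x|lborel. indicator ?K x *\<^sub>R (\<psi> x * F x)))"
      unfolding Bochner_Integration.integral_diff[OF iff(3) Bochner_Integration.integrable_diff[OF iff(1,2)]]
        Bochner_Integration.integral_diff[OF iff(1,2)] ..
    also have "\<dots> = (LINT x|lborel. indicator ?K x *\<^sub>R (\<psi> x * D c))"
      unfolding gf'[symmetric] gF[symmetric] by simp
    also have "\<dots> = (LINT x|lborel. \<psi> x * D c)"
      by (intro Bochner_Integration.integral_cong refl) (use \<psi>0 in \<open>auto simp: indicator_def\<close>)
    also have "\<dots> = of_real (LINT x|lborel. w x) * D c" by (simp add: \<psi>_def)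
    finally have eq: "of_real (LINT x|lborel. w x) * D c = (LINT x|lborel. indicator ?K x *\<^sub>R (\<psi> x * (D c - D x)))" by simp
    have "cmod (LINT x|lborel. indicator ?K x *\<^sub>R (\<psi> x * (D c - D x))) \<le> (LINT x|lborel. w x * (cmod (D c) / 2))"
    proof (rule order_trans[OF integral_norm_bound integral_mono])
      show "integrable lborel (\<lambda>x. cmod (indicator ?K x *\<^sub>R (\<psi> x * (D c - D x))))" by (rule integrable_norm[OF iff(4)])
      show "integrable lborel (\<lambda>x. w x * (cmod (D c) / 2))" using wi by simp
      fix x
      show "cmod (indicator ?K x *\<^sub>R (\<psi> x * (D c - D x))) \<le> w x * (cmod (D c) / 2)"
      proof (cases "x \<in> ?K")
        case True
        obtain x1 x2 where x: "x = (x1, x2)" by (cases x)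
        have "dist x c \<le> \<bar>x1 - a\<bar> + \<bar>x2 - b\<bar>"
          using real_sqrt_sum_squares_triangle_ineq[of "x1 - a" 0 0 "x2 - b"] by (simp add: x ab dist_Pair_Pair dist_real_def)
        also have "\<dots> < d"
        proof -
          have "\<bar>x1 - a\<bar> \<le> 3/2 * \<delta>" "\<bar>x2 - b\<bar> \<le> 3/2 * \<delta>" using True unfolding x mem_Times_iff atLeastAtMost_iff fst_conv snd_conv by linarith+
          then show ?thesis using \<delta>(2) d(1) by linarith
        qed
        finally have "dist x c < d" .
        moreover have "x \<in> {0..1} \<times> {0..1}" using True KQ(1) by blast
        ultimately have "dist (D x) (D c) < cmod (D c) / 2" by (intro d(2))
        hence "cmod (D c - D x) \<le> cmod (D c) / 2" by (simp add: dist_norm norm_minus_commute)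
        hence "w x * cmod (D c - D x) \<le> w x * (cmod (D c) / 2)" by (rule mult_left_mono[OF _ w0])
        moreover have "cmod (indicator ?K x *\<^sub>R (\<psi> x * (D c - D x))) = w x * cmod (D c - D x)"
          unfolding indicator_simps(1)[OF True] scaleR_one norm_mult \<psi>_def norm_of_real abs_of_nonneg[OF w0] ..
        ultimately show ?thesis by (simp only:)
      qed (simp add: w0)
    qed
    hence "(LINT x|lborel. w x) * cmod (D c) \<le> (LINT x|lborel. w x) * (cmod (D c) / 2)"
      unfolding eq[symmetric] norm_mult using w0 by (simp add: Bochner_Integration.integral_nonneg)
    moreover have "0 < (LINT x|lborel. w x)"
    proof -
      have i: "integrable lborel (\<lambda>t. complex_of_real (bump \<phi>\<^sub>0 \<delta> s t))" for s
        by (intro schwartz_integrable bump_schwartz S \<delta>(1))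
      have "complex_of_real (LINT x|lborel. w x) = (LINT x|lborel. \<psi> x)" by (simp add: \<psi>_def)
      also have "\<dots> = of_real (LINT t|lborel. bump \<phi>\<^sub>0 \<delta> a t) * of_real (LINT t|lborel. bump \<phi>\<^sub>0 \<delta> b t)"
        unfolding \<psi>e tensor_integral(2)[OF i i] by simp
      finally have "(LINT x|lborel. w x) = (LINT t|lborel. bump \<phi>\<^sub>0 \<delta> a t) * (LINT t|lborel. bump \<phi>\<^sub>0 \<delta> b t)"
        unfolding of_real_mult[symmetric] of_real_eq_iff .
      then show ?thesis using bump_integral_pos[OF \<phi> \<delta>(1)] by simp
    qed
    ultimately show False using e by (simp add: mult_le_cancel_left)
  qed
  have cl: "closure ({0<..<1} \<times> {0<..<1}) = {0..1::real} \<times> {0..1::real}"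
    by (simp add: closure_Times closure_greaterThanLessThan)
  show ?thesis
  proof -
    have "continuous_on (closure ({0<..<1} \<times> {0<..<1})) (\<lambda>z. f z - F z)"
      unfolding cl by (intro continuous_intros f continuous_on_subset[OF F]) simp
    from continuous_constant_on_closure[OF this, of 0 z] have "f z - F z = 0"
      using z inner unfolding cl by simp
    then show ?thesis by simp
  qed
qed

lemma representative_exists:
  assumes "Lp_norm_distr p T < \<infinity>"
  obtains h where "represents h T" "Lp_norm p h < \<infinity>"
  using assms unfolding Lp_norm_distr_def INF_less_iff by auto

text \<open>The bound \<open>piece_bound\<close> with the dependence on the frequency made explicit; it holds for all
  representing functions, hence for the infimum of their norms.\<close>

lemma piece_bound_distr:
  assumes S: "\<phi>\<^sub>0 \<in> schwartz" and p: "1 \<le> p"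
  obtains K where "0 < K" "\<And>g m y. ennreal (cmod (piece \<phi>\<^sub>0 g m y)) \<le>
     ennreal (K * 2 powr (real_of_ereal (1 / p) * real (fst m + snd m))) * Lp_norm_distr p (block \<phi>\<^sub>0 g m)"
proof -
  obtain B where B: "0 < B" "\<And>z. cmod (mother \<phi>\<^sub>0 z) \<le> B * rho z" using mother_bounds[OF S] by metis
  let ?P = "real_of_ereal (1 / p)"
  define K where "K = B\<^sup>2 * ((pi * pi) powr (1 - ?P) * 4 powr ?P)"
  have K0: "0 < K" using B(1) by (simp add: K_def)
  show thesis
  proof (rule that[OF K0])
    fix g and m :: "nat \<times> nat" and y
    have e: "B\<^sup>2 * ((pi * pi) powr (1 - ?P) * (2 ^ Suc (fst m) * 2 ^ Suc (snd m)) powr ?P) = K * 2 powr (?P * real (fst m + snd m))"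
    proof -
      have "(2 ^ Suc (fst m) * 2 ^ Suc (snd m) :: real) = 4 * 2 powr (real (fst m + snd m))"
        by (simp add: powr_realpow powr_add)
      hence "(2 ^ Suc (fst m) * 2 ^ Suc (snd m)) powr ?P = 4 powr ?P * 2 powr (?P * real (fst m + snd m))"
        by (simp only: powr_mult powr_powr mult.commute[of ?P])
      then show ?thesis by (simp add: K_def)
    qed
    show "ennreal (cmod (piece \<phi>\<^sub>0 g m y)) \<le> ennreal (K * 2 powr (?P * real (fst m + snd m))) * Lp_norm_distr p (block \<phi>\<^sub>0 g m)"
      unfolding Lp_norm_distr_def
    proof (rule ennreal_le_mult_INF)
      show "0 < K * 2 powr (?P * real (fst m + snd m))" using K0 by simp
      show "ennreal (cmod (piece \<phi>\<^sub>0 g m y)) \<le> ennreal (K * 2 powr (?P * real (fst m + snd m))) * Lp_norm p h"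
        if "h \<in> {h. represents h (block \<phi>\<^sub>0 g m)}" for h
        using piece_bound[OF S _ p B, of h g m y] that unfolding e by simp
    qed
  qed
qed

lemma summable_on_of_nn_integral:
  fixes c :: "'a \<Rightarrow> real"
  assumes "\<And>m. 0 \<le> c m" "(\<integral>\<^sup>+m. ennreal (c m) \<partial>count_space UNIV) < \<infinity>"
  shows "c summable_on UNIV"
proof -
  have "integrable (count_space UNIV) c" using assms by (intro integrableI_nonneg) auto
  then show ?thesis
    using abs_summable_equivalent[of c UNIV] by (simp add: Infinite_Set_Sum.abs_summable_on_def abs_summable_summable)
qed

text \<open>Under the summability assumption the pieces converge uniformly, so their sum is continuous. It
  represents \<open>g\<close>, because the blocks sum up to \<open>g\<close> and each block is represented by its piece.\<close>

theorem pieces_represent: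
  assumes \<phi>: "resolution_generator \<phi>\<^sub>0" and p: "1 \<le> p" and g: "g \<in> tempered_distributions"
    and fin: "(\<integral>\<^sup>+m. ennreal (2 powr (real_of_ereal (1 / p) * real (fst m + snd m))) * Lp_norm_distr p (block \<phi>\<^sub>0 g m) \<partial>count_space UNIV) < \<infinity>"
  obtains F where "continuous_on UNIV F" "\<And>y. ((\<lambda>m. piece \<phi>\<^sub>0 g m y) has_sum F y) UNIV"
    "\<And>\<psi>. \<psi> \<in> schwartz \<Longrightarrow> g \<psi> = (LINT y|lborel. \<psi> y * F y)"
proof -
  have S: "\<phi>\<^sub>0 \<in> schwartz" using \<phi> by (simp add: resolution_generator_def)
  let ?P = "real_of_ereal (1 / p)" and ?N = "\<lambda>m. Lp_norm_distr p (block \<phi>\<^sub>0 g m)"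
  obtain K where K0: "0 < K" and K: "\<And>m y. ennreal (cmod (piece \<phi>\<^sub>0 g m y)) \<le> ennreal (K * 2 powr (?P * real (fst m + snd m))) * ?N m"
    using piece_bound_distr[OF S p] by metis
  have Nfin: "?N m < \<infinity>" for m
  proof -
    have "ennreal (2 powr (?P * real (fst m + snd m))) * ?N m < \<infinity>"
      using nn_integral_ge_point[of m UNIV "\<lambda>m. ennreal (2 powr (?P * real (fst m + snd m))) * ?N m"] fin
      by (auto intro: le_less_trans)
    then show ?thesis by (auto simp: ennreal_mult_less_top)
  qed
  define c where "c m = K * 2 powr (?P * real (fst m + snd m)) * enn2real (?N m)" for m
  have c0: "0 \<le> c m" for m using K0 by (simp add: c_def)
  have ce: "ennreal (c m) = ennreal K * (ennreal (2 powr (?P * real (fst m + snd m))) * ?N m)" for m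
    using K0 Nfin[of m] by (simp add: c_def ennreal_mult mult.assoc)
  have cb: "cmod (piece \<phi>\<^sub>0 g m y) \<le> c m" for m y
  proof -
    have "ennreal (cmod (piece \<phi>\<^sub>0 g m y)) \<le> ennreal (c m)"
      using K[of m y] K0 unfolding ce by (simp add: ennreal_mult mult.assoc)
    then show ?thesis using c0 by (simp add: ennreal_le_iff)
  qed
  have csum: "c summable_on UNIV"
  proof (rule summable_on_of_nn_integral[OF c0])
    have "(\<integral>\<^sup>+m. ennreal (c m) \<partial>count_space UNIV) = ennreal K * (\<integral>\<^sup>+m. ennreal (2 powr (?P * real (fst m + snd m))) * ?N m \<partial>count_space UNIV)"
      unfolding ce by (rule nn_integral_cmult) simp
    also have "\<dots> < \<infinity>" using fin by (simp add: ennreal_mult_less_top)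
    finally show "(\<integral>\<^sup>+m. ennreal (c m) \<partial>count_space UNIV) < \<infinity>" .
  qed
  define F where "F y = (\<Sum>\<^sub>\<infinity>m. piece \<phi>\<^sub>0 g m y)" for y
  have unif: "uniform_limit UNIV (\<lambda>X y. \<Sum>m\<in>X. piece \<phi>\<^sub>0 g m y) F (finite_subsets_at_top UNIV)"
    unfolding F_def by (rule Weierstrass_m_test_general[of UNIV UNIV "\<lambda>m y. piece \<phi>\<^sub>0 g m y" c]) (use cb csum in auto)
  have hs: "((\<lambda>m. piece \<phi>\<^sub>0 g m y) has_sum F y) UNIV" for y
  proof -
    have "((\<lambda>X. \<Sum>m\<in>X. piece \<phi>\<^sub>0 g m y) \<longlongrightarrow> F y) (finite_subsets_at_top UNIV)"
      by (rule tendsto_uniform_limitI[OF unif]) simp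
    then show ?thesis by (simp add: has_sum_def)
  qed
  have pc: "continuous_on UNIV (piece \<phi>\<^sub>0 g m)" for m
    using representative_exists[OF Nfin[of m]] piece_continuous[OF S _ p] by metis
  have Fc: "continuous_on UNIV F"
  proof (rule uniform_limit_theorem[OF _ unif])
    show "\<forall>\<^sub>F X in finite_subsets_at_top UNIV. continuous_on UNIV (\<lambda>y. \<Sum>m\<in>X. piece \<phi>\<^sub>0 g m y)"
      by (intro always_eventually allI continuous_on_sum pc)
  qed simp
  \<comment> \<open>Unconditional summation specialises to summation over squares, as in \<open>sum_blocks_tendsto\<close>.\<close>
  have squares: "filterlim (\<lambda>M::nat. {..M} \<times> {..M}) (finite_subsets_at_top UNIV) sequentially"
    unfolding filterlim_finite_subsets_at_top
  proof (intro allI impI)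
    fix X :: "(nat \<times> nat) set" assume X: "finite X \<and> X \<subseteq> UNIV"
    show "\<forall>\<^sub>F M in sequentially. finite ({..M} \<times> {..M}) \<and> X \<subseteq> {..M} \<times> {..M} \<and> {..M} \<times> {..M} \<subseteq> UNIV"
    proof (rule eventually_sequentiallyI)
      fix M assume M: "Max (insert 0 (fst ` X \<union> snd ` X)) \<le> M"
      have "fst x \<le> M \<and> snd x \<le> M" if "x \<in> X" for x
        using X that by (auto intro!: order_trans[OF Max_ge M])
      then show "finite ({..M} \<times> {..M}) \<and> X \<subseteq> {..M} \<times> {..M} \<and> {..M} \<times> {..M} \<subseteq> UNIV" by fastforce
    qed
  qed
  have rep: "g \<psi> = (LINT y|lborel. \<psi> y * F y)" if \<psi>: "\<psi> \<in> schwartz" for \<psi>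
  proof -
    have [measurable]: "piece \<phi>\<^sub>0 g m \<in> borel_measurable borel" for m by (rule borel_measurable_continuous_onI[OF pc])
    have [measurable]: "F \<in> borel_measurable borel" by (rule borel_measurable_continuous_onI[OF Fc])
    have [measurable]: "\<psi> \<in> borel_measurable borel" by (rule schwartz_measurable[OF \<psi>])
    define C where "C = infsum c UNIV"
    have sb: "cmod (\<Sum>m\<in>X. piece \<phi>\<^sub>0 g m y) \<le> C" if "finite X" for X y
    proof -
      have "cmod (\<Sum>m\<in>X. piece \<phi>\<^sub>0 g m y) \<le> sum c X" by (rule sum_norm_le) (rule cb)
      also have "\<dots> \<le> C" unfolding C_def by (rule finite_sum_le_infsum[OF csum that]) (auto simp: c0)
      finally show ?thesis .
    qed
    have dom: "integrable lborel (\<lambda>y. C * cmod (\<psi> y))"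
      by (intro integrable_mult_right integrable_norm schwartz_integrable \<psi>)
    have "(\<lambda>M. LINT y|lborel. \<psi> y * (\<Sum>m\<in>{..M} \<times> {..M}. piece \<phi>\<^sub>0 g m y)) \<longlonglongrightarrow> (LINT y|lborel. \<psi> y * F y)"
    proof (rule integral_dominated_convergence[OF _ _ dom])
      show "AE y in lborel. (\<lambda>M. \<psi> y * (\<Sum>m\<in>{..M} \<times> {..M}. piece \<phi>\<^sub>0 g m y)) \<longlonglongrightarrow> \<psi> y * F y"
        using filterlim_compose[OF hs[unfolded has_sum_def] squares] by (intro AE_I2 tendsto_intros) auto
      show "AE y in lborel. cmod (\<psi> y * (\<Sum>m\<in>{..M} \<times> {..M}. piece \<phi>\<^sub>0 g m y)) \<le> C * cmod (\<psi> y)" for M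
      proof (rule AE_I2)
        fix y
        show "cmod (\<psi> y * (\<Sum>m\<in>{..M} \<times> {..M}. piece \<phi>\<^sub>0 g m y)) \<le> C * cmod (\<psi> y)"
          using mult_left_mono[OF sb[of "{..M} \<times> {..M}" y] norm_ge_zero[of "\<psi> y"]] by (simp add: norm_mult mult.commute)
      qed
    qed measurable
    moreover have "(LINT y|lborel. \<psi> y * (\<Sum>m\<in>{..M} \<times> {..M}. piece \<phi>\<^sub>0 g m y)) = (\<Sum>m\<in>{..M} \<times> {..M}. block \<phi>\<^sub>0 g m \<psi>)" for M
    proof -
      have i: "integrable lborel (\<lambda>y. \<psi> y * piece \<phi>\<^sub>0 g m y)" for m
      proof (rule Bochner_Integration.integrable_bound[OF dom])
        show "AE y in lborel. cmod (\<psi> y * piece \<phi>\<^sub>0 g m y) \<le> norm (C * cmod (\<psi> y))"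
        proof (rule AE_I2)
          fix y
          show "cmod (\<psi> y * piece \<phi>\<^sub>0 g m y) \<le> norm (C * cmod (\<psi> y))"
            using mult_left_mono[OF sb[of "{m}" y] norm_ge_zero[of "\<psi> y"]] by (simp add: norm_mult mult.commute)
        qed
      qed measurable
      have "block \<phi>\<^sub>0 g m \<psi> = (LINT y|lborel. \<psi> y * piece \<phi>\<^sub>0 g m y)" for m
        using representative_exists[OF Nfin[of m]] block_eq_integral_piece[OF \<phi> _ p _ \<psi>] by metis
      then show ?thesis using i by (simp add: sum_distrib_left Bochner_Integration.integral_sum)
    qed
    ultimately show ?thesis
      using LIMSEQ_unique[OF sum_blocks_tendsto[OF \<phi> g \<psi>]] by simp
  qed
  show thesis by (rule that[OF Fc hs rep])
qed

lemma real_succ_le_pow2: "k < 2 ^ j \<Longrightarrow> real k + 1 \<le> 2 ^ j"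
proof -
  assume "k < 2 ^ j"
  hence "real (k + 1) \<le> real (2 ^ j)" unfolding of_nat_le_iff by simp
  then show ?thesis by simp
qed

lemma faber_coeff_cong:
  assumes "k < 2 ^ level a" "\<And>x. x \<in> {0..1} \<Longrightarrow> f x = g x"
  shows "faber_coeff a k f = faber_coeff a k g"
proof (cases a)
  case (Suc j)
  have k: "real k + 1 \<le> 2 ^ j" using assms(1) Suc by (simp add: real_succ_le_pow2)
  have "real (2 * k + 1) / 2 ^ Suc j \<in> {0..1}" "real (2 * k) / 2 ^ Suc j \<in> {0..1}" "real (2 * k + 2) / 2 ^ Suc j \<in> {0..1}"
    using k assms(1) Suc by (auto simp: divide_le_eq)
  then show ?thesis unfolding Suc faber_coeff.simps using assms(2) by simp
qed (use assms in simp)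

lemma faber_coeff2_cong:
  assumes "k < 2 ^ level a" "l < 2 ^ level b" "\<And>z. z \<in> {0..1} \<times> {0..1} \<Longrightarrow> f z = g z"
  shows "faber_coeff2 a k b l f = faber_coeff2 a k b l g"
  unfolding faber_coeff2_def using assms by (intro faber_coeff_cong) auto

lemma has_sum_faber_coeff:
  assumes "\<And>x. ((\<lambda>m. G m x) has_sum F x) A"
  shows "((\<lambda>m. faber_coeff a k (G m)) has_sum faber_coeff a k F) A"
proof (cases a)
  case (Suc j)
  have d: "((\<lambda>m. u m / 2) has_sum (s / 2)) A" if "(u has_sum s) A" for u :: "_ \<Rightarrow> complex" and s
    using has_sum_cmult_right[OF that, of "1 / 2"] by simp
  have "((\<lambda>m. u m + (- 1) * v m) has_sum (s + (- 1) * t)) A" if "(u has_sum s) A" "(v has_sum t) A" for u v :: "_ \<Rightarrow> complex" and s t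
    by (intro has_sum_add that has_sum_cmult_right)
  hence m: "((\<lambda>m. u m - v m) has_sum (s - t)) A" if "(u has_sum s) A" "(v has_sum t) A" for u v :: "_ \<Rightarrow> complex" and s t
    using that by fastforce
  show ?thesis unfolding Suc faber_coeff.simps by (intro m d has_sum_add assms)
qed (use assms in simp)

lemma has_sum_faber_coeff2:
  assumes "\<And>z. ((\<lambda>m. G m z) has_sum F z) A"
  shows "((\<lambda>m. faber_coeff2 a k b l (G m)) has_sum faber_coeff2 a k b l F) A"
  unfolding faber_coeff2_def by (intro has_sum_faber_coeff assms)

text \<open>The triangle inequality; the right-hand side may be infinite, so absolute convergence need not be
  checked.\<close>

lemma norm_has_sum_le_nn_integral:
  fixes u :: "'a \<Rightarrow> complex"
  assumes "(u has_sum s) UNIV"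
  shows "ennreal (cmod s) \<le> (\<integral>\<^sup>+m. ennreal (cmod (u m)) \<partial>count_space UNIV)"
proof (rule tendsto_upperbound)
  show "((\<lambda>X. ennreal (cmod (sum u X))) \<longlongrightarrow> ennreal (cmod s)) (finite_subsets_at_top UNIV)"
    using assms unfolding has_sum_def by (intro tendsto_ennrealI tendsto_norm)
  show "\<forall>\<^sub>F X in finite_subsets_at_top UNIV. ennreal (cmod (sum u X)) \<le> (\<integral>\<^sup>+m. ennreal (cmod (u m)) \<partial>count_space UNIV)"
  proof (rule eventually_finite_subsets_at_top_weakI)
    fix X :: "'a set" assume X: "finite X"
    have "ennreal (cmod (sum u X)) \<le> ennreal (\<Sum>m\<in>X. cmod (u m))" by (intro ennreal_leI norm_sum)
    also have "\<dots> = (\<Sum>m\<in>X. ennreal (cmod (u m)))" by simp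
    also have "\<dots> = (\<integral>\<^sup>+m. ennreal (cmod (u m)) \<partial>count_space X)" using X by (simp add: nn_integral_count_space_finite)
    also have "\<dots> = (\<integral>\<^sup>+m. ennreal (cmod (u m)) * indicator X m \<partial>count_space UNIV)" by (simp add: nn_integral_count_space_indicator)
    also have "\<dots> \<le> (\<integral>\<^sup>+m. ennreal (cmod (u m)) \<partial>count_space UNIV)" by (intro nn_integral_mono) (auto simp: indicator_def)
    finally show "ennreal (cmod (sum u X)) \<le> (\<integral>\<^sup>+m. ennreal (cmod (u m)) \<partial>count_space UNIV)" .
  qed
qed simp

section \<open>The quadrature error in terms of Faber coefficients\<close>

lemma faber_partial_error:
  fixes f :: "real \<times> real \<Rightarrow> complex"
  shows "set_integrable lborel unit_square (faber_sum2 J f)"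
    and "(LINT z:unit_square|lborel. faber_sum2 J f z) - (\<Sum>c<4. \<Sum>i<2 ^ n. faber_sum2 J f (hammersley n c i)) / 2 ^ (n + 2)
     = (\<Sum>a\<le>J. \<Sum>b\<le>J. \<Sum>k<2 ^ level a. \<Sum>l<2 ^ level b. faber_coeff2 a k b l f * of_real (faber_err n a k b l))"
proof -
  let ?v = "\<lambda>a k b l z. complex_of_real (faber_fun a k (fst z) * faber_fun b l (snd z))"
  have v: "has_bochner_integral lborel (\<lambda>z. indicator unit_square z *\<^sub>R ?v a k b l z) (of_real (faber_int a * faber_int b))"
    if "k < 2 ^ level a" "l < 2 ^ level b" for a k b l
  proof -
    let ?f = "\<lambda>a k x. complex_of_real (indicator {0..<1} x *\<^sub>R faber_fun a k x)"
    have i: "integrable lborel (?f a k)" if "k < 2 ^ level a" for a k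
      using faber_fun_integral(1)[OF that] unfolding set_integrable_def by (rule integrable_of_real)
    have s: "(LINT x|lborel. ?f a k x) = of_real (faber_int a)" if "k < 2 ^ level a" for a k
      using faber_fun_integral(2)[OF that] unfolding set_lebesgue_integral_def integral_complex_of_real by simp
    have e: "(\<lambda>z. indicator unit_square z *\<^sub>R ?v a k b l z) = (\<lambda>z. ?f a k (fst z) * ?f b l (snd z))"
      by (rule ext) (auto simp: indicator_def split: prod.splits)
    show ?thesis unfolding has_bochner_integral_iff e
      using tensor_integral[OF i[OF that(1)] i[OF that(2)]] by (simp only: s[OF that(1)] s[OF that(2)] of_real_mult)
  qed
  have hb: "has_bochner_integral lborel (\<lambda>z. indicator unit_square z *\<^sub>R faber_sum2 J f z)
    (\<Sum>a\<le>J. \<Sum>b\<le>J. \<Sum>k<2 ^ level a. \<Sum>l<2 ^ level b. faber_coeff2 a k b l f * of_real (faber_int a * faber_int b))"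
  proof -
    have "has_bochner_integral lborel (\<lambda>z. \<Sum>a\<le>J. \<Sum>b\<le>J. \<Sum>k<2 ^ level a. \<Sum>l<2 ^ level b. faber_coeff2 a k b l f * (indicator unit_square z *\<^sub>R ?v a k b l z))
      (\<Sum>a\<le>J. \<Sum>b\<le>J. \<Sum>k<2 ^ level a. \<Sum>l<2 ^ level b. faber_coeff2 a k b l f * of_real (faber_int a * faber_int b))"
      by (intro has_bochner_integral_sum has_bochner_integral_mult_right v) auto
    also have "(\<lambda>z. \<Sum>a\<le>J. \<Sum>b\<le>J. \<Sum>k<2 ^ level a. \<Sum>l<2 ^ level b. faber_coeff2 a k b l f * (indicator unit_square z *\<^sub>R ?v a k b l z)) =
      (\<lambda>z. indicator unit_square z *\<^sub>R faber_sum2 J f z)"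
      by (rule ext) (simp add: faber_sum2_def scaleR_sum_right)
    finally show ?thesis .
  qed
  then show "set_integrable lborel unit_square (faber_sum2 J f)" by (simp add: set_integrable_def has_bochner_integral_iff)
  have I: "(LINT z:unit_square|lborel. faber_sum2 J f z) = (\<Sum>a\<le>J. \<Sum>b\<le>J. \<Sum>k<2 ^ level a. \<Sum>l<2 ^ level b. faber_coeff2 a k b l f * of_real (faber_int a * faber_int b))"
    using hb by (simp add: set_lebesgue_integral_def has_bochner_integral_iff)
  let ?S = "\<lambda>a k b l. \<Sum>c<4. \<Sum>i<2 ^ n. ?v a k b l (hammersley n c i)"
  have swap: "(\<Sum>i\<in>I. \<Sum>a\<in>A. \<Sum>b\<in>B. \<Sum>k\<in>K a. \<Sum>l\<in>L b. g a b k l i) = (\<Sum>a\<in>A. \<Sum>b\<in>B. \<Sum>k\<in>K a. \<Sum>l\<in>L b. \<Sum>i\<in>I. (g a b k l i :: complex))"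
    for I :: "nat set" and A B :: "nat set" and K L :: "nat \<Rightarrow> nat set" and g
  proof -
    have "(\<Sum>i\<in>I. \<Sum>a\<in>A. \<Sum>b\<in>B. \<Sum>k\<in>K a. \<Sum>l\<in>L b. g a b k l i) = (\<Sum>a\<in>A. \<Sum>i\<in>I. \<Sum>b\<in>B. \<Sum>k\<in>K a. \<Sum>l\<in>L b. g a b k l i)"
      by (rule sum.swap)
    also have "\<dots> = (\<Sum>a\<in>A. \<Sum>b\<in>B. \<Sum>i\<in>I. \<Sum>k\<in>K a. \<Sum>l\<in>L b. g a b k l i)"
      by (rule sum.cong[OF refl]) (rule sum.swap)
    also have "\<dots> = (\<Sum>a\<in>A. \<Sum>b\<in>B. \<Sum>k\<in>K a. \<Sum>i\<in>I. \<Sum>l\<in>L b. g a b k l i)"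
      by (rule sum.cong[OF refl], rule sum.cong[OF refl]) (rule sum.swap)
    also have "\<dots> = (\<Sum>a\<in>A. \<Sum>b\<in>B. \<Sum>k\<in>K a. \<Sum>l\<in>L b. \<Sum>i\<in>I. g a b k l i)"
      by (rule sum.cong[OF refl], rule sum.cong[OF refl], rule sum.cong[OF refl]) (rule sum.swap)
    finally show ?thesis .
  qed
  have "(\<Sum>c<4. \<Sum>i<2 ^ n. faber_sum2 J f (hammersley n c i)) = (\<Sum>a\<le>J. \<Sum>b\<le>J. \<Sum>k<2 ^ level a. \<Sum>l<2 ^ level b. faber_coeff2 a k b l f * ?S a k b l)"
  proof -
    have "(\<Sum>i<2 ^ n. faber_sum2 J f (hammersley n c i)) =
      (\<Sum>a\<le>J. \<Sum>b\<le>J. \<Sum>k<2 ^ level a. \<Sum>l<2 ^ level b. faber_coeff2 a k b l f * (\<Sum>i<2 ^ n. ?v a k b l (hammersley n c i)))" for c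
      unfolding faber_sum2_def swap[where K = "\<lambda>a. {..<2 ^ level a}" and L = "\<lambda>b. {..<2 ^ level b}" and A = "{..J}" and B = "{..J}" and I = "{..<2 ^ n}"] sum_distrib_left ..
    note 1 = this
    show ?thesis unfolding 1 swap[where K = "\<lambda>a. {..<2 ^ level a}" and L = "\<lambda>b. {..<2 ^ level b}" and A = "{..J}" and B = "{..J}" and I = "{..<4}"] sum_distrib_left ..
  qed
  hence "(LINT z:unit_square|lborel. faber_sum2 J f z) - (\<Sum>c<4. \<Sum>i<2 ^ n. faber_sum2 J f (hammersley n c i)) / 2 ^ (n + 2) =
    (\<Sum>a\<le>J. \<Sum>b\<le>J. \<Sum>k<2 ^ level a. \<Sum>l<2 ^ level b. faber_coeff2 a k b l f * of_real (faber_int a * faber_int b) - faber_coeff2 a k b l f * ?S a k b l / 2 ^ (n + 2))"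
    unfolding I by (simp only: sum_divide_distrib sum_subtractf)
  also have "\<dots> = (\<Sum>a\<le>J. \<Sum>b\<le>J. \<Sum>k<2 ^ level a. \<Sum>l<2 ^ level b. faber_coeff2 a k b l f * of_real (faber_err n a k b l))"
    by (intro sum.cong refl) (simp add: faber_err_def algebra_simps)
  finally show "(LINT z:unit_square|lborel. faber_sum2 J f z) - (\<Sum>c<4. \<Sum>i<2 ^ n. faber_sum2 J f (hammersley n c i)) / 2 ^ (n + 2)
     = (\<Sum>a\<le>J. \<Sum>b\<le>J. \<Sum>k<2 ^ level a. \<Sum>l<2 ^ level b. faber_coeff2 a k b l f * of_real (faber_err n a k b l))" .
qed

lemma hammersley_in_square: "i < 2 ^ n \<Longrightarrow> hammersley n c i \<in> unit_square"
  using coordx_bounds[of i n] coordy_bounds[of n i] by (auto simp: hammersley_def reflect_def)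

text \<open>A uniform limit of partial sums of the Faber expansion inherits the bound on their quadrature
  errors, since integration over the square and the quadrature rule are both bounded by the supremum.\<close>

theorem quadrature_error_le:
  fixes f :: "real \<times> real \<Rightarrow> complex"
  assumes cont: "continuous_on ({0..1} \<times> {0..1}) f"
    and top: "\<And>x. x \<in> {0..1} \<Longrightarrow> f (x, 1) = 0" and right: "\<And>y. y \<in> {0..1} \<Longrightarrow> f (1, y) = 0"
    and bound: "\<And>J. (\<Sum>a\<le>J. \<Sum>b\<le>J. \<Sum>k<2 ^ level a. \<Sum>l<2 ^ level b. ennreal (\<bar>faber_err n a k b l\<bar> * cmod (faber_coeff2 a k b l f))) \<le> ennreal K"
    and K: "0 \<le> K"
  shows "cmod ((LINT z:unit_square|lborel. f z) - (\<Sum>c<4. \<Sum>i<2 ^ n. f (hammersley n c i)) / 2 ^ (n + 2)) \<le> K"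
proof (rule field_le_epsilon)
  fix e :: real assume e: "0 < e"
  obtain J where J: "\<And>z. z \<in> unit_square \<Longrightarrow> cmod (faber_sum2 J f z - f z) \<le> e / 2"
    using faber_sum2_uniform[OF cont top right, of "e / 2"] e by (metis half_gt_zero)
  let ?g = "faber_sum2 J f" and ?M = "2 ^ (n + 2) :: complex"
  let ?q = "\<lambda>f. (\<Sum>c<4. \<Sum>i<2 ^ n. f (hammersley n c i)) / ?M"
  have gi: "set_integrable lborel unit_square ?g" by (rule faber_partial_error)
  have fi: "set_integrable lborel unit_square f"
  proof (rule set_integrable_subset)
    show "set_integrable lborel ({0..1} \<times> {0..1}) f"
      unfolding set_integrable_def by (rule borel_integrable_compact[OF _ cont]) (intro compact_Times compact_Icc)
    show "unit_square \<in> sets lborel"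
      by (simp add: borel_prod[symmetric] pair_measureI)
  qed auto
  have d1: "cmod ((LINT z:unit_square|lborel. f z) - (LINT z:unit_square|lborel. ?g z)) \<le> e / 2"
  proof -
    have "(LINT z:unit_square|lborel. f z) - (LINT z:unit_square|lborel. ?g z) = (LINT z|lborel. indicator unit_square z *\<^sub>R f z - indicator unit_square z *\<^sub>R ?g z)"
      unfolding set_lebesgue_integral_def
      by (rule Bochner_Integration.integral_diff[symmetric]) (use fi gi in \<open>auto simp: set_integrable_def\<close>)
    also have "cmod \<dots> \<le> (LINT z|lborel. e / 2 * indicator unit_square z)"
    proof (rule order_trans[OF integral_norm_bound integral_mono])
      show "integrable lborel (\<lambda>z. cmod (indicator unit_square z *\<^sub>R f z - indicator unit_square z *\<^sub>R ?g z))"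
        using fi gi by (auto simp: set_integrable_def)
      show "integrable lborel (\<lambda>z. e / 2 * indicator unit_square z)"
      proof -
        have "integrable lborel (\<lambda>z::real \<times> real. indicator ({0..1} \<times> {0..1}) z *\<^sub>R (1::real))"
          by (rule borel_integrable_compact) (auto intro!: compact_Times compact_Icc)
        hence "set_integrable lborel ({0..1} \<times> {0..1}) (\<lambda>z::real\<times>real. 1::real)" by (simp add: set_integrable_def)
        hence "set_integrable lborel unit_square (\<lambda>z::real\<times>real. 1::real)"
          by (rule set_integrable_subset) (auto simp: borel_prod[symmetric])
        then show ?thesis by (simp add: set_integrable_def)
      qed
      fix z
      show "cmod (indicator unit_square z *\<^sub>R f z - indicator unit_square z *\<^sub>R ?g z) \<le> e / 2 * indicator unit_square z"
        using J[of z] by (cases "z \<in> unit_square") (auto simp: norm_minus_commute)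
    qed
    also have "\<dots> = e / 2 * measure lborel unit_square" by simp
    also have "measure lborel unit_square = 1"
    proof -
      have "emeasure (lborel \<Otimes>\<^sub>M lborel) unit_square = emeasure lborel {0..<1::real} * emeasure lborel {0..<1::real}"
        by (rule lborel.emeasure_pair_measure_Times) auto
      then show ?thesis by (simp add: lborel_prod measure_def)
    qed
    finally show ?thesis by simp
  qed
  have d2: "cmod (?q f - ?q ?g) \<le> e / 2"
  proof -
    have "?q f - ?q ?g = (\<Sum>c<4. \<Sum>i<2 ^ n. f (hammersley n c i) - ?g (hammersley n c i)) / ?M"
      by (simp add: sum_subtractf diff_divide_distrib)
    also have "cmod \<dots> = cmod (\<Sum>c<4. \<Sum>i<2 ^ n. f (hammersley n c i) - ?g (hammersley n c i)) / 2 ^ (n + 2)"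
      by (simp add: norm_divide norm_mult norm_power)
    also have "\<dots> \<le> (\<Sum>c<(4::nat). \<Sum>i<(2::nat) ^ n. e / 2) / 2 ^ (n + 2)"
      by (intro divide_right_mono sum_norm_le) (use J hammersley_in_square in \<open>auto simp: norm_minus_commute\<close>)
    also have "\<dots> = e / 2" by (simp add: power_add)
    finally show ?thesis .
  qed
  have d3: "cmod ((LINT z:unit_square|lborel. ?g z) - ?q ?g) \<le> K"
  proof -
    have "cmod ((LINT z:unit_square|lborel. ?g z) - ?q ?g) \<le> (\<Sum>a\<le>J. \<Sum>b\<le>J. \<Sum>k<2 ^ level a. \<Sum>l<2 ^ level b. \<bar>faber_err n a k b l\<bar> * cmod (faber_coeff2 a k b l f))"
      unfolding faber_partial_error(2) by (intro sum_norm_le) (simp add: norm_mult mult.commute)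
    moreover have "ennreal (\<Sum>a\<le>J. \<Sum>b\<le>J. \<Sum>k<2 ^ level a. \<Sum>l<2 ^ level b. \<bar>faber_err n a k b l\<bar> * cmod (faber_coeff2 a k b l f)) \<le> ennreal K"
      using bound[of J] by (simp add: sum_nonneg)
    ultimately show ?thesis using K by (simp add: ennreal_le_iff)
  qed
  have telescope: "cmod (a - d) \<le> cmod (a - b) + cmod (b - c) + cmod (d - c)" for a b c d :: complex
  proof -
    have "a - d = (a - b) + (b - c) - (d - c)" by simp
    also have "cmod \<dots> \<le> cmod ((a - b) + (b - c)) + cmod (d - c)" by (rule norm_triangle_ineq4)
    finally show ?thesis using norm_triangle_ineq[of "a - b" "b - c"] by linarith
  qed
  show "cmod ((LINT z:unit_square|lborel. f z) - ?q f) \<le> K + e"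
    using telescope[of "LINT z:unit_square|lborel. f z" "?q f" "LINT z:unit_square|lborel. ?g z" "?q ?g"] d1 d2 d3 by linarith
qed

text \<open>Indices start at 1. The quotient selects the reflection and the remainder the Hammersley point.\<close>

definition qmc_points :: "nat \<Rightarrow> nat \<Rightarrow> real \<times> real" where
  "qmc_points n i = hammersley n ((i - 1) div 2 ^ n) ((i - 1) mod 2 ^ n)"

lemma qmc_points_in: "qmc_points n \<in> {1..N} \<rightarrow> unit_square"
  unfolding qmc_points_def by (intro Pi_I hammersley_in_square) simp

lemma qmc_rule_points:
  "qmc_rule (2 ^ (n + 2)) (qmc_points n) f = (\<Sum>c<4. \<Sum>i<2 ^ n. f (hammersley n c i)) / 2 ^ (n + 2)"
proof -
  have "(\<Sum>i=1..2 ^ (n + 2). f (qmc_points n i)) = (\<Sum>i<2 ^ (n + 2). f (qmc_points n (Suc i)))"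
    using sum.atLeast1_atMost_eq[of "\<lambda>i. f (qmc_points n i)" "2 ^ (n + 2)"] by simp
  also have "\<dots> = (\<Sum>i<2 ^ (2 + n). f (qmc_points n (Suc i)))" by (simp add: add.commute)
  also have "\<dots> = (\<Sum>c<2 ^ 2. \<Sum>i<2 ^ n. f (qmc_points n (Suc (c * 2 ^ n + i))))" by (rule sum_split_pow)
  also have "\<dots> = (\<Sum>c<4. \<Sum>i<2 ^ n. f (hammersley n c i))"
    by (simp add: qmc_points_def)
  finally show ?thesis by (simp add: qmc_rule_def)
qed

section \<open>Summation over levels and frequencies\<close>

definition decay :: "real \<Rightarrow> int \<Rightarrow> real" where "decay \<kappa> t = 2 powr (- \<kappa> * \<bar>real_of_int t\<bar>)"

lemma decay_pos [simp]: "0 < decay \<kappa> t" by (simp add: decay_def)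
lemma decay_nonneg [simp]: "0 \<le> decay \<kappa> t" by (simp add: decay_def)
lemma decay_le_1: "0 \<le> \<kappa> \<Longrightarrow> decay \<kappa> t \<le> 1"
  unfolding decay_def using powr_mono[of "- \<kappa> * \<bar>real_of_int t\<bar>" 0 2] by simp

lemma decay_eq_power: "decay \<kappa> t = (2 powr (- \<kappa>)) ^ nat \<bar>t\<bar>"
proof -
  have "decay \<kappa> t = (2 powr (- \<kappa>)) powr (real (nat \<bar>t\<bar>))" by (simp add: decay_def powr_powr)
  moreover have "0 < 2 powr (- \<kappa>)" by simp
  ultimately show ?thesis by (simp only: powr_realpow)
qed

text \<open>An upper bound for the sum of \<open>decay \<kappa>\<close> over all integers, by two geometric series.\<close>

definition decay_total :: "real \<Rightarrow> real" where "decay_total \<kappa> = 2 / (1 - 2 powr (- \<kappa>))"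

lemma decay_ratio: "0 < \<kappa> \<Longrightarrow> 2 powr (- \<kappa>) < (1::real)"
  using powr_less_mono[of "- \<kappa>" 0 2] by simp

lemma decay_total_ge: "0 < \<kappa> \<Longrightarrow> 2 \<le> decay_total \<kappa>"
  using decay_ratio[of \<kappa>] by (simp add: decay_total_def le_divide_eq)

lemma sum_decay_le:
  assumes \<kappa>: "0 < \<kappa>" and A: "finite (A :: nat set)"
  shows "(\<Sum>j\<in>A. decay \<kappa> (int j - t)) \<le> decay_total \<kappa>"
proof -
  define x where "x = 2 powr (- \<kappa>)"
  have x: "0 < x" "x < 1" using decay_ratio[OF \<kappa>] by (auto simp: x_def)
  have geo: "(\<Sum>i\<in>B. x ^ i) \<le> 1 / (1 - x)" if "finite B" for B
    using sum_le_suminf[OF summable_geometric[of x] that] x suminf_geometric[of x] by simp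
  let ?A1 = "{j \<in> A. int j \<ge> t}" and ?A2 = "{j \<in> A. int j < t}"
  have 1: "(\<Sum>j\<in>?A1. decay \<kappa> (int j - t)) \<le> 1 / (1 - x)"
  proof -
    have "(\<Sum>j\<in>?A1. decay \<kappa> (int j - t)) = (\<Sum>j\<in>?A1. x ^ nat (int j - t))"
      by (intro sum.cong refl) (auto simp: decay_eq_power x_def)
    also have "\<dots> = (\<Sum>i\<in>(\<lambda>j. nat (int j - t)) ` ?A1. x ^ i)"
      by (rule sum.reindex_cong[symmetric, where l = "\<lambda>j. nat (int j - t)"]) (auto simp: inj_on_def)
    also have "\<dots> \<le> 1 / (1 - x)" using A by (intro geo) auto
    finally show ?thesis .
  qed
  have 2: "(\<Sum>j\<in>?A2. decay \<kappa> (int j - t)) \<le> 1 / (1 - x)"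
  proof -
    have "(\<Sum>j\<in>?A2. decay \<kappa> (int j - t)) = (\<Sum>j\<in>?A2. x ^ nat (t - int j))"
      by (intro sum.cong refl) (auto simp: decay_eq_power x_def)
    also have "\<dots> = (\<Sum>i\<in>(\<lambda>j. nat (t - int j)) ` ?A2. x ^ i)"
      by (rule sum.reindex_cong[symmetric, where l = "\<lambda>j. nat (t - int j)"]) (auto simp: inj_on_def)
    also have "\<dots> \<le> 1 / (1 - x)" using A by (intro geo) auto
    finally show ?thesis .
  qed
  have "(\<Sum>j\<in>A. decay \<kappa> (int j - t)) = (\<Sum>j\<in>?A1. decay \<kappa> (int j - t)) + (\<Sum>j\<in>?A2. decay \<kappa> (int j - t))"
    using A by (subst sum.union_disjoint[symmetric]) (auto intro!: sum.cong)
  also have "\<dots> \<le> 2 / (1 - x)" using add_mono[OF 1 2] by simp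
  finally show ?thesis by (simp add: decay_total_def x_def)
qed

text \<open>The factor 2 accounts for the level 0, which occurs twice.\<close>

lemma sum_decay_level_le:
  assumes \<kappa>: "0 < \<kappa>"
  shows "(\<Sum>a\<le>J. decay \<kappa> (int (level a) - t)) \<le> 2 * decay_total \<kappa>"
proof (cases J)
  case 0
  have "decay \<kappa> (0 - t) \<le> 1" using \<kappa> by (intro decay_le_1) simp
  also have "\<dots> \<le> 2 * decay_total \<kappa>" using decay_total_ge[OF \<kappa>] by simp
  finally show ?thesis by (simp add: 0)
next
  case (Suc K)
  have "(\<Sum>a\<le>J. decay \<kappa> (int (level a) - t)) = decay \<kappa> (0 - t) + (\<Sum>j\<le>K. decay \<kappa> (int j - t))"
    unfolding Suc by (subst sum.atMost_Suc_shift) simp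
  also have "\<dots> \<le> 1 + decay_total \<kappa>"
    using \<kappa> by (intro add_mono decay_le_1 sum_decay_le) auto
  also have "\<dots> \<le> 2 * decay_total \<kappa>" using decay_total_ge[OF \<kappa>] by simp
  finally show ?thesis .
qed

text \<open>There are about \<open>n\<close> pairs of levels with sum \<open>n\<close>, and the other pairs contribute geometric tails.
  This count is the source of the logarithm in the rate.\<close>

lemma sum_decay_diagonal_le:
  assumes \<kappa>: "0 < \<kappa>"
  shows "(\<Sum>a\<le>J. \<Sum>b\<le>J. decay \<kappa> (int (level a + level b) - int n)) \<le> (2 * decay_total \<kappa> + (2 * decay_total \<kappa>)\<^sup>2) * (real n + 2)"
proof -
  let ?E = "2 * decay_total \<kappa>"
  have E: "0 \<le> ?E" using decay_total_ge[OF \<kappa>] by simp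
  have row: "(\<Sum>b\<le>J. decay \<kappa> (int (level a + level b) - int n)) \<le> (if level a \<le> n then ?E else 0) + ?E * decay \<kappa> (int (level a) - int n)" for a
  proof (cases "level a \<le> n")
    case True
    have "(\<Sum>b\<le>J. decay \<kappa> (int (level a + level b) - int n)) = (\<Sum>b\<le>J. decay \<kappa> (int (level b) - (int n - int (level a))))"
      by (intro sum.cong refl arg_cong[of _ _ "decay \<kappa>"]) simp
    also have "\<dots> \<le> ?E" by (rule sum_decay_level_le[OF \<kappa>])
    finally show ?thesis using True mult_nonneg_nonneg[OF E decay_nonneg[of \<kappa> "int (level a) - int n"]] by simp
  next
    case False
    have "decay \<kappa> (int (level a + level b) - int n) = decay \<kappa> (int (level b) - 0) * decay \<kappa> (int (level a) - int n)" for b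
      unfolding decay_def powr_add[symmetric] using False by (intro arg_cong[of _ _ "\<lambda>x. 2 powr x"]) (simp add: algebra_simps)
    hence "(\<Sum>b\<le>J. decay \<kappa> (int (level a + level b) - int n)) = (\<Sum>b\<le>J. decay \<kappa> (int (level b) - 0)) * decay \<kappa> (int (level a) - int n)"
      by (simp only: sum_distrib_right)
    also have "\<dots> \<le> ?E * decay \<kappa> (int (level a) - int n)"
      by (intro mult_right_mono sum_decay_level_le[OF \<kappa>]) simp
    finally show ?thesis using False by simp
  qed
  have "(\<Sum>a\<le>J. \<Sum>b\<le>J. decay \<kappa> (int (level a + level b) - int n)) \<le> (\<Sum>a\<le>J. (if level a \<le> n then ?E else 0) + ?E * decay \<kappa> (int (level a) - int n))"
    by (intro sum_mono row)
  also have "\<dots> = (\<Sum>a\<le>J. if level a \<le> n then ?E else 0) + ?E * (\<Sum>a\<le>J. decay \<kappa> (int (level a) - int n))"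
    by (simp add: sum.distrib sum_distrib_left)
  also have "\<dots> \<le> (real n + 2) * ?E + ?E * ?E"
  proof (intro add_mono mult_left_mono sum_decay_level_le[OF \<kappa>] E)
    have "(\<Sum>a\<le>J. if level a \<le> n then ?E else 0) = (\<Sum>a\<in>{a \<in> {..J}. level a \<le> n}. ?E)"
      by (rule sum.inter_filter[symmetric]) simp
    also have "\<dots> \<le> (\<Sum>a\<in>{..n + 1}. ?E)"
      using E by (intro sum_mono2) (auto simp: level_def)
    finally show "(\<Sum>a\<le>J. if level a \<le> n then ?E else 0) \<le> (real n + 2) * ?E" by (simp add: algebra_simps)
  qed
  also have "\<dots> \<le> (?E + ?E\<^sup>2) * (real n + 2)"
  proof -
    have "?E * ?E * 1 \<le> ?E * ?E * (real n + 2)" using E by (intro mult_left_mono) auto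
    then show ?thesis by (simp add: power2_eq_square algebra_simps)
  qed
  finally show ?thesis .
qed

text \<open>With \<open>t\<close> the difference of frequency and level, this is the size of the Faber coefficients of a
  block relative to its norm: below the level of the coefficient the second difference gains \<open>4 powr t\<close>, above
  it the passage from the norm of order \<open>p\<close> to point values loses \<open>2 powr (P * t)\<close>. By \<open>near_constant\<close> and
  \<open>far_constant\<close> the same profile describes the integration errors, with the sum of the two levels in place
  of the frequency and \<open>n\<close> in place of the level.\<close>

definition growth :: "real \<Rightarrow> int \<Rightarrow> real" where
  "growth P t = (if t < 0 then 4 powr real_of_int t else 2 powr (P * real_of_int t))"

lemma growth_pos [simp]: "0 < growth P t" by (simp add: growth_def)

text \<open>The smoothness weight \<open>2 powr (- r * t)\<close> beats the growth on both sides exactly when \<open>r\<close> lies between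
  \<open>P\<close> and 2.\<close>

lemma growth_decay:
  assumes "P < r" "r < 2"
  shows "growth P t * 2 powr (- r * real_of_int t) \<le> decay (min (2 - r) (r - P)) t"
proof -
  have four: "4 powr x = 2 powr (2 * x)" for x :: real
    using powr_powr[of 2 2 x] by simp
  show ?thesis
  proof (cases "t < 0")
    case True
    have "growth P t * 2 powr (- r * real_of_int t) = 2 powr ((2 - r) * real_of_int t)"
      using True by (simp add: growth_def four powr_add[symmetric] algebra_simps)
    also have "\<dots> \<le> decay (min (2 - r) (r - P)) t"
      unfolding decay_def
    proof (intro powr_mono)
      have "min (2 - r) (r - P) * \<bar>real_of_int t\<bar> \<le> (2 - r) * \<bar>real_of_int t\<bar>" by (intro mult_right_mono) auto
      then show "(2 - r) * real_of_int t \<le> - min (2 - r) (r - P) * \<bar>real_of_int t\<bar>" using True by simp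
    qed simp
    finally show ?thesis .
  next
    case False
    have "growth P t * 2 powr (- r * real_of_int t) = 2 powr (- (r - P) * real_of_int t)"
      using False by (simp add: growth_def powr_add[symmetric] algebra_simps)
    also have "\<dots> \<le> decay (min (2 - r) (r - P)) t"
      unfolding decay_def
    proof (intro powr_mono)
      have e: "\<bar>real_of_int t\<bar> = real_of_int t" using False by simp
      show "- (r - P) * real_of_int t \<le> - min (2 - r) (r - P) * \<bar>real_of_int t\<bar>"
        unfolding e minus_mult_left[symmetric] neg_le_iff_le using False by (intro mult_right_mono) auto
    qed simp
    finally show ?thesis .
  qed
qed

lemma smoothing_growth:
  assumes P: "0 \<le> P"
  shows "smoothing m j * (max (2 ^ m) (2 ^ j) / 2 ^ j) powr P = growth P (int m - int j)"
proof (cases "m < j")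
  case True
  have "max (2 ^ m) (2 ^ j) = (2::real) ^ j" using True by (simp add: max_def)
  moreover have "smoothing m j = 4 powr (real m - real j)"
  proof -
    have "4 powr (real m - real j) = 4 powr (- real (j - m))" using True by (simp add: of_nat_diff)
    also have "\<dots> = 1 / 4 ^ (j - m)" unfolding powr_minus_divide by (simp only: powr_realpow)
    finally show ?thesis using True by (simp add: smoothing_def power_one_over)
  qed
  ultimately show ?thesis using True by (simp add: growth_def)
next
  case False
  have "max (2 ^ m) (2 ^ j) / 2 ^ j = (2::real) ^ (m - j)" using False by (simp add: max_def power_diff)
  also have "\<dots> = 2 powr (real m - real j)" using False by (simp add: powr_realpow[symmetric] of_nat_diff)
  finally show ?thesis using False by (simp add: growth_def smoothing_def powr_powr mult.commute)
qed

text \<open>The constant of \<open>faber_coeff2_piece_weighted_sum\<close> factorises into contributions of the quadrature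
  rule and of the two directions.\<close>

lemma weight_constant_eq:
  assumes \<omega>: "0 < \<omega>" and \<sigma>: "0 < \<sigma>" and D: "0 < D" and P: "0 \<le> P" "P \<le> 1"
  shows "(\<sigma> * (D\<^sup>2 * (smoothing m j * smoothing m' j'))) powr (1 - P) *
      (\<omega> * (D\<^sup>2 * (smoothing m j * smoothing m' j') * (max (2 ^ m) (2 ^ j) * max (2 ^ m') (2 ^ j')))) powr P =
    D\<^sup>2 * (\<sigma> powr (1 - P) * \<omega> powr P * 2 powr (P * real (j + j'))) *
      (growth P (int m - int j) * growth P (int m' - int j'))"
proof -
  define s where "s = smoothing m j * smoothing m' j'"
  define M M' where "M = max (2 ^ m) (2 ^ j) / (2 ^ j :: real)" and "M' = max (2 ^ m') (2 ^ j') / (2 ^ j' :: real)"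
  have s: "0 < s" by (simp add: s_def smoothing_pos)
  have M: "0 < M" "0 < M'" by (auto simp: M_def M'_def less_max_iff_disj)
  have x: "0 < D\<^sup>2 * s" using D s by simp
  have jj: "(2::real) ^ (j + j') = 2 powr real (j + j')" by (rule powr_realpow[symmetric]) simp
  have MM: "max (2 ^ m) (2 ^ j) * max (2 ^ m') (2 ^ j') = 2 ^ (j + j') * (M * M')"
    by (simp add: M_def M'_def power_add)
  have "(\<sigma> * (D\<^sup>2 * s)) powr (1 - P) * (\<omega> * (D\<^sup>2 * s * (2 ^ (j + j') * (M * M')))) powr P =
    (\<sigma> powr (1 - P) * (D\<^sup>2 * s) powr (1 - P)) * (\<omega> powr P * ((D\<^sup>2 * s) powr P * (2 powr (P * real (j + j')) * (M powr P * M' powr P))))"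
    using \<omega> \<sigma> x M by (simp add: powr_mult jj powr_powr mult.commute del: powr_realpow)
  also have "\<dots> = ((D\<^sup>2 * s) powr (1 - P) * (D\<^sup>2 * s) powr P) * (\<sigma> powr (1 - P) * \<omega> powr P * 2 powr (P * real (j + j'))) * (M powr P * M' powr P)"
    by (simp only: mult_ac)
  also have "(D\<^sup>2 * s) powr (1 - P) * (D\<^sup>2 * s) powr P = D\<^sup>2 * s"
    unfolding powr_add[symmetric] using x by simp
  also have "D\<^sup>2 * s * (\<sigma> powr (1 - P) * \<omega> powr P * 2 powr (P * real (j + j'))) * (M powr P * M' powr P) =
    D\<^sup>2 * (\<sigma> powr (1 - P) * \<omega> powr P * 2 powr (P * real (j + j'))) * ((smoothing m j * M powr P) * (smoothing m' j' * M' powr P))"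
    by (simp only: s_def mult_ac)
  finally show ?thesis unfolding s_def[symmetric] MM unfolding M_def M'_def smoothing_growth[OF P(1)] .
qed

text \<open>In the near case all \<open>2 ^ s\<close> errors of a pair of levels have the bound \<open>2 ^ s / 4 ^ n\<close>, so that their
  sum has the bound \<open>2 ^ s * (2 ^ s / 4 ^ n)\<close>.\<close>

lemma near_constant:
  assumes P: "0 \<le> P" "P \<le> 1" and s: "s + 2 \<le> n"
  shows "(2 ^ s * (2 ^ s / 4 ^ n)) powr (1 - P) * (2 ^ s / 4 ^ n) powr P * 2 powr (P * real s) \<le> 8 * growth P (int s - int n)"
proof -
  define \<omega> :: real where "\<omega> = 2 ^ s / 4 ^ n"
  have \<omega>: "0 < \<omega>" by (simp add: \<omega>_def)
  have "(2 ^ s * \<omega>) powr (1 - P) * \<omega> powr P * 2 powr (P * real s) = (2 powr real s) powr (1 - P) * 2 powr (P * real s) * (\<omega> powr (1 - P) * \<omega> powr P)"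
    using \<omega> by (simp add: powr_mult powr_realpow)
  also have "\<omega> powr (1 - P) * \<omega> powr P = \<omega>" unfolding powr_add[symmetric] using \<omega> by simp
  also have "(2 powr real s) powr (1 - P) * 2 powr (P * real s) = 2 powr (real s)"
    unfolding powr_powr powr_add[symmetric] by (simp add: algebra_simps)
  also have "2 powr real s * \<omega> = 4 powr (real s - real n)"
  proof -
    have "(2::real) ^ s * 2 ^ s = 4 ^ s" by (simp flip: power_mult_distrib)
    then show ?thesis by (simp add: \<omega>_def powr_diff powr_realpow)
  qed
  also have "\<dots> = growth P (int s - int n)" using s by (simp add: growth_def)
  finally show ?thesis using growth_pos[of P "int s - int n"] unfolding \<omega>_def by simp
qed

text \<open>In the far case a single error is at most \<open>2 / 2 ^ n\<close> and their sum at most 2. The factor 8 is needed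
  for \<open>s = n - 1\<close> only, where \<open>growth\<close> has the value 1/4.\<close>

lemma far_constant:
  assumes P: "0 \<le> P" "P \<le> 1" and s: "n \<le> s + 1"
  shows "2 powr (1 - P) * (2 / 2 ^ n) powr P * 2 powr (P * real s) \<le> 8 * growth P (int s - int n)"
proof -
  have "2 powr (1 - P) * (2 / 2 ^ n) powr P * 2 powr (P * real s) = 2 powr (1 + P * (real s - real n))"
  proof -
    have "2 / 2 ^ n = 2 powr (1 - real n)" by (simp add: powr_diff powr_realpow)
    then show ?thesis by (simp add: powr_powr powr_add[symmetric] algebra_simps)
  qed
  also have "\<dots> \<le> 8 * growth P (int s - int n)"
  proof (cases "n \<le> s")
    case True
    have "2 powr (1 + P * (real s - real n)) = 2 * growth P (int s - int n)"
      using True by (simp add: growth_def powr_add)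
    then show ?thesis using growth_pos[of P "int s - int n"] by simp
  next
    case False
    hence e: "int s - int n = - 1" "real s - real n = - 1" using s by auto
    have "2 powr (1 + P * (real s - real n)) \<le> 2 powr 1" unfolding e using P by (intro powr_mono) auto
    also have "\<dots> = 8 * growth P (int s - int n)" by (simp add: e(1) growth_def powr_minus_divide)
    finally show ?thesis .
  qed
  finally show ?thesis .
qed

lemma conjugate_exponent_bounds:
  fixes p :: ereal assumes "1 \<le> p"
  shows "0 \<le> real_of_ereal (1 / p)" "real_of_ereal (1 / p) \<le> 1" "1 / p = ereal (real_of_ereal (1 / p))"
  using assms by (cases p; simp add: one_ereal_def divide_le_eq zero_ereal_def)+

lemma ennreal_powr_mult_ennreal:
  assumes c: "0 < c" shows "ennreal_powr (ennreal c * x) a = ennreal (c powr a) * ennreal_powr x a"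
proof (cases x rule: ennreal_cases)
  case (real t)
  then show ?thesis using c by (simp add: ennreal_powr_ennreal powr_mult flip: ennreal_mult)
next
  case top
  then show ?thesis using c by (simp add: ennreal_powr_def ennreal_mult_top)
qed

lemma besov_norm_eq_seq_norm:
  assumes "1 \<le> q"
  shows "besov_norm \<phi>\<^sub>0 p q r g = (let u = \<lambda>m. ennreal (2 powr (r * real (fst m + snd m))) * Lp_norm_distr p (block \<phi>\<^sub>0 g m) in
    if q = \<infinity> then (SUP m. u m)
    else ennreal_powr (infsum (\<lambda>m. ennreal_powr (u m) (real_of_ereal q)) UNIV) (1 / real_of_ereal q))"
  unfolding besov_norm_def Let_def block_def
  by (simp add: ennreal_powr_mult_ennreal powr_powr)

lemma decay_commute: "decay \<kappa> (s - t) = decay \<kappa> (t - s)"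
  by (simp add: decay_def abs_minus_commute)

text \<open>The smoothness weight of the frequency \<open>(m, m')\<close> splits into \<open>2 powr (- r * n)\<close>, which is the rate, and
  one factor for each of the three differences, which \<open>growth_decay\<close> absorbs.\<close>

lemma weighted_constant_le:
  assumes P: "0 \<le> P" "P < r" "r < 2" "\<kappa> = min (2 - r) (r - P)" and D: "0 < D"
    and x: "x \<le> 8 * growth P (int (j + j') - int n)"
  shows "D\<^sup>2 * x * (growth P (int m - int j) * growth P (int m' - int j')) * 2 powr (- r * real (m + m')) \<le>
    8 * D\<^sup>2 * 2 powr (- r * real n) * (decay \<kappa> (int (j + j') - int n) * (decay \<kappa> (int j - int m) * decay \<kappa> (int j' - int m')))"
proof -
  let ?g = "growth P" and ?h = "\<lambda>t::int. 2 powr (- r * real_of_int t)"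
  have e: "2 powr (- r * real (m + m')) = 2 powr (- r * real n) * (?h (int (j + j') - int n) * (?h (int m - int j) * ?h (int m' - int j')))"
    unfolding powr_add[symmetric] by (simp add: algebra_simps)
  have gd: "?g t * ?h t \<le> decay \<kappa> t" for t using growth_decay[OF P(2,3)] P(4) by simp
  have "D\<^sup>2 * x * (?g (int m - int j) * ?g (int m' - int j')) * 2 powr (- r * real (m + m')) \<le>
    D\<^sup>2 * (8 * ?g (int (j + j') - int n)) * (?g (int m - int j) * ?g (int m' - int j')) * 2 powr (- r * real (m + m'))"
    using x by (intro mult_right_mono mult_left_mono) (auto intro!: mult_nonneg_nonneg less_imp_le)
  also have "\<dots> = 8 * D\<^sup>2 * 2 powr (- r * real n) * ((?g (int (j + j') - int n) * ?h (int (j + j') - int n)) *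
      ((?g (int m - int j) * ?h (int m - int j)) * (?g (int m' - int j') * ?h (int m' - int j'))))"
    unfolding e by (simp only: mult_ac)
  also have "\<dots> \<le> 8 * D\<^sup>2 * 2 powr (- r * real n) * (decay \<kappa> (int (j + j') - int n) * (decay \<kappa> (int m - int j) * decay \<kappa> (int m' - int j')))"
    by (intro mult_left_mono mult_mono gd) (auto intro!: mult_nonneg_nonneg less_imp_le)
  finally show ?thesis by (simp only: decay_commute[of \<kappa> "int m"] decay_commute[of \<kappa> "int m'"])
qed

text \<open>The contribution of the frequency \<open>m\<close> to the integration error on one pair of levels. Depending on
  whether the levels are small or large compared to \<open>n\<close>, the bounds \<open>faber_err_near\<close> or \<open>faber_err_far\<close> for
  the weights enter.\<close>

lemma level_error_le:
  assumes S: "\<phi>\<^sub>0 \<in> schwartz" and p: "1 \<le> p" and r: "real_of_ereal (1 / p) < r" "r < 2"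
    and \<kappa>: "\<kappa> = min (2 - r) (r - real_of_ereal (1 / p))"
    and D: "0 < D"
    "\<And>a k m. (\<integral>\<^sup>+y. ennreal (cmod (faber_kernel \<phi>\<^sub>0 a k m y)) \<partial>lborel) \<le> ennreal (D * smoothing m (level a))"
    "\<And>a m y. (\<Sum>k<2 ^ level a. cmod (faber_kernel \<phi>\<^sub>0 a k m y)) \<le> D * (smoothing m (level a) * max (2 ^ m) (2 ^ level a))"
  shows "(\<Sum>k<2 ^ level a. \<Sum>l<2 ^ level b. ennreal (\<bar>faber_err n a k b l\<bar> * cmod (faber_coeff2 a k b l (piece \<phi>\<^sub>0 g m)))) \<le>
    ennreal (8 * D\<^sup>2 * 2 powr (- r * real n)) *
    (ennreal (2 powr (r * real (fst m + snd m))) * Lp_norm_distr p (block \<phi>\<^sub>0 g m) *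
     ennreal (decay \<kappa> (int (level a + level b) - int n) * (decay \<kappa> (int (level a) - int (fst m)) * decay \<kappa> (int (level b) - int (snd m)))))"
    (is "?X \<le> _")
proof -
  let ?P = "real_of_ereal (1 / p)" and ?s = "level a + level b" and ?N = "Lp_norm_distr p (block \<phi>\<^sub>0 g m)"
  let ?d = "decay \<kappa> (int (level a + level b) - int n) * (decay \<kappa> (int (level a) - int (fst m)) * decay \<kappa> (int (level b) - int (snd m)))"
  note P = conjugate_exponent_bounds(1,2)[OF p]
  obtain \<omega> \<sigma> :: real where pos: "0 < \<omega>" "0 < \<sigma>"
    and w: "\<And>k l. k < 2 ^ level a \<Longrightarrow> l < 2 ^ level b \<Longrightarrow> \<bar>faber_err n a k b l\<bar> \<le> \<omega>"
    and sw: "(\<Sum>k<2 ^ level a. \<Sum>l<2 ^ level b. \<bar>faber_err n a k b l\<bar>) \<le> \<sigma>"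
    and c: "\<sigma> powr (1 - ?P) * \<omega> powr ?P * 2 powr (?P * real ?s) \<le> 8 * growth ?P (int ?s - int n)"
  proof (cases "?s + 2 \<le> n")
    case True
    show thesis
    proof (rule that[of "2 ^ ?s / 4 ^ n" "2 ^ ?s * (2 ^ ?s / 4 ^ n)"])
      show "(\<Sum>k<2 ^ level a. \<Sum>l<2 ^ level b. \<bar>faber_err n a k b l\<bar>) \<le> 2 ^ ?s * (2 ^ ?s / 4 ^ n)"
      proof -
        have "(\<Sum>k<2 ^ level a. \<Sum>l<2 ^ level b. \<bar>faber_err n a k b l\<bar>) \<le> (\<Sum>k<(2::nat) ^ level a. \<Sum>l<(2::nat) ^ level b. 2 ^ ?s / 4 ^ n)"
          by (intro sum_mono faber_err_near True) auto
        also have "\<dots> = 2 ^ ?s * (2 ^ ?s / 4 ^ n)" by (simp add: power_add)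
        finally show ?thesis .
      qed
      show "(2 ^ ?s * (2 ^ ?s / 4 ^ n)) powr (1 - ?P) * (2 ^ ?s / 4 ^ n) powr ?P * 2 powr (?P * real ?s) \<le> 8 * growth ?P (int ?s - int n)"
        by (rule near_constant[OF P True])
    qed (use faber_err_near True in simp_all)
  next
    case False
    hence far: "n \<le> ?s + 1" by simp
    show thesis
      by (rule that[of "2 / 2 ^ n" 2]) (use faber_err_far[OF _ _ far] sum_faber_err_le far_constant[OF P far] in simp_all)
  qed
  let ?c = "(\<sigma> * (D\<^sup>2 * (smoothing (fst m) (level a) * smoothing (snd m) (level b)))) powr (1 - ?P) *
      (\<omega> * (D\<^sup>2 * (smoothing (fst m) (level a) * smoothing (snd m) (level b)) *
        (max (2 ^ fst m) (2 ^ level a) * max (2 ^ snd m) (2 ^ level b)))) powr ?P"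
  have X: "?X \<le> ennreal ?c * ?N"
    by (rule faber_coeff2_piece_weighted_sum[OF S p D _ sw pos]) (use w in simp)
  have cc: "?c * 2 powr (- r * real (fst m + snd m)) \<le> 8 * D\<^sup>2 * 2 powr (- r * real n) * ?d"
    unfolding weight_constant_eq[OF pos D(1) P] by (rule weighted_constant_le[OF P(1) r \<kappa> D(1) c])
  have "2 powr (- r * real (fst m + snd m)) * 2 powr (r * real (fst m + snd m)) = 1"
    by (simp flip: powr_add)
  hence "ennreal ?c * ?N = ennreal (?c * 2 powr (- r * real (fst m + snd m)) * 2 powr (r * real (fst m + snd m))) * ?N"
    by (simp only: mult.assoc mult_1_right)
  also have "\<dots> = ennreal (?c * 2 powr (- r * real (fst m + snd m))) * (ennreal (2 powr (r * real (fst m + snd m))) * ?N)"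
    by (subst ennreal_mult) (simp_all add: mult.assoc)
  also have "\<dots> \<le> ennreal (8 * D\<^sup>2 * 2 powr (- r * real n) * ?d) * (ennreal (2 powr (r * real (fst m + snd m))) * ?N)"
    by (intro mult_right_mono ennreal_leI cc) simp
  also have "\<dots> = ennreal (8 * D\<^sup>2 * 2 powr (- r * real n)) * (ennreal (2 powr (r * real (fst m + snd m))) * ?N * ennreal ?d)"
    by (subst ennreal_mult) (simp_all only: mult_ac, simp_all)
  finally show ?thesis by (rule order_trans[OF X])
qed

lemma nn_integral_decay_le:
  assumes \<kappa>: "0 < \<kappa>"
  shows "(\<integral>\<^sup>+j. ennreal (decay \<kappa> (t - int j)) \<partial>count_space UNIV) \<le> ennreal (decay_total \<kappa>)"
  unfolding nn_integral_count_space_nat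
proof (rule suminf_le_const)
  fix n
  have "(\<Sum>j<n. ennreal (decay \<kappa> (t - int j))) = ennreal (\<Sum>j<n. decay \<kappa> (int j - t))"
    by (simp add: decay_commute[of \<kappa> t])
  also have "\<dots> \<le> ennreal (decay_total \<kappa>)" by (intro ennreal_leI sum_decay_le \<kappa>) simp
  finally show "(\<Sum>j<n. ennreal (decay \<kappa> (t - int j))) \<le> ennreal (decay_total \<kappa>)" .
qed simp

lemma nn_integral_decay2_le:
  assumes \<kappa>: "0 < \<kappa>"
  shows "(\<integral>\<^sup>+m. ennreal (decay \<kappa> (s - int (fst m)) * decay \<kappa> (t - int (snd m))) \<partial>count_space UNIV) \<le> ennreal ((decay_total \<kappa>)\<^sup>2)"
proof -
  have "(\<integral>\<^sup>+m. ennreal (decay \<kappa> (s - int (fst m)) * decay \<kappa> (t - int (snd m))) \<partial>count_space UNIV) =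
    (\<integral>\<^sup>+i. \<integral>\<^sup>+j. ennreal (decay \<kappa> (s - int i)) * ennreal (decay \<kappa> (t - int j)) \<partial>count_space UNIV \<partial>count_space UNIV)"
    by (subst nn_integral_fst_count_space[symmetric]) (simp add: ennreal_mult)
  also have "\<dots> = (\<integral>\<^sup>+i. ennreal (decay \<kappa> (s - int i)) \<partial>count_space UNIV) * (\<integral>\<^sup>+j. ennreal (decay \<kappa> (t - int j)) \<partial>count_space UNIV)"
    by (simp add: nn_integral_cmult nn_integral_multc)
  also have "\<dots> \<le> ennreal (decay_total \<kappa>) * ennreal (decay_total \<kappa>)" by (intro mult_mono nn_integral_decay_le \<kappa>) auto
  also have "\<dots> = ennreal ((decay_total \<kappa>)\<^sup>2)"
    using decay_total_ge[OF \<kappa>] by (simp add: power2_eq_square ennreal_mult)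
  finally show ?thesis .
qed

text \<open>The total influence of the frequency \<open>m\<close> on the integration error over all levels up to \<open>J\<close>.\<close>

definition level_weight :: "real \<Rightarrow> nat \<Rightarrow> nat \<Rightarrow> nat \<times> nat \<Rightarrow> real" where
  "level_weight \<kappa> n J m = (\<Sum>a\<le>J. \<Sum>b\<le>J. decay \<kappa> (int (level a + level b) - int n) *
     (decay \<kappa> (int (level a) - int (fst m)) * decay \<kappa> (int (level b) - int (snd m))))"

lemma level_weight_le:
  assumes \<kappa>: "0 < \<kappa>"
  shows "level_weight \<kappa> n J m \<le> (2 * decay_total \<kappa>)\<^sup>2"
proof -
  have "level_weight \<kappa> n J m \<le> (\<Sum>a\<le>J. \<Sum>b\<le>J. 1 * (decay \<kappa> (int (level a) - int (fst m)) * decay \<kappa> (int (level b) - int (snd m))))"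
    unfolding level_weight_def by (intro sum_mono mult_right_mono decay_le_1) (use \<kappa> in auto)
  also have "\<dots> = (\<Sum>a\<le>J. decay \<kappa> (int (level a) - int (fst m))) * (\<Sum>b\<le>J. decay \<kappa> (int (level b) - int (snd m)))"
    by (simp add: sum_product)
  also have "\<dots> \<le> (2 * decay_total \<kappa>) * (2 * decay_total \<kappa>)"
    using decay_total_ge[OF \<kappa>] by (intro mult_mono sum_decay_level_le[OF \<kappa>] sum_nonneg) auto
  finally show ?thesis by (simp only: power2_eq_square)
qed

text \<open>Summing over the frequencies first removes the dependence on the levels except through their sum,
  and leaves the count of \<open>sum_decay_diagonal_le\<close>.\<close>

lemma nn_integral_level_weight_le:
  assumes \<kappa>: "0 < \<kappa>"
  shows "(\<integral>\<^sup>+m. ennreal (level_weight \<kappa> n J m) \<partial>count_space UNIV) \<le>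
    ennreal ((2 * decay_total \<kappa> + (2 * decay_total \<kappa>)\<^sup>2) * (decay_total \<kappa>)\<^sup>2 * (real n + 2))"
proof -
  let ?d = "\<lambda>a b. decay \<kappa> (int (level a + level b) - int n)"
  let ?e = "\<lambda>a b m. decay \<kappa> (int (level a) - int (fst m)) * decay \<kappa> (int (level b) - int (snd m))"
  have "(\<integral>\<^sup>+m. ennreal (level_weight \<kappa> n J m) \<partial>count_space UNIV) =
    (\<integral>\<^sup>+m. (\<Sum>a\<le>J. \<Sum>b\<le>J. ennreal (?d a b) * ennreal (?e a b m)) \<partial>count_space UNIV)"
    unfolding level_weight_def by (simp add: sum_nonneg flip: ennreal_mult)
  also have "\<dots> = (\<Sum>a\<le>J. \<Sum>b\<le>J. ennreal (?d a b) * (\<integral>\<^sup>+m. ennreal (?e a b m) \<partial>count_space UNIV))"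
    by (simp add: nn_integral_sum nn_integral_cmult)
  also have "\<dots> \<le> (\<Sum>a\<le>J. \<Sum>b\<le>J. ennreal (?d a b) * ennreal ((decay_total \<kappa>)\<^sup>2))"
    by (intro sum_mono mult_left_mono nn_integral_decay2_le \<kappa>) simp
  also have "\<dots> = ennreal ((\<Sum>a\<le>J. \<Sum>b\<le>J. ?d a b) * (decay_total \<kappa>)\<^sup>2)"
    by (simp add: sum_distrib_right sum_nonneg flip: ennreal_mult)
  also have "\<dots> \<le> ennreal ((2 * decay_total \<kappa> + (2 * decay_total \<kappa>)\<^sup>2) * (real n + 2) * (decay_total \<kappa>)\<^sup>2)"
    by (intro ennreal_leI mult_right_mono sum_decay_diagonal_le \<kappa>) simp
  also have "(2 * decay_total \<kappa> + (2 * decay_total \<kappa>)\<^sup>2) * (real n + 2) * (decay_total \<kappa>)\<^sup>2 =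
     (2 * decay_total \<kappa> + (2 * decay_total \<kappa>)\<^sup>2) * (decay_total \<kappa>)\<^sup>2 * (real n + 2)" by (simp only: mult_ac)
  finally show ?thesis .
qed

section \<open>The worst-case error\<close>

text \<open>The infimum over all extensions need not be attained, so the extension may have a larger norm.\<close>

lemma unit_ball_extension:
  assumes "besov_fun_norm \<phi>\<^sub>0 p q r f \<le> 1"
  obtains g where "g \<in> tempered_distributions" "besov_norm \<phi>\<^sub>0 p q r g \<le> 2"
    "restrict g (test_functions unit_square) = regular_distr unit_square f"
proof -
  have "besov_fun_norm \<phi>\<^sub>0 p q r f < 2" using assms by (rule le_less_trans) simp
  then show thesis using that unfolding besov_fun_norm_def besov_square_norm_def INF_less_iff besov_def by auto
qed

text \<open>An extension \<open>g\<close> of \<open>f\<close> to the plane has a continuous representative that is the sum of its pieces,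
  and it agrees with \<open>f\<close> on the square. Expanding the quadrature error in the Faber coefficients of the
  pieces and applying \<open>level_error_le\<close> leaves the sequence of weighted norms of the blocks, summed against
  \<open>level_weight\<close>; \<open>seq_norm_weighted_le\<close> finishes the estimate.\<close>

theorem worst_case_error_le:
  assumes \<phi>: "resolution_generator \<phi>\<^sub>0" and p: "1 \<le> p" and q: "1 \<le> q"
    and r: "real_of_ereal (1 / p) < r" "r < 2"
  obtains C where "0 < C"
    "\<And>n f. f \<in> besov_square_vanishing \<phi>\<^sub>0 p q r \<Longrightarrow> besov_fun_norm \<phi>\<^sub>0 p q r f \<le> 1 \<Longrightarrow>
      cmod ((LINT z:unit_square|lborel. f z) - qmc_rule (2 ^ (n + 2)) (qmc_points n) f) \<le>
      C * 2 powr (- r * real n) * (real n + 2) powr (1 - real_of_ereal (1 / q))"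
proof -
  have S: "\<phi>\<^sub>0 \<in> schwartz" using \<phi> by (simp add: resolution_generator_def)
  let ?P = "real_of_ereal (1 / p)" and ?Q = "real_of_ereal (1 / q)"
  define \<kappa> where "\<kappa> = min (2 - r) (r - ?P)"
  have \<kappa>: "0 < \<kappa>" using r by (simp add: \<kappa>_def)
  obtain D where D: "0 < D"
    "\<And>a k m. (\<integral>\<^sup>+y. ennreal (cmod (faber_kernel \<phi>\<^sub>0 a k m y)) \<partial>lborel) \<le> ennreal (D * smoothing m (level a))"
    "\<And>a m y. (\<Sum>k<2 ^ level a. cmod (faber_kernel \<phi>\<^sub>0 a k m y)) \<le> D * (smoothing m (level a) * max (2 ^ m) (2 ^ level a))"
    using faber_kernel_schur[OF S] by metis
  define T E where "T = decay_total \<kappa>" and "E = 2 * T"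
  have T: "2 \<le> T" using decay_total_ge[OF \<kappa>] by (simp add: T_def)
  define G where "G = (E + E\<^sup>2) * T\<^sup>2"
  have G: "0 < G" and E: "0 < E\<^sup>2" using T by (auto simp: G_def E_def add_pos_pos)
  \<comment> \<open>The last factor 2 bounds the norm of the extension.\<close>
  define C where "C = 8 * D\<^sup>2 * (G powr (1 - ?Q) * (E\<^sup>2) powr ?Q * 2)"
  have C0: "0 < C" using D(1) G E by (auto simp: C_def intro!: mult_pos_pos)
  show thesis
  proof (rule that[OF C0])
    fix n f
    assume f: "f \<in> besov_square_vanishing \<phi>\<^sub>0 p q r" and "besov_fun_norm \<phi>\<^sub>0 p q r f \<le> 1"
    then obtain g where g: "g \<in> tempered_distributions" and g2: "besov_norm \<phi>\<^sub>0 p q r g \<le> 2"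
      and restr: "restrict g (test_functions unit_square) = regular_distr unit_square f"
      using unit_ball_extension by metis
    define u where "u m = ennreal (2 powr (r * real (fst m + snd m))) * Lp_norm_distr p (block \<phi>\<^sub>0 g m)" for m
    have nrm: "(if q = \<infinity> then (SUP m. u m) else ennreal_powr (infsum (\<lambda>m. ennreal_powr (u m) (real_of_ereal q)) UNIV) (1 / real_of_ereal q)) \<le> 2"
      using g2 unfolding besov_norm_eq_seq_norm[OF q] Let_def u_def .
    have weighted: "(\<integral>\<^sup>+m. u m * W m \<partial>count_space UNIV) \<le> ennreal (A powr (1 - ?Q) * V powr ?Q) * 2"
      if "(\<integral>\<^sup>+m. W m \<partial>count_space UNIV) \<le> ennreal A" "\<And>m. W m \<le> ennreal V" "0 < A" "0 < V" for W A V
      by (rule order_trans[OF seq_norm_weighted_le[OF that q]]) (intro mult_left_mono nrm, simp)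
    \<comment> \<open>The excess smoothness \<open>r - 1/p\<close> gives geometric weights, which makes the pieces summable.\<close>
    have fin: "(\<integral>\<^sup>+m. ennreal (2 powr (?P * real (fst m + snd m))) * Lp_norm_distr p (block \<phi>\<^sub>0 g m) \<partial>count_space UNIV) < \<infinity>"
    proof -
      let ?W = "\<lambda>m. ennreal (decay (r - ?P) (0 - int (fst m)) * decay (r - ?P) (0 - int (snd m)))"
      have rP: "0 < r - ?P" using r by simp
      have "ennreal (2 powr (?P * real (fst m + snd m))) * Lp_norm_distr p (block \<phi>\<^sub>0 g m) = u m * ?W m" for m
      proof -
        have "2 powr (r * real (fst m + snd m)) * (decay (r - ?P) (0 - int (fst m)) * decay (r - ?P) (0 - int (snd m))) = 2 powr (?P * real (fst m + snd m))"
          unfolding decay_def powr_add[symmetric] by (simp add: algebra_simps)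
        note e = this
        have "u m * ?W m = ennreal (2 powr (r * real (fst m + snd m))) * ?W m * Lp_norm_distr p (block \<phi>\<^sub>0 g m)"
          unfolding u_def by (simp only: mult_ac)
        also have "ennreal (2 powr (r * real (fst m + snd m))) * ?W m = ennreal (2 powr (?P * real (fst m + snd m)))"
          unfolding e[symmetric] by (rule ennreal_mult[symmetric]) auto
        finally show ?thesis ..
      qed
      hence "(\<integral>\<^sup>+m. ennreal (2 powr (?P * real (fst m + snd m))) * Lp_norm_distr p (block \<phi>\<^sub>0 g m) \<partial>count_space UNIV) = (\<integral>\<^sup>+m. u m * ?W m \<partial>count_space UNIV)"
        by simp
      also have "\<dots> \<le> ennreal (((decay_total (r - ?P))\<^sup>2) powr (1 - ?Q) * 1 powr ?Q) * 2"
      proof (rule weighted)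
        show "(\<integral>\<^sup>+m. ?W m \<partial>count_space UNIV) \<le> ennreal ((decay_total (r - ?P))\<^sup>2)" by (rule nn_integral_decay2_le[OF rP])
        show "?W m \<le> ennreal 1" for m
          by (intro ennreal_leI mult_le_one decay_le_1) (use rP in auto)
        show "0 < (decay_total (r - ?P))\<^sup>2" using decay_total_ge[OF rP] by simp
      qed simp
      also have "\<dots> < \<infinity>" by (simp add: ennreal_mult_less_top)
      finally show ?thesis .
    qed
    obtain F where F: "continuous_on UNIV F" "\<And>y. ((\<lambda>m. piece \<phi>\<^sub>0 g m y) has_sum F y) UNIV"
      "\<And>\<psi>. \<psi> \<in> schwartz \<Longrightarrow> g \<psi> = (LINT y|lborel. \<psi> y * F y)"
      using pieces_represent[OF \<phi> p g fin] by metis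
    have cont: "continuous_on ({0..1} \<times> {0..1}) f" and edges: "\<And>x. x \<in> {0..1} \<Longrightarrow> f (x, 1) = 0" "\<And>y. y \<in> {0..1} \<Longrightarrow> f (1, y) = 0"
      using f by (auto simp: besov_square_vanishing_def)
    have fF: "f z = F z" if "z \<in> {0..1} \<times> {0..1}" for z
      by (rule distribution_determines_function[OF \<phi> cont F(1,3) restr that])
    have coeff: "ennreal (cmod (faber_coeff2 a k b l f)) \<le> (\<integral>\<^sup>+m. ennreal (cmod (faber_coeff2 a k b l (piece \<phi>\<^sub>0 g m))) \<partial>count_space UNIV)"
      if "k < 2 ^ level a" "l < 2 ^ level b" for a k b l
    proof -
      have "faber_coeff2 a k b l f = faber_coeff2 a k b l F" by (rule faber_coeff2_cong[OF that fF])
      then show ?thesis using norm_has_sum_le_nn_integral[OF has_sum_faber_coeff2[OF F(2)]] by simp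
    qed
    let ?K = "C * 2 powr (- r * real n) * (real n + 2) powr (1 - ?Q)"
    have "cmod ((LINT z:unit_square|lborel. f z) - (\<Sum>c<4. \<Sum>i<2 ^ n. f (hammersley n c i)) / 2 ^ (n + 2)) \<le> ?K"
    proof (rule quadrature_error_le[OF cont edges])
      fix J
      let ?X = "\<lambda>a b k l m. ennreal (\<bar>faber_err n a k b l\<bar> * cmod (faber_coeff2 a k b l (piece \<phi>\<^sub>0 g m)))"
      let ?d = "\<lambda>a b m. decay \<kappa> (int (level a + level b) - int n) * (decay \<kappa> (int (level a) - int (fst m)) * decay \<kappa> (int (level b) - int (snd m)))"
      let ?M = "8 * D\<^sup>2 * 2 powr (- r * real n)"
      have "(\<Sum>a\<le>J. \<Sum>b\<le>J. \<Sum>k<2 ^ level a. \<Sum>l<2 ^ level b. ennreal (\<bar>faber_err n a k b l\<bar> * cmod (faber_coeff2 a k b l f))) \<le>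
        (\<Sum>a\<le>J. \<Sum>b\<le>J. \<Sum>k<2 ^ level a. \<Sum>l<2 ^ level b. \<integral>\<^sup>+m. ?X a b k l m \<partial>count_space UNIV)"
      proof (intro sum_mono)
        fix a b k l assume "k \<in> {..<(2::nat) ^ level a}" "l \<in> {..<(2::nat) ^ level b}"
        hence kl: "k < 2 ^ level a" "l < 2 ^ level b" by auto
        have "ennreal (\<bar>faber_err n a k b l\<bar> * cmod (faber_coeff2 a k b l f)) = ennreal \<bar>faber_err n a k b l\<bar> * ennreal (cmod (faber_coeff2 a k b l f))"
          by (simp add: ennreal_mult)
        also have "\<dots> \<le> ennreal \<bar>faber_err n a k b l\<bar> * (\<integral>\<^sup>+m. ennreal (cmod (faber_coeff2 a k b l (piece \<phi>\<^sub>0 g m))) \<partial>count_space UNIV)"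
          by (intro mult_left_mono coeff kl) simp
        also have "\<dots> = (\<integral>\<^sup>+m. ?X a b k l m \<partial>count_space UNIV)"
          by (simp add: nn_integral_cmult[symmetric] ennreal_mult)
        finally show "ennreal (\<bar>faber_err n a k b l\<bar> * cmod (faber_coeff2 a k b l f)) \<le> (\<integral>\<^sup>+m. ?X a b k l m \<partial>count_space UNIV)" .
      qed
      also have "\<dots> = (\<integral>\<^sup>+m. (\<Sum>a\<le>J. \<Sum>b\<le>J. \<Sum>k<2 ^ level a. \<Sum>l<2 ^ level b. ?X a b k l m) \<partial>count_space UNIV)"
        by (simp add: nn_integral_sum del: sum_ennreal)
      also have "\<dots> \<le> (\<integral>\<^sup>+m. ennreal ?M * (u m * ennreal (level_weight \<kappa> n J m)) \<partial>count_space UNIV)"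
      proof (rule nn_integral_mono)
        fix m
        have "(\<Sum>a\<le>J. \<Sum>b\<le>J. \<Sum>k<2 ^ level a. \<Sum>l<2 ^ level b. ?X a b k l m) \<le> (\<Sum>a\<le>J. \<Sum>b\<le>J. ennreal ?M * (u m * ennreal (?d a b m)))"
          unfolding u_def by (intro sum_mono level_error_le[OF S p r \<kappa>_def D])
        also have "\<dots> = ennreal ?M * (u m * (\<Sum>a\<le>J. \<Sum>b\<le>J. ennreal (?d a b m)))"
          by (simp only: sum_distrib_left)
        also have "(\<Sum>a\<le>J. \<Sum>b\<le>J. ennreal (?d a b m)) = ennreal (level_weight \<kappa> n J m)"
          by (simp add: level_weight_def sum_nonneg)
        finally show "(\<Sum>a\<le>J. \<Sum>b\<le>J. \<Sum>k<2 ^ level a. \<Sum>l<2 ^ level b. ?X a b k l m) \<le> ennreal ?M * (u m * ennreal (level_weight \<kappa> n J m))" .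
      qed
      also have "\<dots> = ennreal ?M * (\<integral>\<^sup>+m. u m * ennreal (level_weight \<kappa> n J m) \<partial>count_space UNIV)"
        by (rule nn_integral_cmult) simp
      also have "\<dots> \<le> ennreal ?M * (ennreal ((G * (real n + 2)) powr (1 - ?Q) * (E\<^sup>2) powr ?Q) * 2)"
      proof (intro mult_left_mono weighted)
        show "(\<integral>\<^sup>+m. ennreal (level_weight \<kappa> n J m) \<partial>count_space UNIV) \<le> ennreal (G * (real n + 2))"
          using nn_integral_level_weight_le[OF \<kappa>, of n J] by (simp only: G_def E_def T_def)
        show "ennreal (level_weight \<kappa> n J m) \<le> ennreal (E\<^sup>2)" for m
          unfolding E_def T_def by (intro ennreal_leI level_weight_le \<kappa>)
      qed (use G E in auto)
      also have "\<dots> = ennreal (?M * ((G * (real n + 2)) powr (1 - ?Q) * (E\<^sup>2) powr ?Q * 2))"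
      proof -
        have "ennreal x * (ennreal y * 2) = ennreal (x * (y * 2))" if "0 \<le> x" "0 \<le> y" for x y
          using that by (simp add: ennreal_mult mult_ac)
        note double = this
        show ?thesis by (rule double) auto
      qed
      also have "?M * ((G * (real n + 2)) powr (1 - ?Q) * (E\<^sup>2) powr ?Q * 2) = ?K"
        using G by (simp add: C_def powr_mult)
      finally show "(\<Sum>a\<le>J. \<Sum>b\<le>J. \<Sum>k<2 ^ level a. \<Sum>l<2 ^ level b. ennreal (\<bar>faber_err n a k b l\<bar> * cmod (faber_coeff2 a k b l f))) \<le> ennreal ?K" .
      show "0 \<le> ?K" using C0 by (intro mult_nonneg_nonneg) auto
    qed
    then show "cmod ((LINT z:unit_square|lborel. f z) - qmc_rule (2 ^ (n + 2)) (qmc_points n) f) \<le> ?K"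
      by (simp only: qmc_rule_points)
  qed
qed

theorem theorem2:
  fixes \<phi>\<^sub>0 :: "real \<Rightarrow> complex" and p q :: ereal and r :: real
  assumes "resolution_generator \<phi>\<^sub>0"
    and "1 \<le> p" and "1 \<le> q"
    and "p = 1 \<Longrightarrow> q < \<infinity>" and "p = \<infinity> \<Longrightarrow> 1 < q"
    and "1 / p < ereal r" and "ereal r < 1 + 1 / p"
  shows "\<exists>C::real. C > 0 \<and> (\<forall>n N :: nat. n \<ge> 1 \<longrightarrow> N = 2 ^ (n + 2) \<longrightarrow>
           qmc_error (besov_square_vanishing \<phi>\<^sub>0 p q r) (besov_fun_norm \<phi>\<^sub>0 p q r) N
             \<le> ennreal (C * real N powr (- r) * ln (real N) powr real_of_ereal (1 - 1 / q)))"
proof -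
  let ?P = "real_of_ereal (1 / p)" and ?Q = "real_of_ereal (1 / q)"
  note P = conjugate_exponent_bounds[OF assms(2)] and Q = conjugate_exponent_bounds[OF assms(3)]
  have "ereal ?P < ereal r" using assms(6) by (simp only: P(3)[symmetric])
  hence r1: "?P < r" by simp
  have "ereal r < 1 + ereal ?P" using assms(7) by (simp only: P(3)[symmetric])
  hence "r < 1 + ?P" by (simp add: one_ereal_def)
  hence r2: "r < 2" using P(2) by simp
  have expo: "real_of_ereal (1 - 1 / q) = 1 - ?Q"
    by (subst Q(3)) (simp add: one_ereal_def)
  obtain C where C: "0 < C" "\<And>n f. f \<in> besov_square_vanishing \<phi>\<^sub>0 p q r \<Longrightarrow> besov_fun_norm \<phi>\<^sub>0 p q r f \<le> 1 \<Longrightarrow>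
      cmod ((LINT z:unit_square|lborel. f z) - qmc_rule (2 ^ (n + 2)) (qmc_points n) f) \<le>
      C * 2 powr (- r * real n) * (real n + 2) powr (1 - ?Q)"
    using worst_case_error_le[OF assms(1-3) r1 r2] by metis
  \<comment> \<open>Conversion from \<open>2 ^ n\<close> and \<open>n + 2\<close> to \<open>N\<close> and \<open>ln N = (n + 2) * ln 2\<close>.\<close>
  let ?C = "C * 2 powr (2 * r) / ln 2 powr (1 - ?Q)"
  have "qmc_error (besov_square_vanishing \<phi>\<^sub>0 p q r) (besov_fun_norm \<phi>\<^sub>0 p q r) N
     \<le> ennreal (?C * real N powr (- r) * ln (real N) powr real_of_ereal (1 - 1 / q))" if N: "N = 2 ^ (n + 2)" for n N :: nat
  proof -
    have N2: "real N = 2 powr (real n + 2)" using powr_realpow[of 2 "n + 2"] by (simp add: N add.commute)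
    have "?C * real N powr (- r) * ln (real N) powr real_of_ereal (1 - 1 / q) =
      C * (2 powr (2 * r) * 2 powr ((real n + 2) * - r)) * (real n + 2) powr (1 - ?Q)"
      unfolding N2 expo by (simp add: powr_powr ln_powr powr_mult)
    also have "2 powr (2 * r) * 2 powr ((real n + 2) * - r) = 2 powr (- r * real n)"
      unfolding powr_add[symmetric] by (simp add: algebra_simps)
    finally have K: "?C * real N powr (- r) * ln (real N) powr real_of_ereal (1 - 1 / q) = C * 2 powr (- r * real n) * (real n + 2) powr (1 - ?Q)" .
    show ?thesis
      unfolding qmc_error_def K
    proof (rule order_trans[OF INF_lower[OF qmc_points_in[of n]]], rule SUP_least)
      fix f assume "f \<in> {f \<in> besov_square_vanishing \<phi>\<^sub>0 p q r. besov_fun_norm \<phi>\<^sub>0 p q r f \<le> 1}"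
      then show "ennreal (cmod ((LINT z:unit_square|lborel. f z) - qmc_rule N (qmc_points n) f)) \<le>
        ennreal (C * 2 powr (- r * real n) * (real n + 2) powr (1 - ?Q))"
        unfolding N by (intro ennreal_leI C(2)) auto
    qed
  qed
  moreover have "0 < ?C" using C(1) by simp
  ultimately show ?thesis by blast
qed

end
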